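(* Let $n\ge 2$, $l>0$ and $\rho>0$ (with $\rho<\pi$ in the case of $\mathbb{S}^n$). (1) A tube of radius $\rho$ and height $l$ in $\mathbb{H}^n\times[0,l]$ is stable if and only if $\pi\sinh\rho\ge\sqrt{n-1}\,l$. (2) A tube of radius $\rho$ and height $l$ in $\mathbb{R}^n\times[0,l]$ is stable if and only if $\pi\rho\ge\sqrt{n-1}\,l$. (3) A tube of radius $\rho$ and height $l$ in $\mathbb{S}^n\times[0,l]$ is stable if and only if $\pi\sin\rho\ge\sqrt{n-1}\,l$.
   Context: $\mathbb{H}^n,\mathbb{R}^n,\mathbb{S}^n$ denote the complete simply connected space forms of dimension $n$ and curvature $-1,0,1$. For $M$ one of these, a tube of radius $\rho$ and height $l$ in $M\times[0,l]$ is the hypersurface $S_\rho\times[0,l]$, where $S_\rho\subset M$ is a geodesic sphere of radius $\rho$. It is a constant mean curvature hypersurface with free boundary in the slab $M\times[0,l]$ of the Riemannian product $M\times\mathbb{R}$, i.e. it meets $M\times\{0,l\}$ orthogonally along its boundary. Such a hypersurface $\Sigma$, with unit normal $N$ and second fundamental form $\sigma$, is stable if $$\int_\Sigma\big(|\nabla f|^2-(|\sigma|^2+\mathrm{Ric}(N))f^2\big)\,d\Sigma\ge 0$$ for all $f\in H^1(\Sigma)$ with $\int_\Sigma f\,d\Sigma=0$, where $\mathrm{Ric}(N)=\mathrm{Ric}(N,N)$ is the Ricci curvature of $M\times\mathbb{R}$ in the direction $N$. *)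

theory Defs
  imports "HOL-Analysis.Analysis"
begin

text \<open>
  Riemannian manifolds are represented as submanifolds \<open>S\<close> of a Euclidean space \<open>'w\<close>, with the
  metric induced by a constant symmetric bilinear form \<open>b\<close> on \<open>'w\<close> that is positive definite on
  the tangent spaces of \<open>S\<close>.  The form \<open>b\<close> itself may be indefinite (hyperboloid model).
  All notions below are the usual ones of Riemannian geometry, computed in this representation.
\<close>

type_synonym 'w bilinear_form = "'w \<Rightarrow> 'w \<Rightarrow> real"

section \<open>Smooth maps\<close>

primrec iterated_derivative ::
  "('a::real_normed_vector \<Rightarrow> 'b::real_normed_vector) \<Rightarrow> 'a list \<Rightarrow> 'a \<Rightarrow> 'b" where
  "iterated_derivative f [] = f"
| "iterated_derivative f (v # vs) =
     (\<lambda>x. frechet_derivative (iterated_derivative f vs) (at x) v)"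

text \<open>\<open>C\<^sup>\<infinity>\<close> on an open set.\<close>

definition smooth_on ::
  "'a::real_normed_vector set \<Rightarrow> ('a \<Rightarrow> 'b::real_normed_vector) \<Rightarrow> bool" where
  "smooth_on U f \<longleftrightarrow> (\<forall>vs. \<forall>x\<in>U. iterated_derivative f vs differentiable (at x))"

section \<open>Tangent spaces\<close>

text \<open>
  One-sided velocities are used so that at a boundary point of a manifold with boundary one
  also obtains the full tangent space (the one-sided velocities form a half-space there).
\<close>

definition tangent_space :: "'w::euclidean_space set \<Rightarrow> 'w \<Rightarrow> 'w set" where
  "tangent_space S p = span {v. \<exists>\<gamma>. \<gamma> 0 = p \<and> (\<forall>\<^sub>F t in at_right 0. \<gamma> t \<in> S) \<and>
                                 (\<gamma> has_vector_derivative v) (at 0 within {0..})}"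

definition tangential_proj :: "'w::euclidean_space bilinear_form \<Rightarrow> 'w set \<Rightarrow> 'w \<Rightarrow> 'w" where
  "tangential_proj b V w = (THE u. u \<in> V \<and> (\<forall>v\<in>V. b (w - u) v = 0))"

definition orthonormal_basis :: "'w::euclidean_space bilinear_form \<Rightarrow> 'w set \<Rightarrow> 'w set" where
  "orthonormal_basis b V = (SOME E. E \<subseteq> V \<and> span E = V \<and>
     (\<forall>e\<in>E. \<forall>e'\<in>E. b e e' = (if e = e' then 1 else 0)))"

section \<open>Levi-Civita connection, curvature, geodesics\<close>

text \<open>
  Derivatives are taken within the submanifold, since the maps involved are only meaningful
  there.  Such a derivative is not unique as a linear map on \<open>'w\<close>, but its values on tangent
  vectors are, and only these are used.
\<close>

definition vector_field :: "'w::euclidean_space set \<Rightarrow> ('w \<Rightarrow> 'w) \<Rightarrow> bool" where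
  "vector_field S X \<longleftrightarrow> smooth_on UNIV X \<and> (\<forall>p\<in>S. X p \<in> tangent_space S p)"

text \<open>The Levi-Civita connection of the induced metric: the tangential part of the flat
  derivative of the ambient space.\<close>

definition covariant_derivative ::
  "'w::euclidean_space bilinear_form \<Rightarrow> 'w set \<Rightarrow> ('w \<Rightarrow> 'w) \<Rightarrow> ('w \<Rightarrow> 'w) \<Rightarrow> 'w \<Rightarrow> 'w" where
  "covariant_derivative b S X Y p =
     tangential_proj b (tangent_space S p) (frechet_derivative Y (at p within S) (X p))"

definition lie_bracket ::
  "'w::euclidean_space set \<Rightarrow> ('w \<Rightarrow> 'w) \<Rightarrow> ('w \<Rightarrow> 'w) \<Rightarrow> 'w \<Rightarrow> 'w" where
  "lie_bracket S X Y p =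
     frechet_derivative Y (at p within S) (X p) - frechet_derivative X (at p within S) (Y p)"

definition curvature_field ::
  "'w::euclidean_space bilinear_form \<Rightarrow> 'w set \<Rightarrow> ('w \<Rightarrow> 'w) \<Rightarrow> ('w \<Rightarrow> 'w) \<Rightarrow> ('w \<Rightarrow> 'w) \<Rightarrow> 'w \<Rightarrow> 'w"
  where
  "curvature_field b S X Y Z p =
     covariant_derivative b S X (covariant_derivative b S Y Z) p
     - covariant_derivative b S Y (covariant_derivative b S X Z) p
     - covariant_derivative b S (lie_bracket S X Y) Z p"

text \<open>The curvature tensor at \<open>p\<close>: the common value for all extensions of the three tangent
  vectors to vector fields.\<close>

definition curvature_tensor ::
  "'w::euclidean_space bilinear_form \<Rightarrow> 'w set \<Rightarrow> 'w \<Rightarrow> 'w \<Rightarrow> 'w \<Rightarrow> 'w \<Rightarrow> 'w" where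
  "curvature_tensor b S p x y z = (THE w. \<forall>X Y Z.
     vector_field S X \<and> vector_field S Y \<and> vector_field S Z \<and> X p = x \<and> Y p = y \<and> Z p = z \<longrightarrow>
     curvature_field b S X Y Z p = w)"

text \<open>The trace of \<open>e \<mapsto> R(e, x) y\<close>; the unit sphere of dimension \<open>m\<close> has Ricci curvature
  \<open>m - 1\<close> in this sign convention.\<close>

definition ricci :: "'w::euclidean_space bilinear_form \<Rightarrow> 'w set \<Rightarrow> 'w \<Rightarrow> 'w \<Rightarrow> 'w \<Rightarrow> real" where
  "ricci b S p x y =
     (\<Sum>e\<in>orthonormal_basis b (tangent_space S p). b (curvature_tensor b S p e x y) e)"

definition geodesic :: "'w::euclidean_space bilinear_form \<Rightarrow> 'w set \<Rightarrow> (real \<Rightarrow> 'w) \<Rightarrow> bool" where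
  "geodesic b S \<gamma> \<longleftrightarrow> smooth_on UNIV \<gamma> \<and> range \<gamma> \<subseteq> S \<and>
     (\<forall>t. tangential_proj b (tangent_space S (\<gamma> t))
            (vector_derivative (\<lambda>s. vector_derivative \<gamma> (at s)) (at t)) = 0)"

text \<open>The image under the exponential map at \<open>p\<close> of the sphere of radius \<open>\<rho>\<close> in the tangent
  space at \<open>p\<close>.\<close>

definition geodesic_sphere ::
  "'w::euclidean_space bilinear_form \<Rightarrow> 'w set \<Rightarrow> 'w \<Rightarrow> real \<Rightarrow> 'w set" where
  "geodesic_sphere b S p \<rho> = {\<gamma> \<rho> | \<gamma>. geodesic b S \<gamma> \<and> \<gamma> 0 = p \<and>
     b (vector_derivative \<gamma> (at 0)) (vector_derivative \<gamma> (at 0)) = 1}"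

section \<open>Hypersurfaces\<close>

text \<open>\<open>\<Sigma>\<close> is a hypersurface, possibly with boundary, in the Riemannian manifold \<open>P\<close>.\<close>

definition unit_normal ::
  "'w::euclidean_space bilinear_form \<Rightarrow> 'w set \<Rightarrow> 'w set \<Rightarrow> ('w \<Rightarrow> 'w) \<Rightarrow> bool" where
  "unit_normal b P \<Sigma> N \<longleftrightarrow> smooth_on UNIV N \<and>
     (\<forall>p\<in>\<Sigma>. N p \<in> tangent_space P p \<and> b (N p) (N p) = 1 \<and>
            (\<forall>v\<in>tangent_space \<Sigma> p. b (N p) v = 0))"

definition second_fundamental_form ::
  "'w::euclidean_space bilinear_form \<Rightarrow> 'w set \<Rightarrow> 'w set \<Rightarrow> ('w \<Rightarrow> 'w) \<Rightarrow> 'w \<Rightarrow> 'w \<Rightarrow> 'w \<Rightarrow> real"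
  where
  "second_fundamental_form b P \<Sigma> N p u v =
     - b (tangential_proj b (tangent_space P p) (frechet_derivative N (at p within \<Sigma>) u)) v"

definition sff_norm_sq ::
  "'w::euclidean_space bilinear_form \<Rightarrow> 'w set \<Rightarrow> 'w set \<Rightarrow> ('w \<Rightarrow> 'w) \<Rightarrow> 'w \<Rightarrow> real" where
  "sff_norm_sq b P \<Sigma> N p =
     (\<Sum>u\<in>orthonormal_basis b (tangent_space \<Sigma> p).
       \<Sum>v\<in>orthonormal_basis b (tangent_space \<Sigma> p). (second_fundamental_form b P \<Sigma> N p u v)\<^sup>2)"

section \<open>The Riemannian measure\<close>

text \<open>The dimension of the manifold is \<open>CARD('n)\<close>.  Parametrizations are defined on open subsets
  of Euclidean space, so they do not reach boundary points.\<close>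

definition parametrization ::
  "'w::euclidean_space set \<Rightarrow> (real^'n) set \<Rightarrow> (real^'n \<Rightarrow> 'w) \<Rightarrow> bool" where
  "parametrization S U \<phi> \<longleftrightarrow> open U \<and> smooth_on U \<phi> \<and> inj_on \<phi> U \<and> \<phi> ` U \<subseteq> S \<and>
     (\<forall>x\<in>U. inj (frechet_derivative \<phi> (at x)))"

definition volume_density ::
  "'w::euclidean_space bilinear_form \<Rightarrow> (real^'n \<Rightarrow> 'w) \<Rightarrow> real^'n \<Rightarrow> real" where
  "volume_density b \<phi> x = sqrt (det ((\<chi> i j.
     b (frechet_derivative \<phi> (at x) (axis i 1)) (frechet_derivative \<phi> (at x) (axis j 1)))
     :: real^'n^'n))"

text \<open>The last condition says that the boundary is a null set.\<close>

definition is_riemannian_measure ::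
  "'n::finite itself \<Rightarrow> 'w::euclidean_space bilinear_form \<Rightarrow> 'w set \<Rightarrow> 'w measure \<Rightarrow> bool" where
  "is_riemannian_measure (_ :: 'n itself) b S \<mu> \<longleftrightarrow>
     space \<mu> = S \<and> sets \<mu> = sets (restrict_space borel S) \<and>
     (\<forall>U (\<phi> :: real^'n \<Rightarrow> 'w) A. parametrization S U \<phi> \<and> A \<in> sets borel \<and> A \<subseteq> U \<longrightarrow>
        emeasure \<mu> (\<phi> ` A) = (\<integral>\<^sup>+x\<in>A. ennreal (volume_density b \<phi> x) \<partial>lborel)) \<and>
     S - \<Union>{\<phi> ` U | U (\<phi> :: real^'n \<Rightarrow> 'w). parametrization S U \<phi>} \<in> null_sets \<mu>"

definition riemannian_measure ::
  "'n::finite itself \<Rightarrow> 'w::euclidean_space bilinear_form \<Rightarrow> 'w set \<Rightarrow> 'w measure" where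
  "riemannian_measure n b S = (THE \<mu>. is_riemannian_measure n b S \<mu>)"

section \<open>The Sobolev space and stability\<close>

definition gradient ::
  "'w::euclidean_space bilinear_form \<Rightarrow> 'w set \<Rightarrow> ('w \<Rightarrow> real) \<Rightarrow> 'w \<Rightarrow> 'w" where
  "gradient b S u p = (THE g. g \<in> tangent_space S p \<and>
     (\<forall>v\<in>tangent_space S p. b g v = frechet_derivative u (at p) v))"

text \<open>
  \<open>f\<close> lies in \<open>H\<^sup>1(S)\<close> and has gradient \<open>G\<close>, for compact \<open>S\<close>: \<open>H\<^sup>1(S)\<close> is the completion, within
  \<open>L\<^sup>2(S)\<close>, of the functions on \<open>S\<close> that are smooth up to the boundary, with respect to the
  \<open>H\<^sup>1\<close> norm.  As \<open>S\<close> is compact, these functions are the restrictions of smooth functions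
  on the ambient space, and they lie in \<open>L\<^sup>2(S)\<close> together with their gradients.
\<close>

definition sobolev_H1_gradient ::
  "'n::finite itself \<Rightarrow> 'w::euclidean_space bilinear_form \<Rightarrow> 'w set \<Rightarrow> ('w \<Rightarrow> real) \<Rightarrow> ('w \<Rightarrow> 'w) \<Rightarrow> bool"
  where
  "sobolev_H1_gradient n b S f G \<longleftrightarrow>
     (let \<mu> = riemannian_measure n b S in
      f \<in> borel_measurable \<mu> \<and> G \<in> borel_measurable \<mu> \<and> (\<forall>p\<in>S. G p \<in> tangent_space S p) \<and>
      (\<exists>u :: nat \<Rightarrow> 'w \<Rightarrow> real. (\<forall>k. smooth_on UNIV (u k)) \<and>
        (\<lambda>k. \<integral>\<^sup>+p. ennreal ((u k p - f p)\<^sup>2) \<partial>\<mu>) \<longlonglongrightarrow> 0 \<and>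
        (\<lambda>k. \<integral>\<^sup>+p. ennreal (b (gradient b S (u k) p - G p) (gradient b S (u k) p - G p)) \<partial>\<mu>)
          \<longlonglongrightarrow> 0))"

text \<open>The choice of \<open>N\<close> is irrelevant, as the integrand is invariant under \<open>N \<mapsto> - N\<close>.\<close>

definition stable ::
  "'n::finite itself \<Rightarrow> 'w::euclidean_space bilinear_form \<Rightarrow> 'w set \<Rightarrow> 'w set \<Rightarrow> bool" where
  "stable n b P \<Sigma> \<longleftrightarrow>
     (let \<mu> = riemannian_measure n b \<Sigma> in
      \<exists>N. unit_normal b P \<Sigma> N \<and>
        (\<forall>f G. sobolev_H1_gradient n b \<Sigma> f G \<and> (\<integral>p. f p \<partial>\<mu>) = 0 \<longrightarrow>
           (\<integral>p. b (G p) (G p)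
                - (sff_norm_sq b P \<Sigma> N p + ricci b P p (N p) (N p)) * (f p)\<^sup>2 \<partial>\<mu>) \<ge> 0))"

section \<open>Space forms, products with the line, and tubes\<close>

text \<open>Euclidean space is \<open>UNIV\<close> with the form \<open>inner\<close>, and the round sphere is \<open>sphere 0 1\<close> with
  the form \<open>inner\<close>.\<close>

definition lorentz_form :: "('v::euclidean_space \<times> real) bilinear_form" where
  "lorentz_form x y = fst x \<bullet> fst y - snd x * snd y"

definition hyperboloid :: "('v::euclidean_space \<times> real) set" where
  "hyperboloid = {x. lorentz_form x x = -1 \<and> snd x > 0}"

definition product_form :: "'w bilinear_form \<Rightarrow> ('w \<times> real) bilinear_form" where
  "product_form b x y = b (fst x) (fst y) + snd x * snd y"

definition tube ::
  "'w::euclidean_space bilinear_form \<Rightarrow> 'w set \<Rightarrow> 'w \<Rightarrow> real \<Rightarrow> real \<Rightarrow> ('w \<times> real) set" where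
  "tube b M p \<rho> l = geodesic_sphere b M p \<rho> \<times> {0..l}"

definition stable_tube ::
  "'n::finite itself \<Rightarrow> 'w::euclidean_space bilinear_form \<Rightarrow> 'w set \<Rightarrow> 'w \<Rightarrow> real \<Rightarrow> real \<Rightarrow> bool"
  where
  "stable_tube n b M p \<rho> l \<longleftrightarrow> stable n (product_form b) (M \<times> UNIV) (tube b M p \<rho> l)"

end

theory Submission
  imports Defs
begin

text \<open>
  With \<open>r = sn \<rho>\<close>, where \<open>sn\<close> is \<open>sinh\<close>, the identity or \<open>sin\<close>, the tube is isometric to the
  product of a round sphere of dimension \<open>n - 1\<close> and radius \<open>r\<close> with the interval \<open>[0, l]\<close>, and
  its stability potential \<open>|\<sigma>|\<^sup>2 + Ric(N)\<close> is the constant \<open>(n - 1) / r\<^sup>2\<close>.  Stability therefore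
  says that the first nonzero Neumann eigenvalue of the product is at least \<open>(n - 1) / r\<^sup>2\<close>.  This
  eigenvalue is the minimum of \<open>(n - 1) / r\<^sup>2\<close>, from the sphere, and \<open>(\<pi> / l)\<^sup>2\<close>, from the interval.

  The eigenvalue of the interval follows from a Riccati argument, and that of the sphere from an
  inequality on circles, averaged over pairs of points.  The Efron-Stein inequality for the variance
  yields the product.  The inequality for smooth functions passes to \<open>H\<^sup>1\<close> by approximation.
\<close>

section \<open>Smooth functions\<close>

text \<open>The sphere eigenvalue must come out sharp, yet no spectral decomposition is used; the
  extension \<open>F\<close> of degree one makes this possible. Let \<open>n = CARD('n)\<close>. At
  a unit vector the squared gradient of \<open>F\<close> is \<open>f\<^sup>2\<close> plus the
  squared tangential gradient of \<open>f\<close>. When the directions of \<open>x\<close> and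
  \<open>y\<close> are independent and uniform and \<open>f\<close> has mean zero, the mean of
  \<open>(F x - F y)\<^sup>2\<close> is twice that of \<open>(F x)\<^sup>2\<close>, whereas the
  squared derivative of \<open>F\<close> at \<open>x\<close> along \<open>y\<close> averages to
  \<open>1 / n\<close> times the squared gradient times \<open>(norm y)\<^sup>2\<close>. The circle
  inequality thus bounds \<open>n\<close> times the integral of \<open>f\<^sup>2\<close> by the
  integral of \<open>f\<^sup>2\<close> plus the tangential energy, and the \<open>f\<^sup>2\<close>
  on the right lowers \<open>n\<close> to \<open>n - 1\<close>. Linear functions have frequency one
  on every circle, so nothing is lost on them. The sphere eigenvalue equals the stability potential
  for every radius. Hence the interval alone decides, and its constant must be sharp as
  well.\<close>

lemma frechet_derivative_cong_open:
  assumes "open U" "x \<in> U" "\<And>y. y \<in> U \<Longrightarrow> f y = g y"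
  shows "frechet_derivative f (at x) = frechet_derivative g (at x)"
    and "f differentiable (at x) \<longleftrightarrow> g differentiable (at x)"
proof -
  have "(f has_derivative D) (at x) \<longleftrightarrow> (g has_derivative D) (at x)" for D
    using assms by (metis has_derivative_transform_within_open)
  then show "frechet_derivative f (at x) = frechet_derivative g (at x)"
    "f differentiable (at x) \<longleftrightarrow> g differentiable (at x)"
    by (simp_all add: frechet_derivative_def differentiable_def)
qed

lemma has_derivative_imp_frechet:
  assumes "(f has_derivative D) (at x)"
  shows "frechet_derivative f (at x) = D"
  using assms frechet_derivative_at by metis

text \<open>Iterated derivatives of a member stay in the class \<open>P\<close> up to their values
  outside the open set \<open>U\<close>, which do not influence derivatives inside \<open>U\<close>.
  A smoothness proof thereby reduces to naming a class that is closed under directional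
  derivatives.\<close>

lemma smooth_on_coinduct:
  assumes U: "open U" and f: "P f"
    and diff: "\<And>f x. P f \<Longrightarrow> x \<in> U \<Longrightarrow> f differentiable (at x)"
    and closed: "\<And>f v. P f \<Longrightarrow> \<exists>g. P g \<and> (\<forall>x\<in>U. frechet_derivative f (at x) v = g x)"
  shows "smooth_on U f"
proof -
  have "\<exists>g. P g \<and> (\<forall>x\<in>U. iterated_derivative f vs x = g x)" for vs
  proof (induction vs)
    case Nil
    then show ?case using f by auto
  next
    case (Cons v vs)
    then obtain g where g: "P g" "\<forall>x\<in>U. iterated_derivative f vs x = g x" by blast
    obtain h where h: "P h" "\<forall>x\<in>U. frechet_derivative g (at x) v = h x"
      using closed[OF g(1)] by blast
    have "frechet_derivative (iterated_derivative f vs) (at x) = frechet_derivative g (at x)" if "x \<in> U" for x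
      using g by (intro frechet_derivative_cong_open(1)[OF U that]) auto
    then show ?case using h by auto
  qed
  then show ?thesis
    unfolding smooth_on_def using diff frechet_derivative_cong_open(2)[OF U] by (metis (no_types, lifting))
qed

lemma smooth_on_differentiable: "smooth_on U f \<Longrightarrow> x \<in> U \<Longrightarrow> f differentiable (at x)"
  unfolding smooth_on_def by (drule spec[where x="[]"]) auto

lemma smooth_on_has_derivative:
  "smooth_on U f \<Longrightarrow> x \<in> U \<Longrightarrow> (f has_derivative frechet_derivative f (at x)) (at x)"
  using smooth_on_differentiable frechet_derivative_works by blast

lemma smooth_on_frechet_derivative:
  assumes "smooth_on U f"
  shows "smooth_on U (\<lambda>x. frechet_derivative f (at x) v)"
proof -
  \<comment> \<open>The recursion adds later derivatives at the head of the list, so the derivative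
    taken first stands at its end.\<close>
  have "iterated_derivative (\<lambda>x. frechet_derivative f (at x) v) vs = iterated_derivative f (vs @ [v])" for vs
    by (induction vs) auto
  then show ?thesis using assms unfolding smooth_on_def by simp
qed

lemma smooth_on_continuous_on: "smooth_on U f \<Longrightarrow> continuous_on U f"
  by (meson smooth_on_differentiable continuous_at_imp_continuous_on differentiable_imp_continuous_within)

lemma smooth_on_const [simp]: "open U \<Longrightarrow> smooth_on U (\<lambda>x. c)"
  by (rule smooth_on_coinduct[where P = "\<lambda>f. \<exists>c. f = (\<lambda>x. c)"]) auto

lemma smooth_on_bounded_linear_compose:
  assumes "open U" "bounded_linear L" "smooth_on U f"
  shows "smooth_on U (\<lambda>x. L (f x))"
proof (rule smooth_on_coinduct[where P = "\<lambda>g. \<exists>f. smooth_on U f \<and> g = (\<lambda>x. L (f x))"])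
  fix g x assume "\<exists>f. smooth_on U f \<and> g = (\<lambda>x. L (f x))" "x \<in> U"
  then show "g differentiable (at x)"
    by (metis (mono_tags) assms(2) bounded_linear.has_derivative differentiable_def smooth_on_has_derivative)
next
  fix g v assume "\<exists>f. smooth_on U f \<and> g = (\<lambda>x. L (f x))"
  then obtain f where f: "smooth_on U f" "g = (\<lambda>x. L (f x))" by blast
  have "frechet_derivative g (at x) v = L (frechet_derivative f (at x) v)" if "x \<in> U" for x
    unfolding f(2)
    by (subst has_derivative_imp_frechet[OF bounded_linear.has_derivative[OF assms(2) smooth_on_has_derivative[OF f(1) that]]]) simp
  then show "\<exists>h. (\<exists>f. smooth_on U f \<and> h = (\<lambda>x. L (f x))) \<and> (\<forall>x\<in>U. frechet_derivative g (at x) v = h x)"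
    using smooth_on_frechet_derivative[OF f(1), of v] by auto
qed (use assms in auto)

lemma smooth_on_ident [simp]:
  assumes "open U"
  shows "smooth_on U (\<lambda>x. x)"
proof (rule smooth_on_coinduct[where P = "\<lambda>f. f = (\<lambda>x. x) \<or> (\<exists>c. f = (\<lambda>x. c))"])
  fix f :: "'a \<Rightarrow> 'a" and v assume "f = (\<lambda>x. x) \<or> (\<exists>c. f = (\<lambda>x. c))"
  then show "\<exists>g. (g = (\<lambda>x. x) \<or> (\<exists>c. g = (\<lambda>x. c))) \<and> (\<forall>x\<in>U. frechet_derivative f (at x) v = g x)"
    by (intro exI[of _ "if f = (\<lambda>x. x) then (\<lambda>x. v) else (\<lambda>x. 0)"]) auto
qed (use assms in auto)

lemma smooth_on_bounded_linear: "open U \<Longrightarrow> bounded_linear L \<Longrightarrow> smooth_on U L"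
  using smooth_on_bounded_linear_compose[OF _ _ smooth_on_ident] by blast

lemma smooth_on_add:
  assumes "open U" "smooth_on U f" "smooth_on U g"
  shows "smooth_on U (\<lambda>x. f x + g x)"
proof (rule smooth_on_coinduct[where P = "\<lambda>h. \<exists>f g. smooth_on U f \<and> smooth_on U g \<and> h = (\<lambda>x. f x + g x)"])
  fix h x assume "\<exists>f g. smooth_on U f \<and> smooth_on U g \<and> h = (\<lambda>x. f x + g x)" "x \<in> U"
  then show "h differentiable (at x)"
    by (auto intro: differentiable_add smooth_on_differentiable)
next
  fix h v assume "\<exists>f g. smooth_on U f \<and> smooth_on U g \<and> h = (\<lambda>x. f x + g x)"
  then obtain f g where f: "smooth_on U f" "smooth_on U g" "h = (\<lambda>x. f x + g x)" by blast
  have "frechet_derivative h (at x) v = frechet_derivative f (at x) v + frechet_derivative g (at x) v" if "x \<in> U" for x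
    unfolding f(3)
    by (subst has_derivative_imp_frechet[OF has_derivative_add[OF smooth_on_has_derivative[OF f(1) that] smooth_on_has_derivative[OF f(2) that]]]) simp
  then show "\<exists>k. (\<exists>f g. smooth_on U f \<and> smooth_on U g \<and> k = (\<lambda>x. f x + g x)) \<and> (\<forall>x\<in>U. frechet_derivative h (at x) v = k x)"
    using smooth_on_frechet_derivative[OF f(1), of v] smooth_on_frechet_derivative[OF f(2), of v]
    by (intro exI[of _ "\<lambda>x. frechet_derivative f (at x) v + frechet_derivative g (at x) v"]) blast
qed (use assms in auto)

text \<open>The product rule turns one product into a sum of two. A coinduction class for products
  must therefore contain finite sums of products, and this is the smallest such class.\<close>

inductive bilinear_sum for p :: "'b::real_normed_vector \<Rightarrow> 'c::real_normed_vector \<Rightarrow> 'd::real_normed_vector"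
    and U :: "'a::real_normed_vector set" where
  product: "smooth_on U f \<Longrightarrow> smooth_on U g \<Longrightarrow> bilinear_sum p U (\<lambda>x. p (f x) (g x))"
| sum: "bilinear_sum p U f \<Longrightarrow> bilinear_sum p U g \<Longrightarrow> bilinear_sum p U (\<lambda>x. f x + g x)"

lemma smooth_on_bounded_bilinear:
  assumes "open U" "bounded_bilinear p" "smooth_on U f" "smooth_on U g"
  shows "smooth_on U (\<lambda>x. p (f x) (g x))"
proof (rule smooth_on_coinduct[where P = "bilinear_sum p U"])
  show "h differentiable (at x)" if "bilinear_sum p U h" "x \<in> U" for h x
    using that
  proof (induction h)
    case (product f g)
    then show ?case
      using bounded_bilinear.FDERIV[OF assms(2) smooth_on_has_derivative smooth_on_has_derivative]
      unfolding differentiable_def by blast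
  qed (auto intro: differentiable_add)
  show "\<exists>k. bilinear_sum p U k \<and> (\<forall>x\<in>U. frechet_derivative h (at x) v = k x)" if "bilinear_sum p U h" for h v
    using that
  proof (induction h)
    case (product f g)
    have "frechet_derivative (\<lambda>x. p (f x) (g x)) (at x) v =
       p (f x) (frechet_derivative g (at x) v) + p (frechet_derivative f (at x) v) (g x)" if "x \<in> U" for x
      by (subst has_derivative_imp_frechet[OF bounded_bilinear.FDERIV[OF assms(2) smooth_on_has_derivative[OF product(1) that] smooth_on_has_derivative[OF product(2) that]]]) simp
    moreover have "bilinear_sum p U (\<lambda>x. p (f x) (frechet_derivative g (at x) v) + p (frechet_derivative f (at x) v) (g x))"
      by (intro bilinear_sum.intros product smooth_on_frechet_derivative)
    ultimately show ?case by blast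
  next
    case (sum f g)
    then obtain f' g' where *: "bilinear_sum p U f'" "\<forall>x\<in>U. frechet_derivative f (at x) v = f' x"
      "bilinear_sum p U g'" "\<forall>x\<in>U. frechet_derivative g (at x) v = g' x" by blast
    have "frechet_derivative (\<lambda>x. f x + g x) (at x) v = f' x + g' x" if "x \<in> U" for x
    proof -
      have "f differentiable (at x)" "g differentiable (at x)"
        using sum(1,2) \<open>\<And>x h. bilinear_sum p U h \<Longrightarrow> x \<in> U \<Longrightarrow> h differentiable (at x)\<close> that by auto
      then have "((\<lambda>x. f x + g x) has_derivative (\<lambda>v. frechet_derivative f (at x) v + frechet_derivative g (at x) v)) (at x)"
        by (intro has_derivative_add) (simp_all add: frechet_derivative_works)
      then show ?thesis using * that by (simp add: has_derivative_imp_frechet)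
    qed
    then show ?case using * bilinear_sum.sum by (metis (no_types, lifting))
  qed
qed (use assms in \<open>auto intro: bilinear_sum.intros\<close>)

lemmas smooth_on_mult = smooth_on_bounded_bilinear[OF _ bounded_bilinear_mult]
  and smooth_on_scaleR = smooth_on_bounded_bilinear[OF _ bounded_bilinear_scaleR]
  and smooth_on_inner = smooth_on_bounded_bilinear[OF _ bounded_bilinear_inner]

lemma smooth_on_diff:
  assumes "open U" "smooth_on U f" "smooth_on U g"
  shows "smooth_on U (\<lambda>x. f x - g x)"
  using smooth_on_add[OF assms(1,2) smooth_on_bounded_linear_compose[OF assms(1) bounded_linear_minus[OF bounded_linear_ident] assms(3)]]
  by simp

lemma smooth_on_Pair:
  assumes U: "open U" and "smooth_on U f" "smooth_on U g"
  shows "smooth_on U (\<lambda>x. (f x, g x))"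
proof -
  have "smooth_on U (\<lambda>x. (f x, 0) + (0, g x))"
    using assms by (intro smooth_on_add smooth_on_bounded_linear_compose[where L = "\<lambda>y. (y, 0)"]
        smooth_on_bounded_linear_compose[where L = "\<lambda>y. (0, y)"]) (auto intro!: bounded_linear_Pair bounded_linear_ident bounded_linear_zero)
  then show ?thesis by simp
qed

text \<open>Differentiation raises the exponent \<open>k\<close> by 2 and replaces \<open>g\<close>
  by another smooth numerator, so quotients of this shape form a class closed under derivatives. The
  norm itself belongs to it as \<open>(x \<bullet> x) / norm x\<close>.\<close>

lemma smooth_on_norm_power_inverse:
  fixes U :: "'a::real_inner set"
  assumes U: "open U" "0 \<notin> U" and g: "smooth_on U g"
  shows "smooth_on U (\<lambda>x. g x * inverse (norm x) ^ k :: real)"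
proof (rule smooth_on_coinduct[where P = "\<lambda>f. \<exists>g k. smooth_on U g \<and> f = (\<lambda>x. g x * inverse (norm x) ^ k)"])
  have der: "((\<lambda>x. g x * inverse (norm x) ^ k) has_derivative
     (\<lambda>v. (frechet_derivative g (at x) v * (x \<bullet> x) - real k * g x * (x \<bullet> v)) * inverse (norm x) ^ (k+2))) (at x)"
    if g: "smooth_on U g" and x: "x \<in> U" for g and k :: nat and x
  proof -
    have x0: "x \<noteq> 0" using x U by auto
    have nn: "x \<bullet> x = norm x * norm x" by (simp add: power2_norm_eq_inner[symmetric] power2_eq_square)
    have [derivative_intros]: "(g has_derivative frechet_derivative g (at x)) (at x)"
      using g x by (rule smooth_on_has_derivative)
    have n: "(norm has_derivative (\<lambda>v. (x \<bullet> v) / norm x)) (at x)"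
      using has_derivative_norm[OF x0] by (simp add: sgn_div_norm inner_commute divide_inverse mult.commute)
    have p: "((\<lambda>x. inverse (norm x) ^ k) has_derivative (\<lambda>v. - (real k * (x \<bullet> v) * inverse (norm x) ^ (k+2)))) (at x)"
    proof (rule has_derivative_eq_rhs)
      show "((\<lambda>x. inverse (norm x) ^ k) has_derivative (\<lambda>v. of_nat k * (- (inverse (norm x) * ((x \<bullet> v) / norm x) * inverse (norm x))) * inverse (norm x) ^ (k-1))) (at x)"
        by (rule has_derivative_power[OF Deriv.has_derivative_inverse[OF _ n]]) (use x0 in auto)
    qed (use x0 in \<open>cases k; auto simp: fun_eq_iff divide_simps\<close>)
    show ?thesis
      by (rule has_derivative_eq_rhs[OF has_derivative_mult[OF smooth_on_has_derivative[OF g x] p]])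
        (use x0 in \<open>auto simp: fun_eq_iff field_simps nn\<close>)
  qed
  show "f differentiable (at x)" if "\<exists>g k. smooth_on U g \<and> f = (\<lambda>x. g x * inverse (norm x) ^ k)" "x \<in> U" for f x
    using that der unfolding differentiable_def by blast
  show "\<exists>h. (\<exists>g k. smooth_on U g \<and> h = (\<lambda>x. g x * inverse (norm x) ^ k)) \<and> (\<forall>x\<in>U. frechet_derivative f (at x) v = h x)"
    if f: "\<exists>g k. smooth_on U g \<and> f = (\<lambda>x. g x * inverse (norm x) ^ k)" for f v
  proof -
    obtain g k where g: "smooth_on U g" "f = (\<lambda>x. g x * inverse (norm x) ^ k)" using f by blast
    have "smooth_on U (\<lambda>x. frechet_derivative g (at x) v * (x \<bullet> x) - real k * g x * (x \<bullet> v))"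
      using U(1) g(1) by (intro smooth_on_diff smooth_on_mult smooth_on_frechet_derivative smooth_on_inner smooth_on_const smooth_on_ident)
    moreover have "frechet_derivative f (at x) v =
       (frechet_derivative g (at x) v * (x \<bullet> x) - real k * g x * (x \<bullet> v)) * inverse (norm x) ^ (k+2)" if "x \<in> U" for x
      unfolding g(2) by (subst has_derivative_imp_frechet[OF der[OF g(1) that]]) simp
    ultimately show ?thesis by blast
  qed
qed (use assms in auto)

lemma smooth_on_norm:
  fixes U :: "'a::real_inner set"
  assumes U: "open U" "0 \<notin> U"
  shows "smooth_on U norm" and "smooth_on U (\<lambda>x. inverse (norm x))"
proof -
  have eq: "(\<lambda>x::'a. (x \<bullet> x) * inverse (norm x) ^ 1) = norm"
    by (rule ext, case_tac "x = 0") (auto simp: fun_eq_iff power2_norm_eq_inner[symmetric] power2_eq_square)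
  show "smooth_on U norm"
    using smooth_on_norm_power_inverse[OF U smooth_on_inner[OF U(1) smooth_on_ident[OF U(1)] smooth_on_ident[OF U(1)]], of 1]
    unfolding eq .
  show "smooth_on U (\<lambda>x. inverse (norm x))"
    using smooth_on_norm_power_inverse[OF U, of "\<lambda>x. 1" 1] U by simp
qed

text \<open>\<open>C\<close> and \<open>S\<close> are exchanged by differentiation up to constants
  and the fixed linear factor \<open>L\<close>, as for cosine and sine of a linear phase.
  Combinations with vector coefficients are then closed under derivatives. This covers the geodesics
  of all three space forms and the test function for instability.\<close>

lemma smooth_on_combination:
  fixes C S :: "'a::real_normed_vector \<Rightarrow> real" and L :: "'a \<Rightarrow> real"
    and a b :: "'b::real_normed_vector"
  assumes U: "open U"
    and "\<And>x. x \<in> U \<Longrightarrow> (C has_derivative (\<lambda>v. c * S x * L v)) (at x)"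
    and "\<And>x. x \<in> U \<Longrightarrow> (S has_derivative (\<lambda>v. d * C x * L v)) (at x)"
  shows "smooth_on U (\<lambda>x. C x *\<^sub>R a + S x *\<^sub>R b)"
proof (rule smooth_on_coinduct[where P = "\<lambda>f. \<exists>a b. f = (\<lambda>x. C x *\<^sub>R a + S x *\<^sub>R b)"])
  have der: "((\<lambda>x. C x *\<^sub>R a + S x *\<^sub>R b) has_derivative (\<lambda>v. (c * S x * L v) *\<^sub>R a + (d * C x * L v) *\<^sub>R b)) (at x)"
    if "x \<in> U" for a b :: 'b and x
    using assms(2,3)[OF that] by (auto intro!: derivative_eq_intros simp: fun_eq_iff)
  show "f differentiable (at x)" if "\<exists>a b. f = (\<lambda>x. C x *\<^sub>R a + S x *\<^sub>R b)" "x \<in> U" for f :: "'a \<Rightarrow> 'b" and x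
    using that der unfolding differentiable_def by blast
  show "\<exists>g. (\<exists>a b. g = (\<lambda>x. C x *\<^sub>R a + S x *\<^sub>R b)) \<and> (\<forall>x\<in>U. frechet_derivative f (at x) v = g x)"
    if f: "\<exists>a b. f = (\<lambda>x. C x *\<^sub>R a + S x *\<^sub>R b)" for f :: "'a \<Rightarrow> 'b" and v
  proof -
    obtain a b where f: "f = (\<lambda>x. C x *\<^sub>R a + S x *\<^sub>R b)" using f by blast
    have "frechet_derivative f (at x) v = C x *\<^sub>R ((d * L v) *\<^sub>R b) + S x *\<^sub>R ((c * L v) *\<^sub>R a)" if "x \<in> U" for x
      unfolding f by (subst has_derivative_imp_frechet[OF der[OF that]]) (simp add: mult_ac)
    then show ?thesis by blast
  qed
qed (use U in blast)+

section \<open>One-dimensional Poincare inequalities\<close>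

text \<open>In the Riccati argument the phase has to stay away from the pole of the cotangent, which
  forces a slope strictly below the critical one. The sharp constant is then a limit.\<close>

lemma square_mult_le_of_less:
  fixes K I J :: real
  assumes "K > 0" and le: "\<And>c. 0 < c \<Longrightarrow> c < K \<Longrightarrow> c\<^sup>2 * I \<le> J"
  shows "K\<^sup>2 * I \<le> J"
proof (rule tendsto_upperbound)
  show "((\<lambda>c. c\<^sup>2 * I) \<longlongrightarrow> K\<^sup>2 * I) (at_left K)"
    by (intro tendsto_intros)
  show "\<forall>\<^sub>F c in at_left K. c\<^sup>2 * I \<le> J"
    using eventually_at_left_real[OF assms(1)] by eventually_elim (auto intro: le)
qed auto

text \<open>With \<open>\<theta>\<close> an affine phase of slope \<open>c\<close> that stays in \<open>(0, \<pi>/2]\<close>, the difference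
  \<open>f'\<^sup>2 - c\<^sup>2 f\<^sup>2\<close> exceeds the derivative of \<open>c f\<^sup>2 cot \<theta>\<close> by the square of \<open>f' - c f cot \<theta>\<close>.\<close>

lemma wirtinger_left_zero:
  fixes f f' :: "real \<Rightarrow> real"
  assumes ab: "a < b"
    and f: "\<And>x. x \<in> {a..b} \<Longrightarrow> (f has_real_derivative f' x) (at x within {a..b})"
    and f': "continuous_on {a..b} f'"
    and f0: "f a = 0"
  shows "(pi / (2 * (b - a)))\<^sup>2 * integral {a..b} (\<lambda>x. (f x)\<^sup>2) \<le> integral {a..b} (\<lambda>x. (f' x)\<^sup>2)"
proof (rule square_mult_le_of_less)
  fix c assume c: "0 < c" "c < pi / (2 * (b - a))"
  \<comment> \<open>The phase is pinned to \<open>pi / 2\<close> at \<open>b\<close>, where the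
    cotangent vanishes, so the boundary term there is zero without any condition on
    \<open>f b\<close>. At \<open>a\<close> the boundary term is zero because
    \<open>f a = 0\<close>.\<close>
  define \<theta> where "\<theta> x = pi / 2 - c * (b - x)" for x
  have cb: "c * (b - a) < pi / 2" using c ab by (simp add: field_simps)
  have th: "sin (\<theta> x) > 0" if "x \<in> {a..b}" for x
  proof -
    have "c * (b - x) \<le> c * (b - a)" "0 \<le> c * (b - x)" using that c by auto
    then show ?thesis unfolding \<theta>_def using cb by (intro sin_gt_zero) auto
  qed
  define H where "H x = c * cot (\<theta> x) * (f x)\<^sup>2" for x
  define H' where "H' x = - (c * c / (sin (\<theta> x))\<^sup>2) * (f x)\<^sup>2 + c * cot (\<theta> x) * (2 * f x * f' x)" for x
  have "(H has_real_derivative H' x) (at x within {a..b})" if x: "x \<in> {a..b}" for x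
  proof -
    have 1: "((\<lambda>x. cot (\<theta> x)) has_real_derivative (- inverse ((sin (\<theta> x))\<^sup>2)) * c) (at x within {a..b})"
      by (rule DERIV_chain2[OF DERIV_cot]) (use th[OF x] in \<open>auto simp: \<theta>_def intro!: derivative_eq_intros\<close>)
    show ?thesis unfolding H_def H'_def
      by (rule derivative_eq_intros 1 f[OF x] refl)+ (simp add: divide_inverse algebra_simps)
  qed
  then have "(H' has_integral (H b - H a)) {a..b}"
    using ab by (intro fundamental_theorem_of_calculus) (auto simp: has_real_derivative_iff_has_vector_derivative)
  moreover have "H b = 0" "H a = 0" by (simp_all add: H_def \<theta>_def cot_def f0)
  ultimately have H': "(H' has_integral 0) {a..b}" by simp
  have fc: "continuous_on {a..b} f"
    using f by (meson DERIV_continuous continuous_on_eq_continuous_within)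
  have "((\<lambda>x. (f' x)\<^sup>2 - c\<^sup>2 * (f x)\<^sup>2) has_integral (integral {a..b} (\<lambda>x. (f' x)\<^sup>2) - c\<^sup>2 * integral {a..b} (\<lambda>x. (f x)\<^sup>2))) {a..b}"
    by (intro has_integral_diff has_integral_mult_right integrable_integral integrable_continuous_real continuous_intros fc f')
  then have "0 \<le> integral {a..b} (\<lambda>x. (f' x)\<^sup>2) - c\<^sup>2 * integral {a..b} (\<lambda>x. (f x)\<^sup>2)"
  proof (rule has_integral_le[OF H'])
    fix x assume "x \<in> {a..b}"
    then have s: "sin (\<theta> x) \<noteq> 0" using th by fastforce
    then have "1 / (sin (\<theta> x))\<^sup>2 = 1 + (cot (\<theta> x))\<^sup>2"
      using sin_cos_squared_add[of "\<theta> x"] by (simp add: cot_def power_divide add_divide_distrib[symmetric] field_simps)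
    then have "c * c / (sin (\<theta> x))\<^sup>2 = c\<^sup>2 * (1 + (cot (\<theta> x))\<^sup>2)"
      by (simp add: power2_eq_square divide_inverse)
    then have "(f' x)\<^sup>2 - c\<^sup>2 * (f x)\<^sup>2 - H' x = (f' x - c * cot (\<theta> x) * f x)\<^sup>2"
      unfolding H'_def by (simp add: power2_eq_square algebra_simps)
    also have "\<dots> \<ge> 0" by simp
    finally show "H' x \<le> (f' x)\<^sup>2 - c\<^sup>2 * (f x)\<^sup>2" by simp
  qed
  then show "c\<^sup>2 * integral {a..b} (\<lambda>x. (f x)\<^sup>2) \<le> integral {a..b} (\<lambda>x. (f' x)\<^sup>2)" by simp
qed (use ab in simp)

lemma wirtinger_right_zero:
  fixes f f' :: "real \<Rightarrow> real"
  assumes ab: "a < b"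
    and f: "\<And>x. x \<in> {a..b} \<Longrightarrow> (f has_real_derivative f' x) (at x within {a..b})"
    and f': "continuous_on {a..b} f'"
    and f0: "f b = 0"
  shows "(pi / (2 * (b - a)))\<^sup>2 * integral {a..b} (\<lambda>x. (f x)\<^sup>2) \<le> integral {a..b} (\<lambda>x. (f' x)\<^sup>2)"
proof -
  have "((\<lambda>x. f (- x)) has_real_derivative (- f' (- x))) (at x within {-b..-a})" if "x \<in> {-b..-a}" for x
  proof -
    have "(f \<circ> uminus has_real_derivative f' (- x) * (- 1)) (at x within {-b..-a})"
      using f[of "- x"] that by (intro DERIV_image_chain) (auto intro!: derivative_eq_intros)
    then show ?thesis by (simp add: o_def)
  qed
  moreover have "continuous_on {-b..-a} (\<lambda>x. - f' (- x))"
    by (intro continuous_intros continuous_on_compose2[OF f']) auto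
  ultimately have "(pi / (2 * (- a - - b)))\<^sup>2 * integral {-b..-a} (\<lambda>x. (f (-x))\<^sup>2) \<le> integral {-b..-a} (\<lambda>x. (- f' (-x))\<^sup>2)"
    using ab f0 by (intro wirtinger_left_zero) auto
  then show ?thesis
    using Henstock_Kurzweil_Integration.integral_reflect_real[of b a "\<lambda>x. (f x)\<^sup>2"]
      Henstock_Kurzweil_Integration.integral_reflect_real[of b a "\<lambda>x. (f' x)\<^sup>2"]
    by (simp add: algebra_simps)
qed

text \<open>Among the constants, the value at the midpoint is good enough as a substitute for the mean.\<close>

lemma wirtinger_midpoint:
  fixes f f' :: "real \<Rightarrow> real"
  assumes ab: "a < b"
    and f: "\<And>x. x \<in> {a..b} \<Longrightarrow> (f has_real_derivative f' x) (at x within {a..b})"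
    and f': "continuous_on {a..b} f'"
  shows "(pi / (b - a))\<^sup>2 * integral {a..b} (\<lambda>x. (f x - f ((a + b) / 2))\<^sup>2) \<le> integral {a..b} (\<lambda>x. (f' x)\<^sup>2)"
proof -
  define m where "m = (a + b) / 2"
  have m: "a < m" "m < b" using ab by (auto simp: m_def)
  have sub: "{a..m} \<subseteq> {a..b}" "{m..b} \<subseteq> {a..b}" using m by auto
  have "(pi / (2 * (m - a)))\<^sup>2 * integral {a..m} (\<lambda>x. (f x - f m)\<^sup>2) \<le> integral {a..m} (\<lambda>x. (f' x)\<^sup>2)"
  proof (rule wirtinger_right_zero)
    show "((\<lambda>x. f x - f m) has_real_derivative f' x) (at x within {a..m})" if "x \<in> {a..m}" for x
      using f[of x] that sub by (auto intro!: derivative_eq_intros intro: has_field_derivative_subset)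
  qed (use m sub f' in \<open>auto intro: continuous_on_subset\<close>)
  moreover have "(pi / (2 * (b - m)))\<^sup>2 * integral {m..b} (\<lambda>x. (f x - f m)\<^sup>2) \<le> integral {m..b} (\<lambda>x. (f' x)\<^sup>2)"
  proof (rule wirtinger_left_zero)
    show "((\<lambda>x. f x - f m) has_real_derivative f' x) (at x within {m..b})" if "x \<in> {m..b}" for x
      using f[of x] that sub by (auto intro!: derivative_eq_intros intro: has_field_derivative_subset)
  qed (use m sub f' in \<open>auto intro: continuous_on_subset\<close>)
  moreover have "2 * (m - a) = b - a" "2 * (b - m) = b - a" by (auto simp: m_def field_simps)
  moreover have fc: "continuous_on {a..b} f"
    using f by (meson DERIV_continuous continuous_on_eq_continuous_within)
  have "integral {a..m} (\<lambda>x. (f x - f m)\<^sup>2) + integral {m..b} (\<lambda>x. (f x - f m)\<^sup>2) = integral {a..b} (\<lambda>x. (f x - f m)\<^sup>2)"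
    using m by (intro Henstock_Kurzweil_Integration.integral_combine integrable_continuous_real continuous_intros fc) auto
  moreover have "integral {a..m} (\<lambda>x. (f' x)\<^sup>2) + integral {m..b} (\<lambda>x. (f' x)\<^sup>2) = integral {a..b} (\<lambda>x. (f' x)\<^sup>2)"
    using m by (intro Henstock_Kurzweil_Integration.integral_combine integrable_continuous_real continuous_intros f') auto
  ultimately show ?thesis unfolding m_def[symmetric] by (smt (verit) distrib_left)
qed

lemma integral_split_half:
  fixes h :: "real \<Rightarrow> real"
  assumes "continuous_on UNIV h" "0 \<le> T"
  shows "integral {0..2*T} h = integral {0..T} (\<lambda>s. h s + h (s + T))"
proof -
  have c: "continuous_on X h" for X using assms(1) continuous_on_subset by blast
  have "integral {0..2*T} h = integral {0..T} h + integral {T..2*T} h"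
    using assms by (intro Henstock_Kurzweil_Integration.integral_combine[symmetric] integrable_continuous_real c) auto
  also have "integral {T..2*T} h = integral {0..T} (\<lambda>s. h (s + T))"
    using integral_shift_Icc_real[of 0 T h T] by (simp add: o_def add.commute)
  also have "integral {0..T} h + integral {0..T} (\<lambda>s. h (s + T)) = integral {0..T} (\<lambda>s. h s + h (s + T))"
    by (intro Henstock_Kurzweil_Integration.integral_add[symmetric] integrable_continuous_real c continuous_on_compose2[OF c]
        continuous_intros) auto
  finally show ?thesis .
qed

lemma integral_periodic_shift:
  fixes h :: "real \<Rightarrow> real"
  assumes c: "continuous_on UNIV h" and per: "\<And>s. h (s + T) = h s" and a: "0 \<le> a" "a \<le> T"
  shows "integral {a..a + T} h = integral {0..T} h"
proof -
  have c: "continuous_on X h" for X using c continuous_on_subset by blast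
  have "integral {a..a+T} h = integral {a..T} h + integral {T..a+T} h"
    using a by (intro Henstock_Kurzweil_Integration.integral_combine[symmetric] integrable_continuous_real c) auto
  also have "integral {T..a+T} h = integral {0..a} h"
    using integral_shift_Icc_real[of 0 a h T] per by (simp add: o_def add.commute)
  also have "integral {a..T} h + integral {0..a} h = integral {0..T} h"
    using Henstock_Kurzweil_Integration.integral_combine[OF a integrable_continuous_real[OF c]] by simp
  finally show ?thesis .
qed

text \<open>Antiperiodicity forces a zero \<open>s\<close>, and then \<open>f\<close> vanishes at
  \<open>s\<close> and at \<open>s + T\<close>. The one-sided inequalities on the two halves, each
  of length \<open>T / 2\<close>, both carry the constant \<open>pi / T\<close>.\<close>

lemma wirtinger_antiperiodic:
  fixes f f' :: "real \<Rightarrow> real"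
  assumes T: "T > 0"
    and f: "\<And>x. (f has_real_derivative f' x) (at x)"
    and f': "continuous_on UNIV f'"
    and anti: "\<And>x. f (x + T) = - f x" and anti': "\<And>x. f' (x + T) = - f' x"
  shows "(pi / T)\<^sup>2 * integral {0..T} (\<lambda>x. (f x)\<^sup>2) \<le> integral {0..T} (\<lambda>x. (f' x)\<^sup>2)"
proof -
  have fc: "continuous_on X f" for X
    using f by (meson DERIV_continuous continuous_at_imp_continuous_on)
  have f'c: "continuous_on X f'" for X using f' continuous_on_subset by blast
  have "f T = - f 0" using anti[of 0] by simp
  then obtain s where s: "0 \<le> s" "s \<le> T" "f s = 0"
    using IVT'[of f 0 0 T] IVT2'[of f T 0 0] fc T by (cases "f 0 \<le> 0") auto
  define m where "m = s + T / 2"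
  have 1: "(pi / (2 * (m - s)))\<^sup>2 * integral {s..m} (\<lambda>x. (f x)\<^sup>2) \<le> integral {s..m} (\<lambda>x. (f' x)\<^sup>2)"
    using T s by (intro wirtinger_left_zero f'c) (auto simp: m_def intro: has_field_derivative_at_within f)
  have 2: "(pi / (2 * (s + T - m)))\<^sup>2 * integral {m..s+T} (\<lambda>x. (f x)\<^sup>2) \<le> integral {m..s+T} (\<lambda>x. (f' x)\<^sup>2)"
    using T s by (intro wirtinger_right_zero f'c) (auto simp: m_def anti intro: has_field_derivative_at_within f)
  have "2 * (m - s) = T" "2 * (s + T - m) = T" by (auto simp: m_def)
  moreover have "integral {s..m} (\<lambda>x. (f x)\<^sup>2) + integral {m..s+T} (\<lambda>x. (f x)\<^sup>2) = integral {0..T} (\<lambda>x. (f x)\<^sup>2)"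
    using T s by (subst integral_periodic_shift[symmetric, of _ _ s], (auto simp: anti intro!: continuous_intros fc)[4],
       intro Henstock_Kurzweil_Integration.integral_combine integrable_continuous_real continuous_intros fc) (auto simp: m_def)
  moreover have "integral {s..m} (\<lambda>x. (f' x)\<^sup>2) + integral {m..s+T} (\<lambda>x. (f' x)\<^sup>2) = integral {0..T} (\<lambda>x. (f' x)\<^sup>2)"
    using T s by (subst integral_periodic_shift[symmetric, of _ _ s], (auto simp: anti' intro!: continuous_intros f'c)[4],
       intro Henstock_Kurzweil_Integration.integral_combine integrable_continuous_real continuous_intros f'c) (auto simp: m_def)
  ultimately show ?thesis using 1 2 by (smt (verit) distrib_left)
qed

text \<open>In terms of the Fourier coefficients this says \<open>1 - cos (k \<pi> / 2) \<le> k\<^sup>2\<close>, with equality for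
  \<open>k = 1\<close>.  The proof splits \<open>g\<close> into its parts \<open>p\<close> and \<open>q\<close> with odd and even frequencies.\<close>

lemma circle_quarter_turn_inequality:
  fixes g g' :: "real \<Rightarrow> real"
  assumes g: "\<And>x. (g has_real_derivative g' x) (at x)"
    and g': "continuous_on UNIV g'"
    and per: "\<And>x. g (x + 2 * pi) = g x" and per': "\<And>x. g' (x + 2 * pi) = g' x"
  shows "integral {0..2*pi} (\<lambda>s. (g s - g (s + pi/2))\<^sup>2) \<le> 2 * integral {0..2*pi} (\<lambda>s. (g' s)\<^sup>2)"
proof -
  have gc: "continuous_on X g" for X
    using g by (meson DERIV_continuous continuous_at_imp_continuous_on)
  have g'c: "continuous_on X g'" for X using g' continuous_on_subset by blast
  note comp = continuous_on_compose2[OF gc[of UNIV]] continuous_on_compose2[OF g'c[of UNIV]]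
  have shift: "((\<lambda>x. g (x + c)) has_real_derivative g' (x + c)) (at x)" for x c
    using g[of "x + c"] by (simp add: DERIV_shift)
  define p where "p s = (g s - g (s + pi)) / 2" for s
  define q where "q s = (g s + g (s + pi)) / 2" for s
  define p' where "p' s = (g' s - g' (s + pi)) / 2" for s
  define q' where "q' s = (g' s + g' (s + pi)) / 2" for s
  have pp: "g (s + pi + pi) = g s" "g' (s + pi + pi) = g' s" for s
    using per[of s] per'[of s] by (simp_all add: algebra_simps)
  have p: "(p has_real_derivative p' x) (at x)" and q: "(q has_real_derivative q' x) (at x)" for x
    unfolding p_def[abs_def] q_def[abs_def] p'_def q'_def by (auto intro!: derivative_eq_intros g shift)
  have pa: "p (s + pi) = - p s" "p' (s + pi) = - p' s" and qa: "q (s + pi) = q s" "q' (s + pi) = q' s" for s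
    unfolding p_def q_def p'_def q'_def using pp[of s] by (simp_all add: field_simps)
  have [continuous_intros]: "continuous_on X p" "continuous_on X q" "continuous_on X p'" "continuous_on X q'" for X
    unfolding p_def[abs_def] q_def[abs_def] p'_def[abs_def] q'_def[abs_def]
    by (intro continuous_intros comp; auto)+
  note pq = \<open>\<And>X. continuous_on X p\<close> \<open>\<And>X. continuous_on X q\<close> \<open>\<And>X. continuous_on X p'\<close> \<open>\<And>X. continuous_on X q'\<close>
  note pq2 = continuous_on_compose2[OF pq(1)[of UNIV]] continuous_on_compose2[OF pq(2)[of UNIV]]
    continuous_on_compose2[OF pq(3)[of UNIV]] continuous_on_compose2[OF pq(4)[of UNIV]]
  have gpq: "g s = p s + q s" "g' s = p' s + q' s" for s by (simp_all add: p_def q_def p'_def q'_def field_simps)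
  \<comment> \<open>Two quarter turns make a half turn, which acts as \<open>-1\<close> on
    \<open>p\<close> and as \<open>1\<close> on \<open>q\<close>. So \<open>u\<close> keeps the
    antiperiod \<open>pi\<close>, whereas \<open>v\<close> acquires the shorter antiperiod
    \<open>pi / 2\<close>.\<close>
  define u where "u s = p s - p (s + pi/2)" for s
  define v where "v s = q s - q (s + pi/2)" for s
  define v' where "v' s = q' s - q' (s + pi/2)" for s
  have ua: "u (s + pi) = - u s" and va: "v (s + pi) = v s" for s
    unfolding u_def v_def using pa(1)[of s] pa(1)[of "s + pi/2"] qa(1)[of s] qa(1)[of "s + pi/2"] by (simp_all add: algebra_simps)
  have q_half: "q (s + pi/2 + pi/2) = q s" "q' (s + pi/2 + pi/2) = q' s" for s
    using qa[of s] by (simp_all add: algebra_simps)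
  have p_half: "p (s + pi/2 + pi/2) = - p s" for s
    using pa[of s] by (simp add: algebra_simps)
  have cuv: "continuous_on X u" "continuous_on X v" "continuous_on X v'" for X
    unfolding u_def[abs_def] v_def[abs_def] v'_def[abs_def] by (intro continuous_intros pq2; auto)+
  note cuv2 = continuous_on_compose2[OF cuv(1)[of UNIV]] continuous_on_compose2[OF cuv(2)[of UNIV]]
  have "integral {0..2*pi} (\<lambda>s. (g s - g (s + pi/2))\<^sup>2) = integral {0..2*pi} (\<lambda>s. (u s + v s)\<^sup>2)"
    by (simp add: gpq u_def v_def algebra_simps)
  also have "\<dots> = integral {0..pi} (\<lambda>s. (u s + v s)\<^sup>2 + (u (s + pi) + v (s + pi))\<^sup>2)"
    by (intro integral_split_half continuous_intros cuv) auto
  \<comment> \<open>Under the half turn \<open>u\<close> changes sign and \<open>v\<close> does not,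
    so the mixed terms cancel and the two parts decouple.\<close>
  also have "\<dots> = integral {0..pi} (\<lambda>s. 2 * (u s)\<^sup>2 + 2 * (v s)\<^sup>2)"
    by (simp add: ua va power2_eq_square algebra_simps)
  also have "\<dots> = 2 * integral {0..pi} (\<lambda>s. (u s)\<^sup>2) + 2 * integral {0..pi} (\<lambda>s. (v s)\<^sup>2)"
    by (subst Henstock_Kurzweil_Integration.integral_add) (auto intro!: integrable_continuous_real continuous_intros cuv)
  finally have lhs: "integral {0..2*pi} (\<lambda>s. (g s - g (s + pi/2))\<^sup>2) = \<dots>" .
  have "integral {0..2*pi} (\<lambda>s. (g' s)\<^sup>2) = integral {0..pi} (\<lambda>s. (g' s)\<^sup>2 + (g' (s + pi))\<^sup>2)"
    by (intro integral_split_half continuous_intros g'c) auto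
  also have "\<dots> = integral {0..pi} (\<lambda>s. 2 * (p' s)\<^sup>2 + 2 * (q' s)\<^sup>2)"
    by (simp add: gpq pa qa power2_eq_square algebra_simps)
  also have "\<dots> = 2 * integral {0..pi} (\<lambda>s. (p' s)\<^sup>2) + 2 * integral {0..pi} (\<lambda>s. (q' s)\<^sup>2)"
    by (subst Henstock_Kurzweil_Integration.integral_add) (auto intro!: integrable_continuous_real continuous_intros pq)
  finally have rhs: "integral {0..2*pi} (\<lambda>s. (g' s)\<^sup>2) = \<dots>" .
  have half: "integral {0..pi} h = integral {0..pi/2} (\<lambda>s. h s + h (s + pi/2))" if "continuous_on UNIV h" for h :: "real \<Rightarrow> real"
    using integral_split_half[OF that, of "pi/2"] by simp
  have "integral {0..pi} (\<lambda>s. (u s)\<^sup>2) = integral {0..pi/2} (\<lambda>s. (u s)\<^sup>2 + (u (s + pi/2))\<^sup>2)"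
    by (intro half continuous_intros cuv)
  \<comment> \<open>The mixed terms at \<open>s\<close> and at \<open>s + pi/2\<close> are opposite
    to each other. The odd part is thus treated by an identity, with no loss before Wirtinger is
    applied.\<close>
  also have "\<dots> = integral {0..pi/2} (\<lambda>s. 2 * ((p s)\<^sup>2 + (p (s + pi/2))\<^sup>2))"
    by (simp add: u_def p_half pa power2_eq_square algebra_simps)
  also have "\<dots> = 2 * integral {0..pi/2} (\<lambda>s. (p s)\<^sup>2 + (p (s + pi/2))\<^sup>2)" by (rule Henstock_Kurzweil_Integration.integral_mult_right)
  also have "\<dots> = 2 * integral {0..pi} (\<lambda>s. (p s)\<^sup>2)"
    by (subst half) (auto intro!: continuous_intros)
  finally have "integral {0..pi} (\<lambda>s. (u s)\<^sup>2) = 2 * integral {0..pi} (\<lambda>s. (p s)\<^sup>2)" .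
  moreover have "integral {0..pi} (\<lambda>s. (p s)\<^sup>2) \<le> integral {0..pi} (\<lambda>s. (p' s)\<^sup>2)"
    using wirtinger_antiperiodic[of pi p p', OF _ p pq(3) pa] by simp
  ultimately have U: "integral {0..pi} (\<lambda>s. (u s)\<^sup>2) \<le> 2 * integral {0..pi} (\<lambda>s. (p' s)\<^sup>2)" by simp
  have v: "(v has_real_derivative v' x) (at x)" for x
    unfolding v_def[abs_def] v'_def using q[of "x + pi/2"] by (auto intro!: derivative_eq_intros q simp: DERIV_shift)
  have v_half: "v (x + pi/2) = - v x" "v' (x + pi/2) = - v' x" for x
    unfolding v_def v'_def q_half by simp_all
  \<comment> \<open>Antiperiod \<open>pi / 2\<close> raises the Wirtinger constant from 1 to 4. The
    even part therefore has room for the crude bound of the squared difference by twice the sum of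
    the squares.\<close>
  have "(pi / (pi/2))\<^sup>2 * integral {0..pi/2} (\<lambda>x. (v x)\<^sup>2) \<le> integral {0..pi/2} (\<lambda>x. (v' x)\<^sup>2)"
    by (rule wirtinger_antiperiodic[OF _ v cuv(3) v_half]) simp
  then have "4 * integral {0..pi/2} (\<lambda>x. (v x)\<^sup>2) \<le> integral {0..pi/2} (\<lambda>x. (v' x)\<^sup>2)" by simp
  also have "\<dots> \<le> integral {0..pi/2} (\<lambda>s. 2 * ((q' s)\<^sup>2 + (q' (s + pi/2))\<^sup>2))"
  proof (rule Henstock_Kurzweil_Integration.integral_le)
    fix s
    have "0 \<le> (q' s + q' (s + pi/2))\<^sup>2" by simp
    then show "(v' s)\<^sup>2 \<le> 2 * ((q' s)\<^sup>2 + (q' (s + pi/2))\<^sup>2)"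
      unfolding v'_def power2_eq_square by (simp add: algebra_simps)
  qed (intro integrable_continuous_real continuous_intros cuv pq2; auto)+
  also have "\<dots> = 2 * integral {0..pi/2} (\<lambda>s. (q' s)\<^sup>2 + (q' (s + pi/2))\<^sup>2)" by (rule Henstock_Kurzweil_Integration.integral_mult_right)
  also have "\<dots> = 2 * integral {0..pi} (\<lambda>s. (q' s)\<^sup>2)"
    by (subst half) (auto intro!: continuous_intros)
  finally have V: "2 * integral {0..pi/2} (\<lambda>x. (v x)\<^sup>2) \<le> integral {0..pi} (\<lambda>s. (q' s)\<^sup>2)" by simp
  have "integral {0..pi} (\<lambda>s. (v s)\<^sup>2) = integral {0..pi/2} (\<lambda>s. (v s)\<^sup>2 + (v (s + pi/2))\<^sup>2)"
    by (intro half continuous_intros cuv)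
  also have "\<dots> = integral {0..pi/2} (\<lambda>s. 2 * (v s)\<^sup>2)"
    by (simp add: v_def q_half qa power2_eq_square algebra_simps)
  also have "\<dots> = 2 * integral {0..pi/2} (\<lambda>s. (v s)\<^sup>2)" by simp
  finally have "integral {0..pi} (\<lambda>s. (v s)\<^sup>2) \<le> integral {0..pi} (\<lambda>s. (q' s)\<^sup>2)" using V by simp
  moreover have "0 \<le> integral {0..pi} (\<lambda>s. (q' s)\<^sup>2)"
    by (intro Henstock_Kurzweil_Integration.integral_nonneg integrable_continuous_real continuous_intros) auto
  moreover have "2 * a + 2 * b \<le> 2 * (2 * c + 2 * d)" if "b \<le> d" "0 \<le> d" "a \<le> 2 * c" for a b c d :: real
    using that by (auto simp: distrib_left)
  ultimately show ?thesis using U unfolding lhs rhs by blast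
qed

section \<open>Change of variables\<close>

text \<open>The library proves the change of variables formula for \<open>real^'m\<close> with a well-ordered index
  type \<open>'m\<close>.  A copy of an arbitrary finite type, ordered through an injection into the natural
  numbers, makes it available for all finite index types.\<close>

typedef 'a indexed = "UNIV :: 'a set" ..

definition index_of :: "'a::finite indexed \<Rightarrow> nat" where
  "index_of = (SOME f. inj f) \<circ> Rep_indexed"

lemma inj_index_of: "inj index_of"
proof -
  have "\<exists>f :: 'a::finite \<Rightarrow> nat. inj f"
    using finite_imp_inj_to_nat_seg[of "UNIV :: 'a set"] by auto
  then have "inj (SOME f :: 'a::finite \<Rightarrow> nat. inj f)" by (rule someI_ex)
  then show ?thesis
    unfolding index_of_def by (rule inj_compose) (simp add: inj_on_def Rep_indexed_inject)
qed

instance indexed :: (finite) finite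
proof
  have "(UNIV :: 'a indexed set) = range Abs_indexed"
    by (metis Rep_indexed_inverse surj_def)
  then show "finite (UNIV :: 'a indexed set)" by (metis finite finite_imageI)
qed

instantiation indexed :: (finite) wellorder
begin

definition "x \<le> y \<longleftrightarrow> index_of x \<le> index_of y"
definition "x < y \<longleftrightarrow> index_of x < index_of y"

instance
proof
  fix P :: "'a indexed \<Rightarrow> bool" and a :: "'a indexed"
  assume *: "\<And>x. (\<And>y. y < x \<Longrightarrow> P y) \<Longrightarrow> P x"
  show "P a"
    by (induction "index_of a" arbitrary: a rule: less_induct) (metis * less_indexed_def)
qed (use inj_index_of in \<open>auto simp: less_eq_indexed_def less_indexed_def inj_def\<close>)

end

lemma permutes_conjugate:
  assumes "bij f" "p permutes UNIV"
  shows "f \<circ> p \<circ> inv f permutes UNIV"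
  using assms by (intro bij_imp_permutes) (auto intro!: bij_comp bij_imp_bij_inv dest: permutes_bij)

text \<open>Conjugation by \<open>f\<close> turns the transposition of \<open>a\<close> and
  \<open>b\<close> into that of \<open>f a\<close> and \<open>f b\<close>, so it preserves the
  number of factors in a decomposition into transpositions.\<close>

lemma sign_conjugate:
  fixes p :: "'a::finite \<Rightarrow> 'a" and f :: "'a \<Rightarrow> 'b::finite"
  assumes f: "bij f" and p: "p permutes UNIV"
  shows "sign (f \<circ> p \<circ> inv f) = sign p"
proof -
  have sw: "swapidseq n (f \<circ> p \<circ> inv f)" if "swapidseq n p" for n p
    using that
  proof (induction rule: swapidseq.induct)
    case id
    have "f \<circ> id \<circ> inv f = id" using f by (metis bij_is_surj comp_id surj_iff)
    then show ?case by (simp only: swapidseq.id)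
  next
    case (comp_Suc n p a b)
    have "f \<circ> (Transposition.transpose a b \<circ> p) \<circ> inv f = Transposition.transpose (f a) (f b) \<circ> (f \<circ> p \<circ> inv f)"
      using f by (auto simp: fun_eq_iff Transposition.transpose_def bij_def inj_def)
    moreover have "f a \<noteq> f b" using comp_Suc f by (auto simp: bij_def inj_eq)
    ultimately show ?case by (simp only:) (rule swapidseq.comp_Suc[OF comp_Suc.IH])
  qed
  obtain n where n: "swapidseq n p"
    using p permutation_permutes[of p] by (auto simp: permutation_def)
  have "evenperm (f \<circ> p \<circ> inv f) = evenperm p"
    using evenperm_unique[OF n refl] evenperm_unique[OF sw[OF n] refl] by simp
  then show ?thesis by (simp add: sign_def)
qed

text \<open>Conjugating permutations by \<open>f\<close> reindexes the Leibniz sum and keeps signs.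
  In this way Jacobian determinants can be compared across different index types.\<close>

lemma det_reindex:
  fixes A :: "real^'n^'n" and f :: "'m::finite \<Rightarrow> 'n::finite"
  assumes f: "bij f"
  shows "det (\<chi> i j. A $ f i $ f j) = det A"
proof -
  have bij: "bij_betw (\<lambda>p. f \<circ> p \<circ> inv f) {p. p permutes UNIV} {p. p permutes UNIV}"
  proof (rule bij_betw_byWitness[where f' = "\<lambda>p. inv f \<circ> p \<circ> f"])
    show "(\<lambda>p. inv f \<circ> p \<circ> f) ` {p. p permutes UNIV} \<subseteq> {p. p permutes UNIV}"
      using permutes_conjugate[OF bij_imp_bij_inv[OF f]] by (auto simp: inv_inv_eq[OF f])
  qed (use f permutes_conjugate[OF f] in \<open>auto simp: fun_eq_iff bij_is_inj bij_is_surj surj_f_inv_f\<close>)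
  have "det A = (\<Sum>p\<in>{p. p permutes UNIV}. of_int (sign p) * (\<Prod>i\<in>UNIV. A $ i $ p i))"
    by (simp add: det_def)
  also have "\<dots> = (\<Sum>p\<in>{p. p permutes UNIV}. of_int (sign (f \<circ> p \<circ> inv f)) * (\<Prod>i\<in>UNIV. A $ i $ (f \<circ> p \<circ> inv f) i))"
    by (rule sum.reindex_bij_betw[OF bij, symmetric])
  also have "\<dots> = (\<Sum>p\<in>{p. p permutes UNIV}. of_int (sign p) * (\<Prod>i\<in>UNIV. A $ f i $ f (p i)))"
  proof (intro sum.cong refl arg_cong2[where f = "(*)"])
    fix p :: "'m \<Rightarrow> 'm" assume "p \<in> {p. p permutes UNIV}"
    then show "real_of_int (sign (f \<circ> p \<circ> inv f)) = real_of_int (sign p)" using sign_conjugate[OF f] by auto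
    show "(\<Prod>i\<in>UNIV. A $ i $ (f \<circ> p \<circ> inv f) i) = (\<Prod>i\<in>UNIV. A $ f i $ f (p i))"
      by (subst prod.reindex_bij_betw[OF f, symmetric]) (simp add: bij_is_inj[OF f])
  qed
  finally show ?thesis by (simp add: det_def)
qed

text \<open>The formula for absolutely integrable functions contains an equivalence of
  integrability. For nonnegative integrands, failure of integrability means an infinite integral,
  and this occurs on both sides at once, so no integrability has to be assumed.\<close>

lemma nn_integral_change_of_variables_wellorder:
  fixes f :: "real^'m::{finite,wellorder} \<Rightarrow> real" and g :: "real^'m::_ \<Rightarrow> real^'m::_"
  assumes S: "S \<in> sets borel" and gS: "g ` S \<in> sets borel"
    and g: "\<And>x. x \<in> S \<Longrightarrow> (g has_derivative g' x) (at x within S)"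
    and inj: "inj_on g S"
    and f: "f \<in> borel_measurable borel" "\<And>x. 0 \<le> f x"
    and meas: "(\<lambda>x. indicator S x * (\<bar>det (matrix (g' x))\<bar> * f (g x))) \<in> borel_measurable borel"
  shows "(\<integral>\<^sup>+x\<in>g ` S. f x \<partial>lborel) = (\<integral>\<^sup>+x\<in>S. \<bar>det (matrix (g' x))\<bar> * f (g x) \<partial>lborel)"
proof -
  define F where "F x = indicator (g ` S) x * f x" for x
  define G where "G x = indicator S x * (\<bar>det (matrix (g' x))\<bar> * f (g x))" for x
  have nn: "0 \<le> F x" "0 \<le> G x" for x using f(2) by (auto simp: F_def G_def)
  have Fm: "F \<in> borel_measurable borel" unfolding F_def[abs_def] using gS f(1) by measurable
  have Gm: "G \<in> borel_measurable borel" unfolding G_def[abs_def] by (rule meas)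
  have F_int: "(\<integral>\<^sup>+x\<in>g ` S. f x \<partial>lborel) = integral\<^sup>N lborel F"
    by (intro nn_integral_cong) (auto simp: F_def indicator_def)
  have G_int: "(\<integral>\<^sup>+x\<in>S. \<bar>det (matrix (g' x))\<bar> * f (g x) \<partial>lborel) = integral\<^sup>N lborel G"
    by (intro nn_integral_cong) (auto simp: G_def indicator_def)
  \<comment> \<open>The formula used here concerns vector-valued integrands, so the scalar integrand
    is passed through \<open>real^1\<close>.\<close>
  have "(\<lambda>x. \<bar>det (matrix (g' x))\<bar> *\<^sub>R vec (f (g x)) :: real^1) absolutely_integrable_on S \<and>
      integral S (\<lambda>x. \<bar>det (matrix (g' x))\<bar> *\<^sub>R vec (f (g x))) = (vec b :: real^1)
    \<longleftrightarrow> (\<lambda>x. vec (f x) :: real^1) absolutely_integrable_on g ` S \<and> integral (g ` S) (\<lambda>x. vec (f x)) = (vec b :: real^1)" for b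
    using S by (intro has_absolute_integral_change_of_variables g inj) auto
  then have *: "(\<lambda>x. \<bar>det (matrix (g' x))\<bar> * f (g x)) absolutely_integrable_on S \<and>
      integral S (\<lambda>x. \<bar>det (matrix (g' x))\<bar> * f (g x)) = b
    \<longleftrightarrow> f absolutely_integrable_on g ` S \<and> integral (g ` S) f = b" for b
    by (simp add: absolutely_integrable_on_1_iff integral_on_1_eq)
  have Fi: "(F has_integral b) UNIV \<longleftrightarrow> (f has_integral b) (g ` S)" for b
    by (subst has_integral_restrict_UNIV[symmetric], rule arg_cong[where f = "\<lambda>F. (F has_integral b) UNIV"])
      (auto simp: F_def indicator_def)
  have Gi: "(G has_integral b) UNIV \<longleftrightarrow> ((\<lambda>x. \<bar>det (matrix (g' x))\<bar> * f (g x)) has_integral b) S" for b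
    by (subst has_integral_restrict_UNIV[symmetric], rule arg_cong[where f = "\<lambda>F. (F has_integral b) UNIV"])
      (auto simp: G_def indicator_def)
  have **: "(F has_integral b) UNIV \<longleftrightarrow> (G has_integral b) UNIV" for b
    unfolding Fi Gi using *[of b] f(2)
    by (simp add: absolutely_integrable_on_iff_nonneg has_integral_iff)
  show ?thesis unfolding F_int G_int
  proof (cases "\<exists>b. (F has_integral b) UNIV")
    case True
    then obtain b where "(F has_integral b) UNIV" by blast
    then show "integral\<^sup>N lborel F = integral\<^sup>N lborel G"
      using ** nn_integral_has_integral_lborel[OF Fm nn(1)] nn_integral_has_integral_lborel[OF Gm nn(2)] by metis
  next
    case False
    then have "\<not> F integrable_on UNIV" "\<not> G integrable_on UNIV"
      using ** by (auto simp: integrable_on_def)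
    then have "\<not> integral\<^sup>N lborel F < \<infinity>" "\<not> integral\<^sup>N lborel G < \<infinity>"
      using nn_integral_integrable_on[OF Fm nn(1)] nn_integral_integrable_on[OF Gm nn(2)] by auto
    then show "integral\<^sup>N lborel F = integral\<^sup>N lborel G" by (simp add: not_less top.extremum_unique)
  qed
qed

definition to_indexed :: "real^'n \<Rightarrow> real^('n indexed)" where
  "to_indexed x = (\<chi> i. x $ Rep_indexed i)"

definition of_indexed :: "real^('n indexed) \<Rightarrow> real^'n" where
  "of_indexed x = (\<chi> i. x $ Abs_indexed i)"

lemma indexed_inverse [simp]: "of_indexed (to_indexed x) = x" "to_indexed (of_indexed y) = y"
  by (simp_all add: to_indexed_def of_indexed_def vec_eq_iff Abs_indexed_inverse Rep_indexed_inverse)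

lemma bounded_linear_indexed: "bounded_linear to_indexed" "bounded_linear of_indexed"
  by (auto simp: linear_conv_bounded_linear[symmetric] to_indexed_def of_indexed_def vec_eq_iff intro!: linearI)

lemma bij_indexed: "bij to_indexed" "bij of_indexed" "bij Rep_indexed" "bij Abs_indexed"
proof -
  show "bij to_indexed" "bij of_indexed"
    by (rule o_bij[of of_indexed] o_bij[of to_indexed]; auto simp: fun_eq_iff o_def)+
  show "bij Rep_indexed" "bij Abs_indexed"
    by (rule o_bij[of Abs_indexed] o_bij[of Rep_indexed]; auto simp: fun_eq_iff Abs_indexed_inverse Rep_indexed_inverse)+
qed

lemma measurable_indexed [measurable]:
  "to_indexed \<in> borel_measurable borel" "of_indexed \<in> borel_measurable borel"
  by (auto intro!: borel_measurable_continuous_onI linear_continuous_on bounded_linear_indexed)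

lemma lborel_distr_of_indexed: "distr lborel borel of_indexed = (lborel :: (real^'n) measure)"
proof (rule lborel_eqI[symmetric])
  fix l u :: "real^'n" assume le: "\<And>b. b \<in> Basis \<Longrightarrow> l \<bullet> b \<le> u \<bullet> b"
  have le': "l $ i \<le> u $ i" for i using le[of "axis i 1"] by (simp add: inner_axis axis_in_Basis_iff)
  have v: "of_indexed -` box l u = box (to_indexed l) (to_indexed u)"
    by (auto simp: mem_box_cart to_indexed_def of_indexed_def) (metis Rep_indexed_inverse Abs_indexed_inverse UNIV_I)+
  have prod: "(\<Prod>b\<in>Basis. z \<bullet> b) = (\<Prod>i\<in>UNIV. z $ i)" for z :: "real^'k"
    unfolding Basis_vec_def
    by (simp add: UNION_singleton_eq_range prod.reindex inj_on_def axis_eq_axis inner_axis)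
  have "emeasure (distr lborel borel of_indexed) (box l u) = emeasure lborel (box (to_indexed l) (to_indexed u))"
    by (subst emeasure_distr) (auto simp: v)
  also have "\<dots> = (\<Prod>b\<in>Basis. (to_indexed u - to_indexed l) \<bullet> b)"
  proof (rule emeasure_lborel_box)
    fix b :: "real^('n indexed)" assume "b \<in> Basis"
    then obtain i where "b = axis i 1" by (auto simp: Basis_vec_def)
    then show "to_indexed l \<bullet> b \<le> to_indexed u \<bullet> b" using le' by (simp add: inner_axis to_indexed_def)
  qed
  also have "(\<Prod>b\<in>Basis. (to_indexed u - to_indexed l) \<bullet> b) = (\<Prod>i\<in>UNIV. (u - l) $ Rep_indexed i)"
    unfolding prod by (simp add: to_indexed_def)
  also have "\<dots> = (\<Prod>b\<in>Basis. (u - l) \<bullet> b)"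
    unfolding prod by (rule prod.reindex_bij_betw[OF bij_indexed(3)])
  finally show "emeasure (distr lborel borel of_indexed) (box l u) = (\<Prod>b\<in>Basis. (u - l) \<bullet> b)" .
qed simp

text \<open>Relabelling the coordinates preserves Lebesgue measure and permutes rows and columns of
  the Jacobian matrix simultaneously, so both sides are carried unchanged to the ordered index
  type.\<close>

theorem nn_integral_change_of_variables:
  fixes f :: "real^'n \<Rightarrow> real" and g :: "real^'n \<Rightarrow> real^'n"
  assumes S: "S \<in> sets borel" and gS: "g ` S \<in> sets borel"
    and g: "\<And>x. x \<in> S \<Longrightarrow> (g has_derivative g' x) (at x within S)"
    and inj: "inj_on g S"
    and f: "f \<in> borel_measurable borel" "\<And>x. 0 \<le> f x"
    and meas: "(\<lambda>x. indicator S x * (\<bar>det (matrix (g' x))\<bar> * f (g x))) \<in> borel_measurable borel"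
  shows "(\<integral>\<^sup>+x\<in>g ` S. f x \<partial>lborel) = (\<integral>\<^sup>+x\<in>S. \<bar>det (matrix (g' x))\<bar> * f (g x) \<partial>lborel)"
proof -
  define S' where "S' = to_indexed ` S"
  define h where "h = to_indexed \<circ> g \<circ> of_indexed"
  define h' where "h' y = to_indexed \<circ> g' (of_indexed y) \<circ> of_indexed" for y
  have vimage: "to_indexed ` X = of_indexed -` X" for X :: "(real^'n) set"
    by (auto simp: image_iff) (metis indexed_inverse(2))
  have hS': "h ` S' = to_indexed ` g ` S" by (auto simp: h_def S'_def image_comp)
  have ind: "indicator S' y = (indicator S (of_indexed y) :: 'b::zero_neq_one)"
    "indicator (h ` S') y = (indicator (g ` S) (of_indexed y) :: 'b)" for y
    unfolding hS' unfolding S'_def vimage by (auto simp: indicator_def)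
  have mem: "y \<in> S' \<longleftrightarrow> of_indexed y \<in> S" for y
    unfolding S'_def vimage by simp
  have bl: "(to_indexed has_derivative to_indexed) F" "(of_indexed has_derivative of_indexed) G" for F G
    by (intro bounded_linear.has_derivative[OF bounded_linear_indexed(1) has_derivative_ident]
        bounded_linear.has_derivative[OF bounded_linear_indexed(2) has_derivative_ident])+
  have h: "(h has_derivative h' y) (at y within S')" if y: "y \<in> S'" for y
  proof -
    have im: "of_indexed ` S' = S" by (auto simp: S'_def image_comp)
    have "of_indexed y \<in> S" using y by (auto simp: S'_def)
    then have "(g has_derivative g' (of_indexed y)) (at (of_indexed y) within of_indexed ` S')"
      unfolding im by (rule g)
    then have "(g \<circ> of_indexed has_derivative g' (of_indexed y) \<circ> of_indexed) (at y within S')"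
      by (rule diff_chain_within[OF bl(2)])
    then show ?thesis
      unfolding h_def h'_def comp_assoc by (rule diff_chain_within[OF _ bl(1)])
  qed
  have det: "det (matrix (h' y)) = det (matrix (g' (of_indexed y)))" if y: "y \<in> S'" for y
  proof -
    have ax: "of_indexed (axis i 1) = axis (Rep_indexed i) 1" for i
      by (auto simp: of_indexed_def vec_eq_iff axis_def Abs_indexed_inverse Rep_indexed_inverse)
    have "matrix (h' y) = (\<chi> i j. matrix (g' (of_indexed y)) $ Rep_indexed i $ Rep_indexed j)"
      by (simp add: matrix_def h'_def ax vec_eq_iff) (simp add: to_indexed_def)
    then show ?thesis by (simp add: det_reindex[OF bij_indexed(3)])
  qed
  have "(\<integral>\<^sup>+x\<in>g ` S. f x \<partial>lborel) = (\<integral>\<^sup>+y\<in>h ` S'. f (of_indexed y) \<partial>lborel)"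
    unfolding lborel_distr_of_indexed[symmetric, where 'n = 'n] ind
    using gS f(1) by (subst nn_integral_distr) auto
  also have "\<dots> = (\<integral>\<^sup>+y\<in>S'. \<bar>det (matrix (h' y))\<bar> * f (of_indexed (h y)) \<partial>lborel)"
  proof (rule nn_integral_change_of_variables_wellorder[OF _ _ h])
    show "S' \<in> sets borel" "h ` S' \<in> sets borel"
      unfolding hS' unfolding S'_def vimage using S gS measurable_sets[OF measurable_indexed(2)] by auto
    show "inj_on h S'"
      using inj bij_is_inj[OF bij_indexed(1)] by (auto simp: h_def S'_def inj_on_def)
    show "(\<lambda>y. f (of_indexed y)) \<in> borel_measurable borel" using f(1) by measurable
    have "(\<lambda>y. indicator S' y * (\<bar>det (matrix (h' y))\<bar> * f (of_indexed (h y)))) =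
       (\<lambda>x. indicator S x * (\<bar>det (matrix (g' x))\<bar> * f (g x))) \<circ> of_indexed"
      by (auto simp: fun_eq_iff ind det h_def indicator_def mem)
    then show "(\<lambda>y. indicator S' y * (\<bar>det (matrix (h' y))\<bar> * f (of_indexed (h y)))) \<in> borel_measurable borel"
      using measurable_comp[OF measurable_indexed(2) meas] by simp
  qed (use f in auto)
  also have "\<dots> = (\<integral>\<^sup>+y. ennreal (indicator S (of_indexed y) * (\<bar>det (matrix (g' (of_indexed y)))\<bar> * f (g (of_indexed y)))) \<partial>lborel)"
    by (intro nn_integral_cong) (auto simp: indicator_def det h_def mem)
  also have "\<dots> = (\<integral>\<^sup>+x. ennreal (indicator S x * (\<bar>det (matrix (g' x))\<bar> * f (g x))) \<partial>lborel)"
    by (subst (2) lborel_distr_of_indexed[symmetric]) (use meas in \<open>subst nn_integral_distr; simp\<close>)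
  also have "\<dots> = (\<integral>\<^sup>+x\<in>S. \<bar>det (matrix (g' x))\<bar> * f (g x) \<partial>lborel)"
    by (intro nn_integral_cong) (auto simp: indicator_def)
  finally show ?thesis .
qed

lemma lborel_distr_orthogonal:
  fixes g :: "real^'n \<Rightarrow> real^'n"
  assumes g: "orthogonal_transformation g"
  shows "distr lborel borel g = lborel"
proof (rule measure_eqI)
  show "sets (distr lborel borel g) = sets lborel" by simp
  have lin: "linear g" and inj: "inj g" and surj: "surj g"
    using g orthogonal_transformation_inj orthogonal_transformation_surj by (auto simp: orthogonal_transformation_def)
  have meas: "g \<in> borel_measurable borel"
    using lin by (intro borel_measurable_continuous_onI linear_continuous_on) (simp add: linear_conv_bounded_linear)
  fix A assume "A \<in> sets (distr lborel borel g)"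
  then have A: "A \<in> sets borel" by simp
  have S: "g -` A \<in> sets borel" using measurable_sets[OF meas A] by simp
  have img: "g ` (g -` A) = A" using surj by (simp add: surj_image_vimage_eq)
  have d: "\<bar>det (matrix g)\<bar> = 1" using g
    using det_orthogonal_matrix orthogonal_transformation_matrix[of g] by fastforce
  have "(\<integral>\<^sup>+x\<in>g ` (g -` A). ennreal 1 \<partial>lborel) = (\<integral>\<^sup>+x\<in>g -` A. ennreal (\<bar>det (matrix g)\<bar> * 1) \<partial>lborel)"
  proof (rule nn_integral_change_of_variables[OF S])
    show "(g has_derivative g) (at x within g -` A)" for x
      using lin by (intro bounded_linear_imp_has_derivative) (simp add: linear_conv_bounded_linear)
    show "(\<lambda>x. indicator (g -` A) x * (\<bar>det (matrix g)\<bar> * 1)) \<in> borel_measurable borel"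
      using S by measurable
  qed (use A inj surj in \<open>auto simp: img intro: inj_on_subset\<close>)
  then show "emeasure (distr lborel borel g) A = emeasure lborel A"
    using A S meas unfolding img d by (simp add: emeasure_distr)
qed

section \<open>Polar coordinates\<close>

text \<open>The cone measure: a set of directions has the volume of the part of the unit ball above
  it. This is the surface measure divided by \<open>DIM('a)\<close>. It lives on the whole space,
  and the point \<open>sgn 0 = 0\<close> outside the sphere carries no mass.\<close>

definition sphere_measure :: "'a::euclidean_space measure" where
  "sphere_measure = distr (density lborel (indicator (ball 0 1))) borel sgn"

text \<open>The density is the derivative of \<open>s ^ DIM('a)\<close>; its factor
  \<open>DIM('a)\<close> compensates the normalization of \<open>sphere_measure\<close>.\<close>

definition radial_measure :: "'a::euclidean_space itself \<Rightarrow> real measure" where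
  "radial_measure _ = density lborel (\<lambda>t. ennreal (DIM('a) * t ^ (DIM('a) - 1)) * indicator {0<..} t)"

lemma borel_measurable_sgn [measurable]: "(sgn :: 'a::euclidean_space \<Rightarrow> 'a) \<in> borel_measurable borel"
  unfolding sgn_div_norm[abs_def] by measurable

lemma borel_measurable_indicator_ball: "(indicator (ball (x::'a::euclidean_space) r) :: 'a \<Rightarrow> ennreal) \<in> borel_measurable lborel"
  by (rule borel_measurable_indicator) simp

lemma sets_sphere_measure [measurable_cong, simp]: "sets sphere_measure = sets borel"
  and space_sphere_measure [simp]: "space sphere_measure = UNIV"
  and sets_radial_measure [measurable_cong, simp]: "sets (radial_measure TYPE('a::euclidean_space)) = sets borel"
  and space_radial_measure [simp]: "space (radial_measure TYPE('a)) = UNIV"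
  by (simp_all add: sphere_measure_def radial_measure_def)

lemma nn_integral_lborel_affine:
  fixes h :: "'a::euclidean_space \<Rightarrow> ennreal"
  assumes [measurable]: "h \<in> borel_measurable borel" and c: "c \<noteq> 0"
  shows "(\<integral>\<^sup>+x. h x \<partial>lborel) = ennreal (\<bar>c\<bar> ^ DIM('a)) * (\<integral>\<^sup>+x. h (t + c *\<^sub>R x) \<partial>lborel)"
  by (subst lborel_affine[OF c, of t]) (simp add: nn_integral_density nn_integral_distr nn_integral_cmult)

lemma nn_integral_lborel_pair:
  fixes G :: "'a::euclidean_space \<times> 'b::euclidean_space \<Rightarrow> ennreal"
  assumes "G \<in> borel_measurable borel"
  shows "(\<integral>\<^sup>+z. G z \<partial>lborel) = (\<integral>\<^sup>+x. \<integral>\<^sup>+y. G (x, y) \<partial>lborel \<partial>lborel)"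
proof -
  have "G \<in> borel_measurable (lborel \<Otimes>\<^sub>M lborel)" using assms by (simp add: lborel_prod)
  then show ?thesis by (subst lborel_prod[symmetric]) (simp add: lborel.nn_integral_fst)
qed

lemma emeasure_sphere_measure:
  fixes A :: "'a::euclidean_space set"
  assumes [measurable]: "A \<in> sets borel"
  shows "emeasure sphere_measure A = emeasure lborel {x. sgn x \<in> A \<and> norm x < 1}"
proof -
  have "emeasure sphere_measure A = emeasure (density lborel (indicator (ball 0 1))) (sgn -` A)"
    unfolding sphere_measure_def by (subst emeasure_distr) auto
  also have "\<dots> = (\<integral>\<^sup>+x. indicator {x. sgn x \<in> A \<and> norm x < 1} x \<partial>lborel)"
    using measurable_sets[OF borel_measurable_sgn assms]
    by (subst emeasure_density[OF borel_measurable_indicator_ball])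
      (auto simp: indicator_def simp del: nn_integral_indicator intro!: nn_integral_cong)
  also have "\<dots> = emeasure lborel {x. sgn x \<in> A \<and> norm x < 1}"
    by (rule nn_integral_indicator) simp
  finally show ?thesis .
qed

lemma emeasure_cone:
  fixes A :: "'a::euclidean_space set"
  assumes [measurable]: "A \<in> sets borel" and s: "s > 0"
  shows "emeasure lborel {x. sgn x \<in> A \<and> norm x < s} = emeasure sphere_measure A * ennreal (s ^ DIM('a))"
proof -
  have "emeasure lborel {x. sgn x \<in> A \<and> norm x < s} = (\<integral>\<^sup>+x. indicator {x. sgn x \<in> A \<and> norm x < s} x \<partial>lborel)"
    by (rule nn_integral_indicator[symmetric]) simp
  also have "\<dots> = ennreal (\<bar>s\<bar> ^ DIM('a)) * (\<integral>\<^sup>+x. indicator {x. sgn x \<in> A \<and> norm x < s} (0 + s *\<^sub>R x) \<partial>lborel)"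
    using s by (intro nn_integral_lborel_affine) auto
  also have "(\<integral>\<^sup>+x. indicator {x. sgn x \<in> A \<and> norm x < s} (0 + s *\<^sub>R x) \<partial>lborel)
      = (\<integral>\<^sup>+x. indicator {x. sgn x \<in> A \<and> norm x < 1} x \<partial>lborel)"
    using s by (intro nn_integral_cong) (auto simp: indicator_def sgn_scaleR)
  also have "\<dots> = emeasure sphere_measure A"
    unfolding emeasure_sphere_measure[OF assms(1)] by (rule nn_integral_indicator) simp
  finally show ?thesis using s by (simp add: mult.commute)
qed

lemma finite_measure_sphere_measure: "finite_measure (sphere_measure :: 'a::euclidean_space measure)"
proof
  have "emeasure sphere_measure (UNIV :: 'a set) = emeasure lborel (ball (0::'a) 1)"
    by (simp add: emeasure_sphere_measure ball_def)
  then show "emeasure sphere_measure (space (sphere_measure :: 'a measure)) \<noteq> \<infinity>"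
    using emeasure_lborel_ball_finite[of "0::'a" 1] by simp
qed

lemma emeasure_sphere_measure_pos: "emeasure sphere_measure (UNIV :: 'a::euclidean_space set) > 0"
proof -
  have "emeasure sphere_measure (UNIV :: 'a set) = emeasure lborel (ball (0::'a) 1)"
    by (simp add: emeasure_sphere_measure ball_def)
  then show ?thesis
    using content_ball_pos[of 1 "0::'a"] by (metis measure_def enn2real_0 less_irrefl zero_less_one zero_less_iff_neq_zero)
qed

lemma AE_sphere_measure: "AE \<omega> in (sphere_measure :: 'a::euclidean_space measure). norm \<omega> = 1"
proof -
  have "AE x in density lborel (indicator (ball (0::'a) 1)). norm (sgn x) = 1"
    by (subst AE_density[OF borel_measurable_indicator_ball]) (use AE_lborel_singleton[of "0::'a"] in \<open>eventually_elim, simp add: norm_sgn\<close>)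
  then show ?thesis unfolding sphere_measure_def by (subst AE_distr_iff) auto
qed

lemma emeasure_radial_measure:
  assumes "s > 0"
  shows "emeasure (radial_measure TYPE('a::euclidean_space)) {..<s} = ennreal (s ^ DIM('a))"
proof -
  have "emeasure (radial_measure TYPE('a)) {..<s} = (\<integral>\<^sup>+t. ennreal (DIM('a) * t ^ (DIM('a) - 1)) * indicator {0..s} t \<partial>lborel)"
    unfolding radial_measure_def
  proof (subst emeasure_density, simp, simp, rule nn_integral_cong_AE)
    show "AE t in lborel. ennreal (real DIM('a) * t ^ (DIM('a) - 1)) * indicator {0<..} t * indicator {..<s} t =
         ennreal (real DIM('a) * t ^ (DIM('a) - 1)) * indicator {0..s} t"
      using AE_lborel_singleton[of 0] AE_lborel_singleton[of s] by eventually_elim (auto simp: indicator_def)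
  qed
  also have "\<dots> = ennreal (s ^ DIM('a) - 0 ^ DIM('a))"
    using assms by (intro nn_integral_FTC_Icc) (auto intro!: derivative_eq_intros)
  finally show ?thesis by (simp add: zero_power)
qed

lemma emeasure_radial_measure_nonpos:
  assumes "s \<le> 0"
  shows "emeasure (radial_measure TYPE('a::euclidean_space)) {..<s} = 0"
proof -
  have "emeasure (radial_measure TYPE('a)) {..<s} = (\<integral>\<^sup>+t. 0 \<partial>(lborel :: real measure))"
    unfolding radial_measure_def
    by (subst emeasure_density) (simp, simp, rule nn_integral_cong, use assms in \<open>auto simp: indicator_def\<close>)
  then show ?thesis by simp
qed

lemma sigma_finite_radial_measure: "sigma_finite_measure (radial_measure TYPE('a::euclidean_space))"
proof
  have "emeasure (radial_measure TYPE('a)) {..<real k} \<noteq> \<infinity>" for k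
    by (cases "real k \<le> 0") (simp_all add: emeasure_radial_measure emeasure_radial_measure_nonpos del: of_nat_le_0_iff)
  then show "\<exists>A. countable A \<and> A \<subseteq> sets (radial_measure TYPE('a)) \<and> \<Union>A = space (radial_measure TYPE('a)) \<and>
     (\<forall>a\<in>A. emeasure (radial_measure TYPE('a)) a \<noteq> \<infinity>)"
    by (intro exI[of _ "range (\<lambda>k::nat. {..<real k})"]) (auto intro: reals_Archimedean2)
qed

text \<open>For a cone over \<open>A\<close> the measure of the part in \<open>{x. norm x < s}\<close> scales like \<open>s ^ DIM('a)\<close>,
  and this determines the radial marginal.\<close>

theorem lborel_polar:
  "distr lborel (borel \<Otimes>\<^sub>M borel) (\<lambda>x::'a::euclidean_space. (sgn x, norm x)) =
    sphere_measure \<Otimes>\<^sub>M radial_measure TYPE('a)"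
proof (rule pair_measure_eqI[symmetric])
  interpret S: finite_measure "sphere_measure :: 'a measure" by (rule finite_measure_sphere_measure)
  show "sigma_finite_measure (sphere_measure :: 'a measure)" ..
  have rad: "emeasure (radial_measure TYPE('a)) {..<s} = (if s \<le> 0 then 0 else ennreal (s ^ DIM('a)))" for s
    by (simp add: emeasure_radial_measure emeasure_radial_measure_nonpos)
  show "sigma_finite_measure (radial_measure TYPE('a))" by (rule sigma_finite_radial_measure)
  show "sets (sphere_measure \<Otimes>\<^sub>M radial_measure TYPE('a)) = sets (distr lborel (borel \<Otimes>\<^sub>M borel) (\<lambda>x::'a. (sgn x, norm x)))"
    by (simp cong: sets_pair_measure_cong)
  fix A :: "'a set" and B :: "real set"
  assume "A \<in> sets sphere_measure" "B \<in> sets (radial_measure TYPE('a))"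
  then have [measurable]: "A \<in> sets borel" "B \<in> sets borel" by simp_all
  \<comment> \<open>For a fixed set \<open>A\<close> of directions, agreement on all rectangles
    \<open>A \<times> B\<close> is an equality of two measures in \<open>B\<close>, and half lines
    suffice to test it.\<close>
  define M where "M = distr (density lborel (indicator (sgn -` A))) borel (norm :: 'a \<Rightarrow> real)"
  have sA [measurable]: "sgn -` A \<in> sets borel" using measurable_sets[OF borel_measurable_sgn, of A] by simp
  have M: "emeasure M X = emeasure lborel {x. sgn x \<in> A \<and> norm x \<in> X}" if [measurable]: "X \<in> sets borel" for X
  proof -
    have nX: "(norm :: 'a \<Rightarrow> real) -` X \<in> sets borel" using measurable_sets[of norm borel borel X] that by simp
    have "emeasure M X = emeasure (density lborel (indicator (sgn -` A))) (norm -` X)"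
      unfolding M_def by (subst emeasure_distr) auto
    also have "\<dots> = (\<integral>\<^sup>+x. indicator {x. sgn x \<in> A \<and> norm x \<in> X} x \<partial>lborel)"
      using nX by (subst emeasure_density) (auto intro!: nn_integral_cong simp: indicator_def simp del: nn_integral_indicator)
    also have "\<dots> = emeasure lborel {x. sgn x \<in> A \<and> norm x \<in> X}"
      by (rule nn_integral_indicator) simp
    finally show ?thesis .
  qed
  have "M = scale_measure (emeasure sphere_measure A) (radial_measure TYPE('a))"
  proof (rule measure_eqI_generator_eq[where E = "range lessThan" and \<Omega> = UNIV and A = "\<lambda>i. {..<real i}"])
    show "Int_stable (range lessThan :: real set set)"
      by (auto simp: Int_stable_def greaterThan_Int_greaterThan)
    show "sets M = sigma_sets UNIV (range lessThan)"
      "sets (scale_measure (emeasure sphere_measure A) (radial_measure TYPE('a))) = sigma_sets UNIV (range lessThan)"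
      by (simp_all add: M_def borel_Iio)
    have eq: "emeasure M {..<s} = emeasure sphere_measure A * emeasure (radial_measure TYPE('a)) {..<s}" for s
    proof (cases "s \<le> 0")
      case True
      then have empty: "{x::'a. sgn x \<in> A \<and> norm x < s} = {}" by (auto simp: not_less intro: order_trans)
      have "emeasure M {..<s} = emeasure lborel {x::'a. sgn x \<in> A \<and> norm x < s}" by (simp add: M)
      also have "\<dots> = 0" unfolding empty by simp
      finally show ?thesis using True by (simp add: rad)
    qed (simp add: M emeasure_cone emeasure_radial_measure)
    show "emeasure M X = emeasure (scale_measure (emeasure sphere_measure A) (radial_measure TYPE('a))) X"
      if "X \<in> range lessThan" for X
      using that eq by auto
    show "emeasure M {..<real i} \<noteq> \<infinity>" for i
      unfolding eq rad using S.emeasure_finite by (auto simp: ennreal_mult_eq_top_iff)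
  qed (auto intro: reals_Archimedean2)
  then have "emeasure sphere_measure A * emeasure (radial_measure TYPE('a)) B = emeasure M B" by simp
  also have "\<dots> = emeasure (distr lborel (borel \<Otimes>\<^sub>M borel) (\<lambda>x::'a. (sgn x, norm x))) (A \<times> B)"
    by (subst emeasure_distr) (auto simp: M intro!: arg_cong[where f = "emeasure lborel"])
  finally show "emeasure sphere_measure A * emeasure (radial_measure TYPE('a)) B =
    emeasure (distr lborel (borel \<Otimes>\<^sub>M borel) (\<lambda>x::'a. (sgn x, norm x))) (A \<times> B)" .
qed

lemma nn_integral_polar:
  fixes h :: "'a::euclidean_space \<times> real \<Rightarrow> ennreal"
  assumes [measurable]: "h \<in> borel_measurable (borel \<Otimes>\<^sub>M borel)"
  shows "(\<integral>\<^sup>+x. h (sgn x, norm x) \<partial>lborel) = (\<integral>\<^sup>+\<omega>. \<integral>\<^sup>+t. h (\<omega>, t) \<partial>radial_measure TYPE('a) \<partial>sphere_measure)"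
proof -
  interpret R: sigma_finite_measure "radial_measure TYPE('a)" by (rule sigma_finite_radial_measure)
  have "(\<integral>\<^sup>+x. h (sgn x, norm x) \<partial>lborel) = (\<integral>\<^sup>+z. h z \<partial>distr lborel (borel \<Otimes>\<^sub>M borel) (\<lambda>x::'a. (sgn x, norm x)))"
    by (subst nn_integral_distr) auto
  also have "\<dots> = (\<integral>\<^sup>+\<omega>. \<integral>\<^sup>+t. h (\<omega>, t) \<partial>radial_measure TYPE('a) \<partial>sphere_measure)"
    unfolding lborel_polar by (subst R.nn_integral_fst[symmetric]) auto
  finally show ?thesis .
qed

lemma nn_integral_polar_product:
  fixes a :: "'a::euclidean_space \<Rightarrow> ennreal"
  assumes [measurable]: "a \<in> borel_measurable borel" "w \<in> borel_measurable borel"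
  shows "(\<integral>\<^sup>+x. a (sgn x) * w (norm x) \<partial>lborel) = (\<integral>\<^sup>+\<omega>. a \<omega> \<partial>sphere_measure) * (\<integral>\<^sup>+t. w t \<partial>radial_measure TYPE('a))"
proof -
  have "(\<integral>\<^sup>+x. a (sgn x) * w (norm x) \<partial>lborel) = (\<integral>\<^sup>+\<omega>. \<integral>\<^sup>+t. a \<omega> * w t \<partial>radial_measure TYPE('a) \<partial>sphere_measure)"
    using nn_integral_polar[of "\<lambda>z. a (fst z) * w (snd z)"] by simp
  then show ?thesis by (simp add: nn_integral_cmult nn_integral_multc)
qed

lemma nn_integral_polar_product2:
  fixes a b :: "'a::euclidean_space \<Rightarrow> ennreal" and W :: "real \<times> real \<Rightarrow> ennreal"
  assumes [measurable]: "a \<in> borel_measurable borel" "b \<in> borel_measurable borel" "W \<in> borel_measurable (borel \<Otimes>\<^sub>M borel)"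
  shows "(\<integral>\<^sup>+z. a (sgn (fst z)) * b (sgn (snd z)) * W (norm (fst z), norm (snd z)) \<partial>lborel) =
    (\<integral>\<^sup>+\<omega>. a \<omega> \<partial>sphere_measure) * (\<integral>\<^sup>+\<omega>. b \<omega> \<partial>sphere_measure) *
      (\<integral>\<^sup>+t. \<integral>\<^sup>+t'. W (t, t') \<partial>radial_measure TYPE('a) \<partial>radial_measure TYPE('a))"
proof -
  interpret R: sigma_finite_measure "radial_measure TYPE('a)" by (rule sigma_finite_radial_measure)
  have "(\<integral>\<^sup>+z. a (sgn (fst z)) * b (sgn (snd z)) * W (norm (fst z), norm (snd z)) \<partial>lborel) =
    (\<integral>\<^sup>+x. \<integral>\<^sup>+y. a (sgn x) * (b (sgn y) * W (norm x, norm y)) \<partial>lborel \<partial>lborel)"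
    unfolding lborel_prod[symmetric] by (subst lborel.nn_integral_fst[symmetric]) (auto simp: mult.assoc)
  also have "\<dots> = (\<integral>\<^sup>+x. a (sgn x) * ((\<integral>\<^sup>+\<omega>. b \<omega> \<partial>sphere_measure) * (\<integral>\<^sup>+t'. W (norm x, t') \<partial>radial_measure TYPE('a))) \<partial>lborel)"
    by (simp add: nn_integral_cmult nn_integral_polar_product[of b "\<lambda>t. W (_, t)"])
  also have "\<dots> = (\<integral>\<^sup>+\<omega>. a \<omega> \<partial>sphere_measure) * (\<integral>\<^sup>+t. (\<integral>\<^sup>+\<omega>. b \<omega> \<partial>sphere_measure) * (\<integral>\<^sup>+t'. W (t, t') \<partial>radial_measure TYPE('a)) \<partial>radial_measure TYPE('a))"
    by (rule nn_integral_polar_product) auto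
  also have "\<dots> = (\<integral>\<^sup>+\<omega>. a \<omega> \<partial>sphere_measure) * (\<integral>\<^sup>+\<omega>. b \<omega> \<partial>sphere_measure) *
      (\<integral>\<^sup>+t. \<integral>\<^sup>+t'. W (t, t') \<partial>radial_measure TYPE('a) \<partial>radial_measure TYPE('a))"
    by (simp add: nn_integral_cmult mult.assoc)
  finally show ?thesis .
qed

definition rotate_pair :: "real \<Rightarrow> real \<Rightarrow> 'a::real_vector \<times> 'a \<Rightarrow> 'a \<times> 'a" where
  "rotate_pair c s z = (c *\<^sub>R fst z + s *\<^sub>R snd z, c *\<^sub>R snd z - s *\<^sub>R fst z)"

lemma rotate_pair_measurable [measurable]:
  "rotate_pair c s \<in> borel_measurable (borel :: ('a::euclidean_space \<times> 'a) measure)"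
  unfolding rotate_pair_def[abs_def] by (intro borel_measurable_continuous_onI continuous_intros)

text \<open>A rotation with \<open>c \<noteq> 0\<close> factors into two maps which are affine in one variable, with
  linear parts \<open>c\<close> and \<open>1 / c\<close>; a quarter turn is the square of an eighth turn.\<close>

lemma nn_integral_rotate_pair:
  fixes H :: "'a::euclidean_space \<times> 'a \<Rightarrow> ennreal"
  assumes [measurable]: "H \<in> borel_measurable borel" and cs: "c\<^sup>2 + s\<^sup>2 = 1"
  shows "(\<integral>\<^sup>+z. H (rotate_pair c s z) \<partial>lborel) = (\<integral>\<^sup>+z. H z \<partial>lborel)"
proof -
  have main: "(\<integral>\<^sup>+z. H (rotate_pair c s z) \<partial>lborel) = (\<integral>\<^sup>+z. H z \<partial>lborel)"
    if [measurable]: "H \<in> borel_measurable borel" and cs: "c\<^sup>2 + s\<^sup>2 = 1" and c: "c \<noteq> 0"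
    for c s and H :: "'a \<times> 'a \<Rightarrow> ennreal"
  proof -
    have mH [measurable]: "H \<in> borel_measurable (borel \<Otimes>\<^sub>M borel)" unfolding borel_prod by measurable
    define k where "k = ennreal (\<bar>c\<bar> ^ DIM('a))"
    have k: "k \<noteq> 0" "k \<noteq> \<infinity>" using c by (auto simp: k_def)
    have cc: "c * c = 1 - s * s" using cs by (simp add: power2_eq_square)
    \<comment> \<open>The substitution in \<open>x\<close> with linear part \<open>c\<close>
      consumes the factor \<open>k\<close>, and the one in \<open>y\<close> with linear part
      \<open>1 / c\<close> restores it. Being finite and nonzero, \<open>k\<close> cancels in the
      end.\<close>
    have "k * (\<integral>\<^sup>+z. H (rotate_pair c s z) \<partial>lborel) =
      k * (\<integral>\<^sup>+x. \<integral>\<^sup>+y. H (c *\<^sub>R x + s *\<^sub>R y, c *\<^sub>R y - s *\<^sub>R x) \<partial>lborel \<partial>lborel)"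
      unfolding lborel_prod[symmetric] by (subst lborel.nn_integral_fst[symmetric]) (auto simp: rotate_pair_def borel_prod)
    also have "\<dots> = k * (\<integral>\<^sup>+y. \<integral>\<^sup>+x. H (c *\<^sub>R x + s *\<^sub>R y, c *\<^sub>R y - s *\<^sub>R x) \<partial>lborel \<partial>lborel)"
      by (subst lborel_pair.Fubini') auto
    also have "\<dots> = (\<integral>\<^sup>+y. k * (\<integral>\<^sup>+x. H (s *\<^sub>R y + c *\<^sub>R x, (1 / c) *\<^sub>R (y - s *\<^sub>R (s *\<^sub>R y + c *\<^sub>R x))) \<partial>lborel) \<partial>lborel)"
    proof -
      have "c *\<^sub>R y - s *\<^sub>R x = (1 / c) *\<^sub>R (y - s *\<^sub>R (s *\<^sub>R y + c *\<^sub>R x))" for x y :: 'a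
      proof -
        have "(1 / c) *\<^sub>R (y - s *\<^sub>R (s *\<^sub>R y + c *\<^sub>R x)) = ((1 - s * s) / c) *\<^sub>R y - s *\<^sub>R x"
          using c by (simp add: algebra_simps diff_divide_distrib)
        also have "(1 - s * s) / c = c" using c cc by (simp add: field_simps)
        finally show ?thesis by simp
      qed
      then show ?thesis by (subst nn_integral_cmult) (auto simp: add.commute)
    qed
    also have "\<dots> = (\<integral>\<^sup>+y. \<integral>\<^sup>+x. H (x, (1 / c) *\<^sub>R (y - s *\<^sub>R x)) \<partial>lborel \<partial>lborel)"
      unfolding k_def by (subst nn_integral_lborel_affine[symmetric, where h = "\<lambda>x. H (x, (1 / c) *\<^sub>R (_ - s *\<^sub>R x))"]) (use c in auto)
    also have "\<dots> = (\<integral>\<^sup>+x. \<integral>\<^sup>+y. H (x, (1 / c) *\<^sub>R (y - s *\<^sub>R x)) \<partial>lborel \<partial>lborel)"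
      by (subst lborel_pair.Fubini') auto
    also have "\<dots> = (\<integral>\<^sup>+x. k * (\<integral>\<^sup>+y. H (x, y) \<partial>lborel) \<partial>lborel)"
    proof (rule nn_integral_cong)
      fix x :: 'a
      have "k * (\<integral>\<^sup>+y. H (x, y) \<partial>lborel) = k * (ennreal (\<bar>1 / c\<bar> ^ DIM('a)) * (\<integral>\<^sup>+y. H (x, - (s / c) *\<^sub>R x + (1 / c) *\<^sub>R y) \<partial>lborel))"
        using c by (subst nn_integral_lborel_affine[of "\<lambda>y. H (x, y)" "1 / c" "- (s / c) *\<^sub>R x"]) auto
      also have "\<dots> = (\<integral>\<^sup>+y. H (x, - (s / c) *\<^sub>R x + (1 / c) *\<^sub>R y) \<partial>lborel)"
        using c by (simp add: k_def mult.assoc[symmetric] ennreal_mult[symmetric] power_mult_distrib[symmetric])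
      finally show "(\<integral>\<^sup>+y. H (x, (1 / c) *\<^sub>R (y - s *\<^sub>R x)) \<partial>lborel) = k * (\<integral>\<^sup>+y. H (x, y) \<partial>lborel)"
        by (simp add: algebra_simps)
    qed
    also have "\<dots> = k * (\<integral>\<^sup>+z. H z \<partial>lborel)"
      unfolding lborel_prod[symmetric]
      by (subst lborel.nn_integral_fst[symmetric]) (auto intro!: nn_integral_cmult)
    finally show ?thesis using k by (simp add: ennreal_mult_cancel_left)
  qed
  show ?thesis
  proof (cases "c = 0")
    case False
    then show ?thesis using main assms by simp
  next
    case True
    define r where "r = 1 / sqrt 2"
    have r: "r * r = 1/2" "r \<noteq> 0" by (auto simp: r_def)
    have s: "s * s = 1" using cs True by (simp add: power2_eq_square)
    have "rotate_pair r (s * r) (rotate_pair r (s * r) z) = rotate_pair c s z" for z :: "'a \<times> 'a"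
    proof -
      have rs: "r * (s * r) = s / 2" "(s * r) * r = s / 2" "s * r * (s * r) = 1/2" using r s by (simp_all add: algebra_simps)
      then show ?thesis using r unfolding rotate_pair_def True
        by (simp add: scaleR_add_right scaleR_diff_right rs) (simp add: algebra_simps scaleR_left_distrib[symmetric] mult.assoc)
    qed
    moreover have "r\<^sup>2 + (s * r)\<^sup>2 = 1"
      using r s by (simp add: power2_eq_square algebra_simps)
    ultimately show ?thesis
      using main[of "\<lambda>z. H (rotate_pair r (s * r) z)" r "s * r"] main[of H r "s * r"] r by simp
  qed
qed

section \<open>The Poincare inequality on the sphere\<close>

text \<open>By the equality case of Cauchy-Schwarz, for fixed nonzero \<open>x\<close> the
  exceptional \<open>y\<close> lie on the line through \<open>x\<close>, a null set in dimension at
  least two. Off this set the ellipse \<open>cos s x + sin s y\<close> avoids the origin, where the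
  homogeneous extension \<open>F\<close> need not be differentiable.\<close>

lemma AE_independent_pair:
  assumes "DIM('a::euclidean_space) \<ge> 2"
  shows "AE z in (lborel :: ('a \<times> 'a) measure). \<bar>fst z \<bullet> snd z\<bar> \<noteq> norm (fst z) * norm (snd z)"
  unfolding lborel_prod[symmetric]
proof (rule lborel_pair.AE_pair_measure)
  have "open {z::'a \<times> 'a. \<bar>fst z \<bullet> snd z\<bar> \<noteq> norm (fst z) * norm (snd z)}"
    by (intro open_Collect_neq continuous_intros)
  then show "{z \<in> space (lborel \<Otimes>\<^sub>M lborel). \<bar>fst z \<bullet> snd z\<bar> \<noteq> norm (fst z) * norm (snd (z::'a \<times> 'a))}
      \<in> sets (lborel \<Otimes>\<^sub>M lborel)"
    unfolding lborel_prod by simp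
  show "AE x in lborel. AE y in lborel. \<bar>fst (x, y) \<bullet> snd (x, y)\<bar> \<noteq> norm (fst (x, y)) * norm (snd (x, y :: 'a))"
    using AE_lborel_singleton[of "0::'a"]
  proof eventually_elim
    fix x :: 'a assume x: "x \<noteq> 0"
    have sub: "{y. \<bar>x \<bullet> y\<bar> = norm x * norm y} \<subseteq> span {x}"
    proof
      fix y assume "y \<in> {y. \<bar>x \<bullet> y\<bar> = norm x * norm y}"
      then have "norm x *\<^sub>R y = norm y *\<^sub>R x \<or> norm x *\<^sub>R y = - norm y *\<^sub>R x"
        by (simp add: norm_cauchy_schwarz_abs_eq)
      then have "norm x *\<^sub>R y \<in> span {x}"
        by (metis span_base span_scale singletonI)
      then have "(1 / norm x) *\<^sub>R (norm x *\<^sub>R y) \<in> span {x}" by (rule span_scale)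
      then show "y \<in> span {x}" using x by simp
    qed
    have "dim {y. \<bar>x \<bullet> y\<bar> = norm x * norm y} \<le> dim (span {x})" using sub by (rule dim_subset)
    also have "\<dots> \<le> 1" using dim_le_card'[of "{x}"] by simp
    finally have "negligible {y. \<bar>x \<bullet> y\<bar> = norm x * norm y}"
      using assms by (intro negligible_lowdim) simp
    moreover have "closed {y. \<bar>x \<bullet> y\<bar> = norm x * norm y}"
      by (intro closed_Collect_eq continuous_intros)
    ultimately have "{y. \<bar>x \<bullet> y\<bar> = norm x * norm y} \<in> null_sets lborel"
      by (simp add: negligible_iff_null_sets null_sets_completion_iff)
    then have "AE y in lborel. y \<notin> {y. \<bar>x \<bullet> y\<bar> = norm x * norm y}" by (rule AE_not_in)
    then show "AE y in lborel. \<bar>fst (x, y) \<bullet> snd (x, y)\<bar> \<noteq> norm (fst (x, y)) * norm (snd (x, y))" by simp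
  qed
qed

text \<open>Rotation invariance makes the second moment along \<open>v\<close> depend on
  \<open>norm v\<close> only, and the moments along the coordinate axes add up to the full one. The
  factor \<open>CARD('n)\<close> of the sphere inequality originates here.\<close>

lemma nn_integral_radial_isotropic:
  fixes v :: "real^'n" and \<rho> :: "real \<Rightarrow> ennreal"
  assumes [measurable]: "\<rho> \<in> borel_measurable borel"
  shows "of_nat CARD('n) * (\<integral>\<^sup>+y. \<rho> (norm y) * ennreal ((v \<bullet> y)\<^sup>2) \<partial>lborel) =
    ennreal ((norm v)\<^sup>2) * (\<integral>\<^sup>+y. \<rho> (norm (y::real^'n)) * ennreal ((norm y)\<^sup>2) \<partial>lborel)"
proof -
  define J where "J v = (\<integral>\<^sup>+y. \<rho> (norm y) * ennreal ((v \<bullet> y)\<^sup>2) \<partial>lborel)" for v :: "real^'n"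
  have J: "J v = ennreal ((norm v)\<^sup>2) * J (axis i 1)" for i
  proof -
    have nv: "norm v = norm (norm v *\<^sub>R axis i 1 :: real^'n)" by (simp add: norm_axis_1)
    obtain g :: "real^'n \<Rightarrow> real^'n" where g: "orthogonal_transformation g" "g v = norm v *\<^sub>R axis i 1"
      by (rule orthogonal_transformation_exists[OF nv]) blast
    have [measurable]: "g \<in> borel_measurable borel"
      using g(1) by (intro borel_measurable_continuous_onI linear_continuous_on)
        (simp add: linear_conv_bounded_linear orthogonal_transformation_def)
    have "ennreal ((norm v)\<^sup>2) * J (axis i 1) = (\<integral>\<^sup>+y. ennreal ((norm v)\<^sup>2) * (\<rho> (norm (y::real^'n)) * ennreal ((axis i 1 \<bullet> y)\<^sup>2)) \<partial>lborel)"
      unfolding J_def by (rule nn_integral_cmult[symmetric]) measurable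
    also have "\<dots> = (\<integral>\<^sup>+y. \<rho> (norm y) * ennreal ((g v \<bullet> y)\<^sup>2) \<partial>lborel)"
      by (intro nn_integral_cong) (simp add: g(2) power_mult_distrib ennreal_mult mult_ac)
    also have "\<dots> = (\<integral>\<^sup>+y. \<rho> (norm y) * ennreal ((g v \<bullet> y)\<^sup>2) \<partial>distr lborel borel g)"
      using g(1) by (simp add: lborel_distr_orthogonal)
    also have "\<dots> = J v"
      unfolding J_def using g(1)
      by (subst nn_integral_distr) (auto simp: orthogonal_transformation_norm orthogonal_transformation_def)
    finally show ?thesis by simp
  qed
  have "of_nat CARD('n) * J v = (\<Sum>i\<in>(UNIV :: 'n set). J v)" by simp
  also have "\<dots> = (\<Sum>i\<in>UNIV. ennreal ((norm v)\<^sup>2) * J (axis i 1))" by (intro sum.cong J refl)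
  also have "\<dots> = ennreal ((norm v)\<^sup>2) * (\<Sum>i\<in>UNIV. J (axis i 1))" by (simp add: sum_distrib_left)
  also have "(\<Sum>i\<in>UNIV. J (axis i 1)) = (\<integral>\<^sup>+y. (\<Sum>i\<in>UNIV. \<rho> (norm (y::real^'n)) * ennreal ((axis i 1 \<bullet> y)\<^sup>2)) \<partial>lborel)"
    unfolding J_def by (subst nn_integral_sum) auto
  also have "\<dots> = (\<integral>\<^sup>+y. \<rho> (norm (y::real^'n)) * ennreal ((norm y)\<^sup>2) \<partial>lborel)"
  proof (rule nn_integral_cong)
    fix y :: "real^'n"
    have "(norm y)\<^sup>2 = (\<Sum>i\<in>UNIV. (axis i 1 \<bullet> y)\<^sup>2)"
      unfolding power2_norm_eq_inner by (subst inner_vec_def) (simp add: inner_axis' power2_eq_square)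
    then show "(\<Sum>i\<in>UNIV. \<rho> (norm y) * ennreal ((axis i 1 \<bullet> y)\<^sup>2)) = \<rho> (norm y) * ennreal ((norm y)\<^sup>2)"
      by (simp add: sum_distrib_left[symmetric])
  qed
  finally show ?thesis by (simp add: J_def)
qed

lemma nn_integral_interval_continuous:
  fixes h :: "real \<Rightarrow> real"
  assumes "continuous_on {a..b} h" "\<And>x. 0 \<le> h x"
  shows "(\<integral>\<^sup>+x. ennreal (h x) * indicator {a..b} x \<partial>lborel) = ennreal (integral {a..b} h)"
proof -
  have "(h has_integral integral {a..b} h) {a..b}"
    using assms(1) by (intro integrable_integral integrable_continuous_real)
  then have "(\<integral>\<^sup>+x. ennreal (indicator {a..b} x * h x) \<partial>lborel) = ennreal (integral {a..b} h)"
    by (intro nn_integral_has_integral_lebesgue assms(2))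
  moreover have "(\<integral>\<^sup>+x. ennreal (h x) * indicator {a..b} x \<partial>lborel) = (\<integral>\<^sup>+x. ennreal (indicator {a..b} x * h x) \<partial>lborel)"
    by (intro nn_integral_cong) (auto simp: indicator_def)
  ultimately show ?thesis by simp
qed

text \<open>\<open>F\<close> is the homogeneous extension of degree one of \<open>f\<close> from the sphere.  The circle inequality
  holds for \<open>F\<close> along \<open>cos s x + sin s y\<close>; it is averaged over pairs \<open>(x, y)\<close> with a weight that is
  invariant under rotations.  A quarter turn maps \<open>x\<close> to \<open>y\<close>, whose direction is independent of that
  of \<open>x\<close>, so for \<open>f\<close> of mean zero the mixed term vanishes.\<close>

locale ambient_function =
  fixes f :: "real^'n \<Rightarrow> real" and g :: "real^'n \<Rightarrow> real^'n"
  assumes deriv: "\<And>x. (f has_derivative (\<lambda>h. g x \<bullet> h)) (at x)"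
    and cont: "continuous_on UNIV g"
    and card: "CARD('n) \<ge> 2"
begin

definition F :: "real^'n \<Rightarrow> real" where "F x = norm x * f (sgn x)"

text \<open>For a unit vector \<open>x\<close> this is the gradient of \<open>F\<close>: the radial
  component is \<open>f x\<close>, as Euler's relation for degree one requires, and the tangential
  component is that of \<open>g x\<close>.\<close>

definition w :: "real^'n \<Rightarrow> real^'n" where
  "w x = (f x - g x \<bullet> x) *\<^sub>R x + g x"

lemma cont_f: "continuous_on UNIV f"
  using deriv has_derivative_continuous by (blast intro: continuous_at_imp_continuous_on)

lemma meas [measurable]: "f \<in> borel_measurable borel" "g \<in> borel_measurable borel"
    "F \<in> borel_measurable borel" "w \<in> borel_measurable borel"
proof -
  show [measurable]: "f \<in> borel_measurable borel" "g \<in> borel_measurable borel"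
    using cont_f cont by (auto intro: borel_measurable_continuous_onI)
  show "F \<in> borel_measurable borel" "w \<in> borel_measurable borel"
    unfolding F_def[abs_def] w_def[abs_def] by measurable
qed

lemma norm_w: "norm x = 1 \<Longrightarrow> (norm (w x))\<^sup>2 = (f x)\<^sup>2 + ((norm (g x))\<^sup>2 - (g x \<bullet> x)\<^sup>2)"
proof -
  assume "norm x = 1"
  then have "x \<bullet> x = 1" by (simp add: norm_eq_1)
  then show ?thesis
    unfolding w_def power2_norm_eq_inner by (simp add: inner_simps inner_commute power2_eq_square algebra_simps)
qed

lemma F_derivative:
  assumes "x \<noteq> 0"
  shows "(F has_derivative (\<lambda>h. w (sgn x) \<bullet> h)) (at x)"
proof -
  have n: "(norm has_derivative (\<lambda>h. sgn x \<bullet> h)) (at x)"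
    using has_derivative_norm[OF assms] by (simp add: inner_commute)
  have s: "(sgn has_derivative (\<lambda>h. inverse (norm x) *\<^sub>R (h - (sgn x \<bullet> h) *\<^sub>R sgn x))) (at x)"
  proof -
    have "((\<lambda>x. inverse (norm x) *\<^sub>R x) has_derivative
        (\<lambda>h. inverse (norm x) *\<^sub>R h + (- (inverse (norm x) * (sgn x \<bullet> h) * inverse (norm x))) *\<^sub>R x)) (at x)"
      using assms by (intro has_derivative_scaleR Deriv.has_derivative_inverse n has_derivative_ident) auto
    then show ?thesis
      unfolding sgn_div_norm[abs_def] by (rule has_derivative_eq_rhs) (simp add: fun_eq_iff algebra_simps)
  qed
  have fs: "((\<lambda>x. f (sgn x)) has_derivative (\<lambda>h. g (sgn x) \<bullet> (inverse (norm x) *\<^sub>R (h - (sgn x \<bullet> h) *\<^sub>R sgn x)))) (at x)"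
    by (rule has_derivative_compose[OF s deriv])
  have ni: "norm x * (inverse (norm x) * k) = k" for k using assms by simp
  show ?thesis
    unfolding F_def[abs_def]
    by (intro has_derivative_eq_rhs[OF has_derivative_mult[OF n fs]])
      (simp only: fun_eq_iff w_def inner_simps ni, simp add: algebra_simps)
qed

text \<open>The velocity of \<open>X\<close> at \<open>s\<close> is
  \<open>Y s = X (s + pi/2)\<close>. Hence the quarter turn difference and the derivative of
  \<open>F\<close> along \<open>X\<close> are exactly the two integrands, and linear independence
  keeps \<open>X\<close> away from the origin.\<close>

lemma circle_inequality:
  fixes x y :: "real^'n"
  assumes "\<bar>x \<bullet> y\<bar> \<noteq> norm x * norm y"
  defines "X \<equiv> \<lambda>s. fst (rotate_pair (cos s) (sin s) (x, y))" and "Y \<equiv> \<lambda>s. snd (rotate_pair (cos s) (sin s) (x, y))"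
  shows "(\<integral>\<^sup>+s. ennreal ((F (X s) - F (Y s))\<^sup>2) * indicator {0..2*pi} s \<partial>lborel) \<le>
    2 * (\<integral>\<^sup>+s. ennreal ((w (sgn (X s)) \<bullet> Y s)\<^sup>2) * indicator {0..2*pi} s \<partial>lborel)"
proof -
  have X: "X s = cos s *\<^sub>R x + sin s *\<^sub>R y" and Y: "Y s = cos s *\<^sub>R y - sin s *\<^sub>R x" for s
    by (simp_all add: X_def Y_def rotate_pair_def)
  have X0: "X s \<noteq> 0" for s
  proof
    assume 0: "X s = 0"
    have "\<bar>x \<bullet> y\<bar> = norm x * norm y"
    proof (cases "sin s = 0")
      case True
      then have "cos s \<noteq> 0" using sin_cos_squared_add[of s] by auto
      then show ?thesis using 0 True by (simp add: X)
    next
      case False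
      have "sin s *\<^sub>R y = - cos s *\<^sub>R x" using 0 by (simp add: X add_eq_0_iff)
      then have "y = (- cos s / sin s) *\<^sub>R x"
        using False by (metis (no_types, lifting) divide_inverse_commute inverse_eq_divide scaleR_one scaleR_scaleR left_inverse)
      then show ?thesis by (simp add: power2_norm_eq_inner[symmetric] power2_eq_square abs_mult)
    qed
    then show False using assms(1) by simp
  qed
  have XY: "X (s + pi/2) = Y s" for s by (simp add: X Y cos_add sin_add)
  have cX: "continuous_on S X" and cY: "continuous_on S Y" for S
    unfolding X[abs_def] Y[abs_def] by (intro continuous_intros)+
  have dX: "(X has_derivative (\<lambda>h. h *\<^sub>R Y s)) (at s)" for s
    unfolding X[abs_def] Y by (auto intro!: derivative_eq_intros simp: fun_eq_iff algebra_simps)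
  define \<gamma> where "\<gamma> s = F (X s)" for s
  define \<gamma>' where "\<gamma>' s = w (sgn (X s)) \<bullet> Y s" for s
  have der: "(\<gamma> has_real_derivative \<gamma>' s) (at s)" for s
    unfolding has_field_derivative_def \<gamma>_def[abs_def] \<gamma>'_def
    by (rule has_derivative_eq_rhs[OF has_derivative_compose[OF dX F_derivative[OF X0]]]) (auto simp: fun_eq_iff)
  have cw: "continuous_on UNIV w"
    unfolding w_def[abs_def] by (intro continuous_intros cont cont_f)
  have cs: "continuous_on S (\<lambda>s. sgn (X s))" for S
    using X0 by (intro continuous_on_sgn cX) auto
  have c\<gamma>': "continuous_on S \<gamma>'" for S
    unfolding \<gamma>'_def[abs_def] by (intro continuous_intros cY continuous_on_compose2[OF cw cs]) auto
  have c\<gamma>: "continuous_on S \<gamma>" for S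
    using der by (meson DERIV_continuous continuous_at_imp_continuous_on)
  have per: "X (s + 2 * pi) = X s" "Y (s + 2 * pi) = Y s" for s by (simp_all add: X Y)
  have "integral {0..2*pi} (\<lambda>s. (\<gamma> s - \<gamma> (s + pi/2))\<^sup>2) \<le> 2 * integral {0..2*pi} (\<lambda>s. (\<gamma>' s)\<^sup>2)"
    by (rule circle_quarter_turn_inequality[OF der c\<gamma>']) (simp_all add: \<gamma>_def \<gamma>'_def per)
  then have le: "integral {0..2*pi} (\<lambda>s. (F (X s) - F (Y s))\<^sup>2) \<le> 2 * integral {0..2*pi} (\<lambda>s. (\<gamma>' s)\<^sup>2)"
    by (simp add: \<gamma>_def XY)
  have "continuous_on {0..2*pi} (\<lambda>s. (\<gamma> s - \<gamma> (s + pi/2))\<^sup>2)"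
    by (intro continuous_intros c\<gamma> continuous_on_compose2[OF c\<gamma>[of UNIV]]) auto
  then have c1: "continuous_on {0..2*pi} (\<lambda>s. (F (X s) - F (Y s))\<^sup>2)" by (simp add: \<gamma>_def XY)
  have c2: "continuous_on {0..2*pi} (\<lambda>s. (\<gamma>' s)\<^sup>2)" by (intro continuous_intros c\<gamma>')
  have "0 \<le> integral {0..2*pi} (\<lambda>s. (\<gamma>' s)\<^sup>2)"
    by (intro Henstock_Kurzweil_Integration.integral_nonneg integrable_continuous_real c2) auto
  then have "ennreal (2 * integral {0..2*pi} (\<lambda>s. (\<gamma>' s)\<^sup>2)) = 2 * ennreal (integral {0..2*pi} (\<lambda>s. (\<gamma>' s)\<^sup>2))"
    by (simp add: ennreal_mult)
  then show ?thesis
    using ennreal_leI[OF le] unfolding \<gamma>'_def[symmetric]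
    by (simp add: nn_integral_interval_continuous[OF c1] nn_integral_interval_continuous[OF c2])
qed

text \<open>The unit ball of the product space. It is invariant under \<open>rotate_pair\<close> and
  depends on the two norms only, so it also respects separate rotations of the components; its
  boundedness keeps the moments finite.\<close>

definition D :: "(real^'n) \<times> (real^'n) \<Rightarrow> ennreal" where
  "D z = indicator {..<1} ((norm (fst z))\<^sup>2 + (norm (snd z))\<^sup>2)"

lemma D_rotate: "c\<^sup>2 + s\<^sup>2 = 1 \<Longrightarrow> D (rotate_pair c s z) = D z"
proof -
  assume cs: "c\<^sup>2 + s\<^sup>2 = 1"
  have "(norm (c *\<^sub>R x + s *\<^sub>R y))\<^sup>2 + (norm (c *\<^sub>R y - s *\<^sub>R x))\<^sup>2 = (c\<^sup>2 + s\<^sup>2) * ((norm x)\<^sup>2 + (norm y)\<^sup>2)" for x y :: "real^'n"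
    unfolding power2_norm_eq_inner by (simp add: inner_simps inner_commute power2_eq_square algebra_simps)
  then show ?thesis using cs by (simp add: D_def rotate_pair_def)
qed

lemma D_measurable [measurable]: "D \<in> borel_measurable borel"
proof -
  have "(\<lambda>z :: (real^'n) \<times> (real^'n). (norm (fst z))\<^sup>2 + (norm (snd z))\<^sup>2) \<in> borel_measurable borel"
    by (intro borel_measurable_continuous_onI continuous_intros)
  then show ?thesis unfolding D_def[abs_def] by measurable
qed

text \<open>Every \<open>rotate_pair\<close> preserves Lebesgue measure and \<open>D\<close>, so
  averaging the integrand over all angles leaves an integral against \<open>D\<close> unchanged.
  After Fubini the inner integral over the angle is governed by
  \<open>circle_inequality\<close>.\<close>

lemma averaged_inequality:
  "(\<integral>\<^sup>+z. D z * ennreal ((F (fst z) - F (snd z))\<^sup>2) \<partial>lborel) \<le>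
    2 * (\<integral>\<^sup>+z. D z * ennreal ((w (sgn (fst z)) \<bullet> snd z)\<^sup>2) \<partial>lborel)"
proof -
  have fs [measurable]: "fst \<in> borel_measurable (borel :: ((real^'n) \<times> (real^'n)) measure)"
      "snd \<in> borel_measurable (borel :: ((real^'n) \<times> (real^'n)) measure)"
    by (auto intro!: borel_measurable_continuous_onI continuous_intros)
  have rot [measurable]: "(\<lambda>(s, z). rotate_pair (cos s) (sin s) z) \<in> borel \<Otimes>\<^sub>M borel \<rightarrow>\<^sub>M (borel :: ((real^'n) \<times> (real^'n)) measure)"
    unfolding borel_prod rotate_pair_def[abs_def] case_prod_beta
    by (intro borel_measurable_continuous_onI continuous_intros)
  define P where "P z = ennreal ((F (fst z) - F (snd z))\<^sup>2)" for z
  define Q where "Q z = ennreal ((w (sgn (fst z)) \<bullet> snd z)\<^sup>2)" for z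
  have [measurable]: "P \<in> borel_measurable borel" "Q \<in> borel_measurable borel"
    unfolding P_def[abs_def] Q_def[abs_def] by measurable
  define I where "I s = (indicator {0..2*pi} s :: ennreal)" for s :: real
  have [measurable]: "I \<in> borel_measurable borel" unfolding I_def[abs_def] by measurable
  have I: "(\<integral>\<^sup>+s. I s \<partial>lborel) = ennreal (2 * pi)" unfolding I_def by simp
  have av: "ennreal (2 * pi) * (\<integral>\<^sup>+z. D z * H z \<partial>lborel) =
      (\<integral>\<^sup>+z. D z * (\<integral>\<^sup>+s. H (rotate_pair (cos s) (sin s) z) * I s \<partial>lborel) \<partial>lborel)"
    if [measurable]: "H \<in> borel_measurable borel" for H
  proof -
    have "ennreal (2 * pi) * (\<integral>\<^sup>+z. D z * H z \<partial>lborel) = (\<integral>\<^sup>+s. I s * (\<integral>\<^sup>+z. D z * H z \<partial>lborel) \<partial>lborel)"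
      by (simp add: nn_integral_multc I)
    also have "\<dots> = (\<integral>\<^sup>+s. I s * (\<integral>\<^sup>+z. D z * H (rotate_pair (cos s) (sin s) z) \<partial>lborel) \<partial>lborel)"
      using nn_integral_rotate_pair[of "\<lambda>z. D z * H z" "cos _" "sin _"] by (simp add: D_rotate)
    also have "\<dots> = (\<integral>\<^sup>+s. \<integral>\<^sup>+z. I s * (D z * H (rotate_pair (cos s) (sin s) z)) \<partial>lborel \<partial>lborel)"
      by (subst nn_integral_cmult) auto
    also have "\<dots> = (\<integral>\<^sup>+z. \<integral>\<^sup>+s. I s * (D z * H (rotate_pair (cos s) (sin s) z)) \<partial>lborel \<partial>lborel)"
      by (rule lborel_pair.Fubini'[symmetric]) measurable
    also have "\<dots> = (\<integral>\<^sup>+z. D z * (\<integral>\<^sup>+s. H (rotate_pair (cos s) (sin s) z) * I s \<partial>lborel) \<partial>lborel)"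
      by (subst nn_integral_cmult[symmetric]) (auto simp: mult_ac)
    finally show ?thesis .
  qed
  have "ennreal (2 * pi) * (\<integral>\<^sup>+z. D z * P z \<partial>lborel) =
      (\<integral>\<^sup>+z. D z * (\<integral>\<^sup>+s. P (rotate_pair (cos s) (sin s) z) * I s \<partial>lborel) \<partial>lborel)"
    by (rule av) measurable
  also have "\<dots> \<le> (\<integral>\<^sup>+z. D z * (2 * (\<integral>\<^sup>+s. Q (rotate_pair (cos s) (sin s) z) * I s \<partial>lborel)) \<partial>lborel)"
  proof (rule nn_integral_mono_AE)
    have "DIM(real^'n) \<ge> 2" using card by simp
    from AE_independent_pair[OF this]
    show "AE z in lborel. D z * (\<integral>\<^sup>+s. P (rotate_pair (cos s) (sin s) z) * I s \<partial>lborel)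
      \<le> D z * (2 * (\<integral>\<^sup>+s. Q (rotate_pair (cos s) (sin s) z) * I s \<partial>lborel))"
      by eventually_elim
        (use circle_inequality[of "fst _" "snd _"] in \<open>auto simp: P_def Q_def I_def intro!: mult_left_mono\<close>)
  qed
  also have "\<dots> = 2 * (\<integral>\<^sup>+z. D z * (\<integral>\<^sup>+s. Q (rotate_pair (cos s) (sin s) z) * I s \<partial>lborel) \<partial>lborel)"
    by (subst nn_integral_cmult[symmetric]) (auto simp: mult_ac)
  also have "\<dots> = 2 * (ennreal (2 * pi) * (\<integral>\<^sup>+z. D z * Q z \<partial>lborel))"
    by (subst av) auto
  finally have "ennreal (2 * pi) * (\<integral>\<^sup>+z. D z * P z \<partial>lborel) \<le> ennreal (2 * pi) * (2 * (\<integral>\<^sup>+z. D z * Q z \<partial>lborel))"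
    by (simp add: mult_ac)
  moreover have "ennreal (2 * pi) \<noteq> 0" "ennreal (2 * pi) < \<infinity>" by simp_all
  ultimately show ?thesis
    unfolding P_def Q_def by (simp add: ennreal_mult_le_mult_iff)
qed

end

text \<open>Since \<open>ennreal\<close> truncates at zero, \<open>ennreal x\<close> and
  \<open>ennreal (- x)\<close> are the positive and negative parts of \<open>x\<close>. The mixed
  term of the binomial formula is split accordingly, each piece standing on the side where it is
  nonnegative, so that the identity can be integrated without subtraction.\<close>

lemma ennreal_square_diff:
  "ennreal ((x - y)\<^sup>2) + 2 * (ennreal x * ennreal y + ennreal (- x) * ennreal (- y)) =
   ennreal (x\<^sup>2) + ennreal (y\<^sup>2) + 2 * (ennreal x * ennreal (- y) + ennreal (- x) * ennreal y)"
proof -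
  have E: "ennreal a + 2 * (ennreal b * ennreal c) = ennreal (a + 2 * (b * c))" if "0 \<le> a" "0 \<le> b" "0 \<le> c" for a b c :: real
    using that by (simp add: ennreal_plus ennreal_mult)
  have E': "ennreal a + ennreal b + 2 * (ennreal c * ennreal d) = ennreal (a + b + 2 * (c * d))"
    if "0 \<le> a" "0 \<le> b" "0 \<le> c" "0 \<le> d" for a b c d :: real
    using that by (simp add: ennreal_plus ennreal_mult)
  have sq: "(x - y)\<^sup>2 + 2 * (x * y) = x\<^sup>2 + y\<^sup>2" by (simp add: power2_eq_square algebra_simps)
  have sq': "(x - y)\<^sup>2 = x\<^sup>2 + y\<^sup>2 - 2 * (x * y)" by (simp add: power2_eq_square algebra_simps)
  consider "0 \<le> x" "0 \<le> y" | "x \<le> 0" "y \<le> 0" | "0 \<le> x" "y \<le> 0" | "x \<le> 0" "0 \<le> y" by linarith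
  then show ?thesis
  proof cases
    case 1
    then show ?thesis using E[of "(x - y)\<^sup>2" x y] by (simp add: ennreal_neg sq ennreal_plus)
  next
    case 2
    then show ?thesis using E[of "(x - y)\<^sup>2" "- x" "- y"] by (simp add: ennreal_neg sq ennreal_plus)
  next
    case 3
    then show ?thesis using E'[of "x\<^sup>2" "y\<^sup>2" x "- y"] by (simp add: ennreal_neg sq')
  next
    case 4
    then show ?thesis using E'[of "x\<^sup>2" "y\<^sup>2" "- x" y] by (simp add: ennreal_neg sq')
  qed
qed

lemma integrable_sphere_measure:
  fixes h :: "'a::euclidean_space \<Rightarrow> real"
  assumes "continuous_on UNIV h"
  shows "integrable sphere_measure h"
proof -
  interpret finite_measure "sphere_measure :: 'a measure" by (rule finite_measure_sphere_measure)
  have "compact (h ` sphere 0 1)"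
    using assms by (intro compact_continuous_image) (auto intro: continuous_on_subset)
  then obtain B where B: "\<forall>x\<in>sphere 0 1. norm (h x) \<le> B"
    using compact_imp_bounded bounded_iff by (metis (no_types, lifting) imageI)
  show ?thesis
  proof (rule integrable_const_bound)
    show "AE x in sphere_measure. norm (h x) \<le> B"
      using AE_sphere_measure by eventually_elim (use B in auto)
    show "h \<in> borel_measurable sphere_measure"
      using assms by (simp add: borel_measurable_continuous_onI cong: measurable_cong_sets)
  qed
qed

text \<open>The radial factor left over when an integral against \<open>D\<close> is written in
  polar coordinates in both variables.\<close>

definition weight :: "'a::euclidean_space itself \<Rightarrow> (real \<times> real \<Rightarrow> real) \<Rightarrow> ennreal" where
  "weight _ k = (\<integral>\<^sup>+t. \<integral>\<^sup>+t'. indicator {..<1} (t\<^sup>2 + t'\<^sup>2) * ennreal (k (t, t'))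
     \<partial>radial_measure TYPE('a) \<partial>radial_measure TYPE('a))"

context ambient_function
begin

text \<open>\<open>D\<close> involves the norms only, so under it the directions of the two points
  are independent of each other and of the norms.\<close>

lemma nn_integral_D:
  assumes [measurable]: "a \<in> borel_measurable borel" "b \<in> borel_measurable borel"
    "k \<in> borel_measurable (borel \<Otimes>\<^sub>M borel)"
  shows "(\<integral>\<^sup>+z. D z * (a (sgn (fst z)) * b (sgn (snd z)) * ennreal (k (norm (fst z), norm (snd z)))) \<partial>lborel) =
    (\<integral>\<^sup>+\<omega>. a \<omega> \<partial>sphere_measure) * (\<integral>\<^sup>+\<omega>. b \<omega> \<partial>sphere_measure) * weight TYPE(real^'n) k"
proof -
  have "(\<integral>\<^sup>+z. D z * (a (sgn (fst z)) * b (sgn (snd z)) * ennreal (k (norm (fst z), norm (snd z)))) \<partial>lborel) =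
    (\<integral>\<^sup>+z. a (sgn (fst z)) * b (sgn (snd z)) *
      (\<lambda>(t, t'). indicator {..<1} (t\<^sup>2 + t'\<^sup>2) * ennreal (k (t, t'))) (norm (fst z), norm (snd z)) \<partial>lborel)"
    by (intro nn_integral_cong) (simp add: D_def mult_ac)
  also have "\<dots> = (\<integral>\<^sup>+\<omega>. a \<omega> \<partial>sphere_measure) * (\<integral>\<^sup>+\<omega>. b \<omega> \<partial>sphere_measure) * weight TYPE(real^'n) k"
    unfolding weight_def by (subst nn_integral_polar_product2) simp_all
  finally show ?thesis .
qed

lemma weight_swap: "weight TYPE(real^'n) (\<lambda>(t, t'). t'\<^sup>2) = weight TYPE(real^'n) (\<lambda>(t, t'). t\<^sup>2)"
proof -
  interpret R: sigma_finite_measure "radial_measure TYPE(real^'n)" by (rule sigma_finite_radial_measure)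
  interpret pair_sigma_finite "radial_measure TYPE(real^'n)" "radial_measure TYPE(real^'n)" ..
  have "weight TYPE(real^'n) (\<lambda>(t, t'). t'\<^sup>2) = (\<integral>\<^sup>+t'. \<integral>\<^sup>+t. indicator {..<1} (t\<^sup>2 + t'\<^sup>2) * ennreal (t'\<^sup>2) \<partial>radial_measure TYPE(real^'n)
     \<partial>radial_measure TYPE(real^'n))"
    unfolding weight_def by (subst Fubini') auto
  then show ?thesis by (simp add: weight_def add.commute)
qed

lemma V_bounds: "emeasure sphere_measure (UNIV :: (real^'n) set) \<noteq> 0" "emeasure sphere_measure (UNIV :: (real^'n) set) \<noteq> \<infinity>"
  using emeasure_sphere_measure_pos[where 'a = "real^'n"] finite_measure.emeasure_finite[OF finite_measure_sphere_measure, of "UNIV :: (real^'n) set"]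
  by auto

text \<open>Constant angular factors identify the weight, up to a positive finite constant, with an
  integral over the unit ball of the product.\<close>

lemma weight_finite:
  assumes [measurable]: "k \<in> borel_measurable (borel \<Otimes>\<^sub>M borel)"
    and k: "\<And>t t'. t\<^sup>2 + t'\<^sup>2 < 1 \<Longrightarrow> k (t, t') \<le> 1"
  shows "weight TYPE(real^'n) k \<noteq> \<infinity>"
proof -
  have sub: "{z :: (real^'n) \<times> (real^'n). D z \<noteq> 0} \<subseteq> ball 0 1"
    by (auto simp: D_def indicator_def norm_prod_def split: if_splits)
  have "emeasure sphere_measure (UNIV :: (real^'n) set) * emeasure sphere_measure (UNIV :: (real^'n) set) * weight TYPE(real^'n) k = (\<integral>\<^sup>+z. D z * (1 * 1 * ennreal (k (norm (fst z), norm (snd z)))) \<partial>lborel)"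
    using nn_integral_D[of "\<lambda>_. 1" "\<lambda>_. 1" k] by simp
  also have "\<dots> \<le> (\<integral>\<^sup>+z. indicator (ball (0 :: (real^'n) \<times> (real^'n)) 1) z \<partial>lborel)"
  proof (rule nn_integral_mono)
    fix z :: "(real^'n) \<times> (real^'n)"
    show "D z * (1 * 1 * ennreal (k (norm (fst z), norm (snd z)))) \<le> indicator (ball 0 1) z"
    proof (cases "D z = 0")
      case False
      then have "z \<in> ball 0 1" "D z = 1" "(norm (fst z))\<^sup>2 + (norm (snd z))\<^sup>2 < 1"
        using sub by (auto simp: D_def indicator_def split: if_splits)
      then show ?thesis using k[of "norm (fst z)" "norm (snd z)"] by (simp add: ennreal_le_1)
    qed simp
  qed
  also have "\<dots> < \<infinity>" using emeasure_lborel_ball_finite[of "0 :: (real^'n) \<times> (real^'n)" 1] by simp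
  finally show ?thesis using V_bounds by (auto simp: ennreal_mult_eq_top_iff)
qed

lemma weight_pos: "weight TYPE(real^'n) (\<lambda>(t, t'). t\<^sup>2) \<noteq> 0"
proof
  assume "weight TYPE(real^'n) (\<lambda>(t, t'). t\<^sup>2) = 0"
  then have "(\<integral>\<^sup>+z. D z * ennreal ((norm (fst z))\<^sup>2) \<partial>lborel) = 0"
    using nn_integral_D[of "\<lambda>_. 1" "\<lambda>_. 1" "\<lambda>(t, t'). t\<^sup>2"] by simp
  moreover have [measurable]: "fst \<in> borel_measurable (borel :: ((real^'n) \<times> (real^'n)) measure)"
    by (auto intro!: borel_measurable_continuous_onI continuous_intros)
  ultimately have ae: "AE z in lborel. D z * ennreal ((norm (fst z))\<^sup>2) = 0"
    by (subst (asm) nn_integral_0_iff_AE) auto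
  define S where "S = {z :: (real^'n) \<times> (real^'n). (norm (fst z))\<^sup>2 + (norm (snd z))\<^sup>2 < 1} \<inter> {z. fst z \<noteq> 0}"
  have "open S"
    unfolding S_def by (intro open_Int open_Collect_less open_Collect_neq continuous_intros)
  moreover have "((1/2) *\<^sub>R axis undefined 1, 0) \<in> S"
    by (simp add: S_def norm_axis_1 axis_eq_0_iff power2_eq_square)
  ultimately have "\<not> negligible S" using open_not_negligible by blast
  moreover have "AE z in lborel. z \<notin> S"
    using ae by eventually_elim (auto simp: S_def D_def)
  then have "S \<in> null_sets lborel" using \<open>open S\<close> by (subst AE_iff_null_sets) auto
  ultimately show False by (simp add: negligible_iff_null_sets null_sets_completion_iff \<open>open S\<close>)
qed

text \<open>Mean zero evaluates the left side of the averaged inequality as \<open>2 A V m\<close>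
  and isotropy its right side as \<open>2 W V m / CARD('n)\<close>, where \<open>V\<close> is the
  total mass of the sphere and \<open>m\<close> a weight. Both are positive and finite and
  cancel.\<close>

lemma poincare_nn:
  assumes mean: "(\<integral>\<^sup>+\<omega>. ennreal (f \<omega>) \<partial>sphere_measure) = (\<integral>\<^sup>+\<omega>. ennreal (- f \<omega>) \<partial>sphere_measure)"
    and fin: "(\<integral>\<^sup>+\<omega>. ennreal (f \<omega>) \<partial>sphere_measure) \<noteq> \<infinity>"
  shows "of_nat CARD('n) * (\<integral>\<^sup>+\<omega>. ennreal ((f \<omega>)\<^sup>2) \<partial>sphere_measure) \<le> (\<integral>\<^sup>+\<omega>. ennreal ((norm (w \<omega>))\<^sup>2) \<partial>sphere_measure)"
proof -
  have [measurable]: "fst \<in> borel_measurable (borel :: ((real^'n) \<times> (real^'n)) measure)"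
      "snd \<in> borel_measurable (borel :: ((real^'n) \<times> (real^'n)) measure)"
    by (auto intro!: borel_measurable_continuous_onI continuous_intros)
  define m where "m = weight TYPE(real^'n) (\<lambda>(t, t'). t\<^sup>2)"
  have "m \<noteq> 0" unfolding m_def by (rule weight_pos)
  moreover have "m \<noteq> \<infinity>" unfolding m_def
  proof (rule weight_finite)
    fix t t' :: real assume "t\<^sup>2 + t'\<^sup>2 < 1"
    then have "t\<^sup>2 \<le> 1" using zero_le_power2[of t'] by linarith
    then show "(\<lambda>(t, t'). t\<^sup>2) (t, t') \<le> 1" by simp
  qed measurable
  ultimately have m: "m \<noteq> 0" "m \<noteq> \<infinity>" by auto
  define A where "A = (\<integral>\<^sup>+\<omega>. ennreal ((f \<omega>)\<^sup>2) \<partial>sphere_measure)"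
  define W where "W = (\<integral>\<^sup>+\<omega>. ennreal ((norm (w \<omega>))\<^sup>2) \<partial>sphere_measure)"
  define p where "p = (\<integral>\<^sup>+\<omega>. ennreal (f \<omega>) \<partial>sphere_measure)"
  define c where "c = weight TYPE(real^'n) (\<lambda>(t, t'). t * t')"
  have c: "c \<noteq> \<infinity>"
    unfolding c_def
  proof (rule weight_finite)
    fix t t' :: real assume "t\<^sup>2 + t'\<^sup>2 < 1"
    moreover have "0 \<le> (t - t')\<^sup>2" by simp
    ultimately show "(\<lambda>(t, t'). t * t') (t, t') \<le> 1" by (simp add: power2_eq_square algebra_simps)
  qed measurable
  have F2: "ennreal ((F x)\<^sup>2) = ennreal ((f (sgn x))\<^sup>2) * ennreal ((norm x)\<^sup>2)" for x
    by (simp add: F_def power_mult_distrib ennreal_mult mult.commute)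
  have EX: "(\<integral>\<^sup>+z. D z * ennreal ((F (fst z))\<^sup>2) \<partial>lborel) = A * emeasure sphere_measure (UNIV :: (real^'n) set) * m"
  proof -
    have "(\<integral>\<^sup>+z. D z * ennreal ((F (fst z))\<^sup>2) \<partial>lborel) = (\<integral>\<^sup>+z. D z * (ennreal ((f (sgn (fst z)))\<^sup>2) * 1 *
        ennreal ((\<lambda>(t, t'). t\<^sup>2) (norm (fst z), norm (snd z)))) \<partial>lborel)"
      by (rule nn_integral_cong) (simp add: F2)
    also have "\<dots> = A * (\<integral>\<^sup>+\<omega>. 1 \<partial>(sphere_measure :: (real^'n) measure)) * m"
      unfolding A_def m_def by (rule nn_integral_D) measurable
    finally show ?thesis by simp
  qed
  have EY: "(\<integral>\<^sup>+z. D z * ennreal ((F (snd z))\<^sup>2) \<partial>lborel) = A * emeasure sphere_measure (UNIV :: (real^'n) set) * m"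
  proof -
    have "(\<integral>\<^sup>+z. D z * ennreal ((F (snd z))\<^sup>2) \<partial>lborel) = (\<integral>\<^sup>+z. D z * (1 * ennreal ((f (sgn (snd z)))\<^sup>2) *
        ennreal ((\<lambda>(t, t'). t'\<^sup>2) (norm (fst z), norm (snd z)))) \<partial>lborel)"
      by (rule nn_integral_cong) (simp add: F2)
    also have "\<dots> = (\<integral>\<^sup>+\<omega>. 1 \<partial>(sphere_measure :: (real^'n) measure)) * A * m"
      unfolding A_def m_def weight_swap[symmetric] by (rule nn_integral_D) measurable
    finally show ?thesis by (simp add: mult.commute)
  qed
  \<comment> \<open>Mean zero says that the positive and the negative part of \<open>f\<close> have
    the same integral \<open>p\<close>. All four sign patterns then give the same finite value, and
    the mixed terms on the two sides of the expansion cancel.\<close>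
  have E2: "(\<integral>\<^sup>+z. D z * (ennreal (\<epsilon> * F (fst z)) * ennreal (\<delta> * F (snd z))) \<partial>lborel) = p * p * c"
    if "\<epsilon> \<in> {1, -1}" "\<delta> \<in> {1, -1}" for \<epsilon> \<delta> :: real
  proof -
    have "(\<integral>\<^sup>+z. D z * (ennreal (\<epsilon> * F (fst z)) * ennreal (\<delta> * F (snd z))) \<partial>lborel) =
      (\<integral>\<^sup>+z. D z * (ennreal (\<epsilon> * f (sgn (fst z))) * ennreal (\<delta> * f (sgn (snd z))) *
         ennreal ((\<lambda>(t, t'). t * t') (norm (fst z), norm (snd z)))) \<partial>lborel)"
    proof (rule nn_integral_cong)
      have "ennreal (\<eta> * F x) = ennreal (\<eta> * f (sgn x)) * ennreal (norm x)" for \<eta> x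
        by (simp add: F_def mult.left_commute[of \<eta>] ennreal_mult'[symmetric, of "norm x"] mult.commute[of _ "ennreal (norm x)"])
      then show "D z * (ennreal (\<epsilon> * F (fst z)) * ennreal (\<delta> * F (snd z))) =
          D z * (ennreal (\<epsilon> * f (sgn (fst z))) * ennreal (\<delta> * f (sgn (snd z))) *
            ennreal ((\<lambda>(t, t'). t * t') (norm (fst z), norm (snd z))))" for z
        by (simp add: ennreal_mult mult_ac)
    qed
    also have "\<dots> = (\<integral>\<^sup>+\<omega>. ennreal (\<epsilon> * f \<omega>) \<partial>sphere_measure) * (\<integral>\<^sup>+\<omega>. ennreal (\<delta> * f \<omega>) \<partial>sphere_measure) * c"
      unfolding c_def by (rule nn_integral_D) auto
    also have "\<dots> = p * p * c" using that mean by (auto simp: p_def)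
    finally show ?thesis .
  qed
  define P where "P = (\<integral>\<^sup>+z. D z * ennreal ((F (fst z) - F (snd z))\<^sup>2) \<partial>lborel)"
  have sum: "(\<integral>\<^sup>+z. a z + 2 * (b z + d z) \<partial>lborel) = (\<integral>\<^sup>+z. a z \<partial>lborel) + 2 * ((\<integral>\<^sup>+z. b z \<partial>lborel) + (\<integral>\<^sup>+z. d z \<partial>lborel))"
    if [measurable]: "a \<in> borel_measurable borel" "b \<in> borel_measurable borel" "d \<in> borel_measurable borel"
    for a b d :: "(real^'n) \<times> (real^'n) \<Rightarrow> ennreal"
    by (simp add: nn_integral_add nn_integral_cmult)
  define E where "E \<epsilon> \<delta> z = D z * (ennreal (\<epsilon> * F (fst z)) * ennreal (\<delta> * F (snd z)))" for \<epsilon> \<delta> z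
  have [measurable]: "E \<epsilon> \<delta> \<in> borel_measurable borel" for \<epsilon> \<delta> unfolding E_def[abs_def] by measurable
  have EE: "integral\<^sup>N lborel (E 1 1) = p * p * c" "integral\<^sup>N lborel (E (-1) (-1)) = p * p * c"
    "integral\<^sup>N lborel (E 1 (-1)) = p * p * c" "integral\<^sup>N lborel (E (-1) 1) = p * p * c"
    unfolding E_def[abs_def] by (rule E2; simp)+
  have "P + 2 * (p * p * c + p * p * c) =
    (\<integral>\<^sup>+z. D z * ennreal ((F (fst z) - F (snd z))\<^sup>2) + 2 * (E 1 1 z + E (-1) (-1) z) \<partial>lborel)"
    by (subst sum) (simp_all add: P_def EE)
  also have "\<dots> = (\<integral>\<^sup>+z. (D z * ennreal ((F (fst z))\<^sup>2) + D z * ennreal ((F (snd z))\<^sup>2)) + 2 * (E 1 (-1) z + E (-1) 1 z) \<partial>lborel)"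
  proof (rule nn_integral_cong)
    fix z :: "(real^'n) \<times> (real^'n)"
    have "D z * (ennreal ((F (fst z) - F (snd z))\<^sup>2) +
        2 * (ennreal (F (fst z)) * ennreal (F (snd z)) + ennreal (- F (fst z)) * ennreal (- F (snd z)))) =
      D z * (ennreal ((F (fst z))\<^sup>2) + ennreal ((F (snd z))\<^sup>2) +
        2 * (ennreal (F (fst z)) * ennreal (- F (snd z)) + ennreal (- F (fst z)) * ennreal (F (snd z))))"
      by (simp only: ennreal_square_diff)
    then show "D z * ennreal ((F (fst z) - F (snd z))\<^sup>2) + 2 * (E 1 1 z + E (-1) (-1) z) =
      (D z * ennreal ((F (fst z))\<^sup>2) + D z * ennreal ((F (snd z))\<^sup>2)) + 2 * (E 1 (-1) z + E (-1) 1 z)"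
      unfolding E_def by (simp add: distrib_left mult.left_commute[of 2 "D z"])
  qed
  also have "\<dots> = 2 * (A * emeasure sphere_measure (UNIV :: (real^'n) set) * m) + 2 * (p * p * c + p * p * c)"
    by (subst sum) (simp_all add: nn_integral_add EX EY EE mult_2)
  finally have P: "P = 2 * (A * emeasure sphere_measure (UNIV :: (real^'n) set) * m)"
    using fin c by (simp add: add.commute[of _ "2 * (p * p * c + p * p * c)"] ennreal_add_left_cancel p_def ennreal_mult_eq_top_iff)
  define Q where "Q = (\<integral>\<^sup>+z. D z * ennreal ((w (sgn (fst z)) \<bullet> snd z)\<^sup>2) \<partial>lborel)"
  \<comment> \<open>For fixed \<open>x\<close> the weight \<open>D (x, y)\<close> is radial in
    \<open>y\<close>, so the inner integral is isotropic in the direction of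
    \<open>w\<close>.\<close>
  have "of_nat CARD('n) * Q = (\<integral>\<^sup>+x. \<integral>\<^sup>+y. of_nat CARD('n) * (D (x, y) * ennreal ((w (sgn x) \<bullet> y)\<^sup>2)) \<partial>lborel \<partial>lborel)"
    unfolding Q_def by (subst nn_integral_cmult[symmetric], measurable) (subst nn_integral_lborel_pair, auto)
  also have "\<dots> = (\<integral>\<^sup>+x. \<integral>\<^sup>+y. D (x, y) * (ennreal ((norm (w (sgn x)))\<^sup>2) * ennreal ((norm y)\<^sup>2)) \<partial>lborel \<partial>lborel)"
  proof (rule nn_integral_cong)
    fix x :: "real^'n"
    have [measurable]: "(\<lambda>y. D (x, y)) \<in> borel_measurable borel"
      unfolding D_def[abs_def] by simp
    show "(\<integral>\<^sup>+y. of_nat CARD('n) * (D (x, y) * ennreal ((w (sgn x) \<bullet> y)\<^sup>2)) \<partial>lborel) =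
       (\<integral>\<^sup>+y. D (x, y) * (ennreal ((norm (w (sgn x)))\<^sup>2) * ennreal ((norm y)\<^sup>2)) \<partial>lborel)"
      using nn_integral_radial_isotropic[of "\<lambda>t. indicator {..<1} ((norm x)\<^sup>2 + t\<^sup>2)" "w (sgn x)"]
      by (simp add: nn_integral_cmult[symmetric] mult_ac D_def)
  qed
  also have "\<dots> = (\<integral>\<^sup>+z. D z * (ennreal ((norm (w (sgn (fst z))))\<^sup>2) * ennreal ((norm (snd z))\<^sup>2)) \<partial>lborel)"
    by (subst nn_integral_lborel_pair) auto
  also have "\<dots> = (\<integral>\<^sup>+z. D z * (ennreal ((norm (w (sgn (fst z))))\<^sup>2) * 1 *
      ennreal ((\<lambda>(t, t'). t'\<^sup>2) (norm (fst z), norm (snd z)))) \<partial>lborel)"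
    by simp
  also have "\<dots> = W * (\<integral>\<^sup>+\<omega>. 1 \<partial>(sphere_measure :: (real^'n) measure)) * m"
    unfolding W_def m_def weight_swap[symmetric] by (rule nn_integral_D) measurable
  also have "\<dots> = W * emeasure sphere_measure (UNIV :: (real^'n) set) * m" by simp
  finally have Q: "of_nat CARD('n) * Q = W * emeasure sphere_measure (UNIV :: (real^'n) set) * m" .
  have "P \<le> 2 * Q" unfolding P_def Q_def by (rule averaged_inequality)
  then have "of_nat CARD('n) * P \<le> of_nat CARD('n) * (2 * Q)" by (intro mult_left_mono) auto
  also have "\<dots> = 2 * (W * emeasure sphere_measure (UNIV :: (real^'n) set) * m)" unfolding Q[symmetric] by (simp add: mult_ac)
  finally have "(2 * emeasure sphere_measure (UNIV :: (real^'n) set) * m) * (of_nat CARD('n) * A) \<le> (2 * emeasure sphere_measure (UNIV :: (real^'n) set) * m) * W"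
    unfolding P by (simp add: mult_ac)
  moreover have "2 * emeasure sphere_measure (UNIV :: (real^'n) set) * m \<noteq> 0" "2 * emeasure sphere_measure (UNIV :: (real^'n) set) * m < \<infinity>"
    using m V_bounds by (auto simp: ennreal_mult_less_top less_top)
  ultimately show ?thesis by (simp add: ennreal_mult_le_mult_iff A_def W_def)
qed

end

text \<open>On unit vectors \<open>(norm (w x))\<^sup>2\<close> contains one copy of
  \<open>(f x - m)\<^sup>2\<close>; moving it to the left turns \<open>CARD('n)\<close> into
  \<open>CARD('n) - 1\<close>. The integrand on the right is the squared tangential gradient. Linear
  functions give equality.\<close>

theorem sphere_poincare_inequality:
  fixes f :: "real^'n \<Rightarrow> real" and g :: "real^'n \<Rightarrow> real^'n"
  assumes deriv: "\<And>x. (f has_derivative (\<lambda>h. g x \<bullet> h)) (at x)"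
    and cont: "continuous_on UNIV g" and card: "CARD('n) \<ge> 2"
  defines "m \<equiv> (\<integral>x. f x \<partial>sphere_measure) / measure sphere_measure (UNIV :: (real^'n) set)"
  shows "(real CARD('n) - 1) * (\<integral>x. (f x - m)\<^sup>2 \<partial>sphere_measure) \<le>
    (\<integral>x. (norm (g x))\<^sup>2 - (g x \<bullet> x)\<^sup>2 \<partial>sphere_measure)"
proof -
  interpret S: finite_measure "sphere_measure :: (real^'n) measure" by (rule finite_measure_sphere_measure)
  interpret h: ambient_function "\<lambda>x. f x - m" g
    by standard (use cont card in \<open>auto intro!: derivative_eq_intros deriv\<close>)
  note [continuous_intros] = h.cont_f cont
  have cf: "continuous_on UNIV f" using continuous_on_add[OF h.cont_f, of "\<lambda>_. m"] by simp
  have V: "measure sphere_measure (UNIV :: (real^'n) set) \<noteq> 0"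
    using emeasure_sphere_measure_pos[where 'a = "real^'n"] by (simp add: S.emeasure_eq_measure)
  have int0: "(\<integral>x. f x - m \<partial>sphere_measure) = 0"
    using V by (subst Bochner_Integration.integral_diff) (auto simp: m_def integrable_sphere_measure cf)
  have int: "integrable sphere_measure (\<lambda>x. f x - m)"
    by (intro integrable_sphere_measure h.cont_f)
  from integrableD(2,3)[OF this] have fin: "(\<integral>\<^sup>+x. ennreal (f x - m) \<partial>sphere_measure) \<noteq> \<infinity>"
    "(\<integral>\<^sup>+x. ennreal (- (f x - m)) \<partial>sphere_measure) \<noteq> \<infinity>" by auto
  have mean: "(\<integral>\<^sup>+x. ennreal (f x - m) \<partial>sphere_measure) = (\<integral>\<^sup>+x. ennreal (- (f x - m)) \<partial>sphere_measure)"
  proof -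
    have "a = b" if "enn2real a - enn2real b = 0" "a \<noteq> \<infinity>" "b \<noteq> \<infinity>" for a b
      using that by (cases a; cases b) auto
    then show ?thesis
      using int0 fin unfolding real_lebesgue_integral_def[OF int] by blast
  qed
  have cw: "continuous_on UNIV h.w"
    unfolding h.w_def[abs_def] by (intro continuous_intros)
  define A where "A = (\<integral>x. (f x - m)\<^sup>2 \<partial>sphere_measure)"
  have ig: "integrable sphere_measure (\<lambda>x. (norm (g x))\<^sup>2 - (g x \<bullet> x)\<^sup>2)"
    by (intro integrable_sphere_measure continuous_intros)
  have if2: "integrable sphere_measure (\<lambda>x. (f x - m)\<^sup>2)"
    by (intro integrable_sphere_measure continuous_intros)
  have "(\<integral>x. (norm (h.w x))\<^sup>2 \<partial>sphere_measure) = (\<integral>x. (f x - m)\<^sup>2 + ((norm (g x))\<^sup>2 - (g x \<bullet> x)\<^sup>2) \<partial>sphere_measure)"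
    using AE_sphere_measure
    by (intro integral_cong_AE) (auto simp: h.norm_w elim!: eventually_mono)
  also have "\<dots> = A + (\<integral>x. (norm (g x))\<^sup>2 - (g x \<bullet> x)\<^sup>2 \<partial>sphere_measure)"
    unfolding A_def by (rule Bochner_Integration.integral_add[OF if2 ig])
  finally have W: "(\<integral>x. (norm (h.w x))\<^sup>2 \<partial>sphere_measure) = A + (\<integral>x. (norm (g x))\<^sup>2 - (g x \<bullet> x)\<^sup>2 \<partial>sphere_measure)" .
  have "ennreal (real CARD('n) * A) \<le> ennreal (\<integral>x. (norm (h.w x))\<^sup>2 \<partial>sphere_measure)"
    using h.poincare_nn[OF mean fin(1)]
    by (simp add: A_def nn_integral_eq_integral if2 integrable_sphere_measure cw continuous_intros ennreal_mult ennreal_of_nat_eq_real_of_nat)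
  then have "real CARD('n) * A \<le> (\<integral>x. (norm (h.w x))\<^sup>2 \<partial>sphere_measure)"
    by (subst (asm) ennreal_le_iff) auto
  then show ?thesis unfolding W A_def by (simp add: algebra_simps)
qed

section \<open>The Poincare inequality on a cylinder\<close>

definition segment_measure :: "real \<Rightarrow> real measure" where
  "segment_measure l = density lborel (indicator {0..l})"

lemma sets_segment_measure [measurable_cong, simp]: "sets (segment_measure l) = sets borel"
  and space_segment_measure [simp]: "space (segment_measure l) = UNIV"
  by (simp_all add: segment_measure_def)

lemma AE_segment_measure: "AE t in segment_measure l. t \<in> {0..l}"
  unfolding segment_measure_def by (subst AE_density) (simp_all add: indicator_def)

lemma emeasure_segment_measure: "0 \<le> l \<Longrightarrow> emeasure (segment_measure l) UNIV = ennreal l"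
  unfolding segment_measure_def by (subst emeasure_density) auto

lemma finite_measure_segment_measure: "0 \<le> l \<Longrightarrow> finite_measure (segment_measure l)"
  by (rule finite_measureI) (simp add: emeasure_segment_measure)

lemma integral_segment_measure:
  fixes h :: "real \<Rightarrow> real"
  assumes "continuous_on {0..l} h" and [measurable]: "h \<in> borel_measurable borel"
  shows "(\<integral>t. h t \<partial>segment_measure l) = integral {0..l} h"
proof -
  have "segment_measure l = density lborel (\<lambda>t. ennreal (indicator {0..l} t))"
    by (simp add: segment_measure_def ennreal_indicator)
  then have "(\<integral>t. h t \<partial>segment_measure l) = (LINT t:{0..l}|lborel. h t)"
    by (simp add: integral_density set_lebesgue_integral_def)
  also have "\<dots> = integral {0..l} h"
    using borel_integrable_compact[OF _ assms(1)]
    by (intro set_borel_integral_eq_integral(2)) (auto simp: set_integrable_def)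
  finally show ?thesis .
qed

lemma (in finite_measure) integral_square_diff:
  fixes h :: "'a \<Rightarrow> real"
  assumes "integrable M h" "integrable M (\<lambda>x. (h x)\<^sup>2)"
  shows "(\<integral>x. (h x - c)\<^sup>2 \<partial>M) = (\<integral>x. (h x)\<^sup>2 \<partial>M) - 2 * c * (\<integral>x. h x \<partial>M) + c\<^sup>2 * measure M (space M)"
proof -
  have "(\<integral>x. (h x - c)\<^sup>2 \<partial>M) = (\<integral>x. ((h x)\<^sup>2 - (2 * c) * h x) + c\<^sup>2 \<partial>M)"
    by (intro Bochner_Integration.integral_cong) (auto simp: power2_eq_square algebra_simps)
  also have "\<dots> = (\<integral>x. (h x)\<^sup>2 - (2 * c) * h x \<partial>M) + (\<integral>x. c\<^sup>2 \<partial>M)"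
    by (intro Bochner_Integration.integral_add Bochner_Integration.integrable_diff integrable_mult_right assms) simp
  also have "(\<integral>x. (h x)\<^sup>2 - (2 * c) * h x \<partial>M) = (\<integral>x. (h x)\<^sup>2 \<partial>M) - (\<integral>x. (2 * c) * h x \<partial>M)"
    by (intro Bochner_Integration.integral_diff integrable_mult_right assms)
  finally show ?thesis by (simp add: mult.commute)
qed

lemma (in finite_measure) integral_variance:
  fixes h :: "'a \<Rightarrow> real"
  assumes "integrable M h" "integrable M (\<lambda>x. (h x)\<^sup>2)" "measure M (space M) \<noteq> 0"
  shows "(\<integral>x. (h x)\<^sup>2 \<partial>M) =
    (\<integral>x. (h x - (\<integral>x. h x \<partial>M) / measure M (space M))\<^sup>2 \<partial>M) + (\<integral>x. h x \<partial>M)\<^sup>2 / measure M (space M)"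
  using assms(3) by (subst integral_square_diff[OF assms(1,2)]) (simp add: power2_eq_square field_simps)

lemma (in finite_measure) square_integral_le:
  fixes h :: "'a \<Rightarrow> real"
  assumes "integrable M h" "integrable M (\<lambda>x. (h x)\<^sup>2)" "measure M (space M) \<noteq> 0"
  shows "(\<integral>x. h x \<partial>M)\<^sup>2 / measure M (space M) \<le> (\<integral>x. (h x)\<^sup>2 \<partial>M)"
proof -
  have "0 \<le> (\<integral>x. (h x - (\<integral>x. h x \<partial>M) / measure M (space M))\<^sup>2 \<partial>M)" by simp
  then show ?thesis using integral_variance[OF assms] by simp
qed

text \<open>Completing the square shows that the mean is the best constant. This is what permits the
  midpoint value in the one-dimensional inequality.\<close>

lemma (in finite_measure) variance_le:
  fixes h :: "'a \<Rightarrow> real"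
  assumes "integrable M h" "integrable M (\<lambda>x. (h x)\<^sup>2)" "measure M (space M) \<noteq> 0"
  shows "(\<integral>x. (h x - (\<integral>x. h x \<partial>M) / measure M (space M))\<^sup>2 \<partial>M) \<le> (\<integral>x. (h x - c)\<^sup>2 \<partial>M)"
proof -
  have "A - 2 * (I / V) * I + (I / V)\<^sup>2 * V \<le> A - 2 * c * I + c\<^sup>2 * V" if "V > 0" for A I V :: real
  proof -
    have "0 \<le> (c * V - I)\<^sup>2 / V" using that by simp
    also have "\<dots> = c\<^sup>2 * V - 2 * c * I + I\<^sup>2 / V" using that by (simp add: power2_eq_square field_simps)
    finally show ?thesis using that by (simp add: power2_eq_square)
  qed
  then show ?thesis
    using assms(3) unfolding integral_square_diff[OF assms(1,2)] by (simp add: zero_less_measure_iff)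
qed

text \<open>\<open>gx\<close> is the gradient in the ambient space, not along the sphere. The
  subtraction of \<open>(gx x t \<bullet> x)\<^sup>2\<close> in the energies extracts the tangential
  part, so it does not matter how the function extends off the cylinder.\<close>

locale cylinder_function =
  fixes f :: "real^'n \<Rightarrow> real \<Rightarrow> real" and gx :: "real^'n \<Rightarrow> real \<Rightarrow> real^'n" and gt :: "real^'n \<Rightarrow> real \<Rightarrow> real"
    and l :: real
  assumes deriv: "\<And>x t. ((\<lambda>z. f (fst z) (snd z)) has_derivative (\<lambda>h. gx x t \<bullet> fst h + gt x t * snd h)) (at (x, t))"
    and cont: "continuous_on UNIV (\<lambda>z. gx (fst z) (snd z))" "continuous_on UNIV (\<lambda>z. gt (fst z) (snd z))"
    and card: "CARD('n) \<ge> 2" and l: "l > 0"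
begin

abbreviation "S \<equiv> sphere_measure :: (real^'n) measure"
abbreviation "T \<equiv> segment_measure l"

sublocale S: finite_measure S by (rule finite_measure_sphere_measure)
sublocale T: finite_measure T using l by (simp add: finite_measure_segment_measure)
sublocale ST: pair_sigma_finite S T ..

lemma masses: "measure S UNIV > 0" "measure T UNIV = l"
  using emeasure_sphere_measure_pos[where 'a = "real^'n"] emeasure_segment_measure[of l] l
  by (auto simp: S.emeasure_eq_measure T.emeasure_eq_measure)

text \<open>The bound is imposed only where the measures are concentrated, since continuous
  functions need not be bounded elsewhere. The class is closed under squares, differences and
  partial integrals, which settles the integrability conditions for Fubini.\<close>

definition bounded_on_cylinder :: "(real^'n \<Rightarrow> real \<Rightarrow> real) \<Rightarrow> bool" where
  "bounded_on_cylinder h \<longleftrightarrow> case_prod h \<in> borel_measurable (borel \<Otimes>\<^sub>M borel) \<and>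
     (\<exists>B. \<forall>x t. norm x = 1 \<longrightarrow> t \<in> {0..l} \<longrightarrow> \<bar>h x t\<bar> \<le> B)"

lemma bounded_on_cylinder_continuous:
  assumes "continuous_on UNIV (\<lambda>z. h (fst z) (snd z))"
  shows "bounded_on_cylinder h"
proof -
  have "case_prod h = (\<lambda>z. h (fst z) (snd z))" by (simp add: case_prod_beta')
  moreover have "(\<lambda>z. h (fst z) (snd z)) \<in> borel_measurable borel"
    using assms by (rule borel_measurable_continuous_onI)
  moreover have "compact ((\<lambda>z. h (fst z) (snd z)) ` (sphere 0 1 \<times> {0..l}))"
    using assms by (intro compact_continuous_image compact_Times) (auto intro: continuous_on_subset)
  then obtain B where "\<forall>z\<in>sphere 0 1 \<times> {0..l}. norm (h (fst z) (snd z)) \<le> B"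
    using compact_imp_bounded bounded_iff by (metis (no_types, lifting) imageI)
  then have "\<forall>x t. norm x = 1 \<longrightarrow> t \<in> {0..l} \<longrightarrow> \<bar>h x t\<bar> \<le> B" by auto
  ultimately show ?thesis unfolding bounded_on_cylinder_def by (auto simp: borel_prod)
qed

lemma bounded_slices:
  assumes "bounded_on_cylinder h"
  shows "AE x in S. integrable T (h x)" and "AE t in T. integrable S (\<lambda>x. h x t)"
    and "integrable (S \<Otimes>\<^sub>M T) (\<lambda>z. h (fst z) (snd z))"
    and "bounded_on_cylinder (\<lambda>x t. (h x t)\<^sup>2)"
    and "bounded_on_cylinder (\<lambda>x t. \<integral>t. h x t \<partial>T)" and "bounded_on_cylinder (\<lambda>x t. \<integral>x. h x t \<partial>S)"
proof -
  obtain B where B: "\<And>x t. norm x = 1 \<Longrightarrow> t \<in> {0..l} \<Longrightarrow> \<bar>h x t\<bar> \<le> B"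
    and m [measurable]: "case_prod h \<in> borel_measurable (borel \<Otimes>\<^sub>M borel)"
    using assms unfolding bounded_on_cylinder_def by blast
  have mt [measurable]: "h x \<in> borel_measurable borel" for x
    using measurable_Pair2[OF m, of x] by simp
  have mx [measurable]: "(\<lambda>x. h x t) \<in> borel_measurable borel" for t
    using measurable_Pair1[OF m, of t] by simp
  have it: "integrable T (h x)" if "norm x = 1" for x
    by (rule T.integrable_const_bound[of _ B])
      (use B that in \<open>auto intro!: eventually_mono[OF AE_segment_measure] cong: measurable_cong_sets\<close>)
  have ix: "integrable S (\<lambda>x. h x t)" if "t \<in> {0..l}" for t
    by (rule S.integrable_const_bound[of _ B])
      (use B that in \<open>auto intro!: eventually_mono[OF AE_sphere_measure] cong: measurable_cong_sets\<close>)
  show "AE x in S. integrable T (h x)" using AE_sphere_measure by eventually_elim (rule it)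
  show "AE t in T. integrable S (\<lambda>x. h x t)" using AE_segment_measure by eventually_elim (rule ix)
  have mST: "(\<lambda>z. h (fst z) (snd z)) \<in> borel_measurable (S \<Otimes>\<^sub>M T)"
    using m by (simp add: case_prod_beta' cong: measurable_cong_sets sets_pair_measure_cong)
  interpret P: finite_measure "S \<Otimes>\<^sub>M T"
    by (rule finite_measure_pair_measure) unfold_locales
  show "integrable (S \<Otimes>\<^sub>M T) (\<lambda>z. h (fst z) (snd z))"
  proof (rule P.integrable_const_bound[of _ B, OF _ mST], rule ST.AE_pair_measure)
    show "{z \<in> space (S \<Otimes>\<^sub>M T). norm (h (fst z) (snd z)) \<le> B} \<in> sets (S \<Otimes>\<^sub>M T)"
      using mST by measurable
    show "AE x in S. AE t in T. norm (h (fst (x, t)) (snd (x, t))) \<le> B"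
      using AE_sphere_measure by eventually_elim (rule eventually_mono[OF AE_segment_measure], use B in auto)
  qed
  show "bounded_on_cylinder (\<lambda>x t. (h x t)\<^sup>2)"
    unfolding bounded_on_cylinder_def
  proof (intro conjI exI[of _ "B\<^sup>2"] allI impI)
    show "\<bar>(h x t)\<^sup>2\<bar> \<le> B\<^sup>2" if "norm x = 1" "t \<in> {0..l}" for x t
      using B[OF that] by (simp add: abs_le_square_iff[symmetric])
  qed measurable
  show "bounded_on_cylinder (\<lambda>x t. \<integral>t. h x t \<partial>T)"
    unfolding bounded_on_cylinder_def
  proof (intro conjI exI[of _ "B * l"] allI impI)
    have "(\<lambda>x. \<integral>t. h x t \<partial>T) \<in> borel_measurable borel"
      using m by (intro T.borel_measurable_lebesgue_integral) (simp cong: measurable_cong_sets sets_pair_measure_cong)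
    then show "(\<lambda>(x, t). \<integral>t. h x t \<partial>T) \<in> borel_measurable (borel \<Otimes>\<^sub>M borel)" by measurable
    show "\<bar>\<integral>t. h x t \<partial>T\<bar> \<le> B * l" if "norm x = 1" for x and t :: real
    proof -
      have "\<bar>\<integral>t. h x t \<partial>T\<bar> \<le> (\<integral>t. \<bar>h x t\<bar> \<partial>T)" by (rule integral_abs_bound)
      also have "\<dots> \<le> (\<integral>t. B \<partial>T)"
        using it[OF that] B[OF that] by (intro integral_mono_AE) (auto intro!: eventually_mono[OF AE_segment_measure])
      finally show ?thesis using masses by (simp add: mult.commute)
    qed
  qed
  show "bounded_on_cylinder (\<lambda>x t. \<integral>x. h x t \<partial>S)"
    unfolding bounded_on_cylinder_def
  proof (intro conjI exI[of _ "B * measure S UNIV"] allI impI)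
    have m': "case_prod (\<lambda>t x. h x t) \<in> borel_measurable (borel \<Otimes>\<^sub>M borel)"
      using measurable_compose[OF measurable_pair_swap' m] by (simp add: case_prod_beta')
    then have "(\<lambda>t. \<integral>x. h x t \<partial>S) \<in> borel_measurable borel"
      by (intro S.borel_measurable_lebesgue_integral) (simp cong: measurable_cong_sets sets_pair_measure_cong)
    then show "(\<lambda>(x, t). \<integral>x. h x t \<partial>S) \<in> borel_measurable (borel \<Otimes>\<^sub>M borel)" by measurable
    show "\<bar>\<integral>x. h x t \<partial>S\<bar> \<le> B * measure S UNIV" if "t \<in> {0..l}" for t and x :: "real^'n"
    proof -
      have "\<bar>\<integral>x. h x t \<partial>S\<bar> \<le> (\<integral>x. \<bar>h x t\<bar> \<partial>S)" by (rule integral_abs_bound)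
      also have "\<dots> \<le> (\<integral>x. B \<partial>S)"
        using ix[OF that] B[OF _ that] by (intro integral_mono_AE) (auto intro!: eventually_mono[OF AE_sphere_measure])
      finally show ?thesis by (simp add: mult.commute)
    qed
  qed
qed

lemma bounded_on_cylinder_diff:
  assumes "bounded_on_cylinder h" "bounded_on_cylinder k"
  shows "bounded_on_cylinder (\<lambda>x t. h x t - c * k x t)"
proof -
  obtain B C where "\<And>x t. norm x = 1 \<Longrightarrow> t \<in> {0..l} \<Longrightarrow> \<bar>h x t\<bar> \<le> B"
    "\<And>x t. norm x = 1 \<Longrightarrow> t \<in> {0..l} \<Longrightarrow> \<bar>k x t\<bar> \<le> C"
    and [measurable]: "case_prod h \<in> borel_measurable (borel \<Otimes>\<^sub>M borel)" "case_prod k \<in> borel_measurable (borel \<Otimes>\<^sub>M borel)"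
    using assms unfolding bounded_on_cylinder_def by blast
  then have "\<bar>h x t - c * k x t\<bar> \<le> B + \<bar>c\<bar> * C" if "norm x = 1" "t \<in> {0..l}" for x t
    using that abs_triangle_ineq4[of "h x t" "c * k x t"] mult_left_mono[of "\<bar>k x t\<bar>" C "\<bar>c\<bar>"]
    by (fastforce simp: abs_mult)
  then show ?thesis unfolding bounded_on_cylinder_def by (intro conjI exI[of _ "B + \<bar>c\<bar> * C"]) (auto, measurable)
qed

lemma fubini:
  assumes "bounded_on_cylinder h"
  shows "(\<integral>x. \<integral>t. h x t \<partial>T \<partial>S) = (\<integral>z. h (fst z) (snd z) \<partial>(S \<Otimes>\<^sub>M T))"
    and "(\<integral>t. \<integral>x. h x t \<partial>S \<partial>T) = (\<integral>z. h (fst z) (snd z) \<partial>(S \<Otimes>\<^sub>M T))"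
proof -
  have i: "integrable (S \<Otimes>\<^sub>M T) (case_prod h)"
    using bounded_slices(3)[OF assms] by (simp add: case_prod_beta')
  show "(\<integral>x. \<integral>t. h x t \<partial>T \<partial>S) = (\<integral>z. h (fst z) (snd z) \<partial>(S \<Otimes>\<^sub>M T))"
    using ST.integral_fst[OF i] by (simp add: case_prod_beta')
  show "(\<integral>t. \<integral>x. h x t \<partial>S \<partial>T) = (\<integral>z. h (fst z) (snd z) \<partial>(S \<Otimes>\<^sub>M T))"
    using ST.integral_snd[OF i] by (simp add: case_prod_beta')
qed

lemma bounded_on_cylinder_data:
  "bounded_on_cylinder f" "bounded_on_cylinder (\<lambda>x t. (norm (gx x t))\<^sup>2 - (gx x t \<bullet> x)\<^sup>2)" "bounded_on_cylinder (\<lambda>x t. (gt x t)\<^sup>2)"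
proof -
  have "continuous_on UNIV (\<lambda>z. f (fst z) (snd z))"
    using has_derivative_continuous[OF deriv] by (intro continuous_at_imp_continuous_on ballI) (metis prod.collapse)
  then show "bounded_on_cylinder f" by (rule bounded_on_cylinder_continuous)
  show "bounded_on_cylinder (\<lambda>x t. (norm (gx x t))\<^sup>2 - (gx x t \<bullet> x)\<^sup>2)" "bounded_on_cylinder (\<lambda>x t. (gt x t)\<^sup>2)"
    by (intro bounded_on_cylinder_continuous continuous_intros cont)+
qed

lemma sphere_slice:
  "(real CARD('n) - 1) * ((\<integral>x. (f x t)\<^sup>2 \<partial>S) - (\<integral>x. f x t \<partial>S)\<^sup>2 / measure S UNIV) \<le>
    (\<integral>x. (norm (gx x t))\<^sup>2 - (gx x t \<bullet> x)\<^sup>2 \<partial>S)"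
proof -
  have d: "((\<lambda>x. f x t) has_derivative (\<lambda>h. gx x t \<bullet> h)) (at x)" for x
  proof -
    have "((\<lambda>x. (x, t)) has_derivative (\<lambda>h. (h, 0))) (at x)"
      by (auto intro!: derivative_eq_intros)
    from has_derivative_compose[OF this deriv] show ?thesis by simp
  qed
  have c: "continuous_on UNIV (\<lambda>x. gx x t)"
  proof -
    have "continuous_on UNIV (\<lambda>x :: real^'n. (x, t))" by (intro continuous_intros)
    from continuous_on_compose2[OF cont(1) this] show ?thesis by simp
  qed
  have cf: "continuous_on UNIV (\<lambda>x. f x t)"
    using d has_derivative_continuous by (blast intro: continuous_at_imp_continuous_on)
  have "(\<integral>x. (f x t)\<^sup>2 \<partial>S) - (\<integral>x. f x t \<partial>S)\<^sup>2 / measure S UNIV =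
      (\<integral>x. (f x t - (\<integral>x. f x t \<partial>S) / measure S UNIV)\<^sup>2 \<partial>S)"
    using masses by (subst S.integral_variance) (auto intro!: integrable_sphere_measure continuous_intros cf)
  then show ?thesis using sphere_poincare_inequality[OF d c card] by simp
qed

lemma segment_slice:
  "(pi / l)\<^sup>2 * (\<integral>t. (f x t - (\<integral>t. f x t \<partial>T) / l)\<^sup>2 \<partial>T) \<le> (\<integral>t. (gt x t)\<^sup>2 \<partial>T)"
proof -
  have d: "((\<lambda>t. f x t) has_real_derivative gt x t) (at t)" for t
  proof -
    have "((\<lambda>t. (x, t)) has_derivative (\<lambda>h. (0, h))) (at t)"
      by (auto intro!: derivative_eq_intros)
    from has_derivative_compose[OF this deriv] show ?thesis by (simp add: has_field_derivative_def)
  qed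
  have c: "continuous_on A (\<lambda>t. gt x t)" for A
  proof -
    have "continuous_on A (\<lambda>t. (x, t))" by (intro continuous_intros)
    from continuous_on_compose2[OF cont(2) this] show ?thesis by simp
  qed
  have cf: "continuous_on A (\<lambda>t. f x t)" for A
    using d by (meson DERIV_continuous continuous_at_imp_continuous_on)
  have m: "(\<lambda>t. f x t) \<in> borel_measurable borel" "(\<lambda>t. gt x t) \<in> borel_measurable borel"
    by (intro borel_measurable_continuous_onI cf c)+
  have int: "integrable T h" if h: "continuous_on UNIV h" for h :: "real \<Rightarrow> real"
  proof -
    have "compact (h ` {0..l})" using h by (intro compact_continuous_image) (auto intro: continuous_on_subset)
    then obtain B where "\<forall>t\<in>{0..l}. norm (h t) \<le> B"
      using compact_imp_bounded bounded_iff by (metis (no_types, lifting) imageI)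
    then show ?thesis
      using h by (intro T.integrable_const_bound[of _ B])
        (auto intro!: eventually_mono[OF AE_segment_measure] borel_measurable_continuous_onI cong: measurable_cong_sets)
  qed
  have "(\<integral>t. (f x t - (\<integral>t. f x t \<partial>T) / l)\<^sup>2 \<partial>T) \<le> (\<integral>t. (f x t - f x ((0 + l) / 2))\<^sup>2 \<partial>T)"
    using T.variance_le[OF int int, of "f x" "f x ((0 + l) / 2)"] l masses(2) by (simp add: cf continuous_intros)
  then have "(pi / l)\<^sup>2 * (\<integral>t. (f x t - (\<integral>t. f x t \<partial>T) / l)\<^sup>2 \<partial>T) \<le> (pi / l)\<^sup>2 * (\<integral>t. (f x t - f x ((0 + l) / 2))\<^sup>2 \<partial>T)"
    by (rule mult_left_mono) simp
  also have "\<dots> = (pi / (l - 0))\<^sup>2 * integral {0..l} (\<lambda>t. (f x t - f x ((0 + l) / 2))\<^sup>2)"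
    using m by (subst integral_segment_measure) (auto intro!: continuous_intros cf)
  also have "\<dots> \<le> integral {0..l} (\<lambda>t. (gt x t)\<^sup>2)"
    using l by (intro wirtinger_midpoint c) (auto intro: has_field_derivative_at_within d)
  also have "\<dots> = (\<integral>t. (gt x t)\<^sup>2 \<partial>T)"
    using m by (subst integral_segment_measure) (auto intro!: continuous_intros c)
  finally show ?thesis .
qed

text \<open>The total variance is the averaged variance over the spheres plus the variance of the
  sphere means \<open>I t\<close>. By Cauchy-Schwarz the latter is at most the averaged variance
  along the segments. Each contribution is then estimated by its own one-factor inequality.\<close>

theorem cylinder_poincare_inequality:
  assumes r: "r > 0" and K: "(real CARD('n) - 1) / r\<^sup>2 \<le> (pi / l)\<^sup>2"
  shows "(real CARD('n) - 1) / r\<^sup>2 *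
      ((\<integral>z. (f (fst z) (snd z))\<^sup>2 \<partial>(S \<Otimes>\<^sub>M T)) - (\<integral>z. f (fst z) (snd z) \<partial>(S \<Otimes>\<^sub>M T))\<^sup>2 / (measure S UNIV * l)) \<le>
    (\<integral>z. ((norm (gx (fst z) (snd z)))\<^sup>2 - (gx (fst z) (snd z) \<bullet> fst z)\<^sup>2) / r\<^sup>2 + (gt (fst z) (snd z))\<^sup>2 \<partial>(S \<Otimes>\<^sub>M T))"
proof -
  define V where "V = measure S UNIV"
  have V: "V > 0" using masses by (simp add: V_def)
  define n where "n = real CARD('n) - 1"
  have n: "n \<ge> 1" using card by (simp add: n_def)
  define G where "G x t = (norm (gx x t))\<^sup>2 - (gx x t \<bullet> x)\<^sup>2" for x t
  define J where "J x = (\<integral>t. f x t \<partial>T)" for x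
  define I where "I t = (\<integral>x. f x t \<partial>S)" for t
  define m where "m = (\<integral>x. J x \<partial>S) / l"
  note [simp] = V_def[symmetric]
  note bf = bounded_on_cylinder_data(1) and bG = bounded_on_cylinder_data(2)[folded G_def] and bt = bounded_on_cylinder_data(3)
  have bf2: "bounded_on_cylinder (\<lambda>x t. (f x t)\<^sup>2)" by (rule bounded_slices(4)[OF bf])
  have bI: "bounded_on_cylinder (\<lambda>x t. I t)" unfolding I_def by (rule bounded_slices(6)[OF bf])
  have bJ: "bounded_on_cylinder (\<lambda>x t. J x)" unfolding J_def by (rule bounded_slices(5)[OF bf])
  have bd: "bounded_on_cylinder (\<lambda>x t. f x t - J x / l)"
    using bounded_on_cylinder_diff[OF bf bJ, of "1 / l"] by simp
  have bd2: "bounded_on_cylinder (\<lambda>x t. (f x t - J x / l)\<^sup>2)" by (rule bounded_slices(4)[OF bd])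
  have T_int: "integrable T (\<lambda>t. \<integral>x. h x t \<partial>S)" if "bounded_on_cylinder h" for h
  proof -
    \<comment> \<open>The assertion does not involve \<open>x\<close>, and \<open>S\<close> is not
      the zero measure, so its validity almost everywhere is plain validity.\<close>
    have "AE x in S. integrable T (\<lambda>t. \<integral>x. h x t \<partial>S)" by (rule bounded_slices(1)[OF bounded_slices(6)[OF that]])
    moreover have "\<not> (AE x in S. False)" using masses(1) by (auto simp: eventually_False ae_filter_eq_bot_iff S.emeasure_eq_measure)
    ultimately show ?thesis by (metis (mono_tags, lifting) eventually_mono)
  qed
  have S_int: "integrable S (\<lambda>x. \<integral>t. h x t \<partial>T)" if "bounded_on_cylinder h" for h
  proof -
    have "AE t in T. integrable S (\<lambda>x. \<integral>t. h x t \<partial>T)" by (rule bounded_slices(2)[OF bounded_slices(5)[OF that]])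
    moreover have "\<not> (AE t in T. False)" using masses(2) l by (auto simp: eventually_False ae_filter_eq_bot_iff T.emeasure_eq_measure)
    ultimately show ?thesis by (metis (mono_tags, lifting) eventually_mono)
  qed
  have mI: "(\<integral>t. I t \<partial>T) = l * m"
    using l fubini[OF bf] by (simp add: m_def I_def J_def)
  have iI: "integrable T I" unfolding I_def by (rule T_int[OF bf])
  have iI2: "integrable T (\<lambda>t. (I t)\<^sup>2)"
  proof -
    have "integrable T (\<lambda>t. \<integral>x. (I t)\<^sup>2 \<partial>S)" by (rule T_int[OF bounded_slices(4)[OF bI]])
    then show ?thesis using V by simp
  qed
  have sph: "(\<integral>t. \<integral>x. (f x t)\<^sup>2 \<partial>S \<partial>T) - (\<integral>t. (I t)\<^sup>2 / V \<partial>T) \<le> (\<integral>t. \<integral>x. G x t \<partial>S \<partial>T) / n"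
  proof -
    have "(\<integral>t. \<integral>x. (f x t)\<^sup>2 \<partial>S \<partial>T) - (\<integral>t. (I t)\<^sup>2 / V \<partial>T) = (\<integral>t. (\<integral>x. (f x t)\<^sup>2 \<partial>S) - (I t)\<^sup>2 / V \<partial>T)"
      using T_int[OF bf2] iI2 by (intro Bochner_Integration.integral_diff[symmetric]) auto
    also have "\<dots> \<le> (\<integral>t. (\<integral>x. G x t \<partial>S) / n \<partial>T)"
    proof (rule integral_mono)
      show "(\<integral>x. (f x t)\<^sup>2 \<partial>S) - (I t)\<^sup>2 / V \<le> (\<integral>x. G x t \<partial>S) / n" for t
        using sphere_slice[of t] n by (simp add: I_def G_def n_def[symmetric] field_simps)
    qed (use T_int[OF bf2] T_int[OF bG] iI2 in auto)
    finally show ?thesis by simp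
  qed
  \<comment> \<open>The two averages commute, so \<open>I t - m\<close> is the sphere integral of
    \<open>f x t - J x / l\<close>, the deviation of \<open>f\<close> from its segment means.
    Cauchy-Schwarz on the sphere then bounds its square.\<close>
  have mean: "(\<integral>t. (I t)\<^sup>2 / V \<partial>T) \<le> (\<integral>t. \<integral>x. (f x t - J x / l)\<^sup>2 \<partial>S \<partial>T) + l * m\<^sup>2 / V"
  proof -
    have "(\<integral>t. (I t)\<^sup>2 \<partial>T) = (\<integral>t. (I t - m)\<^sup>2 \<partial>T) + l * m\<^sup>2"
      using T.integral_variance[OF iI iI2] l masses(2) mI by (simp add: power2_eq_square)
    then have "(\<integral>t. (I t)\<^sup>2 / V \<partial>T) = (\<integral>t. (I t - m)\<^sup>2 / V \<partial>T) + l * m\<^sup>2 / V"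
      by (simp add: add_divide_distrib)
    also have "(\<integral>t. (I t - m)\<^sup>2 / V \<partial>T) \<le> (\<integral>t. \<integral>x. (f x t - J x / l)\<^sup>2 \<partial>S \<partial>T)"
    proof (rule integral_mono_AE)
      show "integrable T (\<lambda>t. (I t - m)\<^sup>2 / V)"
        using iI iI2 by (simp add: power2_diff)
      show "AE t in T. (I t - m)\<^sup>2 / V \<le> (\<integral>x. (f x t - J x / l)\<^sup>2 \<partial>S)"
        using bounded_slices(2)[OF bd] bounded_slices(2)[OF bd2] bounded_slices(2)[OF bf]
      proof eventually_elim
        fix t assume i: "integrable S (\<lambda>x. f x t - J x / l)" "integrable S (\<lambda>x. (f x t - J x / l)\<^sup>2)" "integrable S (\<lambda>x. f x t)"
        have "(\<integral>x. f x t - J x / l \<partial>S) = I t - m"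
          using i S_int[OF bf] by (subst Bochner_Integration.integral_diff) (auto simp: I_def m_def J_def)
        then show "(I t - m)\<^sup>2 / V \<le> (\<integral>x. (f x t - J x / l)\<^sup>2 \<partial>S)"
          using S.square_integral_le[OF i(1,2)] V by simp
      qed
    qed (rule T_int[OF bd2])
    finally show ?thesis by simp
  qed
  have seg: "(pi / l)\<^sup>2 * (\<integral>x. \<integral>t. (f x t - J x / l)\<^sup>2 \<partial>T \<partial>S) \<le> (\<integral>x. \<integral>t. (gt x t)\<^sup>2 \<partial>T \<partial>S)"
    unfolding integral_mult_right_zero[symmetric]
    by (rule integral_mono) (use S_int[OF bd2] S_int[OF bt] segment_slice in \<open>auto simp: J_def\<close>)
  define X where "X = (\<integral>z. (f (fst z) (snd z) - J (fst z) / l)\<^sup>2 \<partial>(S \<Otimes>\<^sub>M T))"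
  have X: "0 \<le> X" by (simp add: X_def)
  have "(\<integral>z. (f (fst z) (snd z))\<^sup>2 \<partial>(S \<Otimes>\<^sub>M T)) - l * m\<^sup>2 / V \<le> (\<integral>z. G (fst z) (snd z) \<partial>(S \<Otimes>\<^sub>M T)) / n + X"
    using sph mean fubini(2)[OF bf2] fubini(2)[OF bG] fubini(2)[OF bd2] by (simp add: X_def)
  then have "n / r\<^sup>2 * ((\<integral>z. (f (fst z) (snd z))\<^sup>2 \<partial>(S \<Otimes>\<^sub>M T)) - l * m\<^sup>2 / V)
    \<le> n / r\<^sup>2 * ((\<integral>z. G (fst z) (snd z) \<partial>(S \<Otimes>\<^sub>M T)) / n + X)"
    using n by (intro mult_left_mono) auto
  also have "\<dots> = (\<integral>z. G (fst z) (snd z) \<partial>(S \<Otimes>\<^sub>M T)) / r\<^sup>2 + n / r\<^sup>2 * X"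
    using n by (simp add: distrib_left)
  \<comment> \<open>By \<open>K\<close> the interval eigenvalue is the larger one, so the segment
    variance may be charged at the rate that the segment inequality pays for.\<close>
  also have "n / r\<^sup>2 * X \<le> (pi / l)\<^sup>2 * X"
    using K X by (intro mult_right_mono) (auto simp: n_def)
  also have "(pi / l)\<^sup>2 * X \<le> (\<integral>z. (gt (fst z) (snd z))\<^sup>2 \<partial>(S \<Otimes>\<^sub>M T))"
    using seg fubini(1)[OF bd2] fubini(1)[OF bt] by (simp add: X_def)
  also have "(\<integral>z. G (fst z) (snd z) \<partial>(S \<Otimes>\<^sub>M T)) / r\<^sup>2 + (\<integral>z. (gt (fst z) (snd z))\<^sup>2 \<partial>(S \<Otimes>\<^sub>M T)) =
      (\<integral>z. G (fst z) (snd z) / r\<^sup>2 + (gt (fst z) (snd z))\<^sup>2 \<partial>(S \<Otimes>\<^sub>M T))"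
    using bounded_slices(3)[OF bG] bounded_slices(3)[OF bt] by (subst Bochner_Integration.integral_add) auto
  finally have "n / r\<^sup>2 * ((\<integral>z. (f (fst z) (snd z))\<^sup>2 \<partial>(S \<Otimes>\<^sub>M T)) - l * m\<^sup>2 / V) \<le>
     (\<integral>z. G (fst z) (snd z) / r\<^sup>2 + (gt (fst z) (snd z))\<^sup>2 \<partial>(S \<Otimes>\<^sub>M T))" by simp
  moreover have "l * m\<^sup>2 / V = (\<integral>z. f (fst z) (snd z) \<partial>(S \<Otimes>\<^sub>M T))\<^sup>2 / (V * l)"
    using l fubini(1)[OF bf] by (simp add: m_def J_def power2_eq_square)
  ultimately show ?thesis by (simp add: G_def n_def)
qed

end

section \<open>Tangent spaces and second derivatives\<close>

text \<open>The difference of two candidates lies in \<open>V\<close> and is orthogonal to itself.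
  Positivity on \<open>V\<close> alone excludes this, so the description is unique even for an
  indefinite ambient form.\<close>

lemma tangential_proj_eqI:
  assumes V: "subspace V" and pos: "\<And>v. v \<in> V \<Longrightarrow> v \<noteq> 0 \<Longrightarrow> b v v > 0"
    and b: "bounded_bilinear b"
    and u: "u \<in> V" "\<And>v. v \<in> V \<Longrightarrow> b (w - u) v = 0"
  shows "tangential_proj b V w = u"
  unfolding tangential_proj_def
proof (rule the_equality)
  interpret bounded_bilinear b by (rule b)
  show "u \<in> V \<and> (\<forall>v\<in>V. b (w - u) v = 0)" using u by blast
  fix x assume x: "x \<in> V \<and> (\<forall>v\<in>V. b (w - x) v = 0)"
  then have d: "x - u \<in> V" using V u by (simp add: subspace_diff)
  have "b (x - u) (x - u) = b (w - u) (x - u) - b (w - x) (x - u)" by (simp add: diff_left)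
  also have "\<dots> = 0" using d u x by simp
  finally show "x = u" using pos[OF d] by fastforce
qed

lemma subspace_tangent_space [simp]: "subspace (tangent_space S p)"
  by (simp add: tangent_space_def)

text \<open>Shrinking the parameter interval to \<open>{0..<e}\<close> turns eventual membership of
  the curve into membership for all positive parameters. In this form the chain rule for derivatives
  within \<open>S\<close> applies to the curve.\<close>

lemma tangent_space_induct:
  assumes v: "v \<in> tangent_space S p" and W: "subspace W"
    and step: "\<And>\<gamma> A w. \<gamma> 0 = p \<Longrightarrow> 0 \<in> A \<Longrightarrow> at 0 within A \<noteq> bot \<Longrightarrow> \<gamma> ` (A - {0}) \<subseteq> S \<Longrightarrow>
      (\<gamma> has_vector_derivative w) (at 0 within A) \<Longrightarrow> w \<in> W"
  shows "v \<in> W"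
proof -
  have "w \<in> W" if w: "\<gamma> 0 = p" "\<forall>\<^sub>F t in at_right 0. \<gamma> t \<in> S" "(\<gamma> has_vector_derivative w) (at 0 within {0..})"
    for \<gamma> :: "real \<Rightarrow> 'a" and w
  proof -
    obtain e where e: "e > 0" "\<And>t. 0 < t \<Longrightarrow> t < e \<Longrightarrow> \<gamma> t \<in> S"
      using w(2) unfolding eventually_at by (auto simp: dist_real_def)
    show ?thesis
    proof (rule step[of \<gamma> "{0..<e}"])
      have "0 islimpt {0..<e}" by (rule islimpt_subset[OF islimpt_greaterThanLessThan1[OF e(1)]]) auto
      then show "at 0 within {0..<e} \<noteq> bot" by (simp add: trivial_limit_within)
      show "(\<gamma> has_vector_derivative w) (at 0 within {0..<e})"
        using w(3) by (rule has_vector_derivative_within_subset) auto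
      show "\<gamma> ` ({0..<e} - {0}) \<subseteq> S"
      proof (rule image_subsetI)
        fix t assume "t \<in> {0..<e} - {0}"
        then have "0 < t" "t < e" by auto
        then show "\<gamma> t \<in> S" by (rule e(2))
      qed
    qed (use e w in auto)
  qed
  then have "{v. \<exists>\<gamma>. \<gamma> 0 = p \<and> (\<forall>\<^sub>F t in at_right 0. \<gamma> t \<in> S) \<and> (\<gamma> has_vector_derivative v) (at 0 within {0..})} \<subseteq> W"
    by blast
  then show ?thesis using v W unfolding tangent_space_def by (meson span_minimal subsetD)
qed

lemma tangent_spaceI:
  assumes "\<gamma> 0 = p" "e > 0" "\<And>t. 0 < t \<Longrightarrow> t < e \<Longrightarrow> \<gamma> t \<in> S" "(\<gamma> has_vector_derivative v) (at 0 within {0..})"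
  shows "v \<in> tangent_space S p"
  unfolding tangent_space_def
  using assms by (intro span_base) (auto simp: eventually_at_right intro!: exI[of _ \<gamma>])

text \<open>The chain rule along a curve in \<open>S\<close> fixes the value of any derivative
  within \<open>S\<close> on its velocity, and linearity carries this to the span.\<close>

lemma has_derivative_within_tangent_unique:
  assumes p: "p \<in> S" and f: "(f has_derivative D1) (at p within S)" "(f has_derivative D2) (at p within S)"
    and v: "v \<in> tangent_space S p"
  shows "D1 v = D2 v"
proof -
  have lin: "linear D1" "linear D2" using f by (auto intro: has_derivative_linear)
  have "v \<in> {v. D1 v = D2 v}"
    using v
  proof (rule tangent_space_induct)
    show "subspace {v. D1 v = D2 v}"
      using lin by (auto simp: subspace_def linear_0 linear_add linear_cmul)
    fix \<gamma> A w assume *: "\<gamma> 0 = p" "0 \<in> A" "at 0 within A \<noteq> bot" "\<gamma> ` (A - {0}) \<subseteq> S"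
      "(\<gamma> has_vector_derivative w) (at 0 within A)"
    have im: "\<gamma> ` A \<subseteq> S" using * p by (metis Diff_iff image_subset_iff singletonD)
    have "(f \<circ> \<gamma> has_vector_derivative D w) (at 0 within A)" if "(f has_derivative D) (at p within S)" for D
      using vector_derivative_diff_chain_within[OF *(5), of f D] that *(1) im
      by (auto intro: has_derivative_subset)
    then show "w \<in> {v. D1 v = D2 v}"
      using f vector_derivative_unique_within[OF *(3)] by blast
  qed
  then show ?thesis by simp
qed

text \<open>On \<open>S\<close> the function is constant, so the zero map is another derivative
  within \<open>S\<close>. Equations satisfied on \<open>S\<close> thus restrict its tangent
  vectors.\<close>

lemma derivative_tangent_zero:
  assumes p: "p \<in> S" and f: "(f has_derivative D) (at p)" and c: "\<And>x. x \<in> S \<Longrightarrow> f x = c"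
    and v: "v \<in> tangent_space S p"
  shows "D v = 0"
proof -
  have "(f has_derivative D) (at p within S)" using f by (rule has_derivative_at_withinI)
  moreover have "(f has_derivative (\<lambda>_. 0)) (at p within S)"
    by (rule has_derivative_transform[OF p _ has_derivative_const[of c]]) (simp add: c)
  ultimately show ?thesis by (rule has_derivative_within_tangent_unique[OF p _ _ v])
qed

text \<open>Derivatives within a submanifold become computable: any differentiable ambient function
  that agrees on \<open>S\<close> yields the value on tangent vectors.\<close>

lemma frechet_derivative_within_tangent:
  assumes p: "p \<in> S" and f: "(f has_derivative D) (at p)" and g: "\<And>x. x \<in> S \<Longrightarrow> g x = f x"
    and v: "v \<in> tangent_space S p"
  shows "frechet_derivative g (at p within S) v = D v"
proof -
  have "(g has_derivative D) (at p within S)"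
    by (rule has_derivative_transform[OF p g has_derivative_at_withinI[OF f]])
  moreover from this have "(g has_derivative frechet_derivative g (at p within S)) (at p within S)"
    using frechet_derivative_works differentiable_def by blast
  ultimately show ?thesis by (intro has_derivative_within_tangent_unique[OF p _ _ v])
qed

lemma tangent_space_Times:
  assumes "a \<in> A" "c \<in> B"
  shows "tangent_space (A \<times> B) (a, c) = tangent_space A a \<times> tangent_space B c"
proof (intro subset_antisym subsetI)
  fix v assume "v \<in> tangent_space (A \<times> B) (a, c)"
  then show "v \<in> tangent_space A a \<times> tangent_space B c"
    unfolding tangent_space_def[of "A \<times> B"]
  proof (rule subsetD[OF span_minimal, rotated 2])
    show "subspace (tangent_space A a \<times> tangent_space B c)" by (intro subspace_Times) simp_all
    show "{v. \<exists>\<gamma>. \<gamma> 0 = (a, c) \<and> (\<forall>\<^sub>F t in at_right 0. \<gamma> t \<in> A \<times> B) \<and> (\<gamma> has_vector_derivative v) (at 0 within {0..})}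
      \<subseteq> tangent_space A a \<times> tangent_space B c"
    proof clarify
      fix v w \<gamma> assume \<gamma>: "\<gamma> 0 = (a, c)" "\<forall>\<^sub>F t in at_right 0. \<gamma> t \<in> A \<times> B" "(\<gamma> has_vector_derivative (v, w)) (at 0 within {0..})"
      have "((\<lambda>t. fst (\<gamma> t)) has_vector_derivative v) (at 0 within {0..})" "((\<lambda>t. snd (\<gamma> t)) has_vector_derivative w) (at 0 within {0..})"
        using \<gamma>(3) by (auto simp: has_vector_derivative_def dest: has_derivative_fst has_derivative_snd)
      then show "v \<in> tangent_space A a \<and> w \<in> tangent_space B c"
        unfolding tangent_space_def using \<gamma>(1,2)
        by (intro conjI span_base; clarsimp; intro exI conjI; assumption?; (elim eventually_mono)?; auto)
    qed
  qed
next
  fix v assume v: "v \<in> tangent_space A a \<times> tangent_space B c"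
  have "fst v \<in> {x. (x, 0) \<in> tangent_space (A \<times> B) (a, c)}"
  proof (rule subsetD[OF span_minimal])
    show "subspace {x. (x, 0) \<in> tangent_space (A \<times> B) (a, c)}"
      using subspace_tangent_space[of "A \<times> B" "(a, c)"] unfolding subspace_def by (auto simp: zero_prod_def)
        (metis add_Pair add.right_neutral, metis scaleR_Pair scaleR_zero_right)
    show "fst v \<in> span {v. \<exists>\<gamma>. \<gamma> 0 = a \<and> (\<forall>\<^sub>F t in at_right 0. \<gamma> t \<in> A) \<and> (\<gamma> has_vector_derivative v) (at 0 within {0..})}"
      using v unfolding tangent_space_def by auto
    show "{v. \<exists>\<gamma>. \<gamma> 0 = a \<and> (\<forall>\<^sub>F t in at_right 0. \<gamma> t \<in> A) \<and> (\<gamma> has_vector_derivative v) (at 0 within {0..})}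
       \<subseteq> {x. (x, 0) \<in> tangent_space (A \<times> B) (a, c)}"
    proof clarify
      fix x \<gamma> assume \<gamma>: "a = \<gamma> (0::real)" "\<forall>\<^sub>F t in at_right 0. \<gamma> t \<in> A" "(\<gamma> has_vector_derivative x) (at 0 within {0..})"
      have "((\<lambda>t. (\<gamma> t, c)) has_vector_derivative (x, 0)) (at 0 within {0..})"
        by (intro has_vector_derivative_Pair \<gamma>(3) has_vector_derivative_const)
      then show "(x, 0) \<in> tangent_space (A \<times> B) (\<gamma> 0, c)"
        unfolding tangent_space_def using \<gamma>(2) assms(2)
        by (intro span_base CollectI exI[of _ "\<lambda>t. (\<gamma> t, c)"]) auto
    qed
  qed
  moreover have "snd v \<in> {y. (0, y) \<in> tangent_space (A \<times> B) (a, c)}"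
  proof (rule subsetD[OF span_minimal])
    show "subspace {y. (0, y) \<in> tangent_space (A \<times> B) (a, c)}"
      using subspace_tangent_space[of "A \<times> B" "(a, c)"] unfolding subspace_def by (auto simp: zero_prod_def)
        (metis add_Pair add.right_neutral, metis scaleR_Pair scaleR_zero_right)
    show "snd v \<in> span {v. \<exists>\<gamma>. \<gamma> 0 = c \<and> (\<forall>\<^sub>F t in at_right 0. \<gamma> t \<in> B) \<and> (\<gamma> has_vector_derivative v) (at 0 within {0..})}"
      using v unfolding tangent_space_def by auto
    show "{v. \<exists>\<gamma>. \<gamma> 0 = c \<and> (\<forall>\<^sub>F t in at_right 0. \<gamma> t \<in> B) \<and> (\<gamma> has_vector_derivative v) (at 0 within {0..})}
       \<subseteq> {y. (0, y) \<in> tangent_space (A \<times> B) (a, c)}"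
    proof clarify
      fix y \<gamma> assume \<gamma>: "c = \<gamma> (0::real)" "\<forall>\<^sub>F t in at_right 0. \<gamma> t \<in> B" "(\<gamma> has_vector_derivative y) (at 0 within {0..})"
      have "((\<lambda>t. (a, \<gamma> t)) has_vector_derivative (0, y)) (at 0 within {0..})"
        by (intro has_vector_derivative_Pair \<gamma>(3) has_vector_derivative_const)
      then show "(0, y) \<in> tangent_space (A \<times> B) (a, \<gamma> 0)"
        unfolding tangent_space_def using \<gamma>(2) assms(1)
        by (intro span_base CollectI exI[of _ "\<lambda>t. (a, \<gamma> t)"]) auto
    qed
  qed
  ultimately have "(fst v, 0) + (0, snd v) \<in> tangent_space (A \<times> B) (a, c)"
    by (intro subspace_add) auto
  then show "v \<in> tangent_space (A \<times> B) (a, c)" by simp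
qed

lemma tangent_space_UNIV [simp]: "tangent_space UNIV p = UNIV"
proof -
  have "v \<in> tangent_space UNIV p" for v
    by (rule tangent_spaceI[of "\<lambda>t. p + t *\<^sub>R v" _ 1]) (auto intro!: derivative_eq_intros)
  then show ?thesis by auto
qed

text \<open>At an end point the curves in the segment have inward one-sided velocity; the span
  supplies the opposite sign.\<close>

lemma tangent_space_segment:
  assumes "0 < l" "t \<in> {0..l::real}"
  shows "tangent_space {0..l} t = UNIV"
proof -
  have "\<exists>\<epsilon>\<in>{1, -1}. \<epsilon> \<in> tangent_space {0..l} t"
  proof (cases "t < l")
    case True
    have "1 \<in> tangent_space {0..l} t"
      by (rule tangent_spaceI[of "\<lambda>s. t + s" _ "l - t"]) (use True assms in \<open>auto intro!: derivative_eq_intros\<close>)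
    then show ?thesis by blast
  next
    case False
    have "-1 \<in> tangent_space {0..l} t"
      by (rule tangent_spaceI[of "\<lambda>s. t - s" _ l]) (use False assms in \<open>auto intro!: derivative_eq_intros\<close>)
    then show ?thesis by blast
  qed
  then have "x \<in> tangent_space {0..l} t" for x
    using subspace_scale[OF subspace_tangent_space, of 1 "{0..l}" t x] subspace_scale[OF subspace_tangent_space, of "-1" "{0..l}" t "- x"]
    by auto
  then show ?thesis by auto
qed

text \<open>Second difference quotients: two applications of the mean value theorem in either order.\<close>

lemma second_derivative_symmetric_real:
  fixes f :: "'a::real_normed_vector \<Rightarrow> real"
  assumes f: "smooth_on UNIV f"
  shows "frechet_derivative (\<lambda>x. frechet_derivative f (at x) v) (at p) u =
    frechet_derivative (\<lambda>x. frechet_derivative f (at x) u) (at p) v"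
proof -
  define D where "D u x = frechet_derivative f (at x) u" for u x
  define D2 where "D2 u v x = frechet_derivative (D v) (at x) u" for u v x
  have sD: "smooth_on UNIV (D u)" for u unfolding D_def[abs_def] by (rule smooth_on_frechet_derivative[OF f])
  have sD2: "continuous_on UNIV (D2 u v)" for u v
    unfolding D2_def[abs_def] by (intro smooth_on_continuous_on smooth_on_frechet_derivative sD)
  have d1: "((\<lambda>s. f (x + s *\<^sub>R u)) has_real_derivative D u (x + s *\<^sub>R u)) (at s)" for x u s
  proof -
    have "((\<lambda>s. x + s *\<^sub>R u) has_derivative (\<lambda>h. h *\<^sub>R u)) (at s)" by (auto intro!: derivative_eq_intros)
    from has_derivative_compose[OF this smooth_on_has_derivative[OF f]]
    show ?thesis
      by (simp add: has_field_derivative_def D_def linear_cmul[OF has_derivative_linear[OF smooth_on_has_derivative[OF f]]] mult_commute_abs)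
  qed
  have d2: "((\<lambda>s. D v (x + s *\<^sub>R u)) has_real_derivative D2 u v (x + s *\<^sub>R u)) (at s)" for x u v s
  proof -
    have "((\<lambda>s. x + s *\<^sub>R u) has_derivative (\<lambda>h. h *\<^sub>R u)) (at s)" by (auto intro!: derivative_eq_intros)
    from has_derivative_compose[OF this smooth_on_has_derivative[OF sD]]
    show ?thesis
      by (simp add: has_field_derivative_def D2_def linear_cmul[OF has_derivative_linear[OF smooth_on_has_derivative[OF sD]]] mult_commute_abs)
  qed
  have mvt: "\<exists>s t. 0 < s \<and> s < h \<and> 0 < t \<and> t < h \<and>
      f (p + h *\<^sub>R u + h *\<^sub>R v) - f (p + h *\<^sub>R u) - f (p + h *\<^sub>R v) + f p = h * h * D2 v u (p + s *\<^sub>R u + t *\<^sub>R v)"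
    if h: "h > 0" for h u v
  proof -
    have "\<exists>s. 0 < s \<and> s < h \<and> (f ((p + h *\<^sub>R v) + h *\<^sub>R u) - f (p + h *\<^sub>R u)) - (f ((p + h *\<^sub>R v) + 0 *\<^sub>R u) - f (p + 0 *\<^sub>R u)) =
        (h - 0) * (D u ((p + h *\<^sub>R v) + s *\<^sub>R u) - D u (p + s *\<^sub>R u))"
      using h by (intro MVT2 DERIV_diff d1)
    then obtain s where s: "0 < s" "s < h" and 1: "f (p + h *\<^sub>R u + h *\<^sub>R v) - f (p + h *\<^sub>R u) - f (p + h *\<^sub>R v) + f p =
        h * (D u ((p + s *\<^sub>R u) + h *\<^sub>R v) - D u ((p + s *\<^sub>R u) + 0 *\<^sub>R v))"
      by (auto simp: algebra_simps)
    have "\<exists>t. 0 < t \<and> t < h \<and> D u ((p + s *\<^sub>R u) + h *\<^sub>R v) - D u ((p + s *\<^sub>R u) + 0 *\<^sub>R v) = (h - 0) * D2 v u ((p + s *\<^sub>R u) + t *\<^sub>R v)"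
      using h by (intro MVT2 d2)
    then show ?thesis using s 1 by (metis (no_types, opaque_lifting) diff_zero mult.assoc)
  qed
  have "D2 u v p = D2 v u p"
  proof (rule ccontr)
    assume ne: "D2 u v p \<noteq> D2 v u p"
    define \<epsilon> where "\<epsilon> = \<bar>D2 u v p - D2 v u p\<bar> / 2"
    have \<epsilon>: "\<epsilon> > 0" using ne by (simp add: \<epsilon>_def)
    have "isCont (D2 a b) p" for a b using sD2[of a b] by (simp add: continuous_on_eq_continuous_at)
    then obtain d where d: "d > 0" "\<And>x. dist x p < d \<Longrightarrow> dist (D2 u v x) (D2 u v p) < \<epsilon>" "\<And>x. dist x p < d \<Longrightarrow> dist (D2 v u x) (D2 v u p) < \<epsilon>"
      using \<epsilon> unfolding continuous_at_eps_delta by (metis (no_types, lifting) min_less_iff_conj)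
    \<comment> \<open>With this step both evaluation points lie within distance \<open>d\<close> of
      \<open>p\<close>. The summand 1 keeps the quotient meaningful when \<open>u\<close> and
      \<open>v\<close> vanish.\<close>
    define h where "h = d / (norm u + norm v + 1) / 2"
    have h: "h > 0" unfolding h_def using d(1) by (simp add: add_nonneg_pos)
    have hd: "h * (norm u + norm v) < d"
    proof -
      have "h * (norm u + norm v) \<le> h * (norm u + norm v + 1)" using h by simp
      also have "\<dots> = d / 2" unfolding h_def using norm_ge_zero[of u] norm_ge_zero[of v] by (simp add: field_simps add_nonneg_eq_0_iff)
      finally show ?thesis using d(1) by simp
    qed
    have near: "dist (p + s *\<^sub>R a + t *\<^sub>R b) p < d" if "0 < s" "s < h" "0 < t" "t < h" "norm a + norm b = norm u + norm v" for s t a b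
    proof -
      have "dist (p + s *\<^sub>R a + t *\<^sub>R b) p \<le> norm (s *\<^sub>R a) + norm (t *\<^sub>R b)"
        using norm_triangle_ineq[of "s *\<^sub>R a" "t *\<^sub>R b"] by (simp add: dist_norm add.assoc)
      also have "\<dots> \<le> h * norm a + h * norm b" using that by (intro add_mono) (auto intro: mult_right_mono)
      finally show ?thesis using hd that by (simp add: distrib_left[symmetric])
    qed
    obtain s t where st: "0 < s" "s < h" "0 < t" "t < h"
      "f (p + h *\<^sub>R u + h *\<^sub>R v) - f (p + h *\<^sub>R u) - f (p + h *\<^sub>R v) + f p = h * h * D2 v u (p + s *\<^sub>R u + t *\<^sub>R v)"
      using mvt[OF h, of u v] by blast
    obtain s' t' where st': "0 < s'" "s' < h" "0 < t'" "t' < h"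
      "f (p + h *\<^sub>R v + h *\<^sub>R u) - f (p + h *\<^sub>R v) - f (p + h *\<^sub>R u) + f p = h * h * D2 u v (p + s' *\<^sub>R v + t' *\<^sub>R u)"
      using mvt[OF h, of v u] by blast
    have sw: "p + h *\<^sub>R v + h *\<^sub>R u = p + h *\<^sub>R u + h *\<^sub>R v" by (simp add: add_ac)
    have "h * h * D2 u v (p + s' *\<^sub>R v + t' *\<^sub>R u) = h * h * D2 v u (p + s *\<^sub>R u + t *\<^sub>R v)"
      using st(5) st'(5) unfolding sw by linarith
    then have "D2 u v (p + s' *\<^sub>R v + t' *\<^sub>R u) = D2 v u (p + s *\<^sub>R u + t *\<^sub>R v)" using h by simp
    moreover have "dist (D2 u v (p + s' *\<^sub>R v + t' *\<^sub>R u)) (D2 u v p) < \<epsilon>" "dist (D2 v u (p + s *\<^sub>R u + t *\<^sub>R v)) (D2 v u p) < \<epsilon>"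
      using d(2)[OF near[OF st'(1-4), of v u]] d(3)[OF near[OF st(1-4), of u v]] by (simp_all add: add.commute[of "norm v"])
    moreover have "\<epsilon> + \<epsilon> = \<bar>D2 u v p - D2 v u p\<bar>" by (simp add: \<epsilon>_def)
    ultimately show False unfolding dist_real_def by linarith
  qed
  then show ?thesis by (simp add: D2_def D_def[abs_def])
qed

lemma second_derivative_symmetric:
  fixes f :: "'a::real_normed_vector \<Rightarrow> 'b::euclidean_space"
  assumes f: "smooth_on UNIV f"
  shows "frechet_derivative (\<lambda>x. frechet_derivative f (at x) v) (at p) u =
    frechet_derivative (\<lambda>x. frechet_derivative f (at x) u) (at p) v"
proof (rule euclidean_eqI)
  fix e :: 'b
  have comp: "frechet_derivative g (at x) w \<bullet> e = frechet_derivative (\<lambda>x. g x \<bullet> e) (at x) w" if "smooth_on UNIV g" for g :: "'a \<Rightarrow> 'b" and x w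
    by (subst has_derivative_imp_frechet[OF has_derivative_inner_left[OF smooth_on_has_derivative[OF that]]]) simp_all
  have s: "smooth_on UNIV (\<lambda>x. f x \<bullet> e)"
    by (rule smooth_on_bounded_linear_compose[OF open_UNIV bounded_linear_inner_left f])
  show "frechet_derivative (\<lambda>x. frechet_derivative f (at x) v) (at p) u \<bullet> e =
    frechet_derivative (\<lambda>x. frechet_derivative f (at x) u) (at p) v \<bullet> e"
    unfolding comp[OF smooth_on_frechet_derivative[OF f]] comp[OF f] by (rule second_derivative_symmetric_real[OF s])
qed

section \<open>Space forms\<close>

text \<open>Positivity is demanded on \<open>V\<close> only, so that the Lorentz form on tangent
  spaces of the hyperboloid is included. Orthonormal bases and Parseval's identity are developed
  relative to \<open>b\<close>.\<close>

locale positive_form =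
  fixes b :: "'w::euclidean_space bilinear_form" and V :: "'w set"
  assumes bilinear: "bounded_bilinear b" and sym: "b x y = b y x"
    and subspace: "subspace V" and pos: "v \<in> V \<Longrightarrow> v \<noteq> 0 \<Longrightarrow> b v v > 0"
begin

interpretation bounded_bilinear b by (rule bilinear)

definition orthonormal :: "'w set \<Rightarrow> bool" where
  "orthonormal E \<longleftrightarrow> E \<subseteq> V \<and> (\<forall>e\<in>E. \<forall>e'\<in>E. b e e' = (if e = e' then 1 else 0))"

lemma orthonormal_sum:
  assumes "orthonormal E" "finite E" "e \<in> E"
  shows "b (\<Sum>e\<in>E. c e *\<^sub>R e) e = c e"
proof -
  have "b (\<Sum>e\<in>E. c e *\<^sub>R e) e = (\<Sum>e'\<in>E. c e' * b e' e)"
    by (simp add: sum_left scaleR_left)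
  also have "\<dots> = (\<Sum>e'\<in>E. if e' = e then c e' else 0)"
    using assms unfolding orthonormal_def by (intro sum.cong) auto
  finally show ?thesis using assms by simp
qed

lemma orthonormal_independent:
  assumes "orthonormal E"
  shows "independent E"
  unfolding dependent_explicit
proof clarify
  fix t u v assume *: "finite t" "t \<subseteq> E" "(\<Sum>v\<in>t. u v *\<^sub>R v) = 0" "v \<in> t" "u v \<noteq> 0"
  then have "orthonormal t" using assms unfolding orthonormal_def by blast
  from orthonormal_sum[OF this *(1,4), of u] show False using * by (simp add: zero_left)
qed

text \<open>One step of Gram-Schmidt; normalization is possible because the remainder is a nonzero
  vector of \<open>V\<close>, where \<open>b\<close> is positive.\<close>

lemma orthonormal_extend:
  assumes E: "orthonormal E" "finite E" and v: "v \<in> V" "v \<notin> span E"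
  shows "\<exists>e. e \<notin> E \<and> orthonormal (insert e E)"
proof -
  define w where "w = v - (\<Sum>e\<in>E. b v e *\<^sub>R e)"
  have "(\<Sum>e\<in>E. b v e *\<^sub>R e) \<in> span E" by (intro span_sum span_scale span_base)
  then have w0: "w \<noteq> 0" using v(2) unfolding w_def by auto
  have wV: "w \<in> V"
    using E v subspace unfolding w_def orthonormal_def by (intro subspace_diff subspace_sum subspace_scale) auto
  have we: "b w e = 0" if "e \<in> E" for e
    unfolding w_def using orthonormal_sum[OF E that] by (simp add: diff_left)
  define k where "k = 1 / sqrt (b w w)"
  have k: "k * (k * b w w) = 1" "k * k * b w w = 1" using pos[OF wV w0] by (auto simp: k_def power2_eq_square[symmetric] divide_simps)
  define x where "x = k *\<^sub>R w"
  have x: "x \<in> V" "b x x = 1" using wV subspace k by (simp_all add: x_def subspace_scale scaleR_left scaleR_right)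
  have xe: "b x e = 0" "b e x = 0" if "e \<in> E" for e
    using we[OF that] sym[of e w] by (simp_all add: x_def scaleR_left scaleR_right)
  have "x \<notin> E" using xe(1)[of x] x(2) by auto
  moreover have "b e e' = (if e = e' then 1 else 0)" if "e \<in> insert x E" "e' \<in> insert x E" for e e'
  proof (cases "e = x"; cases "e' = x")
    assume "e \<noteq> x" "e' \<noteq> x"
    then have "e \<in> E" "e' \<in> E" using that by auto
    then show ?thesis using E(1) unfolding orthonormal_def by blast
  qed (use that x xe in auto)
  then have "orthonormal (insert x E)"
    using x(1) E(1) unfolding orthonormal_def by blast
  ultimately show ?thesis by blast
qed

lemma orthonormal_exists: "k \<le> dim V \<Longrightarrow> \<exists>E. orthonormal E \<and> finite E \<and> card E = k"
proof (induction k)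
  case 0
  show ?case by (intro exI[of _ "{}"]) (simp add: orthonormal_def)
next
  case (Suc k)
  then obtain E where E: "orthonormal E" "finite E" "card E = k" by auto
  have "\<not> V \<subseteq> span E"
  proof
    assume "V \<subseteq> span E"
    moreover have "E \<subseteq> V" using E(1) unfolding orthonormal_def by blast
    ultimately have "dim V \<le> card E" using E(2) by (intro span_card_ge_dim)
    then show False using Suc.prems E(3) by simp
  qed
  then obtain v where "v \<in> V" "v \<notin> span E" by blast
  from orthonormal_extend[OF E(1,2) this] E show ?case by (metis card_insert_disjoint finite_insert)
qed

lemma orthonormal_basis:
  shows "span (orthonormal_basis b V) = V" "orthonormal (orthonormal_basis b V)" "finite (orthonormal_basis b V)"
    "card (orthonormal_basis b V) = dim V"
proof -
  obtain E where E: "orthonormal E" "finite E" "card E = dim V" using orthonormal_exists[of "dim V"] by auto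
  have "V \<subseteq> span E"
    using E orthonormal_independent[OF E(1)] by (intro card_ge_dim_independent) (auto simp: orthonormal_def)
  moreover have "span E \<subseteq> V" using E(1) subspace by (intro span_minimal) (auto simp: orthonormal_def)
  ultimately have "span E = V" by (intro subset_antisym)
  then have "E \<subseteq> V \<and> span E = V \<and> (\<forall>e\<in>E. \<forall>e'\<in>E. b e e' = (if e = e' then 1 else 0))"
    using E(1) unfolding orthonormal_def by blast
  then have *: "orthonormal_basis b V \<subseteq> V \<and> span (orthonormal_basis b V) = V \<and>
     (\<forall>e\<in>orthonormal_basis b V. \<forall>e'\<in>orthonormal_basis b V. b e e' = (if e = e' then 1 else 0))"
    unfolding orthonormal_basis_def by (rule someI)
  then show s: "span (orthonormal_basis b V) = V" by blast
  show o: "orthonormal (orthonormal_basis b V)" unfolding orthonormal_def using * by blast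
  note ind = orthonormal_independent[OF o]
  show "finite (orthonormal_basis b V)" by (rule independent_imp_finite[OF ind])
  have "card (orthonormal_basis b V) = dim (span (orthonormal_basis b V))"
    using dim_eq_card_independent[OF ind] by (simp only: dim_span)
  then show "card (orthonormal_basis b V) = dim V" by (simp only: s)
qed

lemma orthonormal_expansion:
  assumes "v \<in> V"
  shows "v = (\<Sum>e\<in>orthonormal_basis b V. b v e *\<^sub>R e)"
proof -
  let ?E = "orthonormal_basis b V"
  let ?w = "v - (\<Sum>e\<in>?E. b v e *\<^sub>R e)"
  have "b ?w e = 0" if "e \<in> ?E" for e
    using orthonormal_sum[OF orthonormal_basis(2,3) that, of "b v"] by (simp add: diff_left)
  moreover have "?E \<subseteq> V" using orthonormal_basis(2) unfolding orthonormal_def by blast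
  then have "?w \<in> span ?E"
    unfolding orthonormal_basis(1) using assms subspace by (intro subspace_diff subspace_sum subspace_scale) auto
  moreover have "subspace {u. b ?w u = 0}"
    by (auto simp: subspace_def zero_right add_right scaleR_right)
  ultimately have "b ?w ?w = 0" using span_minimal[of ?E "{u. b ?w u = 0}"] by blast
  then have "?w = 0" using pos[of ?w] \<open>?w \<in> span ?E\<close> orthonormal_basis(1) by fastforce
  then show ?thesis by simp
qed

lemma parseval:
  assumes "u \<in> V" "v \<in> V"
  shows "(\<Sum>e\<in>orthonormal_basis b V. b u e * b v e) = b u v"
proof -
  have "b u v = b u (\<Sum>e\<in>orthonormal_basis b V. b v e *\<^sub>R e)" using orthonormal_expansion[OF assms(2)] by simp
  then show ?thesis by (simp add: sum_right scaleR_right mult.commute)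
qed

end

lemma bounded_bilinear_product_form:
  assumes "bounded_bilinear b"
  shows "bounded_bilinear (product_form b)"
proof -
  interpret bounded_bilinear b by (rule assms)
  obtain K where K: "\<And>x y. norm (b x y) \<le> norm x * norm y * K" "K > 0" using pos_bounded by blast
  have nf: "norm (fst z) \<le> norm z" "norm (snd z) \<le> norm z" for z :: "'a \<times> real"
    using norm_fst_le[of "fst z" "snd z"] norm_snd_le[of "snd z" "fst z"] by simp_all
  show ?thesis
  proof
    show "\<exists>K. \<forall>x y. norm (product_form b x y) \<le> norm x * norm y * K"
    proof (intro exI[of _ "K + 1"] allI)
      fix x y :: "'a \<times> real"
      have "norm (product_form b x y) \<le> norm (b (fst x) (fst y)) + norm (snd x * snd y)"
        unfolding product_form_def by (rule norm_triangle_ineq)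
      also have "\<dots> \<le> norm (fst x) * norm (fst y) * K + norm (snd x) * norm (snd y)"
        using K(1) by (intro add_mono) (simp_all add: abs_mult)
      also have "\<dots> \<le> norm x * norm y * K + norm x * norm y"
        using K(2) by (intro add_mono mult_mono) (auto simp: nf simp del: real_norm_def)
      finally show "norm (product_form b x y) \<le> norm x * norm y * (K + 1)" by (simp add: distrib_left)
    qed
  qed (auto simp: product_form_def add_left add_right scaleR_left scaleR_right algebra_simps)
qed

text \<open>All three models at once: \<open>M\<close> is \<open>{x. b x x = \<kappa>}\<close> (or a component of it) for \<open>\<kappa> = 1\<close> and
  \<open>\<kappa> = -1\<close>, and the whole space for \<open>\<kappa> = 0\<close>.  Factors \<open>\<kappa>\<close> make the equations of the flat case
  trivial.  The functions \<open>cs\<close> and \<open>sn\<close> are the generalized cosine and sine.\<close>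

locale space_form =
  fixes b :: "'w::euclidean_space bilinear_form" and M :: "'w set" and \<kappa> :: real
    and cs sn :: "real \<Rightarrow> real" and n :: nat
  assumes bilinear: "bounded_bilinear b" and sym: "b x y = b y x"
    and kappa: "\<kappa> * \<kappa> * \<kappa> = \<kappa>"
    and level: "x \<in> M \<Longrightarrow> \<kappa> * \<kappa> * b x x = \<kappa>"
    and pos: "x \<in> M \<Longrightarrow> \<kappa> * b x v = 0 \<Longrightarrow> v \<noteq> 0 \<Longrightarrow> b v v > 0"
    and cs: "(cs has_real_derivative - \<kappa> * sn t) (at t)" "cs 0 = 1"
    and sn: "(sn has_real_derivative cs t) (at t)" "sn 0 = 0"
    and curve: "x \<in> M \<Longrightarrow> \<kappa> * b x v = 0 \<Longrightarrow> b v v = 1 \<Longrightarrow> cs t *\<^sub>R x + sn t *\<^sub>R v \<in> M"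
    and dim: "x \<in> M \<Longrightarrow> dim {v. \<kappa> * b x v = 0} = n"
begin

sublocale B: bounded_bilinear b by (rule bilinear)

abbreviation "T x \<equiv> {v. \<kappa> * b x v = 0}"

lemma cs_sn: "cs t * cs t + \<kappa> * (sn t * sn t) = 1"
proof -
  have "((\<lambda>t. cs t * cs t + \<kappa> * (sn t * sn t)) has_real_derivative 0) (at t)" for t
    by (auto intro!: derivative_eq_intros cs sn simp: algebra_simps)
  then have "cs t * cs t + \<kappa> * (sn t * sn t) = cs 0 * cs 0 + \<kappa> * (sn 0 * sn 0)"
    by (intro DERIV_isconst_all) blast
  then show ?thesis using cs(2) sn(2) by simp
qed

lemma subspace_T: "subspace (T x)"
  by (auto simp: subspace_def B.zero_right B.add_right B.scaleR_right distrib_left)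

lemma curve_derivative: "((\<lambda>t. cs t *\<^sub>R x + sn t *\<^sub>R v) has_vector_derivative ((- \<kappa> * sn t) *\<^sub>R x + cs t *\<^sub>R v)) (at t within A)"
  using cs(1)[of t] sn(1)[of t]
  by (auto intro!: derivative_eq_intros simp: has_real_derivative_iff_has_vector_derivative
      intro: has_vector_derivative_at_within)

text \<open>Differentiating the level equation gives one inclusion. For the other, each unit vector
  orthogonal to \<open>x\<close> is the initial velocity of an explicit curve in
  \<open>M\<close>.\<close>

lemma tangent_space_M:
  assumes x: "x \<in> M"
  shows "tangent_space M x = T x"
proof (intro subset_antisym subsetI)
  fix v assume v: "v \<in> tangent_space M x"
  have "((\<lambda>y. \<kappa> * \<kappa> * b y y) has_derivative (\<lambda>h. \<kappa> * \<kappa> * (b x h + b h x))) (at x)"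
    by (intro has_derivative_mult_right B.FDERIV has_derivative_ident)
  from derivative_tangent_zero[OF x this level v] have "\<kappa> * \<kappa> * (2 * b x v) = 0" by (simp add: sym)
  then show "v \<in> T x" by auto
next
  fix v assume v: "v \<in> T x"
  show "v \<in> tangent_space M x"
  proof (cases "v = 0")
    case True
    then show ?thesis by (simp add: subspace_0)
  next
    case False
    define k where "k = sqrt (b v v)"
    have k: "k > 0" "k * k = b v v" using pos[OF x _ False] v by (auto simp: k_def)
    define w where "w = (1 / k) *\<^sub>R v"
    have w: "\<kappa> * b x w = 0" "b w w = 1"
      using v k by (auto simp: w_def B.scaleR_left B.scaleR_right simp flip: k(2))
    have "w \<in> tangent_space M x"
      by (rule tangent_spaceI[of "\<lambda>t. cs t *\<^sub>R x + sn t *\<^sub>R w" _ 1])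
        (use curve[OF x w] curve_derivative[of x w 0 "{0..}"] cs(2) sn(2) in auto)
    then have "k *\<^sub>R w \<in> tangent_space M x" by (intro subspace_scale) simp_all
    then show ?thesis using k by (simp add: w_def)
  qed
qed

text \<open>The normal line is spanned by \<open>x\<close>, whose square is \<open>\<kappa>\<close>.
  The coefficient carries \<open>\<kappa>\<close> in place of \<open>1 / \<kappa>\<close>: these
  agree for \<open>\<kappa>\<close> equal to 1 or -1, and for \<open>\<kappa> = 0\<close> the
  projection becomes the identity.\<close>

lemma proj_M:
  assumes x: "x \<in> M"
  shows "tangential_proj b (T x) w = w - (\<kappa> * b w x) *\<^sub>R x"
proof (rule tangential_proj_eqI[OF subspace_T pos[OF x] bilinear])
  have "\<kappa> * b x (w - (\<kappa> * b w x) *\<^sub>R x) = \<kappa> * b w x - (\<kappa> * \<kappa> * b x x) * b w x"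
    by (simp add: B.diff_right B.scaleR_right sym algebra_simps)
  then show "w - (\<kappa> * b w x) *\<^sub>R x \<in> T x" by (simp add: level[OF x])
  show "b (w - (w - (\<kappa> * b w x) *\<^sub>R x)) v = 0" if "v \<in> T x" for v
    using that by (auto simp: B.scaleR_left)
qed auto

lemma geodesic_curve:
  assumes x: "x \<in> M" and v: "v \<in> T x" "b v v = 1"
  defines "\<gamma> \<equiv> \<lambda>t. cs t *\<^sub>R x + sn t *\<^sub>R v"
  shows "geodesic b M \<gamma>" "\<gamma> 0 = x" "vector_derivative \<gamma> (at 0) = v"
proof -
  have d: "vector_derivative \<gamma> (at t) = (- \<kappa> * sn t) *\<^sub>R x + cs t *\<^sub>R v" for t
    unfolding \<gamma>_def by (rule vector_derivative_at[OF curve_derivative])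
  show "\<gamma> 0 = x" "vector_derivative \<gamma> (at 0) = v"
    using cs(2) sn(2) by (simp_all add: d) (simp add: \<gamma>_def)
  have M: "\<gamma> t \<in> M" for t unfolding \<gamma>_def using v by (intro curve x) auto
  have "((\<lambda>t. (- \<kappa> * sn t) *\<^sub>R x + cs t *\<^sub>R v) has_vector_derivative (- \<kappa> * cs t) *\<^sub>R x + (- \<kappa> * sn t) *\<^sub>R v) (at t)" for t
    using cs(1)[of t] sn(1)[of t]
    by (auto intro!: derivative_eq_intros simp: has_real_derivative_iff_has_vector_derivative)
  then have dd: "vector_derivative (\<lambda>s. vector_derivative \<gamma> (at s)) (at t) = (- \<kappa>) *\<^sub>R \<gamma> t" for t
    unfolding d[abs_def] by (subst vector_derivative_at) (auto simp: \<gamma>_def algebra_simps)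
  have "tangential_proj b (tangent_space M (\<gamma> t)) (vector_derivative (\<lambda>s. vector_derivative \<gamma> (at s)) (at t)) = 0" for t
    unfolding dd tangent_space_M[OF M] proj_M[OF M] using level[OF M, of t]
    by (simp add: B.scaleR_left B.minus_left algebra_simps)
  moreover have "smooth_on UNIV \<gamma>"
    unfolding \<gamma>_def
  proof (rule smooth_on_combination[OF open_UNIV])
    show "(cs has_derivative (\<lambda>h. - \<kappa> * sn t * h)) (at t)" for t
      by (rule cs(1)[unfolded has_field_derivative_def])
    show "(sn has_derivative (\<lambda>h. 1 * cs t * h)) (at t)" for t
      using sn(1)[of t, unfolded has_field_derivative_def] by simp
  qed
  ultimately show "geodesic b M \<gamma>" using M unfolding geodesic_def by auto
qed

text \<open>Staying in \<open>M\<close> determines the normal part of the acceleration, and the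
  geodesic equation removes the tangential part, so \<open>\<gamma>\<close> satisfies a linear
  equation with second derivative \<open>- \<kappa> \<gamma>\<close>. The combinations
  \<open>cs \<gamma> - sn \<gamma>'\<close> and \<open>\<kappa> sn \<gamma> + cs \<gamma>'\<close>
  are constant in time, and solving them for \<open>\<gamma>\<close> gives the formula.\<close>

lemma geodesic_unique:
  assumes g: "geodesic b M \<gamma>" and unit: "b (vector_derivative \<gamma> (at 0)) (vector_derivative \<gamma> (at 0)) = 1"
  shows "vector_derivative \<gamma> (at 0) \<in> T (\<gamma> 0)"
    and "\<gamma> t = cs t *\<^sub>R \<gamma> 0 + sn t *\<^sub>R vector_derivative \<gamma> (at 0)"
proof -
  define \<gamma>' where "\<gamma>' s = vector_derivative \<gamma> (at s)" for s
  define \<gamma>'' where "\<gamma>'' s = vector_derivative \<gamma>' (at s)" for s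
  have sm: "smooth_on UNIV \<gamma>" and M: "\<gamma> t \<in> M"
    and pr: "tangential_proj b (tangent_space M (\<gamma> t)) (\<gamma>'' t) = 0" for t
    using g unfolding geodesic_def \<gamma>''_def \<gamma>'_def[abs_def] by auto
  have \<gamma>'_eq: "\<gamma>' = (\<lambda>s. frechet_derivative \<gamma> (at s) 1)"
    unfolding \<gamma>'_def[abs_def] vector_derivative_def
    using smooth_on_has_derivative[OF sm] by (auto simp: fun_eq_iff vector_derivative_def[symmetric]
        frechet_derivative_eq_vector_derivative smooth_on_differentiable[OF sm])
  have d1: "(\<gamma> has_vector_derivative \<gamma>' t) (at t)" for t
    using smooth_on_differentiable[OF sm, of t] unfolding \<gamma>'_def by (simp add: vector_derivative_works)
  have "smooth_on UNIV \<gamma>'" unfolding \<gamma>'_eq by (rule smooth_on_frechet_derivative[OF sm])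
  then have d2: "(\<gamma>' has_vector_derivative \<gamma>'' t) (at t)" for t
    using smooth_on_differentiable[of UNIV \<gamma>' t] unfolding \<gamma>''_def by (simp add: vector_derivative_works)
  have db: "((\<lambda>t. b (f t) (h t)) has_real_derivative b (f t) h' + b f' (h t)) (at t)"
    if "(f has_vector_derivative f') (at t)" "(h has_vector_derivative h') (at t)" for f h f' h' t
    using B.has_vector_derivative[OF that] by (simp add: has_real_derivative_iff_has_vector_derivative)
  have tan: "\<kappa> * b (\<gamma> t) (\<gamma>' t) = 0" for t
  proof -
    have "((\<lambda>t. \<kappa> * \<kappa> * b (\<gamma> t) (\<gamma> t)) has_real_derivative \<kappa> * \<kappa> * (b (\<gamma> t) (\<gamma>' t) + b (\<gamma>' t) (\<gamma> t))) (at t)"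
      by (intro DERIV_cmult db d1)
    moreover have "(\<lambda>t. \<kappa> * \<kappa> * b (\<gamma> t) (\<gamma> t)) = (\<lambda>t. \<kappa>)" using level[OF M] by auto
    ultimately have "\<kappa> * \<kappa> * (b (\<gamma> t) (\<gamma>' t) + b (\<gamma>' t) (\<gamma> t)) = 0" by (metis DERIV_const DERIV_unique)
    then show ?thesis by (auto simp: sym)
  qed
  then show "vector_derivative \<gamma> (at 0) \<in> T (\<gamma> 0)" unfolding \<gamma>'_def by simp
  have acc: "\<kappa> * b (\<gamma>'' t) (\<gamma> t) = - \<kappa> * b (\<gamma>' t) (\<gamma>' t)" for t
  proof -
    have "((\<lambda>t. \<kappa> * b (\<gamma> t) (\<gamma>' t)) has_real_derivative \<kappa> * (b (\<gamma> t) (\<gamma>'' t) + b (\<gamma>' t) (\<gamma>' t))) (at t)"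
      by (intro DERIV_cmult db d1 d2)
    moreover have "(\<lambda>t. \<kappa> * b (\<gamma> t) (\<gamma>' t)) = (\<lambda>t. 0)" using tan by auto
    ultimately have "\<kappa> * (b (\<gamma> t) (\<gamma>'' t) + b (\<gamma>' t) (\<gamma>' t)) = 0" by (metis DERIV_const DERIV_unique)
    then show ?thesis by (simp add: sym distrib_left)
  qed
  have g2: "\<gamma>'' t = (- \<kappa> * b (\<gamma>' t) (\<gamma>' t)) *\<^sub>R \<gamma> t" for t
    using pr[of t] unfolding tangent_space_M[OF M] proj_M[OF M] acc by (simp add: eq_neg_iff_add_eq_0)
  have "((\<lambda>t. b (\<gamma>' t) (\<gamma>' t)) has_real_derivative 0) (at t)" for t
  proof -
    have "b (\<gamma>' t) (\<gamma>'' t) + b (\<gamma>'' t) (\<gamma>' t) = - 2 * b (\<gamma>' t) (\<gamma>' t) * (\<kappa> * b (\<gamma> t) (\<gamma>' t))"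
      unfolding g2 by (simp add: B.scaleR_left B.scaleR_right B.minus_left B.minus_right sym algebra_simps)
    then show ?thesis using db[OF d2 d2, of t] tan[of t] by simp
  qed
  then have "b (\<gamma>' t) (\<gamma>' t) = b (\<gamma>' 0) (\<gamma>' 0)" for t by (intro DERIV_isconst_all) blast
  then have g3: "\<gamma>'' t = - \<kappa> *\<^sub>R \<gamma> t" for t using unit unfolding g2 by (simp add: \<gamma>'_def)
  have csv: "(cs has_vector_derivative - \<kappa> * sn t) (at t)" and snv: "(sn has_vector_derivative cs t) (at t)" for t
    using cs(1) sn(1) by (simp_all add: has_real_derivative_iff_has_vector_derivative)
  have "((\<lambda>t. cs t *\<^sub>R \<gamma> t - sn t *\<^sub>R \<gamma>' t) has_vector_derivative
      (cs t *\<^sub>R \<gamma>' t + (- \<kappa> * sn t) *\<^sub>R \<gamma> t) - (sn t *\<^sub>R \<gamma>'' t + cs t *\<^sub>R \<gamma>' t)) (at t)" for t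
    by (rule has_vector_derivative_diff; rule bounded_bilinear.has_vector_derivative[OF bounded_bilinear_scaleR]; rule csv snv d1 d2)
  then have "((\<lambda>t. cs t *\<^sub>R \<gamma> t - sn t *\<^sub>R \<gamma>' t) has_vector_derivative 0) (at t within UNIV)" for t
    by (simp add: g3 algebra_simps)
  then obtain A where A: "\<And>t. cs t *\<^sub>R \<gamma> t - sn t *\<^sub>R \<gamma>' t = A"
    using has_vector_derivative_zero_constant[of UNIV] by (metis (no_types, lifting) UNIV_I convex_UNIV)
  have ksn: "((\<lambda>t. \<kappa> * sn t) has_vector_derivative \<kappa> * cs t) (at t)" for t
    using DERIV_cmult[OF sn(1)] by (simp add: has_real_derivative_iff_has_vector_derivative)
  have "((\<lambda>t. (\<kappa> * sn t) *\<^sub>R \<gamma> t + cs t *\<^sub>R \<gamma>' t) has_vector_derivative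
      ((\<kappa> * sn t) *\<^sub>R \<gamma>' t + (\<kappa> * cs t) *\<^sub>R \<gamma> t) + (cs t *\<^sub>R \<gamma>'' t + (- \<kappa> * sn t) *\<^sub>R \<gamma>' t)) (at t)" for t
    by (rule has_vector_derivative_add; rule bounded_bilinear.has_vector_derivative[OF bounded_bilinear_scaleR]; rule ksn csv d1 d2)
  then have "((\<lambda>t. (\<kappa> * sn t) *\<^sub>R \<gamma> t + cs t *\<^sub>R \<gamma>' t) has_vector_derivative 0) (at t within UNIV)" for t
    by (simp add: g3 algebra_simps)
  then obtain E where E: "\<And>t. (\<kappa> * sn t) *\<^sub>R \<gamma> t + cs t *\<^sub>R \<gamma>' t = E"
    using has_vector_derivative_zero_constant[of UNIV] by (metis (no_types, lifting) UNIV_I convex_UNIV)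
  have "A = \<gamma> 0" "E = \<gamma>' 0" using A[of 0] E[of 0] cs(2) sn(2) by auto
  moreover have "cs t *\<^sub>R A + sn t *\<^sub>R E = (cs t * cs t + \<kappa> * (sn t * sn t)) *\<^sub>R \<gamma> t"
    unfolding A[of t, symmetric] E[of t, symmetric] by (simp add: algebra_simps)
  ultimately show "\<gamma> t = cs t *\<^sub>R \<gamma> 0 + sn t *\<^sub>R vector_derivative \<gamma> (at 0)"
    by (simp add: cs_sn \<gamma>'_def)
qed

lemma geodesic_sphere_eq:
  assumes p: "p \<in> M"
  shows "geodesic_sphere b M p \<rho> = {cs \<rho> *\<^sub>R p + sn \<rho> *\<^sub>R v | v. v \<in> T p \<and> b v v = 1}"
proof (intro subset_antisym subsetI)
  fix y assume "y \<in> geodesic_sphere b M p \<rho>"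
  then obtain \<gamma> where \<gamma>: "y = \<gamma> \<rho>" "geodesic b M \<gamma>" "\<gamma> 0 = p" "b (vector_derivative \<gamma> (at 0)) (vector_derivative \<gamma> (at 0)) = 1"
    unfolding geodesic_sphere_def by blast
  then show "y \<in> {cs \<rho> *\<^sub>R p + sn \<rho> *\<^sub>R v | v. v \<in> T p \<and> b v v = 1}"
    using geodesic_unique[OF \<gamma>(2,4)] by blast
next
  fix y assume "y \<in> {cs \<rho> *\<^sub>R p + sn \<rho> *\<^sub>R v | v. v \<in> T p \<and> b v v = 1}"
  then obtain v where v: "v \<in> T p" "b v v = 1" "y = cs \<rho> *\<^sub>R p + sn \<rho> *\<^sub>R v" by blast
  then show "y \<in> geodesic_sphere b M p \<rho>"
    unfolding geodesic_sphere_def using geodesic_curve[OF p v(1,2)] by (auto intro!: exI[of _ "\<lambda>t. cs t *\<^sub>R p + sn t *\<^sub>R v"])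
qed

end

text \<open>Both the base point and the direction vary. Expanding the direction in the standard
  basis reduces this to the product rule: one term differentiates the direction, the other is a
  second derivative of \<open>Z\<close>.\<close>

lemma has_derivative_frechet_apply:
  fixes Z :: "'a::euclidean_space \<Rightarrow> 'b::euclidean_space"
  assumes Z: "smooth_on UNIV Z" and Y: "(Y has_derivative Y') (at p)"
  shows "((\<lambda>q. frechet_derivative Z (at q) (Y q)) has_derivative
    (\<lambda>h. frechet_derivative Z (at p) (Y' h) + frechet_derivative (\<lambda>q. frechet_derivative Z (at q) (Y p)) (at p) h)) (at p)"
proof -
  have lin: "linear (frechet_derivative Z (at q))" for q
    by (rule has_derivative_linear[OF smooth_on_has_derivative[OF Z UNIV_I]])
  have expand: "frechet_derivative Z (at q) y = (\<Sum>e\<in>Basis. (y \<bullet> e) *\<^sub>R frechet_derivative Z (at q) e)" for q y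
  proof -
    have "frechet_derivative Z (at q) y = frechet_derivative Z (at q) (\<Sum>e\<in>Basis. (y \<bullet> e) *\<^sub>R e)"
      by (simp add: euclidean_representation)
    then show ?thesis by (simp add: linear_sum[OF lin] linear_cmul[OF lin])
  qed
  define H where "H e = frechet_derivative (\<lambda>q. frechet_derivative Z (at q) e) (at p)" for e
  have H: "((\<lambda>q. frechet_derivative Z (at q) e) has_derivative H e) (at p)" for e
    unfolding H_def by (rule smooth_on_has_derivative[OF smooth_on_frechet_derivative[OF Z] UNIV_I])
  have H2: "frechet_derivative (\<lambda>q. frechet_derivative Z (at q) y) (at p) h = (\<Sum>e\<in>Basis. (y \<bullet> e) *\<^sub>R H e h)" for y h
  proof -
    have eq: "(\<lambda>q. frechet_derivative Z (at q) y) = (\<lambda>q. \<Sum>e\<in>Basis. (y \<bullet> e) *\<^sub>R frechet_derivative Z (at q) e)"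
      by (rule ext) (rule expand)
    have "((\<lambda>q. \<Sum>e\<in>Basis. (y \<bullet> e) *\<^sub>R frechet_derivative Z (at q) e) has_derivative (\<lambda>h. \<Sum>e\<in>Basis. (y \<bullet> e) *\<^sub>R H e h)) (at p)"
      by (intro has_derivative_sum has_derivative_scaleR_right H)
    then show ?thesis by (subst eq) (simp add: has_derivative_imp_frechet)
  qed
  have eq: "(\<lambda>q. frechet_derivative Z (at q) (Y q)) = (\<lambda>q. \<Sum>e\<in>Basis. (Y q \<bullet> e) *\<^sub>R frechet_derivative Z (at q) e)"
    by (rule ext) (rule expand)
  have eq': "frechet_derivative Z (at p) (Y' h) = (\<Sum>e\<in>Basis. (Y' h \<bullet> e) *\<^sub>R frechet_derivative Z (at p) e)" for h
    by (rule expand)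
  have "((\<lambda>q. \<Sum>e\<in>Basis. (Y q \<bullet> e) *\<^sub>R frechet_derivative Z (at q) e) has_derivative
      (\<lambda>h. \<Sum>e\<in>Basis. (Y p \<bullet> e) *\<^sub>R H e h + (Y' h \<bullet> e) *\<^sub>R frechet_derivative Z (at p) e)) (at p)"
    by (intro has_derivative_sum has_derivative_scaleR H has_derivative_inner_left Y)
  then show ?thesis
    unfolding eq by (rule has_derivative_eq_rhs) (simp add: fun_eq_iff sum.distrib eq' H2 add.commute)
qed

section \<open>Curvature of the product of a space form with the line\<close>

context space_form
begin

abbreviation "B2 \<equiv> product_form b"
abbreviation "P \<equiv> M \<times> (UNIV :: real set)"

sublocale B2: bounded_bilinear B2 by (rule bounded_bilinear_product_form[OF bilinear])

lemma sym2: "B2 v w = B2 w v" by (simp add: product_form_def sym mult.commute)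

lemma tangent_space_P: "z \<in> P \<Longrightarrow> tangent_space P z = {v. \<kappa> * b (fst z) (fst v) = 0}"
  using tangent_space_Times[of "fst z" M "snd z" UNIV] tangent_space_M[of "fst z"] by auto

lemma pos2:
  assumes z: "z \<in> P" and v: "\<kappa> * b (fst z) (fst v) = 0" "v \<noteq> 0"
  shows "B2 v v > 0"
proof (cases "fst v = 0")
  case True
  then have "snd v \<noteq> 0" using v(2) by (metis prod.collapse zero_prod_def)
  then show ?thesis using True by (auto simp: product_form_def B.zero_right zero_less_mult_iff linorder_neq_iff)
next
  case False
  then have "b (fst v) (fst v) > 0" using pos[of "fst z" "fst v"] z v by auto
  then show ?thesis by (simp add: product_form_def add_pos_nonneg)
qed

lemma positive_form_P:
  assumes z: "z \<in> P"
  shows "positive_form B2 (tangent_space P z)"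
proof -
  have "B2 v v > 0" if "v \<in> tangent_space P z" "v \<noteq> 0" for v
    using that pos2[OF z, of v] unfolding tangent_space_P[OF z] by blast
  then show ?thesis
    unfolding positive_form_def using sym2 B2.bounded_bilinear_axioms subspace_tangent_space by blast
qed

lemma proj_P:
  assumes z: "z \<in> P"
  shows "tangential_proj B2 (tangent_space P z) w = w - (\<kappa> * b (fst w) (fst z)) *\<^sub>R (fst z, 0)"
proof (rule tangential_proj_eqI[OF subspace_tangent_space _ B2.bounded_bilinear_axioms])
  show "B2 v v > 0" if "v \<in> tangent_space P z" "v \<noteq> 0" for v
    using pos2[OF z] that by (auto simp: tangent_space_P[OF z])
  have "\<kappa> * b (fst z) (fst w - (\<kappa> * b (fst w) (fst z)) *\<^sub>R fst z) = \<kappa> * b (fst w) (fst z) - (\<kappa> * \<kappa> * b (fst z) (fst z)) * b (fst w) (fst z)"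
    by (simp add: B.diff_right B.scaleR_right sym algebra_simps)
  also have "\<dots> = 0" using level[of "fst z"] z by auto
  finally show "w - (\<kappa> * b (fst w) (fst z)) *\<^sub>R (fst z, 0) \<in> tangent_space P z"
    by (simp add: tangent_space_P[OF z])
  show "B2 (w - (w - (\<kappa> * b (fst w) (fst z)) *\<^sub>R (fst z, 0))) v = 0" if "v \<in> tangent_space P z" for v
    using that by (auto simp: tangent_space_P[OF z] product_form_def B.scaleR_left)
qed

text \<open>The constant vector \<open>v\<close> projected to the tangent space at each point of the
  product, in a form that is polynomial in \<open>q\<close> and hence smooth on the whole ambient
  space. Such fields show that the description defining the curvature tensor is not vacuous.\<close>

definition extension :: "'w \<times> real \<Rightarrow> 'w \<times> real \<Rightarrow> 'w \<times> real" where
  "extension v q = v - (\<kappa> * b (fst v) (fst q)) *\<^sub>R (fst q, 0)"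

lemma vector_field_extension: "vector_field P (extension v)"
  unfolding vector_field_def
proof (intro conjI ballI)
  have lin: "bounded_linear (\<lambda>q :: 'w \<times> real. (fst q, 0 :: real))" "bounded_linear (\<lambda>q :: 'w \<times> real. \<kappa> * b (fst v) (fst q))"
    by (auto intro!: bounded_linear_Pair bounded_linear_fst bounded_linear_zero bounded_linear_mult_right[THEN bounded_linear_compose]
        B.bounded_linear_right[THEN bounded_linear_compose])
  show "smooth_on UNIV (extension v)"
    unfolding extension_def[abs_def]
    by (intro smooth_on_diff smooth_on_const smooth_on_scaleR smooth_on_bounded_linear[OF open_UNIV lin(1)]
        smooth_on_bounded_linear[OF open_UNIV lin(2)]) simp_all
  show "extension v q \<in> tangent_space P q" if q: "q \<in> P" for q
  proof -
    have "\<kappa> * b (fst q) (fst v - (\<kappa> * b (fst v) (fst q)) *\<^sub>R fst q) = \<kappa> * b (fst v) (fst q) - (\<kappa> * \<kappa> * b (fst q) (fst q)) * b (fst v) (fst q)"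
      by (simp add: B.diff_right B.scaleR_right sym algebra_simps)
    also have "\<dots> = 0" using level[of "fst q"] q by auto
    finally show ?thesis by (simp add: tangent_space_P[OF q] extension_def)
  qed
qed

lemma extension_at: "z \<in> P \<Longrightarrow> v \<in> tangent_space P z \<Longrightarrow> extension v z = v"
  by (auto simp: extension_def tangent_space_P sym zero_prod_def)

text \<open>In a second covariant derivative the differentiated field is itself a covariant
  derivative and is known on \<open>P\<close> only; \<open>Y0\<close> is a differentiable ambient
  substitute for it.\<close>

lemma covariant_derivative_eq:
  assumes z: "z \<in> P" and X: "X z \<in> tangent_space P z"
    and D: "(Y0 has_derivative D) (at z)" and Y: "\<And>q. q \<in> P \<Longrightarrow> Y q = Y0 q"
  shows "covariant_derivative B2 P X Y z = D (X z) - (\<kappa> * b (fst (D (X z))) (fst z)) *\<^sub>R (fst z, 0)"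
proof -
  have "frechet_derivative Y (at z within P) (X z) = D (X z)"
    by (rule frechet_derivative_within_tangent[OF z D Y X])
  then show ?thesis unfolding covariant_derivative_def by (simp only: proj_P[OF z])
qed

lemma vector_fieldD:
  assumes "vector_field P Y"
  shows "smooth_on UNIV Y" "q \<in> P \<Longrightarrow> Y q \<in> tangent_space P q" "q \<in> P \<Longrightarrow> \<kappa> * b (fst q) (fst (Y q)) = 0"
    "(Y has_derivative frechet_derivative Y (at q)) (at q)"
  using assms smooth_on_has_derivative[of UNIV Y q] tangent_space_P[of q] unfolding vector_field_def by auto

text \<open>Differentiating the tangency equation of \<open>Y\<close> along \<open>P\<close>
  expresses the normal part of its derivative by values of \<open>Y\<close> alone. This is the
  Weingarten relation of the model.\<close>

lemma tangency_derivative: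
  assumes Y: "vector_field P Y" and q: "q \<in> P" and v: "v \<in> tangent_space P q"
  shows "\<kappa> * b (fst (frechet_derivative Y (at q) v)) (fst q) = - (\<kappa> * b (fst (Y q)) (fst v))"
proof -
  have "((\<lambda>q. \<kappa> * b (fst (Y q)) (fst q)) has_derivative
      (\<lambda>h. \<kappa> * (b (fst (Y q)) (fst h) + b (fst (frechet_derivative Y (at q) h)) (fst q)))) (at q)"
    by (intro has_derivative_mult_right B.FDERIV has_derivative_fst vector_fieldD(4)[OF Y] has_derivative_ident)
  from derivative_tangent_zero[OF q this _ v, of 0] vector_fieldD(3)[OF Y] show ?thesis
    by (simp add: sym distrib_left eq_neg_iff_add_eq_0 add.commute)
qed

text \<open>The covariant derivative of \<open>Z\<close> along \<open>Y\<close> is the flat one plus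
  \<open>\<kappa> b(Z, Y)\<close> times the position vector. Differentiating the position vector
  along \<open>X\<close> produces the last term, the source of curvature. The derivative of the
  coefficient is normal and is removed by the projection.\<close>

lemma covariant_derivative_twice:
  assumes X: "vector_field P X" and Y: "vector_field P Y" and Z: "vector_field P Z" and z: "z \<in> P"
  defines "E \<equiv> frechet_derivative Z (at z) (frechet_derivative Y (at z) (X z)) +
    frechet_derivative (\<lambda>q. frechet_derivative Z (at q) (Y z)) (at z) (X z)"
  shows "covariant_derivative B2 P X (covariant_derivative B2 P Y Z) z =
    E - (\<kappa> * b (fst E) (fst z)) *\<^sub>R (fst z, 0) + (\<kappa> * b (fst (Z z)) (fst (Y z))) *\<^sub>R (fst (X z), 0)"
proof -
  define W where "W q = frechet_derivative Z (at q) (Y q) + (\<kappa> * b (fst (Z q)) (fst (Y q))) *\<^sub>R (fst q, 0)" for q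
  have W: "covariant_derivative B2 P Y Z q = W q" if q: "q \<in> P" for q
    unfolding W_def using covariant_derivative_eq[where Y = Z and X = Y and ?Y0.0 = Z, OF q vector_fieldD(2)[OF Y q] vector_fieldD(4)[OF Z] refl]
      tangency_derivative[OF Z q vector_fieldD(2)[OF Y q]] by simp
  define \<beta> where "\<beta> h = b (fst (Z z)) (fst (frechet_derivative Y (at z) h)) + b (fst (frechet_derivative Z (at z) h)) (fst (Y z))" for h
  define D where "D h = (frechet_derivative Z (at z) (frechet_derivative Y (at z) h) + frechet_derivative (\<lambda>q. frechet_derivative Z (at q) (Y z)) (at z) h) +
     ((\<kappa> * b (fst (Z z)) (fst (Y z))) *\<^sub>R (fst h, 0) + (\<kappa> * \<beta> h) *\<^sub>R (fst z, 0))" for h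
  have "(W has_derivative D) (at z)"
    unfolding W_def[abs_def] D_def[abs_def] \<beta>_def
    by (intro has_derivative_add has_derivative_frechet_apply vector_fieldD[OF Z] vector_fieldD(4)[OF Y] has_derivative_scaleR
        has_derivative_mult_right B.FDERIV has_derivative_fst vector_fieldD(4)[OF Z] has_derivative_Pair has_derivative_ident has_derivative_const)
  from covariant_derivative_eq[where X = X and ?Y0.0 = W and Y = "covariant_derivative B2 P Y Z", OF z vector_fieldD(2)[OF X z] this W]
  have e1: "covariant_derivative B2 P X (covariant_derivative B2 P Y Z) z = D (X z) - (\<kappa> * b (fst (D (X z))) (fst z)) *\<^sub>R (fst z, 0)" .
  have DX: "D (X z) = E + ((\<kappa> * b (fst (Z z)) (fst (Y z))) *\<^sub>R (fst (X z), 0) + (\<kappa> * \<beta> (X z)) *\<^sub>R (fst z, 0))"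
    by (simp add: D_def E_def)
  have e3: "\<kappa> * b (fst (D (X z))) (fst z) = \<kappa> * b (fst E) (fst z) + \<kappa> * \<beta> (X z)"
  proof -
    have "\<kappa> * b (fst (D (X z))) (fst z) = \<kappa> * b (fst E) (fst z) +
       (\<kappa> * b (fst (Z z)) (fst (Y z))) * (\<kappa> * b (fst z) (fst (X z))) + (\<kappa> * \<kappa> * b (fst z) (fst z)) * \<beta> (X z)"
      unfolding DX by (simp add: B.add_left B.scaleR_left B.add_right B.scaleR_right sym algebra_simps)
    then show ?thesis using vector_fieldD(3)[OF X z] level[of "fst z"] z by auto
  qed
  show ?thesis unfolding e1 e3 unfolding DX by (simp add: scaleR_left_distrib)
qed

text \<open>By symmetry of second derivatives the terms \<open>E\<close> for \<open>X, Y\<close> and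
  for \<open>Y, X\<close> differ by the derivative of \<open>Z\<close> along the bracket, which the
  third term of the curvature cancels. What remains is the Gauss equation.\<close>

lemma curvature_field_eq:
  assumes X: "vector_field P X" and Y: "vector_field P Y" and Z: "vector_field P Z" and z: "z \<in> P"
  shows "curvature_field B2 P X Y Z z =
    (\<kappa> * b (fst (Z z)) (fst (Y z))) *\<^sub>R (fst (X z), 0) - (\<kappa> * b (fst (Z z)) (fst (X z))) *\<^sub>R (fst (Y z), 0)"
proof -
  note tX = vector_fieldD(2)[OF X z] and tY = vector_fieldD(2)[OF Y z]
  let ?L = "frechet_derivative Y (at z) (X z) - frechet_derivative X (at z) (Y z)"
  have L: "lie_bracket P X Y z = ?L"
    unfolding lie_bracket_def
    by (simp add: frechet_derivative_within_tangent[OF z vector_fieldD(4)[OF Y] refl tX]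
        frechet_derivative_within_tangent[OF z vector_fieldD(4)[OF X] refl tY])
  \<comment> \<open>Both flat derivatives have the same normal part, determined by \<open>b\<close>
    of \<open>X\<close> and \<open>Y\<close>, so the bracket is tangent.\<close>
  have tL: "lie_bracket P X Y z \<in> tangent_space P z"
  proof -
    have "\<kappa> * b (fst z) (fst ?L) = \<kappa> * b (fst (frechet_derivative Y (at z) (X z))) (fst z) - \<kappa> * b (fst (frechet_derivative X (at z) (Y z))) (fst z)"
      by (simp add: B.diff_right sym right_diff_distrib)
    also have "\<dots> = 0"
      unfolding tangency_derivative[OF Y z tX] tangency_derivative[OF X z tY] by (simp add: sym)
    finally show ?thesis unfolding L tangent_space_P[OF z] by blast
  qed
  have lin: "linear (frechet_derivative Z (at z))"
    by (rule has_derivative_linear[OF vector_fieldD(4)[OF Z]])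
  show ?thesis
    unfolding curvature_field_def covariant_derivative_twice[OF X Y Z z] covariant_derivative_twice[OF Y X Z z]
      covariant_derivative_eq[where X = "lie_bracket P X Y" and Y = Z and ?Y0.0 = Z, OF z tL vector_fieldD(4)[OF Z] refl] unfolding L
    by (simp add: second_derivative_symmetric[OF vector_fieldD(1)[OF Z], of "X z" z "Y z"] linear_diff[OF lin]
        B.diff_left B.add_left algebra_simps)
qed

lemma curvature_tensor_eq:
  assumes z: "z \<in> P" and t: "x \<in> tangent_space P z" "y \<in> tangent_space P z" "w \<in> tangent_space P z"
  shows "curvature_tensor B2 P z x y w = (\<kappa> * b (fst w) (fst y)) *\<^sub>R (fst x, 0) - (\<kappa> * b (fst w) (fst x)) *\<^sub>R (fst y, 0)"
  unfolding curvature_tensor_def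
proof (rule the_equality)
  fix v assume *: "\<forall>X Y Z. vector_field P X \<and> vector_field P Y \<and> vector_field P Z \<and> X z = x \<and> Y z = y \<and> Z z = w \<longrightarrow>
     curvature_field B2 P X Y Z z = v"
  have "curvature_field B2 P (extension x) (extension y) (extension w) z = v"
    using * vector_field_extension extension_at[OF z] t by blast
  then show "v = (\<kappa> * b (fst w) (fst y)) *\<^sub>R (fst x, 0) - (\<kappa> * b (fst w) (fst x)) *\<^sub>R (fst y, 0)"
    using curvature_field_eq[OF vector_field_extension vector_field_extension vector_field_extension z, of x y w] extension_at[OF z] t by simp
qed (use curvature_field_eq[OF _ _ _ z] in blast)

text \<open>A basis vector \<open>e\<close> contributes \<open>\<kappa>\<close> times one minus its
  squared components along the vertical direction and along \<open>N\<close>. By Parseval each of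
  these two directions removes one from the dimension \<open>n + 1\<close>.\<close>

lemma ricci_normal:
  assumes z: "z \<in> P" and N: "N \<in> tangent_space P z" "snd N = 0" "B2 N N = 1"
  shows "ricci B2 P z N N = \<kappa> * (real n - 1)"
proof -
  interpret pf: positive_form B2 "tangent_space P z" by (rule positive_form_P[OF z])
  let ?E = "orthonormal_basis B2 (tangent_space P z)"
  note E = pf.orthonormal_basis
  have fN: "b (fst N) (fst N) = 1" using N by (simp add: product_form_def)
  have v: "(0, 1) \<in> tangent_space P z" by (simp add: tangent_space_P[OF z] B.zero_right)
  have dimP: "dim (tangent_space P z) = n + 1"
  proof -
    have "tangent_space P z = T (fst z) \<times> (UNIV :: real set)" by (auto simp: tangent_space_P[OF z])
    then show ?thesis using dim_Times[OF subspace_T[of "fst z"] subspace_UNIV[where 'a = real]] dim[of "fst z"] z by auto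
  qed
  have "ricci B2 P z N N = (\<Sum>e\<in>?E. B2 (curvature_tensor B2 P z e N N) e)" by (simp add: ricci_def)
  also have "\<dots> = (\<Sum>e\<in>?E. \<kappa> * (1 - B2 (0, 1) e * B2 (0, 1) e - B2 N e * B2 N e))"
  proof (rule sum.cong[OF refl])
    fix e assume e: "e \<in> ?E"
    then have te: "e \<in> tangent_space P z" and "B2 e e = 1" using E(2) by (auto simp: pf.orthonormal_def)
    then have be: "b (fst e) (fst e) = 1 - snd e * snd e" by (simp add: product_form_def)
    show "B2 (curvature_tensor B2 P z e N N) e = \<kappa> * (1 - B2 (0, 1) e * B2 (0, 1) e - B2 N e * B2 N e)"
      unfolding curvature_tensor_eq[OF z te N(1) N(1)]
      by (simp add: be product_form_def fN N(2) B.diff_left B.scaleR_left B.zero_left sym[of "fst e" "fst N"] right_diff_distrib)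
  qed
  also have "\<dots> = \<kappa> * ((\<Sum>e\<in>?E. 1) - (\<Sum>e\<in>?E. B2 (0, 1) e * B2 (0, 1) e) - (\<Sum>e\<in>?E. B2 N e * B2 N e))"
    by (simp add: sum_subtractf sum_distrib_left[symmetric])
  also have "\<dots> = \<kappa> * (real (n + 1) - 1 - 1)"
    using pf.parseval[OF v v] pf.parseval[OF N(1) N(1)] N(3) E(4) by (simp add: dimP) (simp add: product_form_def B.zero_left)
  finally show ?thesis by simp
qed

end

section \<open>The geometry of tubes\<close>

lemma (in positive_form) isometry_exists:
  assumes "dim V = CARD('n::finite)"
  shows "\<exists>L :: real^'n \<Rightarrow> 'w. linear L \<and> (\<forall>u v. b (L u) (L v) = u \<bullet> v) \<and> range L = V"
proof -
  interpret bounded_bilinear b by (rule bilinear)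
  let ?E = "orthonormal_basis b V"
  have "card ?E = card (UNIV :: 'n set)" using orthonormal_basis(4) assms by simp
  then obtain f where f: "bij_betw f (UNIV :: 'n set) ?E"
    using orthonormal_basis(3) by (metis finite_class.finite_UNIV finite_same_card_bij)
  have fE: "f i \<in> ?E" for i using f by (auto simp: bij_betw_def)
  have ff: "b (f i) (f j) = (if i = j then 1 else 0)" for i j
    using orthonormal_basis(2) fE f unfolding orthonormal_def bij_betw_def inj_on_def by (metis UNIV_I)
  define L where "L u = (\<Sum>i\<in>UNIV. (u $ i) *\<^sub>R f i)" for u
  have "linear L" unfolding L_def by (rule linearI) (simp_all add: scaleR_left_distrib sum.distrib scaleR_sum_right)
  moreover have "b (L u) (L v) = u \<bullet> v" for u v
    by (simp add: L_def sum_left sum_right scaleR_left scaleR_right ff inner_vec_def if_distrib cong: if_cong) (simp add: mult.commute)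
  moreover have "range L = V"
  proof
    show "range L \<subseteq> V"
      using fE orthonormal_basis(2) subspace unfolding L_def orthonormal_def
      by (auto intro!: subspace_sum subspace_scale)
    show "V \<subseteq> range L"
    proof
      fix v assume "v \<in> V"
      then have "v = (\<Sum>e\<in>?E. b v e *\<^sub>R e)" by (rule orthonormal_expansion)
      also have "\<dots> = (\<Sum>i\<in>UNIV. b v (f i) *\<^sub>R f i)" by (rule sum.reindex_bij_betw[OF f, symmetric])
      also have "\<dots> = L (\<chi> i. b v (f i))" by (simp add: L_def)
      finally show "v \<in> range L" by blast
    qed
  qed
  ultimately show ?thesis by blast
qed

locale space_form_tube = space_form b M \<kappa> cs sn "CARD('n)"
  for b :: "'w::euclidean_space bilinear_form" and M \<kappa> cs sn +
  fixes p :: 'w and \<rho> l :: real and L :: "real^'n::finite \<Rightarrow> 'w"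
  assumes p: "p \<in> M" and sn_pos: "sn \<rho> > 0" and l_pos: "l > 0"
    and linear_L: "linear L" and isometry: "b (L u) (L v) = u \<bullet> v" and range_L: "range L = T p"
begin

text \<open>In the ambient space the geodesic sphere is a round sphere of radius \<open>r\<close>
  about \<open>q\<close>, inside the affine space through \<open>q\<close> parallel to the tangent
  space at \<open>p\<close>.\<close>

definition "r = sn \<rho>"
definition "q = cs \<rho> *\<^sub>R p"
definition "\<Sigma> = tube b M p \<rho> l"

definition point :: "real^'n \<Rightarrow> real \<Rightarrow> 'w \<times> real" where
  "point \<omega> t = (q + r *\<^sub>R L \<omega>, t)"

text \<open>A left inverse of \<open>L\<close> that is linear on the whole ambient space, so that
  functions on the tube expressed through it have ambient derivatives.\<close>

definition coord :: "'w \<Rightarrow> real^'n" where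
  "coord y = (\<chi> i. b y (L (axis i 1)))"

lemma r_pos: "r > 0" using sn_pos by (simp add: r_def)

lemma bounded_linear_L: "bounded_linear L" using linear_L by (simp add: linear_conv_bounded_linear)

lemma linear_coord: "linear coord"
  unfolding coord_def by (rule linearI) (simp_all add: vec_eq_iff B.add_left B.scaleR_left)

lemma bounded_linear_coord: "bounded_linear coord" using linear_coord by (simp add: linear_conv_bounded_linear)

lemma coord_L [simp]: "coord (L u) = u"
  by (simp add: coord_def isometry inner_axis vec_eq_iff)

lemma inj_L: "inj L" by (metis coord_L injI)

lemma tangent_L: "\<kappa> * b p (L u) = 0" using range_L by auto

lemma geodesic_sphere_points: "geodesic_sphere b M p \<rho> = (\<lambda>\<omega>. q + r *\<^sub>R L \<omega>) ` sphere 0 1"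
proof -
  have "{cs \<rho> *\<^sub>R p + sn \<rho> *\<^sub>R v | v. v \<in> T p \<and> b v v = 1} = (\<lambda>\<omega>. q + r *\<^sub>R L \<omega>) ` sphere 0 1"
    unfolding q_def r_def range_L[symmetric] by (auto simp: isometry norm_eq_1 image_iff)
  then show ?thesis by (simp add: geodesic_sphere_eq[OF p])
qed

lemma \<Sigma>_points: "\<Sigma> = (\<lambda>(\<omega>, t). point \<omega> t) ` (sphere 0 1 \<times> {0..l})"
  unfolding \<Sigma>_def tube_def geodesic_sphere_points point_def by auto

lemma \<Sigma>_cases:
  assumes "z \<in> \<Sigma>"
  obtains \<omega> t where "norm \<omega> = 1" "t \<in> {0..l}" "z = point \<omega> t"
  using assms unfolding \<Sigma>_points by auto

lemma point_in_\<Sigma>: "norm \<omega> = 1 \<Longrightarrow> t \<in> {0..l} \<Longrightarrow> point \<omega> t \<in> \<Sigma>"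
  unfolding \<Sigma>_points by auto

lemma point_in_P: "norm \<omega> = 1 \<Longrightarrow> point \<omega> t \<in> P"
  using curve[OF p tangent_L, of \<omega> \<rho>] by (simp add: point_def q_def r_def isometry norm_eq_1)

lemma \<Sigma>_in_P: "z \<in> \<Sigma> \<Longrightarrow> z \<in> P"
  by (metis \<Sigma>_cases point_in_P)

text \<open>Two equations hold on the sphere: displacements from \<open>q\<close> lie in the range
  of \<open>L\<close>, and their coordinates have norm \<open>r\<close>. Their derivatives give one
  inclusion, and great circles realize the other.\<close>

lemma tangent_space_sphere_points:
  assumes \<omega>: "norm \<omega> = 1"
  shows "tangent_space ((\<lambda>\<omega>. q + r *\<^sub>R L \<omega>) ` sphere 0 1) (q + r *\<^sub>R L \<omega>) = L ` {v. v \<bullet> \<omega> = 0}"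
    (is "tangent_space ?S ?y = _")
proof (intro subset_antisym subsetI)
  have y: "?y \<in> ?S" using \<omega> by auto
  fix v assume v: "v \<in> tangent_space ?S ?y"
  have dc: "((\<lambda>y. coord (y - q)) has_derivative coord) (at ?y)"
    by (rule bounded_linear.has_derivative[OF bounded_linear_coord]) (auto intro!: derivative_eq_intros)
  have "((\<lambda>y. L (coord (y - q)) - (y - q)) has_derivative (\<lambda>h. L (coord h) - h)) (at ?y)"
    by (intro has_derivative_diff bounded_linear.has_derivative[OF bounded_linear_L dc]) (auto intro!: derivative_eq_intros)
  moreover have "L (coord (x - q)) - (x - q) = 0" if "x \<in> ?S" for x
    using that linear_cmul[OF linear_coord] linear_cmul[OF linear_L] by auto
  ultimately have "L (coord v) - v = 0" by (rule derivative_tangent_zero[OF y _ _ v])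
  then have 1: "L (coord v) = v" by simp
  have "((\<lambda>y. coord (y - q) \<bullet> coord (y - q)) has_derivative (\<lambda>h. coord (?y - q) \<bullet> coord h + coord h \<bullet> coord (?y - q))) (at ?y)"
    by (intro has_derivative_inner dc)
  moreover have "coord (x - q) \<bullet> coord (x - q) = r * r" if "x \<in> ?S" for x
    using that linear_cmul[OF linear_coord] by (auto simp: norm_eq_1)
  ultimately have "coord (?y - q) \<bullet> coord v + coord v \<bullet> coord (?y - q) = 0" by (rule derivative_tangent_zero[OF y _ _ v])
  then have "2 * (r * (coord v \<bullet> \<omega>)) = 0"
    using linear_cmul[OF linear_coord] by (simp add: inner_commute)
  then show "v \<in> L ` {v. v \<bullet> \<omega> = 0}" using 1 r_pos by (metis (mono_tags, lifting) image_eqI less_irrefl mem_Collect_eq mult_eq_0_iff zero_neq_numeral)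
next
  fix v assume "v \<in> L ` {v. v \<bullet> \<omega> = 0}"
  then obtain u where u: "v = L u" "u \<bullet> \<omega> = 0" by auto
  show "v \<in> tangent_space ?S ?y"
  proof (cases "u = 0")
    case True
    then show ?thesis using u linear_0[OF linear_L] by (simp add: subspace_0)
  next
    case False
    define e where "e = u /\<^sub>R norm u"
    have e: "norm e = 1" "e \<bullet> \<omega> = 0" using False u by (auto simp: e_def)
    have un: "norm (cos t *\<^sub>R \<omega> + sin t *\<^sub>R e) = 1" for t
    proof -
      have "(cos t *\<^sub>R \<omega> + sin t *\<^sub>R e) \<bullet> (cos t *\<^sub>R \<omega> + sin t *\<^sub>R e) = (cos t)\<^sup>2 * (\<omega> \<bullet> \<omega>) + (sin t)\<^sup>2 * (e \<bullet> e) + 2 * (cos t * sin t * (e \<bullet> \<omega>))"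
        by (simp add: inner_simps inner_commute power2_eq_square algebra_simps)
      also have "\<dots> = 1" using e \<omega> by (simp add: norm_eq_1)
      finally show ?thesis by (simp add: norm_eq_1)
    qed
    have d: "((\<lambda>t. cos t *\<^sub>R \<omega> + sin t *\<^sub>R e) has_vector_derivative e) (at 0 within {0..})"
      by (auto intro!: derivative_eq_intros simp: has_vector_derivative_def fun_eq_iff)
    have "((\<lambda>t. q + r *\<^sub>R L (cos t *\<^sub>R \<omega> + sin t *\<^sub>R e)) has_vector_derivative (0 + r *\<^sub>R L e)) (at 0 within {0..})"
      by (intro has_vector_derivative_add has_vector_derivative_const bounded_linear.has_vector_derivative[OF bounded_linear_scaleR_right]
          bounded_linear.has_vector_derivative[OF bounded_linear_L d])
    then have "r *\<^sub>R L e \<in> tangent_space ?S ?y"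
      by (intro tangent_spaceI[of "\<lambda>t. q + r *\<^sub>R L (cos t *\<^sub>R \<omega> + sin t *\<^sub>R e)" _ 1]) (use un in auto)
    then have "(norm u / r) *\<^sub>R (r *\<^sub>R L e) \<in> tangent_space ?S ?y" by (rule subspace_scale[OF subspace_tangent_space])
    moreover have "(norm u / r) *\<^sub>R (r *\<^sub>R L e) = v"
      using False r_pos u linear_cmul[OF linear_L] by (simp add: e_def)
    ultimately show ?thesis by (simp only:)
  qed
qed

lemma tangent_space_\<Sigma>:
  assumes "norm \<omega> = 1" "t \<in> {0..l}"
  shows "tangent_space \<Sigma> (point \<omega> t) = (\<lambda>(v, s). (L v, s)) ` {z. (\<omega>, 0) \<bullet> z = 0}"
proof -
  have "tangent_space \<Sigma> (point \<omega> t) = L ` {v. v \<bullet> \<omega> = 0} \<times> UNIV"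
    unfolding \<Sigma>_def tube_def geodesic_sphere_points point_def
    using assms tangent_space_sphere_points[OF assms(1)] tangent_space_segment[OF l_pos assms(2)]
    by (subst tangent_space_Times) auto
  also have "\<dots> = (\<lambda>(v, s). (L v, s)) ` {z. (\<omega>, 0) \<bullet> z = 0}"
    by (auto simp: inner_commute image_iff)
  finally show ?thesis .
qed

lemma tangent_space_\<Sigma>_iff:
  assumes "norm \<omega> = 1" "t \<in> {0..l}"
  shows "w \<in> tangent_space \<Sigma> (point \<omega> t) \<longleftrightarrow> (\<exists>v. fst w = L v \<and> v \<bullet> \<omega> = 0)"
  unfolding tangent_space_\<Sigma>[OF assms] by (cases w) (auto simp: inner_commute image_iff)

lemma tangent_\<Sigma>_P:
  assumes z: "z \<in> \<Sigma>" and v: "v \<in> tangent_space \<Sigma> z"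
  shows "v \<in> tangent_space P z" "\<kappa> * b (fst z) (fst v) = 0"
proof -
  obtain \<omega> t where \<omega>: "norm \<omega> = 1" "t \<in> {0..l}" "z = point \<omega> t" using z by (rule \<Sigma>_cases)
  obtain u where u: "fst v = L u" "u \<bullet> \<omega> = 0" using v tangent_space_\<Sigma>_iff[OF \<omega>(1,2)] \<omega>(3) by auto
  have "\<kappa> * b (fst z) (fst v) = cs \<rho> * (\<kappa> * b p (L u)) + \<kappa> * r * b (L \<omega>) (L u)"
    by (simp add: \<omega>(3) u point_def q_def B.add_left B.scaleR_left algebra_simps)
  then show "\<kappa> * b (fst z) (fst v) = 0" using u by (simp add: tangent_L isometry inner_commute)
  then show "v \<in> tangent_space P z" by (simp add: tangent_space_P[OF \<Sigma>_in_P[OF z]])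
qed

lemma positive_form_\<Sigma>:
  assumes z: "z \<in> \<Sigma>"
  shows "positive_form B2 (tangent_space \<Sigma> z)"
  using positive_form_P[OF \<Sigma>_in_P[OF z]] tangent_\<Sigma>_P(1)[OF z] subspace_tangent_space
  unfolding positive_form_def by blast

lemma dim_tangent_space_\<Sigma>:
  assumes z: "z \<in> \<Sigma>"
  shows "dim (tangent_space \<Sigma> z) = CARD('n)"
proof -
  obtain \<omega> t where \<omega>: "norm \<omega> = 1" "t \<in> {0..l}" "z = point \<omega> t" using z by (rule \<Sigma>_cases)
  have lin: "linear (\<lambda>(v, s). (L v, s :: real))"
    by (rule linearI) (auto simp: linear_add[OF linear_L] linear_cmul[OF linear_L])
  have inj: "inj (\<lambda>(v, s). (L v, s :: real))" using inj_L by (auto simp: inj_def)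
  have "\<omega> \<noteq> 0" using \<omega>(1) by auto
  then have "dim {z :: (real^'n) \<times> real. (\<omega>, 0) \<bullet> z = 0} = CARD('n)"
    by (subst dim_hyperplane) (auto simp: zero_prod_def)
  moreover have "dim ((\<lambda>(v, s). (L v, s)) ` {z. (\<omega>, 0 :: real) \<bullet> z = 0}) = dim {z :: (real^'n) \<times> real. (\<omega>, 0) \<bullet> z = 0}"
    by (rule dim_image_eq[OF lin]) (use inj in \<open>auto intro: inj_on_subset\<close>)
  ultimately show ?thesis unfolding \<omega>(3) tangent_space_\<Sigma>[OF \<omega>(1,2)] by simp
qed

text \<open>At a point of the tube this is the velocity at time \<open>\<rho>\<close> of the radial
  geodesic issuing from \<open>p\<close>, rewritten as an affine function of the point so that it is
  smooth on the ambient space.\<close>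

definition normal :: "'w \<times> real \<Rightarrow> 'w \<times> real" where
  "normal z = ((- \<kappa> * r) *\<^sub>R p + (cs \<rho> / r) *\<^sub>R (fst z - q), 0)"

lemma normal_point: "normal (point \<omega> t) = ((- \<kappa> * r) *\<^sub>R p + cs \<rho> *\<^sub>R L \<omega>, 0)"
  using r_pos by (simp add: normal_def point_def)

lemma normal_derivative: "(normal has_derivative (\<lambda>h. ((cs \<rho> / r) *\<^sub>R fst h, 0))) (at z)"
  unfolding normal_def[abs_def] by (auto intro!: derivative_eq_intros)

lemma smooth_normal: "smooth_on UNIV normal"
proof -
  have eq: "normal = (\<lambda>z. ((- \<kappa> * r) *\<^sub>R p - (cs \<rho> / r) *\<^sub>R q, 0) + ((cs \<rho> / r) *\<^sub>R fst z, 0))"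
    by (auto simp: normal_def fun_eq_iff algebra_simps)
  have "bounded_linear (\<lambda>z :: 'w \<times> real. ((cs \<rho> / r) *\<^sub>R fst z, 0 :: real))"
    by (intro bounded_linear_Pair bounded_linear_zero bounded_linear_compose[OF bounded_linear_scaleR_right bounded_linear_fst])
  then show ?thesis
    unfolding eq by (intro smooth_on_add smooth_on_const smooth_on_bounded_linear open_UNIV)
qed

text \<open>Position and normal arise from \<open>p\<close> and \<open>L \<omega>\<close> by the
  generalized rotation with entries \<open>cs \<rho>\<close> and \<open>r\<close>. The identity
  \<open>cs_sn\<close> gives both the unit length of the normal and the inverse rotation.\<close>

lemma frame_identities:
  fixes \<omega> t
  assumes \<omega>: "norm \<omega> = 1"
  defines "y \<equiv> fst (point \<omega> t)" and "\<nu> \<equiv> fst (normal (point \<omega> t))"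
  shows "\<kappa> * b y \<nu> = 0" "b \<nu> \<nu> = 1" "p = cs \<rho> *\<^sub>R y - r *\<^sub>R \<nu>" "L \<omega> = (\<kappa> * r) *\<^sub>R y + cs \<rho> *\<^sub>R \<nu>"
    "v \<bullet> \<omega> = 0 \<Longrightarrow> b \<nu> (L v) = 0"
proof -
  have LL: "b (L \<omega>) (L \<omega>) = 1" using \<omega> by (simp add: isometry norm_eq_1)
  have y: "y = cs \<rho> *\<^sub>R p + r *\<^sub>R L \<omega>" by (simp add: y_def point_def q_def)
  have \<nu>: "\<nu> = (- \<kappa> * r) *\<^sub>R p + cs \<rho> *\<^sub>R L \<omega>" by (simp add: \<nu>_def normal_point)
  note pL = tangent_L[of \<omega>] and pp = level[OF p] and C = cs_sn[of \<rho>, folded r_def]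
  have "\<kappa> * b y \<nu> = - (\<kappa> * \<kappa> * b p p) * (cs \<rho> * r) + \<kappa> * b (L \<omega>) (L \<omega>) * (cs \<rho> * r) + (\<kappa> * b p (L \<omega>)) * (cs \<rho> * cs \<rho> - \<kappa> * (r * r))"
    unfolding y \<nu> by (simp add: B.add_left B.add_right B.diff_left B.diff_right B.scaleR_left B.scaleR_right B.minus_left B.minus_right sym algebra_simps)
  then show "\<kappa> * b y \<nu> = 0" using pL pp LL by simp
  have "b \<nu> \<nu> = (\<kappa> * \<kappa> * b p p) * (r * r) + b (L \<omega>) (L \<omega>) * (cs \<rho> * cs \<rho>) - 2 * (\<kappa> * b p (L \<omega>)) * (cs \<rho> * r)"
    unfolding \<nu> by (simp add: B.add_left B.add_right B.diff_left B.diff_right B.scaleR_left B.scaleR_right B.minus_left B.minus_right sym algebra_simps)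
  then show "b \<nu> \<nu> = 1" using pL pp LL C by simp
  have "cs \<rho> *\<^sub>R y - r *\<^sub>R \<nu> = (cs \<rho> * cs \<rho> + \<kappa> * (r * r)) *\<^sub>R p"
    unfolding y \<nu> by (simp add: algebra_simps)
  then show "p = cs \<rho> *\<^sub>R y - r *\<^sub>R \<nu>" by (simp add: C)
  have "(\<kappa> * r) *\<^sub>R y + cs \<rho> *\<^sub>R \<nu> = (cs \<rho> * cs \<rho> + \<kappa> * (r * r)) *\<^sub>R L \<omega>"
    unfolding y \<nu> by (simp add: algebra_simps)
  then show "L \<omega> = (\<kappa> * r) *\<^sub>R y + cs \<rho> *\<^sub>R \<nu>" by (simp add: C)
  assume "v \<bullet> \<omega> = 0"
  moreover have "b \<nu> (L v) = - r * (\<kappa> * b p (L v)) + cs \<rho> * b (L \<omega>) (L v)"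
    unfolding \<nu> by (simp add: B.add_left B.diff_left B.scaleR_left B.minus_left)
  ultimately show "b \<nu> (L v) = 0" by (simp add: tangent_L isometry inner_commute)
qed

lemma unit_normal_normal: "unit_normal B2 P \<Sigma> normal"
  unfolding unit_normal_def
proof (intro conjI ballI smooth_normal)
  fix z assume z: "z \<in> \<Sigma>"
  then obtain \<omega> t where \<omega>: "norm \<omega> = 1" "t \<in> {0..l}" "z = point \<omega> t" by (rule \<Sigma>_cases)
  note fi = frame_identities[where t = t, OF \<omega>(1), folded \<omega>(3)]
  have s: "snd (normal z) = 0" by (simp add: normal_def)
  show "normal z \<in> tangent_space P z" using fi(1) by (simp add: tangent_space_P[OF \<Sigma>_in_P[OF z]])
  show "B2 (normal z) (normal z) = 1" using fi(2) s by (simp add: product_form_def)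
  show "B2 (normal z) v = 0" if "v \<in> tangent_space \<Sigma> z" for v
    using that s fi(5) unfolding \<omega>(3) tangent_space_\<Sigma>_iff[OF \<omega>(1,2)] by (auto simp: product_form_def)
qed

text \<open>The part \<open>w\<close> of \<open>N z\<close> orthogonal to the radial normal is
  itself tangent to the tube, hence orthogonal to \<open>N z\<close>. So it is orthogonal to itself
  and vanishes.\<close>

lemma unit_normal_unique:
  assumes N: "unit_normal B2 P \<Sigma> N" and z: "z \<in> \<Sigma>"
  shows "N z = B2 (N z) (normal z) *\<^sub>R normal z" "B2 (N z) (normal z) * B2 (N z) (normal z) = 1" "snd (N z) = 0"
proof -
  obtain \<omega> t where \<omega>: "norm \<omega> = 1" "t \<in> {0..l}" "z = point \<omega> t" using z by (rule \<Sigma>_cases)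
  note fi = frame_identities[where t = t, OF \<omega>(1), folded \<omega>(3)]
  have NP: "N z \<in> tangent_space P z" "B2 (N z) (N z) = 1" "\<And>v. v \<in> tangent_space \<Sigma> z \<Longrightarrow> B2 (N z) v = 0"
    using N z unfolding unit_normal_def by auto
  have "(0, 1) \<in> tangent_space \<Sigma> z"
    unfolding \<omega>(3) tangent_space_\<Sigma>_iff[OF \<omega>(1,2)] by (auto intro!: exI[of _ 0] simp: linear_0[OF linear_L])
  from NP(3)[OF this] show s: "snd (N z) = 0" by (simp add: product_form_def B.zero_right)
  define a where "a = fst (N z)"
  define \<nu> where "\<nu> = fst (normal z)"
  define w where "w = a - b a \<nu> *\<^sub>R \<nu>"
  have c: "B2 (N z) (normal z) = b a \<nu>" using s by (simp add: product_form_def a_def \<nu>_def)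
  have ya: "\<kappa> * b (fst z) a = 0" using NP(1) by (auto simp: tangent_space_P[OF \<Sigma>_in_P[OF z]] a_def)
  have yw: "\<kappa> * b (fst z) w = 0"
  proof -
    have "\<kappa> * b (fst z) w = \<kappa> * b (fst z) a - b a \<nu> * (\<kappa> * b (fst z) \<nu>)"
      by (simp add: w_def B.diff_right B.scaleR_right right_diff_distrib)
    then show ?thesis using ya fi(1) by (simp add: \<nu>_def)
  qed
  have \<nu>w: "b \<nu> w = 0"
    using fi(2) by (simp add: w_def B.diff_right B.scaleR_right sym \<nu>_def)
  have "\<kappa> * b p w = cs \<rho> * (\<kappa> * b (fst z) w) - \<kappa> * r * b \<nu> w"
    by (subst fi(3)) (simp add: \<nu>_def B.diff_left B.scaleR_left right_diff_distrib)
  then have "w \<in> range L" using yw \<nu>w by (simp add: range_L)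
  then obtain u where u: "w = L u" by auto
  have "b (L \<omega>) w = r * (\<kappa> * b (fst z) w) + cs \<rho> * b \<nu> w"
    by (subst fi(4)) (simp add: \<nu>_def B.add_left B.scaleR_left)
  then have "u \<bullet> \<omega> = 0" using yw \<nu>w by (simp add: u isometry inner_commute)
  then have "(w, 0) \<in> tangent_space \<Sigma> z"
    unfolding \<omega>(3) tangent_space_\<Sigma>_iff[OF \<omega>(1,2)] using u by auto
  from NP(3)[OF this] have "b a w = 0" by (simp add: product_form_def a_def)
  moreover have "b w w = b a w - b a \<nu> * b \<nu> w" by (subst (1) w_def) (simp add: B.diff_left B.scaleR_left)
  ultimately have "b w w = 0" using \<nu>w by simp
  then have "u \<bullet> u = 0" by (simp add: u isometry)
  then have "w = 0" by (simp add: u linear_0[OF linear_L])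
  then have a: "a = b a \<nu> *\<^sub>R \<nu>" by (simp add: w_def)
  have sn0: "snd (normal z) = 0" by (simp add: normal_def)
  show "N z = B2 (N z) (normal z) *\<^sub>R normal z"
    unfolding c using a s sn0 by (intro prod_eqI) (simp_all add: a_def[symmetric] \<nu>_def[symmetric])
  have "1 = b a a" using NP(2) s by (simp add: product_form_def a_def)
  also have "\<dots> = b a \<nu> * b a \<nu>" by (subst (2) a) (simp add: B.scaleR_right)
  finally show "B2 (N z) (normal z) * B2 (N z) (normal z) = 1" by (simp add: c)
qed

text \<open>The factor \<open>c\<close> relating \<open>N\<close> to \<open>normal\<close> has
  square 1 on the tube, so its derivative along the tube vanishes; no appeal to connectedness is
  made. The shape operator is then \<open>cs \<rho> / r\<close> up to sign on horizontal vectors and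
  zero on the vertical one.\<close>

lemma second_fundamental_form_eq:
  assumes N: "unit_normal B2 P \<Sigma> N" and z: "z \<in> \<Sigma>" and u: "u \<in> tangent_space \<Sigma> z"
  shows "(second_fundamental_form B2 P \<Sigma> N z u v)\<^sup>2 = (cs \<rho> / r)\<^sup>2 * (b (fst u) (fst v))\<^sup>2"
proof -
  define c where "c z = B2 (N z) (normal z)" for z
  define N' where "N' = frechet_derivative N (at z)"
  have N': "(N has_derivative N') (at z)"
    unfolding N'_def using N by (intro smooth_on_has_derivative) (auto simp: unit_normal_def)
  define c' where "c' h = B2 (N z) ((cs \<rho> / r) *\<^sub>R fst h, 0) + B2 (N' h) (normal z)" for h
  have c': "(c has_derivative c') (at z)"
    unfolding c_def[abs_def] c'_def[abs_def] by (intro B2.FDERIV N' normal_derivative)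
  have c1: "c z * c z = 1" using unit_normal_unique(2)[OF N z] by (simp add: c_def)
  have "((\<lambda>z. c z * c z) has_derivative (\<lambda>h. c z * c' h + c' h * c z)) (at z)"
    by (intro has_derivative_mult c')
  from derivative_tangent_zero[OF z this _ u, of 1] have "2 * (c z * c' u) = 0"
    using unit_normal_unique(2)[OF N] by (simp add: c_def mult.commute)
  then have c'u: "c' u = 0" using c1 by auto
  have "((\<lambda>z. c z *\<^sub>R normal z) has_derivative (\<lambda>h. c z *\<^sub>R ((cs \<rho> / r) *\<^sub>R fst h, 0) + c' h *\<^sub>R normal z)) (at z)"
    by (intro has_derivative_scaleR c' normal_derivative)
  from frechet_derivative_within_tangent[OF z this _ u, of N]
  have "frechet_derivative N (at z within \<Sigma>) u = ((c z * (cs \<rho> / r)) *\<^sub>R fst u, 0)"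
    using unit_normal_unique(1)[OF N] c'u by (simp add: c_def)
  then have "second_fundamental_form B2 P \<Sigma> N z u v = - (c z * (cs \<rho> / r) * b (fst u) (fst v))"
    using tangent_\<Sigma>_P(2)[OF z u] unfolding second_fundamental_form_def proj_P[OF \<Sigma>_in_P[OF z]]
    by (auto simp: product_form_def B.scaleR_left sym[of "fst u" "fst z"] B.zero_left)
  then have "(second_fundamental_form B2 P \<Sigma> N z u v)\<^sup>2 = (c z * c z) * ((cs \<rho> / r)\<^sup>2 * (b (fst u) (fst v))\<^sup>2)"
    by (simp add: power2_eq_square mult_ac)
  then show ?thesis by (simp add: c1)
qed

text \<open>All \<open>CARD('n) - 1\<close> principal curvatures along the sphere have square
  \<open>(cs \<rho> / r)\<^sup>2\<close>, and the vertical one is zero. Adding the Ricci term leaves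
  the factor \<open>(cs \<rho> / r)\<^sup>2 + \<kappa>\<close>, which \<open>cs_sn\<close> evaluates
  to \<open>1 / r\<^sup>2\<close>.\<close>

theorem stability_potential:
  assumes N: "unit_normal B2 P \<Sigma> N" and z: "z \<in> \<Sigma>"
  shows "sff_norm_sq B2 P \<Sigma> N z + ricci B2 P z (N z) (N z) = (real CARD('n) - 1) / r\<^sup>2"
proof -
  interpret pf: positive_form B2 "tangent_space \<Sigma> z" by (rule positive_form_\<Sigma>[OF z])
  let ?E = "orthonormal_basis B2 (tangent_space \<Sigma> z)"
  note E = pf.orthonormal_basis
  have ET: "u \<in> tangent_space \<Sigma> z" if "u \<in> ?E" for u using E(2) that unfolding pf.orthonormal_def by blast
  have EE: "B2 u v = (if u = v then 1 else 0)" if "u \<in> ?E" "v \<in> ?E" for u v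
    using E(2) that unfolding pf.orthonormal_def by blast
  have "(0, 1) \<in> tangent_space \<Sigma> z"
  proof -
    obtain \<omega> t where \<omega>: "norm \<omega> = 1" "t \<in> {0..l}" "z = point \<omega> t" using z by (rule \<Sigma>_cases)
    show ?thesis
      unfolding \<omega>(3) tangent_space_\<Sigma>_iff[OF \<omega>(1,2)] by (auto intro!: exI[of _ 0] simp: linear_0[OF linear_L])
  qed
  \<comment> \<open>The chosen orthonormal basis need not contain the vertical vector, so only the
    sum of the squared vertical components is known.\<close>
  from pf.parseval[OF this this] have \<tau>: "(\<Sum>e\<in>?E. snd e * snd e) = 1" by (simp add: product_form_def B.zero_left)
  have inner_sum: "(\<Sum>v\<in>?E. (b (fst u) (fst v))\<^sup>2) = 1 - snd u * snd u" if u: "u \<in> ?E" for u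
  proof -
    have "(\<Sum>v\<in>?E. (b (fst u) (fst v))\<^sup>2) = (\<Sum>v\<in>?E. (if u = v then 1 - 2 * (snd u * snd u) else 0) + snd u * snd u * (snd v * snd v))"
    proof (rule sum.cong[OF refl])
      fix v assume v: "v \<in> ?E"
      have bb: "b (fst u) (fst v) = (if u = v then 1 else 0) - snd u * snd v"
        using EE[OF u v] by (simp add: product_form_def)
      show "(b (fst u) (fst v))\<^sup>2 = (if u = v then 1 - 2 * (snd u * snd u) else 0) + snd u * snd u * (snd v * snd v)"
        unfolding bb by (auto simp: power2_eq_square algebra_simps)
    qed
    also have "\<dots> = 1 - 2 * (snd u * snd u) + snd u * snd u * (\<Sum>v\<in>?E. snd v * snd v)"
      using u E(3) by (simp add: sum.distrib sum_distrib_left)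
    finally show ?thesis by (simp add: \<tau>)
  qed
  have "sff_norm_sq B2 P \<Sigma> N z = (\<Sum>u\<in>?E. \<Sum>v\<in>?E. (cs \<rho> / r)\<^sup>2 * (b (fst u) (fst v))\<^sup>2)"
    unfolding sff_norm_sq_def by (intro sum.cong refl second_fundamental_form_eq[OF N z] ET)
  also have "\<dots> = (cs \<rho> / r)\<^sup>2 * (\<Sum>u\<in>?E. 1 - snd u * snd u)"
    by (simp add: sum_distrib_left[symmetric] inner_sum)
  also have "(\<Sum>u\<in>?E. 1 - snd u * snd u) = real CARD('n) - 1"
    using E(4) \<tau> by (simp add: sum_subtractf dim_tangent_space_\<Sigma>[OF z])
  finally have sff: "sff_norm_sq B2 P \<Sigma> N z = (cs \<rho> / r)\<^sup>2 * (real CARD('n) - 1)" .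
  have "ricci B2 P z (N z) (N z) = \<kappa> * (real CARD('n) - 1)"
    using N z unit_normal_unique(3)[OF N z] by (intro ricci_normal \<Sigma>_in_P) (auto simp: unit_normal_def)
  moreover have "(cs \<rho> / r)\<^sup>2 + \<kappa> = 1 / r\<^sup>2"
    using r_pos cs_sn[of \<rho>] by (simp add: r_def[symmetric] power2_eq_square field_simps)
  then have "(cs \<rho> / r)\<^sup>2 * (real CARD('n) - 1) + \<kappa> * (real CARD('n) - 1) = (real CARD('n) - 1) / r\<^sup>2"
    by (metis distrib_right mult.commute mult.right_neutral times_divide_eq_right)
  ultimately show ?thesis using sff by simp
qed

end

section \<open>The Riemannian measure of a tube\<close>

lemma gram_compose:
  fixes \<tau> :: "real^'n \<Rightarrow> real^'n" and \<beta> :: "real^'n \<Rightarrow> real^'n \<Rightarrow> real"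
  assumes \<beta>: "bilinear \<beta>" and \<tau>: "linear \<tau>"
  shows "det (\<chi> i j. \<beta> (\<tau> (axis i 1)) (\<tau> (axis j 1))) =
    (det (matrix \<tau>))\<^sup>2 * det (\<chi> i j. \<beta> (axis i 1) (axis j 1))"
proof -
  let ?G = "\<chi> i j. \<beta> (axis i 1) (axis j 1)"
  have exp: "\<tau> (axis i 1) = (\<Sum>k\<in>UNIV. matrix \<tau> $ k $ i *\<^sub>R axis k 1)" for i
    by (simp add: matrix_def vec_eq_iff axis_def if_distrib cong: if_cong)
  have "(\<chi> i j. \<beta> (\<tau> (axis i 1)) (\<tau> (axis j 1))) = transpose (matrix \<tau>) ** (?G ** matrix \<tau>)"
  proof (simp add: vec_eq_iff, intro allI)
    fix i j
    have "\<beta> (\<tau> (axis i 1)) (\<tau> (axis j 1)) =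
      (\<Sum>k\<in>UNIV. \<Sum>m\<in>UNIV. matrix \<tau> $ k $ i * (\<beta> (axis k 1) (axis m 1) * matrix \<tau> $ m $ j))"
      unfolding exp using \<beta> unfolding bilinear_def
      by (simp add: linear_sum[of "\<lambda>x. \<beta> x _"] linear_cmul[of "\<lambda>x. \<beta> x _"] linear_sum[of "\<beta> _"] linear_cmul[of "\<beta> _"]
          sum_distrib_left mult_ac) (subst sum.swap, simp add: mult_ac)
    then show "\<beta> (\<tau> (axis i 1)) (\<tau> (axis j 1)) = (transpose (matrix \<tau>) ** (?G ** matrix \<tau>)) $ i $ j"
      by (simp add: matrix_matrix_mult_def transpose_def sum_distrib_left)
  qed
  then show ?thesis by (simp add: det_mul det_transpose power2_eq_square)
qed

text \<open>The form scales the complement of \<open>\<omega>\<close> by \<open>\<alpha>\<close> and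
  keeps \<open>\<omega>\<close>. An orthogonal map that takes a coordinate axis to
  \<open>\<omega>\<close> makes it diagonal.\<close>

lemma det_gram_radial:
  fixes \<omega> :: "real^'n"
  assumes \<omega>: "norm \<omega> = 1"
  shows "det (\<chi> i j. \<alpha> * (axis i 1 \<bullet> axis j (1::real) - (\<omega> \<bullet> axis i 1) * (\<omega> \<bullet> axis j 1)) + (\<omega> \<bullet> axis i 1) * (\<omega> \<bullet> axis j 1)) =
    \<alpha> ^ (CARD('n) - 1)"
proof -
  define \<beta> where "\<beta> h k = \<alpha> * (h \<bullet> k - (\<omega> \<bullet> h) * (\<omega> \<bullet> k)) + (\<omega> \<bullet> h) * (\<omega> \<bullet> k)" for h k
  have bil: "bilinear \<beta>"
    unfolding bilinear_def by (auto intro!: linearI simp: \<beta>_def inner_simps algebra_simps)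
  obtain k :: 'n where True by blast
  have nk: "norm (axis k 1 :: real^'n) = norm \<omega>" using \<omega> by (simp add: norm_axis_1)
  obtain Q :: "real^'n \<Rightarrow> real^'n" where Q: "orthogonal_transformation Q" "Q (axis k 1) = \<omega>"
    by (rule orthogonal_transformation_exists[OF nk]) blast
  have lin: "linear Q" and QQ: "Q h \<bullet> Q h' = h \<bullet> h'" for h h' using Q(1) by (auto simp: orthogonal_transformation_def)
  have "(\<chi> i j. \<beta> (Q (axis i 1)) (Q (axis j 1))) = (\<chi> i j. if i = j then (if i = k then 1 else \<alpha>) else 0)"
    unfolding \<beta>_def Q(2)[symmetric] QQ by (auto simp: vec_eq_iff inner_axis_axis)
  then have "det (\<chi> i j. \<beta> (Q (axis i 1)) (Q (axis j 1))) = det (\<chi> i j. if i = j then (if i = k then 1 else \<alpha>) else 0 :: real^'n^'n)" by simp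
  also have "\<dots> = (\<Prod>i\<in>UNIV. if i = k then 1 else \<alpha>)"
    by (subst det_diagonal) auto
  also have "\<dots> = (\<Prod>i\<in>UNIV - {k}. \<alpha>)" by (simp add: prod.remove[of UNIV k])
  also have "\<dots> = \<alpha> ^ (CARD('n) - 1)" by (simp add: card_Diff_singleton)
  finally have "det (\<chi> i j. \<beta> (Q (axis i 1)) (Q (axis j 1))) = \<alpha> ^ (CARD('n) - 1)" .
  moreover have "(det (matrix Q))\<^sup>2 = 1"
    using Q(1) det_orthogonal_matrix[of "matrix Q"] orthogonal_transformation_matrix[of Q] by fastforce
  ultimately show ?thesis using gram_compose[OF bil lin] by (simp add: \<beta>_def)
qed

context space_form_tube
begin

text \<open>The domain of a polar chart: the direction of a vector serves as the sphere coordinate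
  and its norm as the height. One chart covers the tube except for its two boundary spheres.\<close>

definition U :: "(real^'n) set" where "U = ball 0 l - {0}"

definition \<phi> :: "real^'n \<Rightarrow> 'w \<times> real" where "\<phi> x = point (sgn x) (norm x)"

text \<open>The volume density of the chart: the \<open>CARD('n) - 1\<close> directions along
  spheres are stretched by \<open>r / norm x\<close>, and the radial direction is preserved.\<close>

definition dens :: "real^'n \<Rightarrow> real" where
  "dens x = indicator U x * (r / norm x) ^ (CARD('n) - 1)"

definition cylinder_coord :: "'w \<times> real \<Rightarrow> (real^'n) \<times> real" where
  "cylinder_coord z = (coord (fst z - q) /\<^sub>R r, snd z)"

definition inverse_chart :: "'w \<times> real \<Rightarrow> real^'n" where
  "inverse_chart z = snd z *\<^sub>R (coord (fst z - q) /\<^sub>R r)"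

lemma open_U: "open U" by (simp add: U_def open_Diff)

lemma U_iff: "x \<in> U \<longleftrightarrow> 0 < norm x \<and> norm x < l" by (auto simp: U_def)

lemma cylinder_coord_point [simp]: "cylinder_coord (point \<omega> t) = (\<omega>, t)"
  using r_pos linear_cmul[OF linear_coord] by (simp add: cylinder_coord_def point_def)

lemma inverse_chart_point [simp]: "inverse_chart (point \<omega> t) = t *\<^sub>R \<omega>"
  using r_pos linear_cmul[OF linear_coord] by (simp add: inverse_chart_def point_def)

lemma inverse_chart_\<phi> [simp]: "inverse_chart (\<phi> x) = x"
  by (cases "x = 0") (simp_all add: \<phi>_def sgn_div_norm)

lemma \<phi>_inverse_chart: "norm \<omega> = 1 \<Longrightarrow> 0 < t \<Longrightarrow> \<phi> (inverse_chart (point \<omega> t)) = point \<omega> t"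
  by (simp add: \<phi>_def sgn_scaleR) (simp add: sgn_div_norm)

lemma continuous_coords: "continuous_on X cylinder_coord" "continuous_on X inverse_chart"
proof -
  have c: "continuous_on X (\<lambda>z. coord (fst z - q))" for X :: "('w \<times> real) set"
    by (intro linear_continuous_on_compose[OF _ linear_coord] continuous_intros)
  show "continuous_on X cylinder_coord" "continuous_on X inverse_chart"
    unfolding cylinder_coord_def[abs_def] inverse_chart_def[abs_def] by (intro continuous_intros c)+
qed

lemma \<phi>_in_\<Sigma>: "x \<in> U \<Longrightarrow> \<phi> x \<in> \<Sigma>"
  unfolding \<phi>_def U_iff by (intro point_in_\<Sigma>) (auto simp: norm_sgn)

lemma image_\<phi>: "\<phi> ` U = {z \<in> \<Sigma>. 0 < snd z \<and> snd z < l}"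
proof (intro subset_antisym subsetI)
  fix z assume z: "z \<in> {z \<in> \<Sigma>. 0 < snd z \<and> snd z < l}"
  then obtain \<omega> t where \<omega>: "norm \<omega> = 1" "t \<in> {0..l}" "z = point \<omega> t" using \<Sigma>_cases by blast
  have t: "0 < t" "t < l" using z \<omega>(3) by (auto simp: point_def)
  have "t *\<^sub>R \<omega> \<in> U" using \<omega> t by (simp add: U_iff)
  moreover have "z = \<phi> (t *\<^sub>R \<omega>)" using \<phi>_inverse_chart[OF \<omega>(1) t(1)] \<omega>(3) by simp
  ultimately show "z \<in> \<phi> ` U" by blast
next
  fix z assume "z \<in> \<phi> ` U"
  then obtain x where "x \<in> U" "z = \<phi> x" by blast
  then show "z \<in> {z \<in> \<Sigma>. 0 < snd z \<and> snd z < l}"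
    using \<phi>_in_\<Sigma>[of x] by (auto simp: \<phi>_def point_def U_iff)
qed

lemma inj_\<phi>: "inj_on \<phi> X"
  by (metis inj_on_inverseI inverse_chart_\<phi>)

lemma smooth_\<phi>: "smooth_on U \<phi>"
proof -
  have 0: "0 \<notin> U" by (simp add: U_def)
  note n = smooth_on_norm[OF open_U 0]
  have "smooth_on U (\<lambda>x. (q + r *\<^sub>R L (inverse (norm x) *\<^sub>R x), norm x))"
    by (intro smooth_on_Pair smooth_on_add smooth_on_const smooth_on_bounded_linear_compose[OF open_U bounded_linear_scaleR_right]
        smooth_on_bounded_linear_compose[OF open_U bounded_linear_L] smooth_on_scaleR n open_U smooth_on_ident)
  then show ?thesis by (simp add: \<phi>_def[abs_def] point_def sgn_div_norm)
qed

definition D\<phi> :: "real^'n \<Rightarrow> real^'n \<Rightarrow> 'w \<times> real" where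
  "D\<phi> x h = ((r / norm x) *\<^sub>R L (h - (sgn x \<bullet> h) *\<^sub>R sgn x), sgn x \<bullet> h)"

lemma has_derivative_\<phi>:
  assumes "x \<in> U"
  shows "(\<phi> has_derivative D\<phi> x) (at x)"
proof -
  have x: "x \<noteq> 0" using assms by (auto simp: U_def)
  have n: "(norm has_derivative (\<lambda>h. sgn x \<bullet> h)) (at x)"
    using has_derivative_norm[OF x] by (simp add: inner_commute)
  have "((\<lambda>x. inverse (norm x) *\<^sub>R x) has_derivative
      (\<lambda>h. inverse (norm x) *\<^sub>R h + (- (inverse (norm x) * (sgn x \<bullet> h) * inverse (norm x))) *\<^sub>R x)) (at x)"
    using x by (intro has_derivative_scaleR Deriv.has_derivative_inverse n has_derivative_ident) auto
  then have s: "(sgn has_derivative (\<lambda>h. inverse (norm x) *\<^sub>R (h - (sgn x \<bullet> h) *\<^sub>R sgn x))) (at x)"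
    unfolding sgn_div_norm[abs_def] by (rule has_derivative_eq_rhs) (simp add: fun_eq_iff algebra_simps)
  have "((\<lambda>x. (q + r *\<^sub>R L (sgn x), norm x)) has_derivative
      (\<lambda>h. (0 + r *\<^sub>R L (inverse (norm x) *\<^sub>R (h - (sgn x \<bullet> h) *\<^sub>R sgn x)), sgn x \<bullet> h))) (at x)"
    by (intro has_derivative_Pair has_derivative_add has_derivative_const has_derivative_scaleR_right
        bounded_linear.has_derivative[OF bounded_linear_L s] n)
  then show ?thesis
    unfolding \<phi>_def[abs_def] point_def D\<phi>_def[abs_def]
    by (rule has_derivative_eq_rhs) (simp add: fun_eq_iff linear_cmul[OF linear_L] divide_inverse)
qed

lemma B2_D\<phi>: "B2 (D\<phi> x h) (D\<phi> x k) =
    (r / norm x)\<^sup>2 * (h \<bullet> k - (sgn x \<bullet> h) * (sgn x \<bullet> k)) + (sgn x \<bullet> h) * (sgn x \<bullet> k)" if "x \<noteq> 0"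
proof -
  have "sgn x \<bullet> sgn x = 1" using that by (metis norm_eq_1 norm_sgn)
  then have "(h - (sgn x \<bullet> h) *\<^sub>R sgn x) \<bullet> (k - (sgn x \<bullet> k) *\<^sub>R sgn x) = h \<bullet> k - (sgn x \<bullet> h) * (sgn x \<bullet> k)"
    by (simp add: inner_simps inner_commute algebra_simps)
  then show ?thesis
    by (simp add: D\<phi>_def product_form_def B.scaleR_left B.scaleR_right isometry power2_eq_square)
qed

lemma gram_\<phi>:
  assumes x: "x \<in> U"
  shows "det (\<chi> i j. B2 (D\<phi> x (axis i 1)) (D\<phi> x (axis j 1))) = (dens x)\<^sup>2"
proof -
  have x0: "x \<noteq> 0" using x by (auto simp: U_def)
  have "det (\<chi> i j. B2 (D\<phi> x (axis i 1)) (D\<phi> x (axis j 1))) = ((r / norm x)\<^sup>2) ^ (CARD('n) - 1)"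
    unfolding B2_D\<phi>[OF x0] by (rule det_gram_radial) (simp add: norm_sgn x0)
  then show ?thesis using x by (simp add: dens_def power_mult[symmetric] mult.commute)
qed

lemma dens_nonneg: "0 \<le> dens x" using r_pos by (simp add: dens_def)

lemma parametrization_\<phi>: "parametrization \<Sigma> U \<phi>"
  unfolding parametrization_def
proof (intro conjI ballI open_U smooth_\<phi> inj_\<phi>)
  show "\<phi> ` U \<subseteq> \<Sigma>" using \<phi>_in_\<Sigma> by blast
  fix x assume x: "x \<in> U"
  have "h = 0" if "D\<phi> x h = 0" for h
  proof -
    have "sgn x \<bullet> h = 0" "(r / norm x) *\<^sub>R L (h - (sgn x \<bullet> h) *\<^sub>R sgn x) = 0" using that by (auto simp: D\<phi>_def zero_prod_def)
    then have "L h = 0" using r_pos x by (simp add: U_iff)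
    then show "h = 0" using inj_L linear_0[OF linear_L] by (metis injD)
  qed
  then show "inj (frechet_derivative \<phi> (at x))"
    unfolding has_derivative_imp_frechet[OF has_derivative_\<phi>[OF x]]
    using has_derivative_linear[OF has_derivative_\<phi>[OF x]] by (subst linear_injective_0) auto
qed

text \<open>At a boundary point the height would be extremal, so that its differential would vanish, but
  the differential of a parametrization is onto the tangent space.\<close>

lemma parametrization_interior:
  assumes f: "parametrization \<Sigma> V (f :: real^'n \<Rightarrow> 'w \<times> real)" and x: "x \<in> V"
  shows "0 < snd (f x)" "snd (f x) < l"
proof -
  have V: "open V" and sm: "smooth_on V f" and im: "\<And>y. y \<in> V \<Longrightarrow> f y \<in> \<Sigma>" and inj: "inj (frechet_derivative f (at x))"
    using f x unfolding parametrization_def by auto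
  define f' where "f' = frechet_derivative f (at x)"
  have f': "(f has_derivative f') (at x)" unfolding f'_def by (rule smooth_on_has_derivative[OF sm x])
  have bounds: "0 \<le> snd (f y)" "snd (f y) \<le> l" if "y \<in> V" for y
    using im[OF that] by (auto elim!: \<Sigma>_cases simp: point_def)
  have False if ext: "snd (f x) = 0 \<or> snd (f x) = l"
  proof -
    have "((\<lambda>y. snd (f y)) has_derivative (\<lambda>h. snd (f' h))) (at x)" by (intro has_derivative_snd f')
    then have "(\<lambda>h. snd (f' h)) = (\<lambda>h. 0)"
      by (rule differential_zero_maxmin[OF x V]) (use ext bounds in auto)
    then have s0: "snd (f' h) = 0" for h by meson
    define c where "c y = coord (fst (f y) - q) /\<^sub>R r" for y
    define c' where "c' h = coord (fst (f' h)) /\<^sub>R r" for h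
    have "((\<lambda>y. fst (f y) - q) has_derivative (\<lambda>h. fst (f' h))) (at x)"
      by (rule has_derivative_eq_rhs[OF has_derivative_diff[OF has_derivative_fst[OF f'] has_derivative_const]]) simp
    then have dc: "(c has_derivative c') (at x)"
      unfolding c_def[abs_def] c'_def[abs_def]
      by (intro has_derivative_scaleR_right bounded_linear.has_derivative[OF bounded_linear_coord])
    have cn: "norm (c y) = 1" and fc: "fst (f y) = q + r *\<^sub>R L (c y)" if "y \<in> V" for y
      using im[OF that] r_pos linear_cmul[OF linear_coord] by (auto elim!: \<Sigma>_cases simp: c_def point_def)
    have "((\<lambda>y. c y \<bullet> c y) has_derivative (\<lambda>h. c x \<bullet> c' h + c' h \<bullet> c x)) (at x)" by (intro has_derivative_inner dc)
    moreover have "((\<lambda>y. c y \<bullet> c y) has_derivative (\<lambda>h. 0)) (at x)"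
      by (rule has_derivative_transform_within_open[OF has_derivative_const[of 1] V x]) (simp add: cn norm_eq_1[symmetric])
    ultimately have "(\<lambda>h. c x \<bullet> c' h + c' h \<bullet> c x) = (\<lambda>h. 0)" by (rule has_derivative_unique)
    then have orth: "c x \<bullet> c' h = 0" for h by (metis inner_commute add_self_div_2 div_0 mult_2 mult_eq_0_iff zero_neq_numeral)
    have "((\<lambda>y. q + r *\<^sub>R L (c y)) has_derivative (\<lambda>h. 0 + r *\<^sub>R L (c' h))) (at x)"
      by (intro has_derivative_add has_derivative_const has_derivative_scaleR_right bounded_linear.has_derivative[OF bounded_linear_L dc])
    then have "((\<lambda>y. fst (f y)) has_derivative (\<lambda>h. 0 + r *\<^sub>R L (c' h))) (at x)"
      by (rule has_derivative_transform_within_open[OF _ V x]) (simp add: fc)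
    then have "(\<lambda>h. 0 + r *\<^sub>R L (c' h)) = (\<lambda>h. fst (f' h))" by (rule has_derivative_unique) (rule has_derivative_fst[OF f'])
    then have ff: "fst (f' h) = r *\<^sub>R L (c' h)" for h by (metis add_0)
    have lin: "linear c'" by (rule has_derivative_linear[OF dc])
    have "h = 0" if "c' h = 0" for h
    proof -
      have "f' h = 0" using ff[of h] s0[of h] that linear_0[OF linear_L] by (intro prod_eqI) auto
      then show ?thesis using inj linear_0[OF has_derivative_linear[OF f']] unfolding f'_def[symmetric] by (metis injD)
    qed
    \<comment> \<open>With constant height, \<open>c'\<close> is an injective endomorphism of
      \<open>real^'n\<close> and hence onto, although its range is orthogonal to the unit vector
      \<open>c x\<close>.\<close>
    then have "surj c'" using lin by (intro linear_injective_imp_surjective) (simp_all add: linear_injective_0[OF lin])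
    then obtain h where "c' h = c x" by (metis surjD)
    then have "c x \<bullet> c x = 0" using orth[of h] by simp
    then show False using cn[OF x] by simp
  qed
  then show "0 < snd (f x)" "snd (f x) < l" using bounds[OF x] by fastforce+
qed

end

section \<open>Existence, uniqueness and product structure of the Riemannian measure\<close>

context space_form_tube
begin

text \<open>The image of the chart density. The boundary is null by construction, as the chart does
  not reach it.\<close>

definition \<mu> :: "('w \<times> real) measure" where
  "\<mu> = distr (density (restrict_space lborel U) dens) (restrict_space borel \<Sigma>) \<phi>"

lemma closed_\<Sigma>: "closed \<Sigma>"
proof -
  have "continuous_on (sphere 0 1 \<times> {0..l}) (\<lambda>(\<omega>, t). point \<omega> t)"
    unfolding point_def case_prod_beta
    by (intro continuous_intros linear_continuous_on_compose[OF _ linear_L])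
  then have "compact \<Sigma>" unfolding \<Sigma>_points by (intro compact_continuous_image compact_Times) auto
  then show ?thesis by (rule compact_imp_closed)
qed

lemma \<Sigma>_borel [measurable]: "\<Sigma> \<in> sets borel" and U_borel [measurable]: "U \<in> sets borel"
  using closed_\<Sigma> open_U by auto

lemma dens_borel [measurable]: "dens \<in> borel_measurable borel"
  unfolding dens_def[abs_def] by measurable

lemma space_\<mu> [simp]: "space \<mu> = \<Sigma>" and sets_\<mu>: "sets \<mu> = sets (restrict_space borel \<Sigma>)"
  by (simp_all add: \<mu>_def space_restrict_space)

lemma sets_\<mu>_iff: "A \<in> sets \<mu> \<longleftrightarrow> A \<subseteq> \<Sigma> \<and> A \<in> sets borel"
  unfolding sets_\<mu> using \<Sigma>_borel by (auto simp: sets_restrict_space_iff)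

lemma measurable_\<phi>: "\<phi> \<in> density (restrict_space lborel U) dens \<rightarrow>\<^sub>M restrict_space borel \<Sigma>"
proof -
  have "\<phi> \<in> borel_measurable (restrict_space borel U)"
    by (rule borel_measurable_continuous_on_restrict[OF smooth_on_continuous_on[OF smooth_\<phi>]])
  then have "\<phi> \<in> borel_measurable (restrict_space lborel U)"
    by (simp cong: measurable_cong_sets sets_restrict_space_cong)
  then have "\<phi> \<in> restrict_space lborel U \<rightarrow>\<^sub>M restrict_space borel \<Sigma>"
    by (rule measurable_restrict_space2[rotated]) (auto simp: space_restrict_space \<phi>_in_\<Sigma>)
  then show ?thesis by simp
qed

lemma nn_integral_\<mu>:
  assumes h: "h \<in> borel_measurable \<mu>"
  shows "(\<integral>\<^sup>+z. h z \<partial>\<mu>) = (\<integral>\<^sup>+x\<in>U. h (\<phi> x) * ennreal (dens x) \<partial>lborel)"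
proof -
  have h': "h \<in> borel_measurable (restrict_space borel \<Sigma>)" using h by (simp add: sets_\<mu> cong: measurable_cong_sets)
  have hm: "(\<lambda>x. h (\<phi> x)) \<in> borel_measurable (restrict_space lborel U)"
    using measurable_compose[OF measurable_\<phi> h'] by simp
  have "(\<integral>\<^sup>+z. h z \<partial>\<mu>) = (\<integral>\<^sup>+x. h (\<phi> x) \<partial>density (restrict_space lborel U) dens)"
    unfolding \<mu>_def by (rule nn_integral_distr[OF measurable_\<phi> h[unfolded \<mu>_def]])
  also have "\<dots> = (\<integral>\<^sup>+x. ennreal (dens x) * h (\<phi> x) \<partial>restrict_space lborel U)"
    using hm by (intro nn_integral_density) (auto intro!: measurable_restrict_space1)
  also have "\<dots> = (\<integral>\<^sup>+x\<in>U. ennreal (dens x) * h (\<phi> x) \<partial>lborel)"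
    by (rule nn_integral_restrict_space) simp
  finally show ?thesis by (simp add: mult.commute)
qed

lemma emeasure_\<mu>:
  assumes A: "A \<in> sets \<mu>"
  shows "emeasure \<mu> A = (\<integral>\<^sup>+x\<in>{x \<in> U. \<phi> x \<in> A}. ennreal (dens x) \<partial>lborel)"
proof -
  have "emeasure \<mu> A = (\<integral>\<^sup>+z. indicator A z \<partial>\<mu>)" using A by simp
  also have "\<dots> = (\<integral>\<^sup>+x\<in>U. indicator A (\<phi> x) * ennreal (dens x) \<partial>lborel)"
    using A by (intro nn_integral_\<mu>) simp
  also have "\<dots> = (\<integral>\<^sup>+x\<in>{x \<in> U. \<phi> x \<in> A}. ennreal (dens x) \<partial>lborel)"
    by (intro nn_integral_cong) (auto simp: indicator_def)
  finally show ?thesis .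
qed

text \<open>By invariance of domain the map is a homeomorphism onto an open set, and the image is a
  preimage under its continuous inverse.\<close>

lemma image_parametrization_borel:
  fixes \<tau> :: "real^'n \<Rightarrow> real^'n"
  assumes V: "open V" and A: "A \<in> sets borel" "A \<subseteq> V"
    and \<tau>: "continuous_on V \<tau>" "inj_on \<tau> V"
  shows "\<tau> ` A \<in> sets borel"
proof -
  obtain g where g: "homeomorphism V (\<tau> ` V) \<tau> g"
    using invariance_of_domain_homeomorphism[OF V \<tau>(1) _ \<tau>(2)] by auto
  have "open (\<tau> ` V)" using invariance_of_domain[OF \<tau>(1) V \<tau>(2)] .
  then have o: "\<tau> ` V \<in> sets borel" by simp
  have "g \<in> borel_measurable (restrict_space borel (\<tau> ` V))"
    using g by (intro borel_measurable_continuous_on_restrict) (simp add: homeomorphism_def)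
  from measurable_sets[OF this A(1)] have "g -` A \<inter> \<tau> ` V \<in> sets borel"
    using o by (simp add: space_restrict_space sets_restrict_space_iff)
  moreover have "g -` A \<inter> \<tau> ` V = \<tau> ` A"
    using g A(2) by (auto simp: homeomorphism_def)
  ultimately show ?thesis by simp
qed

text \<open>A parametrization avoids the boundary, so it factors through the single chart as
  \<open>\<phi>\<close> after a transition map \<open>\<tau>\<close>. The Gram determinant picks up
  the square of the Jacobian of \<open>\<tau>\<close>, and the change of variables formula compares
  the two charts.\<close>

lemma emeasure_parametrization:
  assumes f: "parametrization \<Sigma> V (f :: real^'n \<Rightarrow> 'w \<times> real)" and A: "A \<in> sets borel" "A \<subseteq> V"
  shows "f ` A \<in> sets \<mu>" "emeasure \<mu> (f ` A) = (\<integral>\<^sup>+x\<in>A. ennreal (volume_density B2 f x) \<partial>lborel)"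
proof -
  have V: "open V" and sm: "smooth_on V f" and inj: "inj_on f V" and im: "\<And>y. y \<in> V \<Longrightarrow> f y \<in> \<Sigma>"
    using f unfolding parametrization_def by auto
  define \<tau> where "\<tau> x = inverse_chart (f x)" for x
  have im\<phi>: "f x \<in> \<phi> ` U" if "x \<in> V" for x
    unfolding image_\<phi> using parametrization_interior[OF f that] im[OF that] by auto
  have \<tau>U: "\<tau> x \<in> U" and \<phi>\<tau>: "\<phi> (\<tau> x) = f x" if "x \<in> V" for x
    using im\<phi>[OF that] by (auto simp: \<tau>_def)
  have inj\<tau>: "inj_on \<tau> V" using inj \<phi>\<tau> by (metis inj_on_def)
  have c\<tau>: "continuous_on V \<tau>"
    unfolding \<tau>_def[abs_def] by (rule continuous_on_compose2[OF continuous_coords(2)[of UNIV] smooth_on_continuous_on[OF sm]]) simp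
  have \<tau>A: "\<tau> ` A \<in> sets borel" by (rule image_parametrization_borel[OF V A c\<tau> inj\<tau>])
  have fA: "f ` A = {z \<in> \<Sigma>. inverse_chart z \<in> \<tau> ` A \<and> 0 < snd z \<and> snd z < l}"
  proof (intro subset_antisym subsetI)
    fix z assume "z \<in> f ` A"
    then show "z \<in> {z \<in> \<Sigma>. inverse_chart z \<in> \<tau> ` A \<and> 0 < snd z \<and> snd z < l}"
      using A(2) im parametrization_interior[OF f] by (auto simp: \<tau>_def)
  next
    fix z assume z: "z \<in> {z \<in> \<Sigma>. inverse_chart z \<in> \<tau> ` A \<and> 0 < snd z \<and> snd z < l}"
    then have "z \<in> \<phi> ` U" unfolding image_\<phi> by blast
    then obtain y where y: "y \<in> U" "z = \<phi> y" by blast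
    then obtain a where a: "a \<in> A" "y = \<tau> a" using z by auto
    then have "z = f a" using y \<phi>\<tau> A(2) by auto
    then show "z \<in> f ` A" using a by blast
  qed
  have "inverse_chart \<in> borel_measurable borel" by (intro borel_measurable_continuous_onI continuous_coords)
  from measurable_sets[OF this \<tau>A] have "inverse_chart -` (\<tau> ` A) \<in> sets borel" by simp
  moreover have "open {z :: 'w \<times> real. 0 < snd z \<and> snd z < l}"
    by (intro open_Collect_conj open_Collect_less continuous_intros)
  ultimately have "\<Sigma> \<inter> (inverse_chart -` (\<tau> ` A) \<inter> {z. 0 < snd z \<and> snd z < l}) \<in> sets borel" by auto
  moreover have "\<Sigma> \<inter> (inverse_chart -` (\<tau> ` A) \<inter> {z. 0 < snd z \<and> snd z < l}) = f ` A" unfolding fA by auto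
  ultimately show fA_sets: "f ` A \<in> sets \<mu>" unfolding sets_\<mu>_iff using im A(2) by auto
  have pre: "{x \<in> U. \<phi> x \<in> f ` A} = \<tau> ` A"
  proof (intro subset_antisym subsetI)
    fix x assume "x \<in> {x \<in> U. \<phi> x \<in> f ` A}"
    then obtain a where "a \<in> A" "\<phi> x = f a" by auto
    then show "x \<in> \<tau> ` A" unfolding \<tau>_def by (metis image_eqI inverse_chart_\<phi>)
  qed (use \<tau>U \<phi>\<tau> A(2) in auto)
  define f' where "f' x = frechet_derivative f (at x)" for x
  have f': "(f has_derivative f' x) (at x)" if "x \<in> V" for x
    unfolding f'_def by (rule smooth_on_has_derivative[OF sm that])
  define \<tau>' where "\<tau>' x h = snd (f x) *\<^sub>R (coord (fst (f' x h)) /\<^sub>R r) + snd (f' x h) *\<^sub>R (coord (fst (f x) - q) /\<^sub>R r)" for x h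
  have \<tau>': "(\<tau> has_derivative \<tau>' x) (at x)" if "x \<in> V" for x
  proof -
    have "((\<lambda>y. fst (f y) - q) has_derivative (\<lambda>h. fst (f' x h))) (at x)"
      by (rule has_derivative_eq_rhs[OF has_derivative_diff[OF has_derivative_fst[OF f'[OF that]] has_derivative_const]]) simp
    then show ?thesis
      unfolding \<tau>_def[abs_def] inverse_chart_def \<tau>'_def[abs_def]
      by (intro has_derivative_scaleR has_derivative_snd[OF f'[OF that]] has_derivative_scaleR_right
          bounded_linear.has_derivative[OF bounded_linear_coord])
  qed
  have vd: "volume_density B2 f x = \<bar>det (matrix (\<tau>' x))\<bar> * dens (\<tau> x)" if x: "x \<in> V" for x
  proof -
    have lin: "linear (\<tau>' x)" by (rule has_derivative_linear[OF \<tau>'[OF x]])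
    have "((\<lambda>y. \<phi> (\<tau> y)) has_derivative (\<lambda>h. D\<phi> (\<tau> x) (\<tau>' x h))) (at x)"
      by (rule has_derivative_compose[OF \<tau>'[OF x] has_derivative_\<phi>[OF \<tau>U[OF x]]])
    then have "(f has_derivative (\<lambda>h. D\<phi> (\<tau> x) (\<tau>' x h))) (at x)"
      by (rule has_derivative_transform_within_open[OF _ V x]) (simp add: \<phi>\<tau>)
    then have eq: "frechet_derivative f (at x) h = D\<phi> (\<tau> x) (\<tau>' x h)" for h
      by (simp add: has_derivative_imp_frechet)
    have linD: "linear (D\<phi> (\<tau> x))" by (rule has_derivative_linear[OF has_derivative_\<phi>[OF \<tau>U[OF x]]])
    have bil: "bilinear (\<lambda>h k. B2 (D\<phi> (\<tau> x) h) (D\<phi> (\<tau> x) k))"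
      unfolding bilinear_def using linD
      by (auto intro!: linearI simp: linear_add linear_cmul B2.add_left B2.add_right B2.scaleR_left B2.scaleR_right)
    have "volume_density B2 f x = sqrt ((det (matrix (\<tau>' x)))\<^sup>2 * (dens (\<tau> x))\<^sup>2)"
      unfolding volume_density_def eq gram_compose[OF bil lin] gram_\<phi>[OF \<tau>U[OF x]] ..
    then show ?thesis using dens_nonneg[of "\<tau> x"] by (simp add: real_sqrt_mult)
  qed
  have "continuous_on V (\<lambda>x. volume_density B2 f x)"
  proof -
    have c: "continuous_on V (\<lambda>x. frechet_derivative f (at x) v)" for v
      by (rule smooth_on_continuous_on[OF smooth_on_frechet_derivative[OF sm]])
    show ?thesis
      unfolding volume_density_def det_def
      by (simp, intro continuous_intros B2.continuous_on c)
  qed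
  then have "(\<lambda>x. indicator A x *\<^sub>R volume_density B2 f x) \<in> borel_measurable borel"
    by (intro borel_measurable_continuous_on_indicator A(1)) (rule continuous_on_subset[OF _ A(2)])
  moreover have "(\<lambda>x. indicator A x *\<^sub>R volume_density B2 f x) = (\<lambda>x. indicator A x * (\<bar>det (matrix (\<tau>' x))\<bar> * dens (\<tau> x)))"
    using vd A(2) by (auto simp: fun_eq_iff indicator_def)
  ultimately have meas: "(\<lambda>x. indicator A x * (\<bar>det (matrix (\<tau>' x))\<bar> * dens (\<tau> x))) \<in> borel_measurable borel" by simp
  have "emeasure \<mu> (f ` A) = (\<integral>\<^sup>+x\<in>\<tau> ` A. ennreal (dens x) \<partial>lborel)"
    unfolding emeasure_\<mu>[OF fA_sets] pre ..
  also have "\<dots> = (\<integral>\<^sup>+x\<in>A. ennreal (\<bar>det (matrix (\<tau>' x))\<bar> * dens (\<tau> x)) \<partial>lborel)"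
    using A(2) by (intro nn_integral_change_of_variables A(1) \<tau>A dens_borel dens_nonneg meas has_derivative_at_withinI[OF \<tau>'] inj_on_subset[OF inj\<tau>]) auto
  also have "\<dots> = (\<integral>\<^sup>+x\<in>A. ennreal (volume_density B2 f x) \<partial>lborel)"
    using vd A(2) by (intro nn_integral_cong) (auto simp: indicator_def)
  finally show "emeasure \<mu> (f ` A) = (\<integral>\<^sup>+x\<in>A. ennreal (volume_density B2 f x) \<partial>lborel)" .
qed

lemma union_parametrizations:
  "\<Union>{f ` V | V (f :: real^'n \<Rightarrow> 'w \<times> real). parametrization \<Sigma> V f} = \<phi> ` U"
proof (intro subset_antisym subsetI)
  fix z assume "z \<in> \<Union>{f ` V | V (f :: real^'n \<Rightarrow> 'w \<times> real). parametrization \<Sigma> V f}"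
  then obtain V and f :: "real^'n \<Rightarrow> 'w \<times> real" and x where f: "parametrization \<Sigma> V f" "x \<in> V" "z = f x" by blast
  then show "z \<in> \<phi> ` U"
    unfolding image_\<phi> using parametrization_interior[OF f(1,2)] by (auto simp: parametrization_def)
qed (use parametrization_\<phi> in blast)

lemma is_riemannian_measure_\<mu>: "is_riemannian_measure TYPE('n) B2 \<Sigma> \<mu>"
proof -
  have c: "\<phi> ` U \<in> sets \<mu>" using emeasure_parametrization(1)[OF parametrization_\<phi> U_borel] by simp
  then have s: "\<Sigma> - \<phi> ` U \<in> sets \<mu>" using sets.compl_sets[OF c] by simp
  have "emeasure \<mu> (\<Sigma> - \<phi> ` U) = (\<integral>\<^sup>+x\<in>{x \<in> U. \<phi> x \<in> \<Sigma> - \<phi> ` U}. ennreal (dens x) \<partial>lborel)"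
    by (rule emeasure_\<mu>[OF s])
  also have "{x \<in> U. \<phi> x \<in> \<Sigma> - \<phi> ` U} = {}" by auto
  finally have "\<Sigma> - \<phi> ` U \<in> null_sets \<mu>" using s by auto
  then show ?thesis
    unfolding is_riemannian_measure_def union_parametrizations
    by (intro conjI allI impI emeasure_parametrization(2)) (auto simp: sets_\<mu>)
qed

text \<open>A competing measure is determined on the range of the chart by the formula for
  \<open>\<phi>\<close>, and the remainder is a null set for both.\<close>

theorem riemannian_measure_eq: "riemannian_measure TYPE('n) B2 \<Sigma> = \<mu>"
  unfolding riemannian_measure_def
proof (rule the_equality)
  show "is_riemannian_measure TYPE('n) B2 \<Sigma> \<mu>" by (rule is_riemannian_measure_\<mu>)
  fix \<mu>' assume \<mu>': "is_riemannian_measure TYPE('n) B2 \<Sigma> \<mu>'"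
  have sp: "space \<mu>' = \<Sigma>" and se: "sets \<mu>' = sets (restrict_space borel \<Sigma>)"
    and null: "\<Sigma> - \<phi> ` U \<in> null_sets \<mu>'"
    using \<mu>' unfolding is_riemannian_measure_def union_parametrizations by auto
  have se': "sets \<mu>' = sets \<mu>" using se sets_\<mu> by simp
  have null0: "\<Sigma> - \<phi> ` U \<in> null_sets \<mu>"
    using is_riemannian_measure_\<mu> unfolding is_riemannian_measure_def union_parametrizations by auto
  have U\<phi>: "\<phi> ` U \<in> sets \<mu>" using emeasure_parametrization(1)[OF parametrization_\<phi> U_borel] by simp
  show "\<mu>' = \<mu>"
  proof (rule measure_eqI[OF se'])
    fix A assume "A \<in> sets \<mu>'"
    then have A: "A \<in> sets \<mu>" using se' by simp
    then have A\<Sigma>: "A \<subseteq> \<Sigma>" by (simp add: sets_\<mu>_iff)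
    define C where "C = {x \<in> U. \<phi> x \<in> A}"
    have "\<phi> \<in> restrict_space borel U \<rightarrow>\<^sub>M borel"
      by (rule borel_measurable_continuous_on_restrict[OF smooth_on_continuous_on[OF smooth_\<phi>]])
    from measurable_sets[OF this, of A] A have C: "C \<in> sets borel"
      by (simp add: sets_\<mu>_iff space_restrict_space sets_restrict_space_iff C_def Collect_conj_eq vimage_def Int_commute)
    have CU: "C \<subseteq> U" by (auto simp: C_def)
    have img: "A \<inter> \<phi> ` U = \<phi> ` C" by (auto simp: C_def)
    have split: "emeasure M A = emeasure M (\<phi> ` C)" if M: "sets M = sets \<mu>" "\<Sigma> - \<phi> ` U \<in> null_sets M" for M
    proof -
      have "emeasure M ((A \<inter> \<phi> ` U) \<union> (A \<inter> (\<Sigma> - \<phi> ` U))) = emeasure M (A \<inter> \<phi> ` U)"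
        using A U\<phi> M by (intro emeasure_Un_null_set null_set_Int1) auto
      moreover have "(A \<inter> \<phi> ` U) \<union> (A \<inter> (\<Sigma> - \<phi> ` U)) = A" using A\<Sigma> by auto
      ultimately show ?thesis by (simp add: img)
    qed
    have "emeasure \<mu>' (\<phi> ` C) = (\<integral>\<^sup>+x\<in>C. ennreal (volume_density B2 \<phi> x) \<partial>lborel)"
      using \<mu>' parametrization_\<phi> C CU unfolding is_riemannian_measure_def by blast
    then show "emeasure \<mu>' A = emeasure \<mu> A"
      using split[OF se' null] split[OF refl null0] emeasure_parametrization(2)[OF parametrization_\<phi> C CU] by simp
  qed
qed

lemma measurable_cylinder_coord: "cylinder_coord \<in> \<mu> \<rightarrow>\<^sub>M borel \<Otimes>\<^sub>M borel"
proof -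
  have "cylinder_coord \<in> borel_measurable (restrict_space borel \<Sigma>)"
    by (intro measurable_restrict_space1 borel_measurable_continuous_onI continuous_coords)
  then show ?thesis by (simp only: borel_prod measurable_cong_sets[OF sets_\<mu> refl])
qed

text \<open>In the cylinder coordinates \<open>(\<omega>, t)\<close> the factor \<open>t ^ (n - 1)\<close> of the polar decomposition
  cancels against the density of the chart.\<close>

theorem distr_\<mu>_cylinder_coord:
  "distr \<mu> (borel \<Otimes>\<^sub>M borel) cylinder_coord =
    scale_measure (ennreal (CARD('n) * r ^ (CARD('n) - 1))) (sphere_measure \<Otimes>\<^sub>M segment_measure l)"
proof (rule measure_eqI)
  interpret R: sigma_finite_measure "radial_measure TYPE(real^'n)" by (rule sigma_finite_radial_measure)
  interpret T: finite_measure "segment_measure l" using l_pos by (simp add: finite_measure_segment_measure)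
  show "sets (distr \<mu> (borel \<Otimes>\<^sub>M borel) cylinder_coord) =
     sets (scale_measure (ennreal (CARD('n) * r ^ (CARD('n) - 1))) (sphere_measure \<Otimes>\<^sub>M segment_measure l :: ((real^'n) \<times> real) measure))"
    by (simp cong: sets_pair_measure_cong)
  fix A assume "A \<in> sets (distr \<mu> (borel \<Otimes>\<^sub>M borel) cylinder_coord)"
  then have A [measurable]: "A \<in> sets (borel \<Otimes>\<^sub>M borel)" by simp
  note m = measurable_cylinder_coord
  have sA: "cylinder_coord -` A \<inter> \<Sigma> \<in> sets \<mu>" using measurable_sets[OF m A] by simp
  define h where "h z = indicator A z * (indicator {0<..<l} (snd z) * ennreal ((r / snd z) ^ (CARD('n) - 1)))" for z
  have hm [measurable]: "h \<in> borel_measurable (borel \<Otimes>\<^sub>M borel)" unfolding h_def[abs_def] by measurable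
  have "emeasure (distr \<mu> (borel \<Otimes>\<^sub>M borel) cylinder_coord) A = emeasure \<mu> (cylinder_coord -` A \<inter> \<Sigma>)"
    by (subst emeasure_distr[OF m]) auto
  also have "\<dots> = (\<integral>\<^sup>+x\<in>{x \<in> U. \<phi> x \<in> cylinder_coord -` A \<inter> \<Sigma>}. ennreal (dens x) \<partial>lborel)"
    by (rule emeasure_\<mu>[OF sA])
  also have "\<dots> = (\<integral>\<^sup>+x. h (sgn x, norm x) \<partial>lborel)"
    by (intro nn_integral_cong) (auto simp: h_def indicator_def dens_def U_iff \<phi>_in_\<Sigma>, auto simp: \<phi>_def)
  also have "\<dots> = (\<integral>\<^sup>+\<omega>. \<integral>\<^sup>+t. h (\<omega>, t) \<partial>radial_measure TYPE(real^'n) \<partial>sphere_measure)"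
    by (rule nn_integral_polar) measurable
  also have "\<dots> = (\<integral>\<^sup>+\<omega>. ennreal (CARD('n) * r ^ (CARD('n) - 1)) * (\<integral>\<^sup>+t. indicator A (\<omega>, t) \<partial>segment_measure l) \<partial>sphere_measure)"
  proof (rule nn_integral_cong)
    fix \<omega> :: "real^'n"
    have [measurable]: "(\<lambda>t. h (\<omega>, t)) \<in> borel_measurable borel" "(\<lambda>t. indicator A (\<omega>, t) :: ennreal) \<in> borel_measurable borel"
      by measurable
    have "(\<integral>\<^sup>+t. h (\<omega>, t) \<partial>radial_measure TYPE(real^'n)) =
      (\<integral>\<^sup>+t. ennreal (CARD('n) * t ^ (CARD('n) - 1)) * indicator {0<..} t * h (\<omega>, t) \<partial>lborel)"
      unfolding radial_measure_def by (subst nn_integral_density) auto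
    also have "\<dots> = (\<integral>\<^sup>+t. ennreal (CARD('n) * r ^ (CARD('n) - 1)) * (indicator {0..l} t * indicator A (\<omega>, t)) \<partial>lborel)"
    proof (rule nn_integral_cong_AE)
      show "AE t in lborel. ennreal (CARD('n) * t ^ (CARD('n) - 1)) * indicator {0<..} t * h (\<omega>, t) =
         ennreal (CARD('n) * r ^ (CARD('n) - 1)) * (indicator {0..l} t * indicator A (\<omega>, t))"
        using AE_lborel_singleton[of 0] AE_lborel_singleton[of l]
      proof eventually_elim
        fix t :: real assume "t \<noteq> 0" "t \<noteq> l"
        moreover have "t ^ (CARD('n) - 1) * (r / t) ^ (CARD('n) - 1) = r ^ (CARD('n) - 1)" if "t > 0"
          using that by (simp add: power_mult_distrib[symmetric])
        ultimately show "ennreal (CARD('n) * t ^ (CARD('n) - 1)) * indicator {0<..} t * h (\<omega>, t) =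
         ennreal (CARD('n) * r ^ (CARD('n) - 1)) * (indicator {0..l} t * indicator A (\<omega>, t))"
          using r_pos by (auto simp: h_def indicator_def ennreal_mult[symmetric] mult.assoc)
      qed
    qed
    also have "\<dots> = ennreal (CARD('n) * r ^ (CARD('n) - 1)) * (\<integral>\<^sup>+t. indicator {0..l} t * indicator A (\<omega>, t) \<partial>lborel)"
      by (rule nn_integral_cmult) measurable
    also have "(\<integral>\<^sup>+t. indicator {0..l} t * indicator A (\<omega>, t) \<partial>lborel) = (\<integral>\<^sup>+t. indicator A (\<omega>, t) \<partial>segment_measure l)"
      unfolding segment_measure_def by (subst nn_integral_density) auto
    finally show "(\<integral>\<^sup>+t. h (\<omega>, t) \<partial>radial_measure TYPE(real^'n)) =
      ennreal (CARD('n) * r ^ (CARD('n) - 1)) * (\<integral>\<^sup>+t. indicator A (\<omega>, t) \<partial>segment_measure l)" .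
  qed
  also have "\<dots> = ennreal (CARD('n) * r ^ (CARD('n) - 1)) * (\<integral>\<^sup>+\<omega>. \<integral>\<^sup>+t. indicator A (\<omega>, t) \<partial>segment_measure l \<partial>sphere_measure)"
    by (rule nn_integral_cmult) measurable
  also have "(\<integral>\<^sup>+\<omega>. \<integral>\<^sup>+t. indicator A (\<omega>, t) \<partial>segment_measure l \<partial>sphere_measure) = emeasure (sphere_measure \<Otimes>\<^sub>M segment_measure l) A"
    by (subst T.emeasure_pair_measure) (auto cong: sets_pair_measure_cong)
  finally show "emeasure (distr \<mu> (borel \<Otimes>\<^sub>M borel) cylinder_coord) A =
    emeasure (scale_measure (ennreal (CARD('n) * r ^ (CARD('n) - 1))) (sphere_measure \<Otimes>\<^sub>M segment_measure l)) A"
    by simp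
qed

end

section \<open>Stability\<close>

lemma stability_threshold:
  fixes r l k :: real
  assumes "r > 0" "l > 0" "k \<ge> 0"
  shows "k / r\<^sup>2 \<le> (pi / l)\<^sup>2 \<longleftrightarrow> sqrt k * l \<le> pi * r"
proof -
  have "k / r\<^sup>2 \<le> (pi / l)\<^sup>2 \<longleftrightarrow> (sqrt k / r)\<^sup>2 \<le> (pi / l)\<^sup>2"
    using assms by (simp add: power_divide)
  also have "\<dots> \<longleftrightarrow> sqrt k / r \<le> pi / l"
    using assms by (intro power_mono_iff) auto
  also have "\<dots> \<longleftrightarrow> sqrt k * l \<le> pi * r"
    using assms by (simp add: field_simps)
  finally show ?thesis .
qed

context space_form_tube
begin

text \<open>The factor \<open>CARD('n)\<close> converts \<open>sphere_measure\<close> to surface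
  area and the power of \<open>r\<close> rescales to radius \<open>r\<close>.\<close>

definition mass :: real where "mass = CARD('n) * r ^ (CARD('n) - 1)"

abbreviation "N \<equiv> sphere_measure \<Otimes>\<^sub>M segment_measure l :: ((real^'n) \<times> real) measure"

lemma mass_pos: "mass > 0" using r_pos by (simp add: mass_def)

lemma borel_measurable_\<mu>: "continuous_on UNIV h \<Longrightarrow> h \<in> borel_measurable \<mu>"
  by (subst measurable_cong_sets[OF sets_\<mu> refl]) (intro measurable_restrict_space1 borel_measurable_continuous_onI)

lemma point_cylinder_coord: "z \<in> \<Sigma> \<Longrightarrow> point (fst (cylinder_coord z)) (snd (cylinder_coord z)) = z"
  by (auto elim!: \<Sigma>_cases)

lemma integral_\<mu>:
  fixes H :: "(real^'n) \<times> real \<Rightarrow> real"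
  assumes H: "H \<in> borel_measurable (borel \<Otimes>\<^sub>M borel)" and h: "\<And>z. z \<in> \<Sigma> \<Longrightarrow> h z = H (cylinder_coord z)"
  shows "(\<integral>z. h z \<partial>\<mu>) = mass * (\<integral>w. H w \<partial>N)" and "integrable \<mu> h \<longleftrightarrow> integrable N H"
proof -
  \<comment> \<open>The scaled measure is rewritten as a constant density, to which the rules for
    Bochner integrals apply.\<close>
  have d: "distr \<mu> (borel \<Otimes>\<^sub>M borel) cylinder_coord = density N (\<lambda>_. ennreal mass)"
  proof (rule measure_eqI)
    show "sets (distr \<mu> (borel \<Otimes>\<^sub>M borel) cylinder_coord) = sets (density N (\<lambda>_. ennreal mass))"
      by (simp cong: sets_pair_measure_cong)
    fix A assume "A \<in> sets (distr \<mu> (borel \<Otimes>\<^sub>M borel) cylinder_coord)"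
    then have "A \<in> sets N" by (simp cong: sets_pair_measure_cong)
    then show "emeasure (distr \<mu> (borel \<Otimes>\<^sub>M borel) cylinder_coord) A = emeasure (density N (\<lambda>_. ennreal mass)) A"
      unfolding distr_\<mu>_cylinder_coord by (simp add: emeasure_density_const mass_def)
  qed
  have HN: "H \<in> borel_measurable N" using H by (simp cong: measurable_cong_sets sets_pair_measure_cong)
  have "(\<integral>z. h z \<partial>\<mu>) = (\<integral>z. H (cylinder_coord z) \<partial>\<mu>)" by (rule Bochner_Integration.integral_cong) (simp_all add: h)
  also have "\<dots> = (\<integral>w. H w \<partial>density N (\<lambda>_. ennreal mass))"
    unfolding d[symmetric] by (rule integral_distr[OF measurable_cylinder_coord H, symmetric])
  also have "\<dots> = mass * (\<integral>w. H w \<partial>N)"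
    using mass_pos HN by (subst integral_density) auto
  finally show "(\<integral>z. h z \<partial>\<mu>) = mass * (\<integral>w. H w \<partial>N)" .
  have "integrable \<mu> h \<longleftrightarrow> integrable \<mu> (\<lambda>z. H (cylinder_coord z))" by (rule Bochner_Integration.integrable_cong) (simp_all add: h)
  also have "\<dots> \<longleftrightarrow> integrable (density N (\<lambda>_. ennreal mass)) H"
    unfolding d[symmetric] by (rule integrable_distr_eq[OF measurable_cylinder_coord H, symmetric])
  also have "\<dots> \<longleftrightarrow> integrable N H"
    using mass_pos HN by (subst integrable_density) auto
  finally show "integrable \<mu> h \<longleftrightarrow> integrable N H" .
qed

lemma point_has_derivative:
  "((\<lambda>z. point (fst z) (snd z)) has_derivative (\<lambda>h. (r *\<^sub>R L (fst h), snd h))) (at z)"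
proof -
  have "((\<lambda>z. (q + r *\<^sub>R L (fst z), snd z)) has_derivative (\<lambda>h. (0 + r *\<^sub>R L (fst h), snd h))) (at z)"
    by (intro has_derivative_Pair has_derivative_add has_derivative_const has_derivative_scaleR_right
        bounded_linear.has_derivative[OF bounded_linear_L] has_derivative_fst has_derivative_snd has_derivative_ident)
  then show ?thesis by (simp add: point_def)
qed

lemma continuous_point: "continuous_on X (\<lambda>z. point (fst z) (snd z))"
  using point_has_derivative has_derivative_continuous by (blast intro: continuous_at_imp_continuous_on)

end

locale tube_function = space_form_tube b M \<kappa> cs sn p \<rho> l L
  for b :: "'w::euclidean_space bilinear_form" and M \<kappa> cs sn p \<rho> l and L :: "real^'n::finite \<Rightarrow> 'w" +
  fixes u :: "'w \<times> real \<Rightarrow> real"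
  assumes smooth_u: "smooth_on UNIV u" and card: "CARD('n) \<ge> 2"
begin

definition "f x t = u (point x t)"
definition "gt x t = frechet_derivative u (at (point x t)) (0, 1)"
text \<open>The factor \<open>r\<close> is the derivative of \<open>point\<close> in the sphere
  variable: this is the gradient of \<open>f\<close> on the unit cylinder, not that of
  \<open>u\<close> on the tube.\<close>

definition gx :: "real^'n \<Rightarrow> real \<Rightarrow> real^'n" where
  "gx x t = (\<chi> i. r * frechet_derivative u (at (point x t)) (L (axis i 1), 0))"

lemma u_derivative: "(u has_derivative frechet_derivative u (at z)) (at z)"
  by (rule smooth_on_has_derivative[OF smooth_u UNIV_I])

lemma linear_Du: "linear (frechet_derivative u (at z))"
  by (rule has_derivative_linear[OF u_derivative])

lemma gx_inner: "gx x t \<bullet> h = r * frechet_derivative u (at (point x t)) (L h, 0)"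
proof -
  let ?D = "\<lambda>h. frechet_derivative u (at (point x t)) (L h, 0)"
  have lin: "linear ?D"
  proof (rule linearI)
    show "?D (h + k) = ?D h + ?D k" for h k
      using linear_add[OF linear_Du, of "point x t" "(L h, 0)" "(L k, 0)"] by (simp add: linear_add[OF linear_L])
    show "?D (a *\<^sub>R h) = a *\<^sub>R ?D h" for a h
      using linear_cmul[OF linear_Du, of "point x t" a "(L h, 0)"] by (simp add: linear_cmul[OF linear_L])
  qed
  have h: "h = (\<Sum>i\<in>UNIV. (h $ i) *\<^sub>R axis i 1)"
    by (simp add: vec_eq_iff axis_def if_distrib cong: if_cong)
  have "?D h = ?D (\<Sum>i\<in>UNIV. (h $ i) *\<^sub>R axis i 1)" using h by simp
  also have "\<dots> = (\<Sum>i\<in>UNIV. (h $ i) * ?D (axis i 1))"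
    by (simp add: linear_sum[OF lin] linear_cmul[OF lin])
  finally show ?thesis by (simp add: inner_vec_def gx_def sum_distrib_left mult_ac)
qed

lemma Du_split: "frechet_derivative u (at (point x t)) (L v, s) = (gx x t \<bullet> v) / r + gt x t * s"
proof -
  have "(L v, s) = (L v, 0) + s *\<^sub>R (0, 1)" by simp
  then have "frechet_derivative u (at (point x t)) (L v, s) =
     frechet_derivative u (at (point x t)) (L v, 0) + s *\<^sub>R frechet_derivative u (at (point x t)) (0, 1)"
    by (metis linear_add[OF linear_Du] linear_cmul[OF linear_Du])
  then show ?thesis using r_pos by (simp add: gx_inner gt_def)
qed

sublocale cyl: cylinder_function f gx gt l
proof
  show "((\<lambda>z. f (fst z) (snd z)) has_derivative (\<lambda>h. gx x t \<bullet> fst h + gt x t * snd h)) (at (x, t))" for x t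
  proof -
    have "((\<lambda>z. u (point (fst z) (snd z))) has_derivative
        (\<lambda>h. frechet_derivative u (at (point (fst (x, t)) (snd (x, t)))) (r *\<^sub>R L (fst h), snd h))) (at (x, t))"
      by (rule has_derivative_compose[OF point_has_derivative u_derivative])
    then show ?thesis
      unfolding f_def
      by (rule has_derivative_eq_rhs) (use r_pos in \<open>simp add: fun_eq_iff linear_cmul[OF linear_L, symmetric] Du_split\<close>)
  qed
  have c: "continuous_on UNIV (\<lambda>z. frechet_derivative u (at (point (fst z) (snd z))) v)" for v
    by (rule continuous_on_compose2[OF smooth_on_continuous_on[OF smooth_on_frechet_derivative[OF smooth_u]] continuous_point]) simp
  show "continuous_on UNIV (\<lambda>z. gx (fst z) (snd z))" "continuous_on UNIV (\<lambda>z. gt (fst z) (snd z))"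
    unfolding gx_def gt_def by (intro continuous_intros c)+
qed (use card l_pos in auto)

text \<open>The tangential part of the gradient on the unit sphere, divided by \<open>r\<close> for
  a sphere of radius \<open>r\<close>, together with the height derivative.\<close>

definition grad :: "real^'n \<Rightarrow> real \<Rightarrow> 'w \<times> real" where
  "grad x t = (L ((gx x t - (gx x t \<bullet> x) *\<^sub>R x) /\<^sub>R r), gt x t)"

lemma gradient_eq:
  assumes \<omega>: "norm \<omega> = 1" and t: "t \<in> {0..l}"
  shows "gradient B2 \<Sigma> u (point \<omega> t) = grad \<omega> t" "grad \<omega> t \<in> tangent_space \<Sigma> (point \<omega> t)"
    "B2 (grad \<omega> t) (grad \<omega> t) = ((norm (gx \<omega> t))\<^sup>2 - (gx \<omega> t \<bullet> \<omega>)\<^sup>2) / r\<^sup>2 + (gt \<omega> t)\<^sup>2"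
proof -
  have z: "point \<omega> t \<in> \<Sigma>" by (rule point_in_\<Sigma>[OF \<omega> t])
  interpret pf: positive_form B2 "tangent_space \<Sigma> (point \<omega> t)" by (rule positive_form_\<Sigma>[OF z])
  have \<omega>\<omega>: "\<omega> \<bullet> \<omega> = 1" using \<omega> by (simp add: norm_eq_1)
  have perp: "(gx \<omega> t - (gx \<omega> t \<bullet> \<omega>) *\<^sub>R \<omega>) \<bullet> \<omega> = 0" by (simp add: inner_diff_left \<omega>\<omega>)
  show T: "grad \<omega> t \<in> tangent_space \<Sigma> (point \<omega> t)"
    unfolding tangent_space_\<Sigma>_iff[OF \<omega> t] grad_def using perp by (intro exI[of _ "(gx \<omega> t - (gx \<omega> t \<bullet> \<omega>) *\<^sub>R \<omega>) /\<^sub>R r"]) simp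
  have char: "B2 (grad \<omega> t) v = frechet_derivative u (at (point \<omega> t)) v" if "v \<in> tangent_space \<Sigma> (point \<omega> t)" for v
  proof -
    obtain w where w: "fst v = L w" "w \<bullet> \<omega> = 0" using \<open>v \<in> _\<close> unfolding tangent_space_\<Sigma>_iff[OF \<omega> t] by blast
    then have v: "v = (L w, snd v)" by (metis prod.collapse)
    have "B2 (grad \<omega> t) v = (gx \<omega> t \<bullet> w) / r + gt \<omega> t * snd v"
      using w by (simp add: grad_def product_form_def isometry inner_diff_left inner_diff_right inner_commute divide_inverse mult.commute)
    then show ?thesis by (subst (2) v) (simp add: Du_split)
  qed
  show "gradient B2 \<Sigma> u (point \<omega> t) = grad \<omega> t"
    unfolding gradient_def
  proof (rule the_equality)
    fix g assume g: "g \<in> tangent_space \<Sigma> (point \<omega> t) \<and> (\<forall>v\<in>tangent_space \<Sigma> (point \<omega> t). B2 g v = frechet_derivative u (at (point \<omega> t)) v)"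
    then have d: "g - grad \<omega> t \<in> tangent_space \<Sigma> (point \<omega> t)" using T by (intro subspace_diff) auto
    then have "B2 (g - grad \<omega> t) (g - grad \<omega> t) = 0" using g char by (simp add: B2.diff_left)
    then show "g = grad \<omega> t" using pf.pos[OF d] by fastforce
  qed (use T char in blast)
  have "(gx \<omega> t - (gx \<omega> t \<bullet> \<omega>) *\<^sub>R \<omega>) \<bullet> (gx \<omega> t - (gx \<omega> t \<bullet> \<omega>) *\<^sub>R \<omega>) = (norm (gx \<omega> t))\<^sup>2 - (gx \<omega> t \<bullet> \<omega>)\<^sup>2"
    unfolding power2_norm_eq_inner using \<omega>\<omega> by (simp add: inner_simps inner_commute power2_eq_square)
  then show "B2 (grad \<omega> t) (grad \<omega> t) = ((norm (gx \<omega> t))\<^sup>2 - (gx \<omega> t \<bullet> \<omega>)\<^sup>2) / r\<^sup>2 + (gt \<omega> t)\<^sup>2"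
    by (simp add: grad_def product_form_def isometry power2_eq_square divide_inverse mult_ac)
qed

lemma gradient_\<Sigma>:
  assumes "z \<in> \<Sigma>"
  shows "gradient B2 \<Sigma> u z = (\<lambda>(x, t). grad x t) (cylinder_coord z)" "gradient B2 \<Sigma> u z \<in> tangent_space \<Sigma> z"
    "B2 (gradient B2 \<Sigma> u z) (gradient B2 \<Sigma> u z) =
      (\<lambda>(x, t). ((norm (gx x t))\<^sup>2 - (gx x t \<bullet> x)\<^sup>2) / r\<^sup>2 + (gt x t)\<^sup>2) (cylinder_coord z)"
  using assms by (auto elim!: \<Sigma>_cases simp: gradient_eq)

lemma gradient_measurable: "gradient B2 \<Sigma> u \<in> borel_measurable \<mu>"
proof -
  have "continuous_on UNIV (\<lambda>z. grad (fst (cylinder_coord z)) (snd (cylinder_coord z)))"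
  proof -
    have "continuous_on UNIV (\<lambda>w. grad (fst w) (snd w))"
      unfolding grad_def
      by (intro continuous_intros linear_continuous_on_compose[OF _ linear_L] cyl.cont)
    from continuous_on_compose2[OF this continuous_coords(1)] show ?thesis by simp
  qed
  from borel_measurable_\<mu>[OF this] show ?thesis
    by (rule measurable_cong[THEN iffD1, rotated]) (simp add: gradient_\<Sigma> case_prod_beta)
qed

lemma finite_\<mu>: "finite_measure \<mu>" and mass_\<mu>: "measure \<mu> \<Sigma> = mass * (measure (sphere_measure :: (real^'n) measure) UNIV * l)"
proof -
  interpret NN: finite_measure N by (rule finite_measure_pair_measure) unfold_locales
  have U: "UNIV \<in> sets (borel \<Otimes>\<^sub>M borel :: ((real^'n) \<times> real) measure)" unfolding borel_prod by simp
  have "emeasure \<mu> \<Sigma> = emeasure (distr \<mu> (borel \<Otimes>\<^sub>M borel) cylinder_coord) UNIV"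
    by (subst emeasure_distr[OF measurable_cylinder_coord U]) simp
  also have "\<dots> \<noteq> \<infinity>"
    unfolding distr_\<mu>_cylinder_coord using NN.emeasure_finite by (auto simp: ennreal_mult_eq_top_iff)
  finally show "finite_measure \<mu>" by (intro finite_measureI) simp
  have "(\<integral>z. (1::real) \<partial>\<mu>) = mass * (\<integral>w. 1 \<partial>N)" by (rule integral_\<mu>(1)) auto
  moreover have "(\<integral>w. (1::real) \<partial>N) = (\<integral>x. \<integral>t. 1 \<partial>segment_measure l \<partial>(sphere_measure :: (real^'n) measure))"
    by (rule cyl.fubini(1)[symmetric, of "\<lambda>_ _. 1"]) (auto intro: cyl.bounded_on_cylinder_continuous)
  ultimately show "measure \<mu> \<Sigma> = mass * (measure (sphere_measure :: (real^'n) measure) UNIV * l)"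
    using cyl.masses(2) by simp
qed

lemma integrable_u: "integrable \<mu> u" "integrable \<mu> (\<lambda>z. (u z)\<^sup>2)" "integrable \<mu> (\<lambda>z. B2 (gradient B2 \<Sigma> u z) (gradient B2 \<Sigma> u z))"
  and poincare: "(real CARD('n) - 1) / r\<^sup>2 \<le> (pi / l)\<^sup>2 \<Longrightarrow>
    (real CARD('n) - 1) / r\<^sup>2 * ((\<integral>z. (u z)\<^sup>2 \<partial>\<mu>) - (\<integral>z. u z \<partial>\<mu>)\<^sup>2 / measure \<mu> \<Sigma>) \<le>
      (\<integral>z. B2 (gradient B2 \<Sigma> u z) (gradient B2 \<Sigma> u z) \<partial>\<mu>)"
proof -
  have cf: "continuous_on UNIV (\<lambda>w. f (fst w) (snd w))"
    unfolding f_def by (rule continuous_on_compose2[OF smooth_on_continuous_on[OF smooth_u] continuous_point]) simp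
  have cg: "continuous_on UNIV (\<lambda>w. ((norm (gx (fst w) (snd w)))\<^sup>2 - (gx (fst w) (snd w) \<bullet> fst w)\<^sup>2) / r\<^sup>2 + (gt (fst w) (snd w))\<^sup>2)"
    using r_pos by (intro continuous_intros cyl.cont) auto
  have m: "(\<lambda>w. h w) \<in> borel_measurable (borel \<Otimes>\<^sub>M borel)" if "continuous_on UNIV h" for h :: "(real^'n) \<times> real \<Rightarrow> real"
    using that unfolding borel_prod by (rule borel_measurable_continuous_onI)
  have i: "integrable N (\<lambda>w. h (fst w) (snd w))" if "continuous_on UNIV (\<lambda>w. h (fst w) (snd w))" for h :: "real^'n \<Rightarrow> real \<Rightarrow> real"
    by (rule cyl.bounded_slices(3)[OF cyl.bounded_on_cylinder_continuous[OF that]])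
  have u: "u z = f (fst (cylinder_coord z)) (snd (cylinder_coord z))" if "z \<in> \<Sigma>" for z
    using point_cylinder_coord[OF that] by (simp add: f_def)
  note 1 = integral_\<mu>[OF m[OF cf] u]
  have cf2: "continuous_on UNIV (\<lambda>w. (f (fst w) (snd w))\<^sup>2)" by (intro continuous_intros cf)
  have 2: "(\<integral>z. (u z)\<^sup>2 \<partial>\<mu>) = mass * (\<integral>w. (f (fst w) (snd w))\<^sup>2 \<partial>N)"
    "integrable \<mu> (\<lambda>z. (u z)\<^sup>2) \<longleftrightarrow> integrable N (\<lambda>w. (f (fst w) (snd w))\<^sup>2)"
    by (rule integral_\<mu>[OF m[OF cf2]]; simp add: u)+
  have 3: "(\<integral>z. B2 (gradient B2 \<Sigma> u z) (gradient B2 \<Sigma> u z) \<partial>\<mu>) =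
      mass * (\<integral>w. ((norm (gx (fst w) (snd w)))\<^sup>2 - (gx (fst w) (snd w) \<bullet> fst w)\<^sup>2) / r\<^sup>2 + (gt (fst w) (snd w))\<^sup>2 \<partial>N)"
    "integrable \<mu> (\<lambda>z. B2 (gradient B2 \<Sigma> u z) (gradient B2 \<Sigma> u z)) \<longleftrightarrow>
      integrable N (\<lambda>w. ((norm (gx (fst w) (snd w)))\<^sup>2 - (gx (fst w) (snd w) \<bullet> fst w)\<^sup>2) / r\<^sup>2 + (gt (fst w) (snd w))\<^sup>2)"
    by (rule integral_\<mu>[OF m[OF cg]]; simp add: gradient_\<Sigma>(3) case_prod_beta)+
  show "integrable \<mu> u" using 1(2) i[OF cf] by simp
  show "integrable \<mu> (\<lambda>z. (u z)\<^sup>2)" using 2(2) i[OF cf2] by simp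
  show "integrable \<mu> (\<lambda>z. B2 (gradient B2 \<Sigma> u z) (gradient B2 \<Sigma> u z))" using 3(2) i[OF cg] by simp
  assume K: "(real CARD('n) - 1) / r\<^sup>2 \<le> (pi / l)\<^sup>2"
  define V where "V = measure (sphere_measure :: (real^'n) measure) UNIV * l"
  have V: "V > 0" using cyl.masses(1) l_pos by (simp add: V_def)
  have scale: "c * (mass * A - (mass * I)\<^sup>2 / (mass * V)) = mass * (c * (A - I\<^sup>2 / V))" for c A I
    using mass_pos by (simp add: power2_eq_square algebra_simps)
  have I: "(\<integral>z. u z \<partial>\<mu>) = mass * (\<integral>w. f (fst w) (snd w) \<partial>N)" using 1(1) by simp
  have "(real CARD('n) - 1) / r\<^sup>2 * ((\<integral>z. (u z)\<^sup>2 \<partial>\<mu>) - (\<integral>z. u z \<partial>\<mu>)\<^sup>2 / measure \<mu> \<Sigma>) =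
     mass * ((real CARD('n) - 1) / r\<^sup>2 * ((\<integral>w. (f (fst w) (snd w))\<^sup>2 \<partial>N) - (\<integral>w. f (fst w) (snd w) \<partial>N)\<^sup>2 / V))"
    unfolding I 2(1) mass_\<mu> V_def[symmetric] by (rule scale)
  also have "\<dots> \<le> mass * (\<integral>w. ((norm (gx (fst w) (snd w)))\<^sup>2 - (gx (fst w) (snd w) \<bullet> fst w)\<^sup>2) / r\<^sup>2 + (gt (fst w) (snd w))\<^sup>2 \<partial>N)"
    using cyl.cylinder_poincare_inequality[OF r_pos K] mass_pos by (intro mult_left_mono) (auto simp: V_def)
  finally show "(real CARD('n) - 1) / r\<^sup>2 * ((\<integral>z. (u z)\<^sup>2 \<partial>\<mu>) - (\<integral>z. u z \<partial>\<mu>)\<^sup>2 / measure \<mu> \<Sigma>) \<le>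
      (\<integral>z. B2 (gradient B2 \<Sigma> u z) (gradient B2 \<Sigma> u z) \<partial>\<mu>)" unfolding 3(1) .
qed

end

section \<open>From smooth functions to the Sobolev space\<close>

lemma square_young:
  fixes a c e :: real
  assumes "e > 0"
  shows "c\<^sup>2 \<le> (1 + e) * a\<^sup>2 + (1 + 1 / e) * (a - c)\<^sup>2"
proof -
  \<comment> \<open>Expanding this square leaves the constant \<open>1 + e\<close> at the main term,
    so the sharp constant survives the limit \<open>e\<close> to 0.\<close>
  have "0 \<le> (e * a + (a - c))\<^sup>2 / e" using assms by simp
  also have "\<dots> = (1 + e) * a\<^sup>2 + (1 + 1 / e) * (a - c)\<^sup>2 - c\<^sup>2"
    using assms by (simp add: power2_eq_square field_simps)
  finally show ?thesis by simp
qed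

lemma (in positive_form) nonneg: "v \<in> V \<Longrightarrow> 0 \<le> b v v"
proof (cases "v = 0")
  case True
  then show ?thesis using bounded_bilinear.zero_left[OF bilinear] by simp
qed (use pos in \<open>simp add: less_imp_le\<close>)

lemma (in positive_form) young:
  assumes "g \<in> V" "G \<in> V" "e > 0"
  shows "b G G \<le> (1 + e) * b g g + (1 + 1 / e) * b (g - G) (g - G)"
proof -
  interpret bounded_bilinear b by (rule bilinear)
  have "e *\<^sub>R g + (g - G) \<in> V" using assms subspace by (intro subspace_add subspace_scale subspace_diff)
  then have "0 \<le> b (e *\<^sub>R g + (g - G)) (e *\<^sub>R g + (g - G)) / e" using nonneg assms(3) by simp
  also have "\<dots> = (1 + e) * b g g + (1 + 1 / e) * b (g - G) (g - G) - b G G"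
    using assms(3) by (simp add: add_left add_right diff_left diff_right scaleR_left scaleR_right sym[of G g] field_simps)
  finally show ?thesis by simp
qed

text \<open>\<open>F\<close> and \<open>U\<close> stand for the squared norms of the function and
  its approximant, \<open>X\<close> and \<open>Q\<close> for their energies, \<open>I\<close> for
  the mean term of the approximant, \<open>a\<close> and \<open>c\<close> for the approximation
  errors. Errors of size \<open>e\<^sup>2\<close> absorb the large factor \<open>1 + 1 / e\<close>
  and leave \<open>e\<^sup>2 + e\<close>.\<close>

lemma poincare_perturbation:
  fixes K F U I a c Q X e :: real
  assumes e: "e > 0" and K: "K \<ge> 0"
    and F: "F \<le> (1 + e) * U + (1 + 1 / e) * a" and Q: "Q \<le> (1 + e) * X + (1 + 1 / e) * c"
    and KU: "K * (U - I) \<le> Q" and I: "I \<le> a" and a: "a \<le> e\<^sup>2" and c: "c \<le> e\<^sup>2"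
  shows "K * F \<le> (1 + e) * ((1 + e) * X + (e\<^sup>2 + e) + K * e\<^sup>2) + K * (e\<^sup>2 + e)"
proof -
  have E: "(1 + 1 / e) * x \<le> e\<^sup>2 + e" if "x \<le> e\<^sup>2" for x
  proof -
    have "(1 + 1 / e) * x \<le> (1 + 1 / e) * e\<^sup>2" using that e by (intro mult_left_mono) auto
    also have "\<dots> = e\<^sup>2 + e" using e by (simp add: power2_eq_square field_simps)
    finally show ?thesis .
  qed
  have "K * I \<le> K * e\<^sup>2" using I a K by (intro mult_left_mono) auto
  moreover have "K * U - K * I \<le> Q" using KU by (simp add: right_diff_distrib)
  moreover note Q E[OF c]
  ultimately have "K * U \<le> (1 + e) * X + (e\<^sup>2 + e) + K * e\<^sup>2" by linarith
  then have 1: "(1 + e) * (K * U) \<le> (1 + e) * ((1 + e) * X + (e\<^sup>2 + e) + K * e\<^sup>2)"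
    using e by (intro mult_left_mono) auto
  have "F \<le> (1 + e) * U + (e\<^sup>2 + e)" using F E[OF a] by linarith
  then have "K * F \<le> K * ((1 + e) * U + (e\<^sup>2 + e))" using K by (rule mult_left_mono)
  also have "\<dots> = (1 + e) * (K * U) + K * (e\<^sup>2 + e)" by (simp add: algebra_simps)
  finally show ?thesis using 1 by linarith
qed

context space_form_tube
begin

lemma quadratic_form_nonneg:
  assumes card: "CARD('n) \<ge> 2" and K: "(real CARD('n) - 1) / r\<^sup>2 \<le> (pi / l)\<^sup>2"
    and H1: "sobolev_H1_gradient TYPE('n) B2 \<Sigma> f G" and mean: "(\<integral>z. f z \<partial>\<mu>) = 0"
  shows "0 \<le> (\<integral>z. B2 (G z) (G z) - (real CARD('n) - 1) / r\<^sup>2 * (f z)\<^sup>2 \<partial>\<mu>)"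
proof -
  define k where "k = (real CARD('n) - 1) / r\<^sup>2"
  have k: "k \<ge> 0" using card by (simp add: k_def)
  obtain u where f: "f \<in> borel_measurable \<mu>" and G: "G \<in> borel_measurable \<mu>" and tG: "\<And>z. z \<in> \<Sigma> \<Longrightarrow> G z \<in> tangent_space \<Sigma> z"
    and u: "\<And>i. smooth_on UNIV (u i)"
    and lim: "(\<lambda>i. \<integral>\<^sup>+z. ennreal ((u i z - f z)\<^sup>2) \<partial>\<mu>) \<longlonglongrightarrow> 0"
      "(\<lambda>i. \<integral>\<^sup>+z. ennreal (B2 (gradient B2 \<Sigma> (u i) z - G z) (gradient B2 \<Sigma> (u i) z - G z)) \<partial>\<mu>) \<longlonglongrightarrow> 0"
    using H1 unfolding sobolev_H1_gradient_def riemannian_measure_eq Let_def by blast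
  have tf: "tube_function b M \<kappa> cs sn p \<rho> l L (u i)" for i
    by (intro tube_function.intro space_form_tube_axioms tube_function_axioms.intro u card)
  have B2m: "(\<lambda>z. B2 (h z) (h z)) \<in> borel_measurable \<mu>" if "h \<in> borel_measurable \<mu>" for h
    by (rule borel_measurable_continuous_on[OF _ that]) (intro B2.continuous_on continuous_on_id)
  let ?F = "\<integral>z. (f z)\<^sup>2 \<partial>\<mu>" and ?X = "\<integral>z. B2 (G z) (G z) \<partial>\<mu>"
  \<comment> \<open>The definition of \<open>sobolev_H1_gradient\<close> asks for measurability
    only. Square integrability of \<open>f\<close> and \<open>G\<close> follows from domination by
    an approximant plus a small error.\<close>
  have step: "integrable \<mu> (\<lambda>z. (f z)\<^sup>2)" "integrable \<mu> (\<lambda>z. B2 (G z) (G z))"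
    "k * ?F \<le> (1 + e) * ((1 + e) * ?X + (e\<^sup>2 + e) + k * e\<^sup>2) + k * (e\<^sup>2 + e)" if e: "e > 0" for e
  proof -
    have "ennreal (e\<^sup>2) > 0" using e by simp
    then have "\<forall>\<^sub>F i in sequentially. (\<integral>\<^sup>+z. ennreal ((u i z - f z)\<^sup>2) \<partial>\<mu>) < ennreal (e\<^sup>2) \<and>
        (\<integral>\<^sup>+z. ennreal (B2 (gradient B2 \<Sigma> (u i) z - G z) (gradient B2 \<Sigma> (u i) z - G z)) \<partial>\<mu>) < ennreal (e\<^sup>2)"
      by (intro eventually_conj order_tendstoD(2)[OF lim(1)] order_tendstoD(2)[OF lim(2)])
    then obtain i where i: "(\<integral>\<^sup>+z. ennreal ((u i z - f z)\<^sup>2) \<partial>\<mu>) < ennreal (e\<^sup>2)"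
      "(\<integral>\<^sup>+z. ennreal (B2 (gradient B2 \<Sigma> (u i) z - G z) (gradient B2 \<Sigma> (u i) z - G z)) \<partial>\<mu>) < ennreal (e\<^sup>2)"
      using eventually_happens sequentially_bot by blast
    interpret tu: tube_function b M \<kappa> cs sn p \<rho> l L "u i" by (rule tf)
    interpret F: finite_measure \<mu> by (rule tu.finite_\<mu>)
    define g where "g = gradient B2 \<Sigma> (u i)"
    have tg: "g z \<in> tangent_space \<Sigma> z" if "z \<in> \<Sigma>" for z using tu.gradient_\<Sigma>(2)[OF that] by (simp add: g_def)
    have gm: "g \<in> borel_measurable \<mu>" using tu.gradient_measurable by (simp add: g_def)
    have um: "u i \<in> borel_measurable \<mu>" by (rule borel_measurable_\<mu>[OF smooth_on_continuous_on[OF u]])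
    have small: "integrable \<mu> h" "(\<integral>z. h z \<partial>\<mu>) \<le> e\<^sup>2"
      if "h \<in> borel_measurable \<mu>" "\<And>z. z \<in> \<Sigma> \<Longrightarrow> 0 \<le> h z" "(\<integral>\<^sup>+z. ennreal (h z) \<partial>\<mu>) < ennreal (e\<^sup>2)" for h
    proof -
      have nn: "AE z in \<mu>. 0 \<le> h z" using that(2) by (intro AE_I2) simp
      have "(\<integral>\<^sup>+z. ennreal (h z) \<partial>\<mu>) < \<infinity>" using that(3) by (rule less_trans) simp
      then show int: "integrable \<mu> h" by (rule integrableI_nonneg[OF that(1) nn])
      have "ennreal (\<integral>z. h z \<partial>\<mu>) < ennreal (e\<^sup>2)"
        using that(3) unfolding nn_integral_eq_integral[OF int nn] .
      then show "(\<integral>z. h z \<partial>\<mu>) \<le> e\<^sup>2" by (simp add: ennreal_less_iff integral_nonneg_AE[OF nn])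
    qed
    have Dm: "(\<lambda>z. (u i z - f z)\<^sup>2) \<in> borel_measurable \<mu>" by (intro borel_measurable_power borel_measurable_diff um f)
    note D = small[OF Dm _ i(1), simplified]
    have d: "g z - G z \<in> tangent_space \<Sigma> z" if "z \<in> \<Sigma>" for z
      by (intro subspace_diff subspace_tangent_space tg tG that)
    have "0 \<le> B2 (g z - G z) (g z - G z)" if "z \<in> \<Sigma>" for z
      by (rule positive_form.nonneg[OF positive_form_\<Sigma>[OF that] d[OF that]])
    note C = small[OF B2m[OF borel_measurable_diff[OF gm G]] this i(2)[folded g_def]]
    have iu: "integrable \<mu> (\<lambda>z. (u i z)\<^sup>2)" by (rule tu.integrable_u(2))
    have ig: "integrable \<mu> (\<lambda>z. B2 (g z) (g z))" unfolding g_def by (rule tu.integrable_u(3))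
    have fD: "integrable \<mu> (\<lambda>z. (1 + e) * (u i z)\<^sup>2 + (1 + 1 / e) * (u i z - f z)\<^sup>2)"
      by (intro Bochner_Integration.integrable_add integrable_mult_right iu D(1))
    have f2m: "(\<lambda>z. (f z)\<^sup>2) \<in> borel_measurable \<mu>" by (intro borel_measurable_power f)
    have f2: "(f z)\<^sup>2 \<le> (1 + e) * (u i z)\<^sup>2 + (1 + 1 / e) * (u i z - f z)\<^sup>2" for z by (rule square_young[OF e])
    show i1: "integrable \<mu> (\<lambda>z. (f z)\<^sup>2)"
      by (rule Bochner_Integration.integrable_bound[OF fD f2m]) (intro AE_I2, use f2 abs_ge_self order_trans in fastforce)
    \<comment> \<open>Applied in both directions: \<open>G\<close> against \<open>g\<close> yields
      integrability, and \<open>g\<close> against \<open>G\<close> yields the energy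
      estimate.\<close>
    have dominated: "integrable \<mu> (\<lambda>z. B2 (h z) (h z))" "(\<integral>z. B2 (h z) (h z) \<partial>\<mu>) \<le> (1 + e) * (\<integral>z. B2 (h' z) (h' z) \<partial>\<mu>) + (1 + 1 / e) * (\<integral>z. B2 (g z - G z) (g z - G z) \<partial>\<mu>)"
      if h: "h \<in> borel_measurable \<mu>" "integrable \<mu> (\<lambda>z. B2 (h' z) (h' z))"
        "\<And>z. z \<in> \<Sigma> \<Longrightarrow> h z \<in> tangent_space \<Sigma> z" "\<And>z. z \<in> \<Sigma> \<Longrightarrow> h' z \<in> tangent_space \<Sigma> z"
        "\<And>z. B2 (h' z - h z) (h' z - h z) = B2 (g z - G z) (g z - G z)" for h h'
    proof -
      have int: "integrable \<mu> (\<lambda>z. (1 + e) * B2 (h' z) (h' z) + (1 + 1 / e) * B2 (g z - G z) (g z - G z))"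
        by (intro Bochner_Integration.integrable_add integrable_mult_right h C(1))
      have le: "0 \<le> B2 (h z) (h z)" "B2 (h z) (h z) \<le> (1 + e) * B2 (h' z) (h' z) + (1 + 1 / e) * B2 (g z - G z) (g z - G z)"
        if z: "z \<in> \<Sigma>" for z
        using positive_form.nonneg[OF positive_form_\<Sigma>[OF z], of "h z"] positive_form.young[OF positive_form_\<Sigma>[OF z], of "h' z" "h z" e]
          h(3,4)[OF z] e h(5)[of z] by simp_all
      show 1: "integrable \<mu> (\<lambda>z. B2 (h z) (h z))"
        by (rule Bochner_Integration.integrable_bound[OF int B2m[OF h(1)]])
          (intro AE_I2, use le in \<open>fastforce intro: order_trans[OF _ abs_ge_self]\<close>)
      have "(\<integral>z. B2 (h z) (h z) \<partial>\<mu>) \<le> (\<integral>z. (1 + e) * B2 (h' z) (h' z) + (1 + 1 / e) * B2 (g z - G z) (g z - G z) \<partial>\<mu>)"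
        by (rule integral_mono[OF 1 int]) (simp add: le)
      also have "\<dots> = (1 + e) * (\<integral>z. B2 (h' z) (h' z) \<partial>\<mu>) + (1 + 1 / e) * (\<integral>z. B2 (g z - G z) (g z - G z) \<partial>\<mu>)"
        by (subst Bochner_Integration.integral_add) (use h(2) C(1) in auto)
      finally show "(\<integral>z. B2 (h z) (h z) \<partial>\<mu>) \<le> (1 + e) * (\<integral>z. B2 (h' z) (h' z) \<partial>\<mu>) + (1 + 1 / e) * (\<integral>z. B2 (g z - G z) (g z - G z) \<partial>\<mu>)" .
    qed
    show i2: "integrable \<mu> (\<lambda>z. B2 (G z) (G z))"
      by (rule dominated(1)[OF G ig tG tg refl])
    have sw: "B2 (G z - g z) (G z - g z) = B2 (g z - G z) (g z - G z)" for z
      by (simp add: B2.diff_left B2.diff_right)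
    have Q: "(\<integral>z. B2 (g z) (g z) \<partial>\<mu>) \<le> (1 + e) * ?X + (1 + 1 / e) * (\<integral>z. B2 (g z - G z) (g z - G z) \<partial>\<mu>)"
      by (rule dominated(2)[OF gm i2 tg tG sw])
    have "?F \<le> (\<integral>z. (1 + e) * (u i z)\<^sup>2 + (1 + 1 / e) * (u i z - f z)\<^sup>2 \<partial>\<mu>)"
      by (rule integral_mono[OF i1 fD f2])
    also have "\<dots> = (1 + e) * (\<integral>z. (u i z)\<^sup>2 \<partial>\<mu>) + (1 + 1 / e) * (\<integral>z. (u i z - f z)\<^sup>2 \<partial>\<mu>)"
      by (subst Bochner_Integration.integral_add) (use iu D(1) in auto)
    finally have Fle: "?F \<le> (1 + e) * (\<integral>z. (u i z)\<^sup>2 \<partial>\<mu>) + (1 + 1 / e) * (\<integral>z. (u i z - f z)\<^sup>2 \<partial>\<mu>)" .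
    have fi: "integrable \<mu> f" by (rule F.square_integrable_imp_integrable[OF f i1])
    have V: "measure \<mu> (space \<mu>) \<noteq> 0"
      using tu.mass_\<mu> mass_pos tu.cyl.masses(1) l_pos by simp
    \<comment> \<open>The approximant need not have mean zero. As \<open>f\<close> does, its mean is
      that of the error, so the mean term is bounded by the squared error.\<close>
    have "(\<integral>z. u i z - f z \<partial>\<mu>) = (\<integral>z. u i z \<partial>\<mu>)"
      using mean by (simp add: Bochner_Integration.integral_diff[OF tu.integrable_u(1) fi])
    then have I: "(\<integral>z. u i z \<partial>\<mu>)\<^sup>2 / measure \<mu> \<Sigma> \<le> (\<integral>z. (u i z - f z)\<^sup>2 \<partial>\<mu>)"
      using F.square_integral_le[OF Bochner_Integration.integrable_diff[OF tu.integrable_u(1) fi] D(1) V] by simp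
    show "k * ?F \<le> (1 + e) * ((1 + e) * ?X + (e\<^sup>2 + e) + k * e\<^sup>2) + k * (e\<^sup>2 + e)"
      by (rule poincare_perturbation[OF e k Fle Q tu.poincare[OF K, folded k_def g_def] I D(2) C(2)])
  qed
  have "((\<lambda>e. (1 + e) * ((1 + e) * ?X + (e\<^sup>2 + e) + k * e\<^sup>2) + k * (e\<^sup>2 + e)) \<longlongrightarrow>
      (1 + 0) * ((1 + 0) * ?X + (0\<^sup>2 + 0) + k * 0\<^sup>2) + k * (0\<^sup>2 + 0)) (at_right 0)"
    by (intro tendsto_intros)
  moreover have "\<forall>\<^sub>F e in at_right 0. k * ?F \<le> (1 + e) * ((1 + e) * ?X + (e\<^sup>2 + e) + k * e\<^sup>2) + k * (e\<^sup>2 + e)"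
    using step(3) by (intro eventually_at_rightI[of 0 1]) auto
  ultimately have "k * ?F \<le> (1 + 0) * ((1 + 0) * ?X + (0\<^sup>2 + 0) + k * 0\<^sup>2) + k * (0\<^sup>2 + 0)"
    by (rule tendsto_lowerbound) simp
  then have "k * ?F \<le> ?X" by simp
  moreover have "(\<integral>z. B2 (G z) (G z) - k * (f z)\<^sup>2 \<partial>\<mu>) = ?X - k * ?F"
    using step(1,2)[of 1] by (subst Bochner_Integration.integral_diff) auto
  ultimately show ?thesis by (simp add: k_def)
qed

end

context tube_function
begin

lemma sobolev_H1_gradient_smooth: "sobolev_H1_gradient TYPE('n) B2 \<Sigma> u (gradient B2 \<Sigma> u)"
proof -
  have "u \<in> borel_measurable \<mu>" by (rule borel_measurable_\<mu>[OF smooth_on_continuous_on[OF smooth_u]])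
  then show ?thesis
    unfolding sobolev_H1_gradient_def riemannian_measure_eq Let_def
    using gradient_measurable gradient_\<Sigma>(2) smooth_u
    by (intro conjI exI[of _ "\<lambda>_. u"]) (auto simp: B2.zero_left)
qed

lemma integral_height:
  fixes h :: "real \<Rightarrow> real"
  assumes h: "continuous_on UNIV h" and g: "\<And>z. z \<in> \<Sigma> \<Longrightarrow> g z = h (snd z)"
  shows "(\<integral>z. g z \<partial>\<mu>) = mass * (measure (sphere_measure :: (real^'n) measure) UNIV * integral {0..l} h)"
proof -
  have c: "continuous_on UNIV (\<lambda>w :: (real^'n) \<times> real. h (snd w))"
    by (rule continuous_on_compose2[OF h continuous_on_snd[OF continuous_on_id]]) simp
  then have m: "(\<lambda>w :: (real^'n) \<times> real. h (snd w)) \<in> borel_measurable (borel \<Otimes>\<^sub>M borel)"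
    unfolding borel_prod by (rule borel_measurable_continuous_onI)
  have "g z = h (snd (cylinder_coord z))" if "z \<in> \<Sigma>" for z
    using arg_cong[OF point_cylinder_coord[OF that], of snd] g[OF that] by (simp add: point_def)
  then have "(\<integral>z. g z \<partial>\<mu>) = mass * (\<integral>w. h (snd w) \<partial>N)" by (rule integral_\<mu>(1)[OF m])
  also have "(\<integral>w. h (snd w) \<partial>N) = (\<integral>x. \<integral>t. h t \<partial>segment_measure l \<partial>(sphere_measure :: (real^'n) measure))"
    by (rule cyl.fubini(1)[symmetric, OF cyl.bounded_on_cylinder_continuous[OF c]])
  also have "(\<integral>t. h t \<partial>segment_measure l) = integral {0..l} h"
    by (intro integral_segment_measure continuous_on_subset[OF h] borel_measurable_continuous_onI h) simp
  finally show ?thesis by simp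
qed

end

section \<open>Necessity of the threshold and the resulting equivalence\<close>

context space_form_tube
begin

text \<open>The test function is \<open>cos (\<pi> t / l)\<close>, the first Neumann eigenfunction of the interval.\<close>

lemma stable_imp_threshold:
  assumes card: "CARD('n) \<ge> 2" and st: "stable TYPE('n) B2 P \<Sigma>"
  shows "(real CARD('n) - 1) / r\<^sup>2 \<le> (pi / l)\<^sup>2"
proof -
  define k where "k = (real CARD('n) - 1) / r\<^sup>2"
  define a where "a = pi / l"
  have a: "a > 0" and al: "a * l = pi" using l_pos by (simp_all add: a_def)
  define u :: "'w \<times> real \<Rightarrow> real" where "u z = cos (a * snd z)" for z
  have du: "(u has_derivative (\<lambda>h. - (sin (a * snd z) * (a * snd h)))) (at z)" for z
    unfolding u_def[abs_def] by (auto intro!: derivative_eq_intros)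
  have "smooth_on UNIV (\<lambda>z :: 'w \<times> real. cos (a * snd z) *\<^sub>R 1 + sin (a * snd z) *\<^sub>R (0 :: real))"
    by (rule smooth_on_combination[where c = "- a" and d = a and L = snd]) (auto intro!: derivative_eq_intros)
  then have "smooth_on UNIV u" by (simp add: u_def[abs_def])
  then interpret tu: tube_function b M \<kappa> cs sn p \<rho> l L u
    by unfold_locales (simp_all add: card)
  note D = has_derivative_imp_frechet[OF du]
  have gx: "tu.gx x t = 0" and gt: "tu.gt x t = - (a * sin (a * t))" for x t
    unfolding tu.gx_def tu.gt_def D by (simp_all add: vec_eq_iff point_def)
  have grad: "B2 (gradient B2 \<Sigma> u z) (gradient B2 \<Sigma> u z) = (a * sin (a * snd z))\<^sup>2" if z: "z \<in> \<Sigma>" for z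
  proof -
    obtain \<omega> t where \<omega>: "norm \<omega> = 1" "t \<in> {0..l}" and zt: "z = point \<omega> t" using z by (rule \<Sigma>_cases)
    then have "snd z = t" by (simp add: point_def)
    then show ?thesis unfolding zt tu.gradient_eq(1)[OF \<omega>] tu.gradient_eq(3)[OF \<omega>] gx gt by simp
  qed
  have "((\<lambda>t. cos (a * t)) has_integral (sin (a * l) / a - sin (a * 0) / a)) {0..l}"
    using l_pos a by (intro fundamental_theorem_of_calculus)
      (auto intro!: derivative_eq_intros simp: has_real_derivative_iff_has_vector_derivative[symmetric])
  then have "integral {0..l} (\<lambda>t. cos (a * t)) = 0" by (simp add: al integral_unique)
  moreover have "(\<integral>z. u z \<partial>\<mu>) = mass * (measure (sphere_measure :: (real^'n) measure) UNIV * integral {0..l} (\<lambda>t. cos (a * t)))"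
    by (rule tu.integral_height) (auto intro!: continuous_intros simp: u_def)
  ultimately have mean: "(\<integral>z. u z \<partial>\<mu>) = 0" by simp
  obtain N where N: "unit_normal B2 P \<Sigma> N"
    and nonneg: "\<And>f G. sobolev_H1_gradient TYPE('n) B2 \<Sigma> f G \<Longrightarrow> (\<integral>z. f z \<partial>\<mu>) = 0 \<Longrightarrow>
       0 \<le> (\<integral>z. B2 (G z) (G z) - (sff_norm_sq B2 P \<Sigma> N z + ricci B2 P z (N z) (N z)) * (f z)\<^sup>2 \<partial>\<mu>)"
    using st unfolding stable_def riemannian_measure_eq Let_def by blast
  \<comment> \<open>The integrand \<open>a\<^sup>2 sin\<^sup>2 - k cos\<^sup>2\<close> in terms of
    the double angle. Because \<open>a * l = pi\<close>, the oscillating part integrates to zero and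
    the sign of \<open>a\<^sup>2 - k\<close> decides.\<close>
  define h where "h t = (a\<^sup>2 - k) / 2 - ((a\<^sup>2 + k) / 2) * cos (2 * a * t)" for t
  have "(h has_integral (((a\<^sup>2 - k) / 2 * l - ((a\<^sup>2 + k) / 2) * (sin (2 * a * l) / (2 * a))) -
      ((a\<^sup>2 - k) / 2 * 0 - ((a\<^sup>2 + k) / 2) * (sin (2 * a * 0) / (2 * a))))) {0..l}"
    unfolding h_def[abs_def] using l_pos a by (intro fundamental_theorem_of_calculus)
      (auto intro!: derivative_eq_intros simp: has_real_derivative_iff_has_vector_derivative[symmetric])
  moreover have "sin (2 * a * l) = 0" using al by (simp add: mult.assoc)
  ultimately have int: "integral {0..l} h = (a\<^sup>2 - k) / 2 * l" by (simp add: integral_unique)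
  have trig: "(a * sin x)\<^sup>2 - k * (cos x)\<^sup>2 = (a\<^sup>2 - k) / 2 - ((a\<^sup>2 + k) / 2) * cos (2 * x)" for x
  proof -
    have s: "(sin x)\<^sup>2 = 1 - (cos x)\<^sup>2" by (simp add: sin_squared_eq)
    show ?thesis unfolding cos_double_cos power_mult_distrib s by (simp add: field_simps)
  qed
  have "0 \<le> (\<integral>z. B2 (gradient B2 \<Sigma> u z) (gradient B2 \<Sigma> u z) -
      (sff_norm_sq B2 P \<Sigma> N z + ricci B2 P z (N z) (N z)) * (u z)\<^sup>2 \<partial>\<mu>)"
    by (rule nonneg[OF tu.sobolev_H1_gradient_smooth mean])
  also have "\<dots> = mass * (measure (sphere_measure :: (real^'n) measure) UNIV * integral {0..l} h)"
  proof (rule tu.integral_height)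
    show "continuous_on UNIV h" unfolding h_def[abs_def] by (intro continuous_intros)
    show "B2 (gradient B2 \<Sigma> u z) (gradient B2 \<Sigma> u z) -
      (sff_norm_sq B2 P \<Sigma> N z + ricci B2 P z (N z) (N z)) * (u z)\<^sup>2 = h (snd z)" if z: "z \<in> \<Sigma>" for z
      unfolding grad[OF z] stability_potential[OF N z] k_def[symmetric] u_def trig h_def by (simp add: mult.assoc)
  qed
  finally have "0 \<le> mass * (measure (sphere_measure :: (real^'n) measure) UNIV * ((a\<^sup>2 - k) / 2 * l))" unfolding int .
  then have "0 \<le> a\<^sup>2 - k" using mass_pos tu.cyl.masses(1) l_pos by (simp add: zero_le_mult_iff)
  then show ?thesis by (simp add: k_def a_def)
qed

theorem stable_iff:
  assumes card: "CARD('n) \<ge> 2"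
  shows "stable TYPE('n) B2 P \<Sigma> \<longleftrightarrow> (real CARD('n) - 1) / r\<^sup>2 \<le> (pi / l)\<^sup>2"
proof
  assume K: "(real CARD('n) - 1) / r\<^sup>2 \<le> (pi / l)\<^sup>2"
  have "0 \<le> (\<integral>z. B2 (G z) (G z) - (sff_norm_sq B2 P \<Sigma> normal z + ricci B2 P z (normal z) (normal z)) * (f z)\<^sup>2 \<partial>\<mu>)"
    if "sobolev_H1_gradient TYPE('n) B2 \<Sigma> f G" "(\<integral>z. f z \<partial>\<mu>) = 0" for f G
  proof -
    have "(\<integral>z. B2 (G z) (G z) - (sff_norm_sq B2 P \<Sigma> normal z + ricci B2 P z (normal z) (normal z)) * (f z)\<^sup>2 \<partial>\<mu>) =
        (\<integral>z. B2 (G z) (G z) - (real CARD('n) - 1) / r\<^sup>2 * (f z)\<^sup>2 \<partial>\<mu>)"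
      by (rule Bochner_Integration.integral_cong) (simp_all add: stability_potential[OF unit_normal_normal])
    then show ?thesis using quadratic_form_nonneg[OF card K that] by simp
  qed
  then show "stable TYPE('n) B2 P \<Sigma>"
    unfolding stable_def riemannian_measure_eq Let_def using unit_normal_normal by blast
qed (rule stable_imp_threshold[OF card])

end

lemma stable_tube_iff:
  fixes b :: "'w::euclidean_space bilinear_form" and l :: real
  assumes sf: "space_form b M \<kappa> cs sn CARD('n::finite)" and p: "p \<in> M" and "sn \<rho> > 0" "l > 0" "CARD('n) \<ge> 2"
  shows "stable_tube TYPE('n) b M p \<rho> l \<longleftrightarrow> sqrt (real CARD('n) - 1) * l \<le> pi * sn \<rho>"
proof -
  interpret space_form b M \<kappa> cs sn "CARD('n)" by (rule sf)
  interpret pf: positive_form b "T p"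
    using bilinear sym subspace_T pos[OF p] unfolding positive_form_def by blast
  obtain L :: "real^'n \<Rightarrow> 'w" where L: "linear L" "\<And>u v. b (L u) (L v) = u \<bullet> v" "range L = T p"
    using pf.isometry_exists[OF dim[OF p]] by blast
  interpret space_form_tube b M \<kappa> cs sn p \<rho> l L
    by (intro space_form_tube.intro space_form_tube_axioms.intro sf) (fact p assms L)+
  show ?thesis
    using stable_iff[OF assms(5)] stability_threshold[OF r_pos l_pos, of "real CARD('n) - 1"] assms(5)
    unfolding stable_tube_def \<Sigma>_def by (simp add: r_def)
qed

section \<open>The three space forms\<close>

lemma bounded_bilinear_lorentz_form: "bounded_bilinear (lorentz_form :: ('v::euclidean_space \<times> real) bilinear_form)"
proof -
  have "bilinear (lorentz_form :: ('v \<times> real) bilinear_form)"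
    unfolding bilinear_def lorentz_form_def
    by (auto intro!: linearI simp: inner_simps algebra_simps)
  then show ?thesis by (simp add: bilinear_conv_bounded_bilinear)
qed

text \<open>Vectors orthogonal to a timelike vector are spacelike: Cauchy-Schwarz for the spatial
  parts, with \<open>fst x \<bullet> fst x\<close> smaller by 1 than the squared time component of
  \<open>x\<close>, leaves a strict margin.\<close>

lemma hyperboloid_tangent_pos:
  fixes x v :: "'v::euclidean_space \<times> real"
  assumes x: "x \<in> hyperboloid" and v: "lorentz_form x v = 0" "v \<noteq> 0"
  shows "lorentz_form v v > 0"
proof -
  define s t where "s = snd x" and "t = snd v"
  have s: "fst x \<bullet> fst x = s * s - 1" "s > 0" using x by (auto simp: hyperboloid_def lorentz_form_def s_def)
  have xv: "fst x \<bullet> fst v = s * t" using v by (simp add: lorentz_form_def s_def t_def)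
  have cs: "(s * t) * (s * t) \<le> (s * s - 1) * (fst v \<bullet> fst v)"
    using Cauchy_Schwarz_ineq[of "fst x" "fst v"] by (simp add: xv s power2_eq_square)
  have "fst v \<noteq> 0"
  proof
    assume "fst v = 0"
    then have "s * t = 0" using xv by simp
    then show False using s(2) v(2) \<open>fst v = 0\<close> by (simp add: t_def prod_eq_iff)
  qed
  then have vv: "fst v \<bullet> fst v > 0" by simp
  have "(s * s) * (t * t) < (s * s) * (fst v \<bullet> fst v)"
  proof -
    have "(s * s) * (t * t) \<le> (s * s) * (fst v \<bullet> fst v) - fst v \<bullet> fst v" using cs by (simp add: algebra_simps)
    then show ?thesis using vv by linarith
  qed
  then have "t * t < fst v \<bullet> fst v" using s(2) by (simp add: mult_less_cancel_left_pos)
  then show ?thesis by (simp add: lorentz_form_def t_def)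
qed

text \<open>The level equation is the identity for \<open>cosh\<close> and \<open>sinh\<close>.
  Remaining on the upper sheet needs \<open>\<bar>snd v\<bar> \<le> snd x\<close>, again from
  Cauchy-Schwarz, and \<open>\<bar>sinh t\<bar> < cosh t\<close>.\<close>

lemma hyperboloid_curve:
  fixes x v :: "'v::euclidean_space \<times> real"
  assumes x: "x \<in> hyperboloid" and v: "lorentz_form x v = 0" "lorentz_form v v = 1"
  shows "cosh t *\<^sub>R x + sinh t *\<^sub>R v \<in> hyperboloid"
proof -
  interpret bounded_bilinear "lorentz_form :: ('v \<times> real) bilinear_form" by (rule bounded_bilinear_lorentz_form)
  have sym: "lorentz_form v x = 0" using v(1) by (simp add: lorentz_form_def inner_commute mult.commute)
  have xx: "lorentz_form x x = -1" "snd x > 0" using x by (auto simp: hyperboloid_def)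
  have "lorentz_form (cosh t *\<^sub>R x + sinh t *\<^sub>R v) (cosh t *\<^sub>R x + sinh t *\<^sub>R v) = (sinh t)\<^sup>2 - (cosh t)\<^sup>2"
    by (simp add: add_left add_right scaleR_left scaleR_right sym v xx power2_eq_square)
  then have 1: "lorentz_form (cosh t *\<^sub>R x + sinh t *\<^sub>R v) (cosh t *\<^sub>R x + sinh t *\<^sub>R v) = -1"
    by (simp add: cosh_square_eq)
  have "\<bar>snd v\<bar> \<le> snd x"
  proof (rule power2_le_imp_le)
    have e: "fst x \<bullet> fst v = snd x * snd v" "fst x \<bullet> fst x = snd x * snd x - 1" "fst v \<bullet> fst v = 1 + snd v * snd v"
      using v xx by (auto simp: lorentz_form_def)
    have "(snd x * snd v) * (snd x * snd v) \<le> (snd x * snd x - 1) * (1 + snd v * snd v)"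
      using Cauchy_Schwarz_ineq[of "fst x" "fst v"] unfolding e by (simp add: power2_eq_square)
    then show "\<bar>snd v\<bar>\<^sup>2 \<le> (snd x)\<^sup>2" by (simp add: power2_eq_square algebra_simps)
  qed (use xx in simp)
  moreover have "\<bar>sinh t\<bar> < cosh t"
    by (rule power2_less_imp_less) (simp_all add: cosh_square_eq cosh_real_nonneg)
  ultimately have "\<bar>sinh t * snd v\<bar> < cosh t * snd x"
    unfolding abs_mult using xx(2)
    by (meson abs_ge_zero le_less_trans mult_left_mono mult_strict_right_mono)
  then have "snd (cosh t *\<^sub>R x + sinh t *\<^sub>R v) > 0" by (simp add: abs_less_iff)
  then show ?thesis using 1 by (simp add: hyperboloid_def)
qed

lemma space_form_hyperboloid:
  "space_form lorentz_form (hyperboloid :: ((real^'n) \<times> real) set) (-1) cosh sinh CARD('n::finite)"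
proof (rule space_form.intro)
  fix x v :: "(real^'n) \<times> real" assume x: "x \<in> hyperboloid"
  \<comment> \<open>Reversing the sign of the last coordinate turns Lorentz orthogonality into
    Euclidean orthogonality, so the tangent space is an ordinary hyperplane.\<close>
  have "(fst x, - snd x) \<noteq> 0" using x by (auto simp: hyperboloid_def zero_prod_def)
  then have "dim {v. (fst x, - snd x) \<bullet> v = 0} = CARD('n)" by (subst dim_hyperplane) auto
  moreover have "{v. -1 * lorentz_form x v = 0} = {v. (fst x, - snd x) \<bullet> v = 0}"
    by (auto simp: lorentz_form_def inner_prod_def)
  ultimately show "dim {v. -1 * lorentz_form x v = 0} = CARD('n)" by simp
  show "-1 * -1 * lorentz_form x x = -1" using x by (simp add: hyperboloid_def)
  show "v \<noteq> 0 \<Longrightarrow> lorentz_form v v > 0" if "-1 * lorentz_form x v = 0"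
    using hyperboloid_tangent_pos[OF x] that by simp
  show "cosh t *\<^sub>R x + sinh t *\<^sub>R v \<in> hyperboloid" if "-1 * lorentz_form x v = 0" "lorentz_form v v = 1" for t
    using hyperboloid_curve[OF x] that by simp
next
  show "lorentz_form x y = lorentz_form y x" for x y :: "(real^'n) \<times> real"
    by (simp add: lorentz_form_def inner_commute mult.commute)
  show "bounded_bilinear (lorentz_form :: ((real^'n) \<times> real) bilinear_form)" by (rule bounded_bilinear_lorentz_form)
qed (auto intro!: derivative_eq_intros)

lemma space_form_euclidean: "space_form inner (UNIV :: (real^'n) set) 0 (\<lambda>_. 1) (\<lambda>t. t) CARD('n::finite)"
proof (rule space_form.intro)
  show "bounded_bilinear (inner :: (real^'n) bilinear_form)" by (rule bounded_bilinear_inner)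
qed (auto simp: inner_commute)

lemma space_form_sphere:
  "space_form inner (sphere 0 1 :: ((real^'n) \<times> real) set) 1 cos sin CARD('n::finite)"
proof (rule space_form.intro)
  fix x v :: "(real^'n) \<times> real" assume "x \<in> sphere 0 1"
  then have x: "x \<bullet> x = 1" by (simp add: norm_eq_1)
  then have "x \<noteq> 0" by auto
  then have "dim {v. x \<bullet> v = 0} = CARD('n)" by (subst dim_hyperplane) auto
  then show "dim {v. 1 * (x \<bullet> v) = 0} = CARD('n)" by simp
  show "1 * 1 * (x \<bullet> x) = 1" using x by simp
  show "cos t *\<^sub>R x + sin t *\<^sub>R v \<in> sphere 0 1" if "1 * (x \<bullet> v) = 0" "v \<bullet> v = 1" for t
  proof -
    have "(cos t *\<^sub>R x + sin t *\<^sub>R v) \<bullet> (cos t *\<^sub>R x + sin t *\<^sub>R v) = (cos t)\<^sup>2 + (sin t)\<^sup>2"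
      using that x by (simp add: inner_simps inner_commute[of v x] power2_eq_square)
    then have "norm (cos t *\<^sub>R x + sin t *\<^sub>R v) = 1" unfolding norm_eq_1 by simp
    then show ?thesis by simp
  qed
next
  show "bounded_bilinear (inner :: ((real^'n) \<times> real) bilinear_form)" by (rule bounded_bilinear_inner)
qed (auto intro!: derivative_eq_intros simp: inner_commute)

theorem corollary3p4:
  fixes l \<rho> :: real
  assumes "CARD('n::finite) \<ge> 2" and "l > 0" and "\<rho> > 0"
  shows "(\<forall>p \<in> (hyperboloid :: ((real^'n) \<times> real) set).
            stable_tube TYPE('n) lorentz_form hyperboloid p \<rho> l
              \<longleftrightarrow> pi * sinh \<rho> \<ge> sqrt (real CARD('n) - 1) * l)
       \<and> (\<forall>p \<in> (UNIV :: (real^'n) set).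
            stable_tube TYPE('n) inner UNIV p \<rho> l
              \<longleftrightarrow> pi * \<rho> \<ge> sqrt (real CARD('n) - 1) * l)
       \<and> (\<rho> < pi \<longrightarrow> (\<forall>p \<in> (sphere 0 1 :: ((real^'n) \<times> real) set).
            stable_tube TYPE('n) inner (sphere 0 1) p \<rho> l
              \<longleftrightarrow> pi * sin \<rho> \<ge> sqrt (real CARD('n) - 1) * l))"
  using stable_tube_iff[OF space_form_hyperboloid, of _ \<rho> l] stable_tube_iff[OF space_form_euclidean, of _ \<rho> l]
    stable_tube_iff[OF space_form_sphere, of _ \<rho> l] assms sin_gt_zero[of \<rho>]
  by (intro conjI ballI impI) simp_all

end
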